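(* Let $R$ be a one-dimensional Cohen-Macaulay local ring which is not regular, with maximal ideal $\mathfrak{m}$, let $E=\operatorname{Hom}_R(\mathfrak{m},\mathfrak{m})$, and let $M$ be a full-trace Ulrich $R$-module. Then there is an isomorphism of $R$-modules \[ M^{\oplus n}\cong \mathfrak{m}\oplus N \] for some $n\geq 1$ and some $E$-module $N$, where $N=0$ or $N$ is an Ulrich $R$-module. Moreover, if $E$ is a local ring, then one can take $n=1$ in this direct sum decomposition, so that $\mathfrak{m}$ is a direct summand of $M$ as an $R$-module.
   Context: Rings are commutative Noetherian and modules are finitely generated. $E=\operatorname{Hom}_R(\mathfrak{m},\mathfrak{m})$ is the endomorphism algebra of $\mathfrak{m}$; when $R$ is a one-dimensional non-regular Cohen-Macaulay local ring with maximal ideal $\mathfrak{m}$, it is a commutative ring, isomorphic to $(\mathfrak{m}:_{\mathrm{Q}}\mathfrak{m})$ with $\mathrm{Q}$ the total ring of fractions of $R$, and $R$ embeds in $E$ (via multiplication maps), so each $E$-module is also an $R$-module. For an $R$-module $M$, $\mu_R(M)$ is the minimal number of generators and $\mathrm{e}_R(M)$ is the Hilbert-Samuel multiplicity with respect to $\mathfrak{m}$. $M$ is maximal Cohen-Macaulay if $M\neq 0$ and $\operatorname{depth}_R(M)=\dim_R(M)=\dim(R)$. An Ulrich $R$-module is a maximal Cohen-Macaulay $R$-module $M$ with $\mu_R(M)=\mathrm{e}_R(M)$. The trace is $\operatorname{tr}_R(M)=\sum_{f\in\operatorname{Hom}_R(M,R)}\operatorname{im}(f)$. $M$ is full-trace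 Ulrich if $M$ is an Ulrich $R$-module with $\operatorname{tr}_R(M)=\mathfrak{m}$. *)

theory Defs
  imports Complex_Main "HOL-Library.Extended_Nat" "HOL-Algebra.Algebra"
begin

text \<open>
  Modules are records of type \<open>('a, 'b, 'd) module_scheme\<close>, which extend ring records. The
  multiplicative fields of a module are never inspected; the modules built below leave them
  unspecified.
\<close>

section \<open>Rings\<close>

definition local_ring :: "('a, 'c) ring_scheme \<Rightarrow> bool" where
  "local_ring R \<longleftrightarrow> cring R \<and> (\<exists>!I. maximalideal I R)"

definition max_ideal :: "('a, 'c) ring_scheme \<Rightarrow> 'a set" where
  "max_ideal R = (THE I. maximalideal I R)"

text \<open>The zero ring, which has no prime ideals, gets dimension \<open>0\<close> here.\<close>

definition krull_dim :: "('a, 'c) ring_scheme \<Rightarrow> enat" where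
  "krull_dim R = Sup {enat n | n. \<exists>P :: nat \<Rightarrow> 'a set.
     (\<forall>i\<le>n. primeideal (P i) R) \<and> (\<forall>i<n. P i \<subset> P (Suc i))}"

section \<open>Constructions on modules\<close>

definition self_module :: "('a, 'c) ring_scheme \<Rightarrow> ('a, 'a) module" where
  "self_module R = \<lparr>carrier = carrier R, monoid.mult = monoid.mult R, one = one R,
     ring.zero = ring.zero R, add = add R, smult = monoid.mult R\<rparr>"

definition max_ideal_module :: "('a, 'c) ring_scheme \<Rightarrow> ('a, 'a) module" where
  "max_ideal_module R = (self_module R)\<lparr>carrier := max_ideal R\<rparr>"

definition submodule_gen ::
  "('a, 'c) ring_scheme \<Rightarrow> ('a, 'b, 'd) module_scheme \<Rightarrow> 'b set \<Rightarrow> 'b set" where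
  "submodule_gen R M S = \<Inter>{H. submodule H R M \<and> S \<subseteq> H}"

definition ideal_smult ::
  "('a, 'c) ring_scheme \<Rightarrow> 'a set \<Rightarrow> ('a, 'b, 'd) module_scheme \<Rightarrow> 'b set" where
  "ideal_smult R I M = submodule_gen R M {a \<odot>\<^bsub>M\<^esub> x | a x. a \<in> I \<and> x \<in> carrier M}"

definition quotient_module ::
  "('a, 'b, 'd) module_scheme \<Rightarrow> 'b set \<Rightarrow> ('a, 'b set) module" where
  "quotient_module M H = \<lparr>carrier = a_rcosets\<^bsub>M\<^esub> H, monoid.mult = undefined, one = undefined,
     ring.zero = H, add = set_add M, smult = (\<lambda>r C. \<Union>x\<in>C. H +>\<^bsub>M\<^esub> (r \<odot>\<^bsub>M\<^esub> x))\<rparr>"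

definition direct_sum ::
  "('a, 'b, 'd) module_scheme \<Rightarrow> ('a, 'e, 'f) module_scheme \<Rightarrow> ('a, 'b \<times> 'e) module" where
  "direct_sum M N = \<lparr>carrier = carrier M \<times> carrier N, monoid.mult = undefined, one = undefined,
     ring.zero = (\<zero>\<^bsub>M\<^esub>, \<zero>\<^bsub>N\<^esub>),
     add = (\<lambda>(x, y) (x', y'). (x \<oplus>\<^bsub>M\<^esub> x', y \<oplus>\<^bsub>N\<^esub> y')),
     smult = (\<lambda>r (x, y). (r \<odot>\<^bsub>M\<^esub> x, r \<odot>\<^bsub>N\<^esub> y))\<rparr>"

definition direct_power ::
  "('a, 'b, 'd) module_scheme \<Rightarrow> nat \<Rightarrow> ('a, nat \<Rightarrow> 'b) module" where
  "direct_power M n = \<lparr>carrier = {..<n} \<rightarrow>\<^sub>E carrier M, monoid.mult = undefined, one = undefined,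
     ring.zero = (\<lambda>i\<in>{..<n}. \<zero>\<^bsub>M\<^esub>),
     add = (\<lambda>x y. \<lambda>i\<in>{..<n}. x i \<oplus>\<^bsub>M\<^esub> y i),
     smult = (\<lambda>r x. \<lambda>i\<in>{..<n}. r \<odot>\<^bsub>M\<^esub> x i)\<rparr>"

text \<open>Restriction of scalars of an \<open>S\<close>-module along \<open>\<phi> : R \<rightarrow> S\<close>.\<close>

definition restrict_scalars ::
  "('a \<Rightarrow> 's) \<Rightarrow> ('s, 'b, 'd) module_scheme \<Rightarrow> ('a, 'b) module" where
  "restrict_scalars \<phi> N = \<lparr>carrier = carrier N, monoid.mult = monoid.mult N, one = one N,
     ring.zero = ring.zero N, add = add N, smult = (\<lambda>r x. \<phi> r \<odot>\<^bsub>N\<^esub> x)\<rparr>"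

section \<open>Homomorphisms\<close>

text \<open>Homomorphisms are extensional, so that equality of elements of \<open>Hom\<close> is equality in HOL.\<close>

definition module_hom ::
  "('a, 'c) ring_scheme \<Rightarrow> ('a, 'b, 'd) module_scheme \<Rightarrow> ('a, 'e, 'f) module_scheme
     \<Rightarrow> ('b \<Rightarrow> 'e) set" where
  "module_hom R M N = {f \<in> carrier M \<rightarrow>\<^sub>E carrier N.
     (\<forall>x\<in>carrier M. \<forall>y\<in>carrier M. f (x \<oplus>\<^bsub>M\<^esub> y) = f x \<oplus>\<^bsub>N\<^esub> f y) \<and>
     (\<forall>r\<in>carrier R. \<forall>x\<in>carrier M. f (r \<odot>\<^bsub>M\<^esub> x) = r \<odot>\<^bsub>N\<^esub> f x)}"

definition module_iso ::
  "('a, 'c) ring_scheme \<Rightarrow> ('a, 'b, 'd) module_scheme \<Rightarrow> ('a, 'e, 'f) module_scheme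
     \<Rightarrow> bool" where
  "module_iso R M N \<longleftrightarrow> (\<exists>f\<in>module_hom R M N. bij_betw f (carrier M) (carrier N))"

definition direct_summand ::
  "('a, 'c) ring_scheme \<Rightarrow> ('a, 'e, 'f) module_scheme \<Rightarrow> ('a, 'b, 'd) module_scheme
     \<Rightarrow> bool" where
  "direct_summand R K M \<longleftrightarrow> (\<exists>A B. submodule A R M \<and> submodule B R M \<and>
     A \<inter> B = {\<zero>\<^bsub>M\<^esub>} \<and> A <+>\<^bsub>M\<^esub> B = carrier M \<and> module_iso R K (M\<lparr>carrier := A\<rparr>))"

definition endo_ring ::
  "('a, 'c) ring_scheme \<Rightarrow> ('a, 'b, 'd) module_scheme \<Rightarrow> ('b \<Rightarrow> 'b) ring" where
  "endo_ring R M = \<lparr>carrier = module_hom R M M, monoid.mult = compose (carrier M),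
     one = (\<lambda>x\<in>carrier M. x), ring.zero = (\<lambda>x\<in>carrier M. \<zero>\<^bsub>M\<^esub>),
     add = (\<lambda>f g. \<lambda>x\<in>carrier M. f x \<oplus>\<^bsub>M\<^esub> g x)\<rparr>"

definition homothety :: "('a, 'b, 'd) module_scheme \<Rightarrow> 'a \<Rightarrow> ('b \<Rightarrow> 'b)" where
  "homothety M r = (\<lambda>x\<in>carrier M. r \<odot>\<^bsub>M\<^esub> x)"

text \<open>\<open>E = Hom(\<mm>, \<mm>)\<close>, and an \<open>E\<close>-module regarded as an \<open>R\<close>-module through \<open>R \<rightarrow> E\<close>.\<close>

definition max_endo_ring :: "('a, 'c) ring_scheme \<Rightarrow> ('a \<Rightarrow> 'a) ring" where
  "max_endo_ring R = endo_ring R (max_ideal_module R)"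

definition max_endo_restrict ::
  "('a, 'c) ring_scheme \<Rightarrow> ('a \<Rightarrow> 'a, 'b, 'd) module_scheme \<Rightarrow> ('a, 'b) module" where
  "max_endo_restrict R N = restrict_scalars (homothety (max_ideal_module R)) N"

section \<open>Invariants of modules\<close>

definition finitely_generated ::
  "('a, 'c) ring_scheme \<Rightarrow> ('a, 'b, 'd) module_scheme \<Rightarrow> bool" where
  "finitely_generated R M \<longleftrightarrow>
     (\<exists>S. finite S \<and> S \<subseteq> carrier M \<and> submodule_gen R M S = carrier M)"

definition min_gens :: "('a, 'c) ring_scheme \<Rightarrow> ('a, 'b, 'd) module_scheme \<Rightarrow> nat" where
  "min_gens R M = (LEAST n. \<exists>S. finite S \<and> card S = n \<and> S \<subseteq> carrier M \<and>
                                submodule_gen R M S = carrier M)"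

definition annihilator ::
  "('a, 'c) ring_scheme \<Rightarrow> ('a, 'b, 'd) module_scheme \<Rightarrow> 'a set" where
  "annihilator R M = {a \<in> carrier R. \<forall>x\<in>carrier M. a \<odot>\<^bsub>M\<^esub> x = \<zero>\<^bsub>M\<^esub>}"

definition module_dim :: "('a, 'c) ring_scheme \<Rightarrow> ('a, 'b, 'd) module_scheme \<Rightarrow> enat" where
  "module_dim R M = krull_dim (R Quot (annihilator R M))"

text \<open>
  In a regular sequence \<open>x\<^sub>0, x\<^sub>1, \<dots>\<close> on \<open>M\<close>, the element \<open>x\<^sub>i\<close> is a nonzerodivisor on
  \<open>M / (x\<^sub>0, \<dots>, x\<^bsub>i-1\<^esub>) M\<close>, and \<open>M / (x\<^sub>0, x\<^sub>1, \<dots>) M\<close> is nonzero.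
\<close>

definition regular_sequence ::
  "('a, 'c) ring_scheme \<Rightarrow> ('a, 'b, 'd) module_scheme \<Rightarrow> 'a list \<Rightarrow> bool" where
  "regular_sequence R M xs \<longleftrightarrow> set xs \<subseteq> carrier R \<and>
     (\<forall>i<length xs. \<forall>y\<in>carrier M.
        xs ! i \<odot>\<^bsub>M\<^esub> y \<in> ideal_smult R (genideal R (set (take i xs))) M \<longrightarrow>
        y \<in> ideal_smult R (genideal R (set (take i xs))) M) \<and>
     ideal_smult R (genideal R (set xs)) M \<noteq> carrier M"

text \<open>For a local ring; the zero module has depth \<open>0\<close> here rather than \<open>\<infinity>\<close>.\<close>

definition module_depth :: "('a, 'c) ring_scheme \<Rightarrow> ('a, 'b, 'd) module_scheme \<Rightarrow> enat" where
  "module_depth R M =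
     Sup {enat (length xs) | xs. set xs \<subseteq> max_ideal R \<and> regular_sequence R M xs}"

definition module_length :: "('a, 'c) ring_scheme \<Rightarrow> ('a, 'b, 'd) module_scheme \<Rightarrow> enat" where
  "module_length R M = Sup {enat n | n. \<exists>H :: nat \<Rightarrow> 'b set.
     (\<forall>i\<le>n. submodule (H i) R M) \<and> (\<forall>i<n. H i \<subset> H (Suc i))}"

text \<open>
  The Hilbert--Samuel multiplicity, as the limit of \<open>d! length(M / \<mm>\<^sup>n M) / n\<^sup>d\<close> where
  \<open>d = dim R\<close>. The power of the maximal ideal is taken in the monoid of ideals of \<open>R\<close>.
\<close>

definition multiplicity_hs ::
  "('a, 'c) ring_scheme \<Rightarrow> ('a, 'b, 'd) module_scheme \<Rightarrow> real" where
  "multiplicity_hs R M =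
     (let d = the_enat (krull_dim R) in
      lim (\<lambda>n. fact d * real (the_enat (module_length R
                 (quotient_module M (ideal_smult R (max_ideal R [^]\<^bsub>ideals_set R\<^esub> n) M))))
               / real n ^ d))"

definition trace_ideal ::
  "('a, 'c) ring_scheme \<Rightarrow> ('a, 'b, 'd) module_scheme \<Rightarrow> 'a set" where
  "trace_ideal R M = genideal R (\<Union>f\<in>module_hom R M (self_module R). f ` carrier M)"

section \<open>Cohen--Macaulay and regular rings, Ulrich modules\<close>

definition cohen_macaulay_local_ring :: "('a, 'c) ring_scheme \<Rightarrow> bool" where
  "cohen_macaulay_local_ring R \<longleftrightarrow> local_ring R \<and> noetherian_ring R \<and>
     module_depth R (self_module R) = krull_dim R"

definition regular_local_ring :: "('a, 'c) ring_scheme \<Rightarrow> bool" where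
  "regular_local_ring R \<longleftrightarrow> local_ring R \<and> noetherian_ring R \<and>
     enat (min_gens R (max_ideal_module R)) = krull_dim R"

definition maximal_cohen_macaulay ::
  "('a, 'c) ring_scheme \<Rightarrow> ('a, 'b, 'd) module_scheme \<Rightarrow> bool" where
  "maximal_cohen_macaulay R M \<longleftrightarrow> module R M \<and> finitely_generated R M \<and>
     carrier M \<noteq> {\<zero>\<^bsub>M\<^esub>} \<and> module_depth R M = module_dim R M \<and> module_dim R M = krull_dim R"

definition ulrich :: "('a, 'c) ring_scheme \<Rightarrow> ('a, 'b, 'd) module_scheme \<Rightarrow> bool" where
  "ulrich R M \<longleftrightarrow> maximal_cohen_macaulay R M \<and> real (min_gens R M) = multiplicity_hs R M"

definition full_trace_ulrich ::
  "('a, 'c) ring_scheme \<Rightarrow> ('a, 'b, 'd) module_scheme \<Rightarrow> bool" where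
  "full_trace_ulrich R M \<longleftrightarrow> ulrich R M \<and> trace_ideal R M = max_ideal R"

end

theory Submission
  imports Defs
begin

text \<open>
  Write \<open>\<mm>\<^sup>n M\<close> for the \<open>n\<close>-th term of the \<open>\<mm>\<close>-adic filtration and \<open>h\<^sub>n\<close> for the length of
  \<open>\<mm>\<^sup>n M / \<mm>\<^sup>n\<^sup>+\<^sup>1 M\<close>. The residue field may be finite, so \<open>M\<close> need not have a superficial element of
  degree one; but a homogeneous element \<open>c \<in> \<mm>\<^sup>k\<close> of some degree \<open>k \<ge> 1\<close> always satisfies
  \<open>c \<mm>\<^sup>n M = \<mm>\<^sup>n\<^sup>+\<^sup>k M\<close> for large \<open>n\<close>, whence \<open>e(M) = length(M / c M) / k\<close>. Filtering \<open>\<mm>\<^sup>i M\<close> by the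
  kernels of localisation at the generators of \<open>\<mm>\<close> gives \<open>h\<^sub>i \<le> h\<^sub>n\<close> for \<open>i \<le> n\<close> and large \<open>n\<close>, and
  the equality case shows that \<open>M\<close> satisfies \<open>\<mu>(M) = e(M)\<close> if and only if \<open>c M = \<mm>\<^sup>k M\<close> for
  some regular \<open>c \<in> \<mm>\<^sup>k\<close>.

  For such a \<open>c\<close> every endomorphism \<open>\<alpha>\<close> of \<open>\<mm>\<close> acts on \<open>M\<close> as \<open>\<alpha>(c) / c\<close>. If the trace of \<open>M\<close> is
  \<open>\<mm>\<close>, there is a surjection \<open>\<phi> : M\<^sup>n \<rightarrow> \<mm>\<close>, and an element \<open>u \<in> \<mm>\<^sup>k\<^sup>-\<^sup>1 M\<^sup>n\<close> with \<open>\<phi>(u) = c\<close> yields the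
  section \<open>z \<mapsto> z u / c\<close> of \<open>\<phi>\<close>. Its kernel \<open>N\<close> inherits \<open>c N = \<mm>\<^sup>k N\<close>. If \<open>E\<close> is local, then in
  \<open>1 = \<Sum>\<^sub>i \<phi>\<^sub>i(u\<^sub>i) / c\<close> some summand is a unit of \<open>E\<close>, so that a single component of \<open>\<phi>\<close> splits.
\<close>

section \<open>Submodules\<close>

text \<open>Two facts drive the length arguments. As \<open>t\<close> is regular and a power of m
  lies in tR, every h_n is at most length(M / t M); and length(A / c A) is the same for every
  submodule A containing a term of the filtration. The first bound, for R itself, takes the place of
  prime avoidance in the search for c: too many forms of one degree satisfy a relation, and the
  relation combines two elements into one that is nilpotent on a class only where both are. For M,
  the bound makes multiplication by c onto in large degrees, modulo torsion. By the second fact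
  length(M / c M) is a sum of h over k consecutive large degrees, so the multiplicity is an average
  of values that are at least h_0, the number of generators. A degree k > 1 does no harm later:
  endomorphisms of m preserve m^k, so c divides alpha(c) M. The criterion makes c regular on M only.
  Regularity on R, which is used to cancel c in E and in values of linear forms, is read off the
  trace: if c a = 0, then a times a power of t kills all these values.\<close>

lemma submodule_mem_simps:
  assumes "submodule H R M"
  shows "\<zero>\<^bsub>M\<^esub> \<in> H"
    and "x \<in> H \<Longrightarrow> x \<in> carrier M"
    and "x \<in> H \<Longrightarrow> y \<in> H \<Longrightarrow> x \<oplus>\<^bsub>M\<^esub> y \<in> H"
    and "a \<in> carrier R \<Longrightarrow> x \<in> H \<Longrightarrow> a \<odot>\<^bsub>M\<^esub> x \<in> H"
  using submodule.axioms(1)[OF assms] submodule.smult_closed[OF assms]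
  by (auto simp: subgroup_def)

lemma submodule_subset: "submodule H R M \<Longrightarrow> H \<subseteq> carrier M"
  by (auto intro: submodule_mem_simps(2))

context module
begin

lemma submodule_minus:
  assumes "submodule H R M" "x \<in> H" "y \<in> H"
  shows "x \<ominus>\<^bsub>M\<^esub> y \<in> H"
  unfolding a_minus_def using submoduleE(3,5)[OF assms(1)] assms by auto

text \<open>Closure under negatives comes from multiplication by -1.\<close>

lemma submoduleI':
  assumes "H \<subseteq> carrier M" "\<zero>\<^bsub>M\<^esub> \<in> H"
    and "\<And>x y. x \<in> H \<Longrightarrow> y \<in> H \<Longrightarrow> x \<oplus>\<^bsub>M\<^esub> y \<in> H"
    and "\<And>a x. a \<in> carrier R \<Longrightarrow> x \<in> H \<Longrightarrow> a \<odot>\<^bsub>M\<^esub> x \<in> H"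
  shows "submodule H R M"
proof (rule submoduleI[OF assms(1,2) _ assms(3,4)])
  fix a assume a: "a \<in> H"
  then have "a \<in> carrier M" using assms(1) by blast
  then have "\<ominus>\<^bsub>M\<^esub> a = (\<ominus> \<one>) \<odot>\<^bsub>M\<^esub> a" by (simp add: smult_l_minus)
  then show "\<ominus>\<^bsub>M\<^esub> a \<in> H" using assms(4)[OF _ a, of "\<ominus> \<one>"] by simp
qed

lemma minus_add_cancel:
  assumes "x \<in> carrier M" "y \<in> carrier M"
  shows "(x \<oplus>\<^bsub>M\<^esub> y) \<ominus>\<^bsub>M\<^esub> y = x" "(x \<oplus>\<^bsub>M\<^esub> y) \<ominus>\<^bsub>M\<^esub> x = y"
    "(x \<ominus>\<^bsub>M\<^esub> y) \<oplus>\<^bsub>M\<^esub> y = x" "y \<oplus>\<^bsub>M\<^esub> (x \<ominus>\<^bsub>M\<^esub> y) = x"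
proof -
  have 1: "(x \<oplus>\<^bsub>M\<^esub> y) \<ominus>\<^bsub>M\<^esub> y = x" "(x \<ominus>\<^bsub>M\<^esub> y) \<oplus>\<^bsub>M\<^esub> y = x"
    if "x \<in> carrier M" "y \<in> carrier M" for x y
    using that unfolding a_minus_def by (simp_all add: M.a_assoc M.r_neg M.l_neg)
  then show "(x \<oplus>\<^bsub>M\<^esub> y) \<ominus>\<^bsub>M\<^esub> y = x" "(x \<ominus>\<^bsub>M\<^esub> y) \<oplus>\<^bsub>M\<^esub> y = x" using assms by auto
  show "(x \<oplus>\<^bsub>M\<^esub> y) \<ominus>\<^bsub>M\<^esub> x = y" using 1(1)[of y x] assms by (simp add: M.a_comm)
  show "y \<oplus>\<^bsub>M\<^esub> (x \<ominus>\<^bsub>M\<^esub> y) = x" using 1(2)[of x y] assms by (simp add: M.a_comm a_minus_def)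
qed

lemma smult_minus_distr:
  assumes "a \<in> carrier R" "x \<in> carrier M" "y \<in> carrier M"
  shows "a \<odot>\<^bsub>M\<^esub> (x \<ominus>\<^bsub>M\<^esub> y) = a \<odot>\<^bsub>M\<^esub> x \<ominus>\<^bsub>M\<^esub> a \<odot>\<^bsub>M\<^esub> y"
  using assms by (simp add: a_minus_def smult_r_distr smult_r_minus)

lemma smult_minus_distr_l:
  assumes "a \<in> carrier R" "b \<in> carrier R" "x \<in> carrier M"
  shows "(a \<ominus> b) \<odot>\<^bsub>M\<^esub> x = a \<odot>\<^bsub>M\<^esub> x \<ominus>\<^bsub>M\<^esub> b \<odot>\<^bsub>M\<^esub> x"
  using assms by (simp add: a_minus_def smult_l_distr smult_l_minus)

lemma smult_comm:
  assumes "a \<in> carrier R" "b \<in> carrier R" "x \<in> carrier M"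
  shows "a \<odot>\<^bsub>M\<^esub> (b \<odot>\<^bsub>M\<^esub> x) = b \<odot>\<^bsub>M\<^esub> (a \<odot>\<^bsub>M\<^esub> x)"
  using assms by (metis R.m_comm smult_assoc1)

lemma minus_eq_zero_iff:
  assumes "x \<in> carrier M" "y \<in> carrier M"
  shows "x \<ominus>\<^bsub>M\<^esub> y = \<zero>\<^bsub>M\<^esub> \<longleftrightarrow> x = y"
  using assms minus_add_cancel(3) by (metis M.l_zero M.r_neg a_minus_def)

lemma submodule_add_cancel:
  assumes "submodule H R M" "x \<oplus>\<^bsub>M\<^esub> y \<in> H" "y \<in> H" "x \<in> carrier M"
  shows "x \<in> H"
  using submodule_minus[OF assms(1,2,3)] minus_add_cancel(1) assms submodule_mem_simps[OF assms(1)]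
  by simp

lemma mem_set_add_iff: "z \<in> H <+>\<^bsub>M\<^esub> K \<longleftrightarrow> (\<exists>x\<in>H. \<exists>y\<in>K. z = x \<oplus>\<^bsub>M\<^esub> y)"
  by (auto simp: set_add_def')

lemma set_addI: "x \<in> H \<Longrightarrow> y \<in> K \<Longrightarrow> x \<oplus>\<^bsub>M\<^esub> y \<in> H <+>\<^bsub>M\<^esub> K"
  by (auto simp: set_add_def')

lemma submodule_set_add:
  assumes H: "submodule H R M" and K: "submodule K R M"
  shows "submodule (H <+>\<^bsub>M\<^esub> K) R M"
proof (rule submoduleI')
  note h = submodule_mem_simps[OF H] and k = submodule_mem_simps[OF K]
  show "H <+>\<^bsub>M\<^esub> K \<subseteq> carrier M" using h k by (auto simp: set_add_def')
  show "\<zero>\<^bsub>M\<^esub> \<in> H <+>\<^bsub>M\<^esub> K"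
    unfolding mem_set_add_iff using h(1) k(1) by (intro bexI[of _ "\<zero>\<^bsub>M\<^esub>"]) auto
  fix x y assume "x \<in> H <+>\<^bsub>M\<^esub> K" "y \<in> H <+>\<^bsub>M\<^esub> K"
  then obtain a b c d where *: "a \<in> H" "b \<in> K" "c \<in> H" "d \<in> K" "x = a \<oplus>\<^bsub>M\<^esub> b" "y = c \<oplus>\<^bsub>M\<^esub> d"
    by (auto simp: mem_set_add_iff)
  then have "x \<oplus>\<^bsub>M\<^esub> y = (a \<oplus>\<^bsub>M\<^esub> c) \<oplus>\<^bsub>M\<^esub> (b \<oplus>\<^bsub>M\<^esub> d)"
    using h k by (simp add: M.a_ac)
  then show "x \<oplus>\<^bsub>M\<^esub> y \<in> H <+>\<^bsub>M\<^esub> K" using * h(3) k(3) unfolding mem_set_add_iff by blast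
next
  note h = submodule_mem_simps[OF H] and k = submodule_mem_simps[OF K]
  fix r x assume r: "r \<in> carrier R" and "x \<in> H <+>\<^bsub>M\<^esub> K"
  then obtain a b where *: "a \<in> H" "b \<in> K" "x = a \<oplus>\<^bsub>M\<^esub> b" by (auto simp: mem_set_add_iff)
  then have "r \<odot>\<^bsub>M\<^esub> x = r \<odot>\<^bsub>M\<^esub> a \<oplus>\<^bsub>M\<^esub> r \<odot>\<^bsub>M\<^esub> b" using h k r by (simp add: smult_r_distr)
  then show "r \<odot>\<^bsub>M\<^esub> x \<in> H <+>\<^bsub>M\<^esub> K" using * h(4) k(4) r unfolding mem_set_add_iff by blast
qed

lemma set_add_upper:
  assumes H: "submodule H R M" and K: "submodule K R M"
  shows "H \<subseteq> H <+>\<^bsub>M\<^esub> K" "K \<subseteq> H <+>\<^bsub>M\<^esub> K"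
proof -
  note h = submodule_mem_simps[OF H] and k = submodule_mem_simps[OF K]
  show "H \<subseteq> H <+>\<^bsub>M\<^esub> K"
    using h(2) k(1) unfolding mem_set_add_iff subset_iff by (metis M.r_zero)
  show "K \<subseteq> H <+>\<^bsub>M\<^esub> K"
    using k(2) h(1) unfolding mem_set_add_iff subset_iff by (metis M.l_zero)
qed

lemma set_add_least:
  assumes "submodule L R M" "H \<subseteq> L" "K \<subseteq> L"
  shows "H <+>\<^bsub>M\<^esub> K \<subseteq> L"
  using submodule_mem_simps(3)[OF assms(1)] assms(2,3) by (auto simp: mem_set_add_iff subset_iff)

lemma set_add_mono: "H \<subseteq> H' \<Longrightarrow> K \<subseteq> K' \<Longrightarrow> H <+>\<^bsub>M\<^esub> K \<subseteq> H' <+>\<^bsub>M\<^esub> K'"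
  by (fastforce simp: mem_set_add_iff subset_iff)

lemma submodule_set_add_comm:
  assumes H: "submodule H R M" and K: "submodule K R M"
  shows "H <+>\<^bsub>M\<^esub> K = K <+>\<^bsub>M\<^esub> H"
proof -
  have "A <+>\<^bsub>M\<^esub> B \<subseteq> B <+>\<^bsub>M\<^esub> A" if A: "submodule A R M" and B: "submodule B R M" for A B
  proof
    fix z assume "z \<in> A <+>\<^bsub>M\<^esub> B"
    then obtain x y where xy: "x \<in> A" "y \<in> B" "z = x \<oplus>\<^bsub>M\<^esub> y" by (auto simp: mem_set_add_iff)
    have "z = y \<oplus>\<^bsub>M\<^esub> x" unfolding xy(3)
      by (rule M.a_comm[OF submodule_mem_simps(2)[OF A xy(1)] submodule_mem_simps(2)[OF B xy(2)]])
    then show "z \<in> B <+>\<^bsub>M\<^esub> A" using xy by (auto intro: set_addI)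
  qed
  then show ?thesis using H K by blast
qed

lemma submodule_Int:
  assumes "submodule H R M" "submodule K R M"
  shows "submodule (H \<inter> K) R M"
proof -
  note h = submodule_mem_simps[OF assms(1)] and k = submodule_mem_simps[OF assms(2)]
  show ?thesis by (rule submoduleI') (use h k in auto)
qed

lemma submodule_zero: "submodule {\<zero>\<^bsub>M\<^esub>} R M"
  by (rule submoduleI') auto

lemma submodule_preimage:
  assumes "submodule A R M" "submodule H R M" "a \<in> carrier R"
  shows "submodule {v \<in> A. a \<odot>\<^bsub>M\<^esub> v \<in> H} R M"
proof -
  note A = submodule_mem_simps[OF assms(1)] and H = submodule_mem_simps[OF assms(2)]
  show ?thesis
  proof (rule submoduleI')
    fix r x assume r: "r \<in> carrier R" and x: "x \<in> {v \<in> A. a \<odot>\<^bsub>M\<^esub> v \<in> H}"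
    then have "a \<odot>\<^bsub>M\<^esub> (r \<odot>\<^bsub>M\<^esub> x) = r \<odot>\<^bsub>M\<^esub> (a \<odot>\<^bsub>M\<^esub> x)" using A assms smult_comm by auto
    then show "r \<odot>\<^bsub>M\<^esub> x \<in> {v \<in> A. a \<odot>\<^bsub>M\<^esub> v \<in> H}" using A H r x by auto
  qed (use A H assms in \<open>auto simp: smult_r_distr\<close>)
qed

lemma submodule_smult_image:
  assumes "submodule H R M" "a \<in> carrier R"
  shows "submodule ((\<odot>\<^bsub>M\<^esub>) a ` H) R M"
proof -
  note H = submodule_mem_simps[OF assms(1)]
  show ?thesis
  proof (rule submoduleI')
    show "(\<odot>\<^bsub>M\<^esub>) a ` H \<subseteq> carrier M" using H assms by auto
    show "\<zero>\<^bsub>M\<^esub> \<in> (\<odot>\<^bsub>M\<^esub>) a ` H" by (rule image_eqI[of _ _ "\<zero>\<^bsub>M\<^esub>"]) (use H assms in auto)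
    fix x y assume "x \<in> (\<odot>\<^bsub>M\<^esub>) a ` H" "y \<in> (\<odot>\<^bsub>M\<^esub>) a ` H"
    then obtain u v where uv: "u \<in> H" "v \<in> H" "x = a \<odot>\<^bsub>M\<^esub> u" "y = a \<odot>\<^bsub>M\<^esub> v" by auto
    then have "x \<oplus>\<^bsub>M\<^esub> y = a \<odot>\<^bsub>M\<^esub> (u \<oplus>\<^bsub>M\<^esub> v)" using H assms by (simp add: smult_r_distr)
    then show "x \<oplus>\<^bsub>M\<^esub> y \<in> (\<odot>\<^bsub>M\<^esub>) a ` H" using uv H by auto
  next
    fix r x assume r: "r \<in> carrier R" and "x \<in> (\<odot>\<^bsub>M\<^esub>) a ` H"
    then obtain u where u: "u \<in> H" "x = a \<odot>\<^bsub>M\<^esub> u" by auto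
    then have "r \<odot>\<^bsub>M\<^esub> x = a \<odot>\<^bsub>M\<^esub> (r \<odot>\<^bsub>M\<^esub> u)" using H assms r smult_comm by auto
    then show "r \<odot>\<^bsub>M\<^esub> x \<in> (\<odot>\<^bsub>M\<^esub>) a ` H" using u H r by auto
  qed
qed

lemma submodule_Union_chain:
  assumes "C \<noteq> {}" "\<And>H. H \<in> C \<Longrightarrow> submodule H R M"
    and "\<And>H K. H \<in> C \<Longrightarrow> K \<in> C \<Longrightarrow> H \<subseteq> K \<or> K \<subseteq> H"
  shows "submodule (\<Union>C) R M"
proof (rule submoduleI')
  show "\<Union>C \<subseteq> carrier M" using submodule_subset[OF assms(2)] by (rule Union_least)
  show "\<zero>\<^bsub>M\<^esub> \<in> \<Union>C" using assms(1) submodule_mem_simps(1)[OF assms(2)] by auto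
  fix x y assume "x \<in> \<Union>C" "y \<in> \<Union>C"
  then obtain H where "H \<in> C" "x \<in> H" "y \<in> H" using assms(3) by (metis UnionE subsetD)
  then show "x \<oplus>\<^bsub>M\<^esub> y \<in> \<Union>C" using submodule_mem_simps(3)[OF assms(2)] by blast
next
  fix a x assume a: "a \<in> carrier R" and "x \<in> \<Union>C"
  then obtain H where "H \<in> C" "x \<in> H" by auto
  then show "a \<odot>\<^bsub>M\<^esub> x \<in> \<Union>C" using submodule_mem_simps(4)[OF assms(2)] a by blast
qed

lemma submodule_gen_submodule:
  assumes "S \<subseteq> carrier M"
  shows "submodule (submodule_gen R M S) R M"
proof (rule submoduleI')
  show "submodule_gen R M S \<subseteq> carrier M"
    using carrier_is_submodule assms by (auto simp: submodule_gen_def)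
qed (auto simp: submodule_gen_def intro: submodule_mem_simps)

lemma submodule_gen_incl: "S \<subseteq> submodule_gen R M S"
  by (auto simp: submodule_gen_def)

lemma submodule_gen_least: "submodule H R M \<Longrightarrow> S \<subseteq> H \<Longrightarrow> submodule_gen R M S \<subseteq> H"
  by (auto simp: submodule_gen_def)

lemma submodule_gen_mono: "S \<subseteq> T \<Longrightarrow> submodule_gen R M S \<subseteq> submodule_gen R M T"
  by (auto simp: submodule_gen_def)

lemma submodule_span:
  assumes s: "s \<in> carrier M"
  shows "submodule ((\<lambda>r. r \<odot>\<^bsub>M\<^esub> s) ` carrier R) R M"
proof (rule submoduleI')
  let ?T = "(\<lambda>r. r \<odot>\<^bsub>M\<^esub> s) ` carrier R"
  show "\<zero>\<^bsub>M\<^esub> \<in> ?T" by (rule image_eqI[of _ _ "\<zero>"]) (use assms in auto)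
  fix x y assume "x \<in> ?T" "y \<in> ?T"
  then obtain a b where ab: "a \<in> carrier R" "b \<in> carrier R" "x = a \<odot>\<^bsub>M\<^esub> s" "y = b \<odot>\<^bsub>M\<^esub> s"
    by auto
  show "x \<oplus>\<^bsub>M\<^esub> y \<in> ?T"
    by (rule image_eqI[of _ _ "a \<oplus> b"]) (use ab assms in \<open>auto simp: smult_l_distr\<close>)
next
  let ?T = "(\<lambda>r. r \<odot>\<^bsub>M\<^esub> s) ` carrier R"
  fix r x assume r: "r \<in> carrier R" "x \<in> ?T"
  then obtain a where a: "a \<in> carrier R" "x = a \<odot>\<^bsub>M\<^esub> s" by auto
  show "r \<odot>\<^bsub>M\<^esub> x \<in> ?T"
    by (rule image_eqI[of _ _ "r \<otimes> a"]) (use r a assms in \<open>auto simp: smult_assoc1\<close>)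
qed (use assms in auto)

lemma mem_span: "s \<in> carrier M \<Longrightarrow> s \<in> (\<lambda>r. r \<odot>\<^bsub>M\<^esub> s) ` carrier R"
  by (rule image_eqI[of _ _ "\<one>"]) auto

lemma submodule_gen_insert:
  assumes "S \<subseteq> carrier M" "s \<in> carrier M"
  shows "submodule_gen R M (insert s S) = submodule_gen R M S <+>\<^bsub>M\<^esub> ((\<lambda>r. r \<odot>\<^bsub>M\<^esub> s) ` carrier R)"
proof -
  let ?T = "(\<lambda>r. r \<odot>\<^bsub>M\<^esub> s) ` carrier R"
  have T: "submodule ?T R M" by (rule submodule_span[OF assms(2)])
  note S = submodule_gen_submodule[OF assms(1)]
  have ST: "submodule (submodule_gen R M S <+>\<^bsub>M\<^esub> ?T) R M" by (rule submodule_set_add[OF S T])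
  have "s \<in> ?T" by (rule mem_span[OF assms(2)])
  then have "insert s S \<subseteq> submodule_gen R M S <+>\<^bsub>M\<^esub> ?T"
    using set_add_upper[OF S T] submodule_gen_incl by blast
  then have 1: "submodule_gen R M (insert s S) \<subseteq> submodule_gen R M S <+>\<^bsub>M\<^esub> ?T"
    by (rule submodule_gen_least[OF ST])
  have I: "submodule (submodule_gen R M (insert s S)) R M"
    using assms by (intro submodule_gen_submodule) auto
  have "s \<in> submodule_gen R M (insert s S)" using submodule_gen_incl by blast
  then have "?T \<subseteq> submodule_gen R M (insert s S)" using submodule_mem_simps(4)[OF I] by auto
  then have 2: "submodule_gen R M S <+>\<^bsub>M\<^esub> ?T \<subseteq> submodule_gen R M (insert s S)"
    by (intro set_add_least[OF I] submodule_gen_mono) auto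
  show ?thesis using 1 2 by blast
qed

lemma submodule_gen_empty: "submodule_gen R M {} = {\<zero>\<^bsub>M\<^esub>}"
  using submodule_gen_least[OF submodule_zero, of "{}"]
    submodule_mem_simps(1)[OF submodule_gen_submodule[of "{}"]] by auto

end

text \<open>The second factor is any set H, not only the carrier, so that powers of m can be
  obtained by iteration.\<close>

definition ideal_times ::
  "('a, 'c) ring_scheme \<Rightarrow> ('a, 'b, 'd) module_scheme \<Rightarrow> 'a set \<Rightarrow> 'b set \<Rightarrow> 'b set" where
  "ideal_times R M I H = submodule_gen R M {a \<odot>\<^bsub>M\<^esub> x | a x. a \<in> I \<and> x \<in> H}"

lemma ideal_smult_eq: "ideal_smult R I M = ideal_times R M I (carrier M)"
  by (simp add: ideal_smult_def ideal_times_def)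

context module
begin

lemma ideal_times_submodule:
  assumes "I \<subseteq> carrier R" "H \<subseteq> carrier M"
  shows "submodule (ideal_times R M I H) R M"
  unfolding ideal_times_def using assms by (intro submodule_gen_submodule) auto

lemma ideal_times_mem: "a \<in> I \<Longrightarrow> x \<in> H \<Longrightarrow> a \<odot>\<^bsub>M\<^esub> x \<in> ideal_times R M I H"
  unfolding ideal_times_def by (rule subsetD[OF submodule_gen_incl]) auto

lemma ideal_times_least:
  assumes "submodule L R M" "\<And>a x. a \<in> I \<Longrightarrow> x \<in> H \<Longrightarrow> a \<odot>\<^bsub>M\<^esub> x \<in> L"
  shows "ideal_times R M I H \<subseteq> L"
  unfolding ideal_times_def using assms by (intro submodule_gen_least) auto

lemma ideal_times_mono:
  "I \<subseteq> J \<Longrightarrow> H \<subseteq> K \<Longrightarrow> ideal_times R M I H \<subseteq> ideal_times R M J K"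
  unfolding ideal_times_def by (intro submodule_gen_mono) auto

lemma ideal_times_subset:
  assumes "submodule H R M" "I \<subseteq> carrier R"
  shows "ideal_times R M I H \<subseteq> H"
  using submodule_mem_simps(4)[OF assms(1)] assms(2) by (intro ideal_times_least[OF assms(1)]) auto

lemma ideal_times_set_add:
  assumes I: "I \<subseteq> carrier R" and H: "submodule H R M" and K: "submodule K R M"
  shows "ideal_times R M I (H <+>\<^bsub>M\<^esub> K) = ideal_times R M I H <+>\<^bsub>M\<^esub> ideal_times R M I K"
proof
  note Hc = submodule_subset[OF H] and Kc = submodule_subset[OF K]
  note h = ideal_times_submodule[OF I Hc] and k = ideal_times_submodule[OF I Kc]
  show "ideal_times R M I (H <+>\<^bsub>M\<^esub> K) \<subseteq> ideal_times R M I H <+>\<^bsub>M\<^esub> ideal_times R M I K"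
  proof (rule ideal_times_least[OF submodule_set_add[OF h k]])
    fix a z assume a: "a \<in> I" and "z \<in> H <+>\<^bsub>M\<^esub> K"
    then obtain x y where xy: "x \<in> H" "y \<in> K" "z = x \<oplus>\<^bsub>M\<^esub> y" by (auto simp: mem_set_add_iff)
    then have "a \<odot>\<^bsub>M\<^esub> z = a \<odot>\<^bsub>M\<^esub> x \<oplus>\<^bsub>M\<^esub> a \<odot>\<^bsub>M\<^esub> y"
      using a I Hc Kc by (auto intro!: smult_r_distr)
    then show "a \<odot>\<^bsub>M\<^esub> z \<in> ideal_times R M I H <+>\<^bsub>M\<^esub> ideal_times R M I K"
      using set_addI[OF ideal_times_mem[OF a xy(1)] ideal_times_mem[OF a xy(2)]] by simp
  qed
  show "ideal_times R M I H <+>\<^bsub>M\<^esub> ideal_times R M I K \<subseteq> ideal_times R M I (H <+>\<^bsub>M\<^esub> K)"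
  proof (rule set_add_least[OF ideal_times_submodule[OF I]])
    show "H <+>\<^bsub>M\<^esub> K \<subseteq> carrier M" by (rule submodule_subset[OF submodule_set_add[OF H K]])
  qed (intro ideal_times_mono order.refl set_add_upper[OF H K])+
qed

lemma ideal_times_smult_image:
  assumes I: "I \<subseteq> carrier R" and H: "submodule H R M" and c: "c \<in> carrier R"
  shows "ideal_times R M I ((\<odot>\<^bsub>M\<^esub>) c ` H) = (\<odot>\<^bsub>M\<^esub>) c ` ideal_times R M I H"
proof
  note Hc = submodule_subset[OF H]
  note h = ideal_times_submodule[OF I Hc]
  show "ideal_times R M I ((\<odot>\<^bsub>M\<^esub>) c ` H) \<subseteq> (\<odot>\<^bsub>M\<^esub>) c ` ideal_times R M I H"
  proof (rule ideal_times_least[OF submodule_smult_image[OF h c]])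
    fix a z assume a: "a \<in> I" and "z \<in> (\<odot>\<^bsub>M\<^esub>) c ` H"
    then obtain x where x: "x \<in> H" "z = c \<odot>\<^bsub>M\<^esub> x" by auto
    then have "a \<odot>\<^bsub>M\<^esub> z = c \<odot>\<^bsub>M\<^esub> (a \<odot>\<^bsub>M\<^esub> x)" using a I Hc c by (auto intro!: smult_comm)
    then show "a \<odot>\<^bsub>M\<^esub> z \<in> (\<odot>\<^bsub>M\<^esub>) c ` ideal_times R M I H"
      using ideal_times_mem[OF a x(1)] by auto
  qed
  have cH: "submodule ((\<odot>\<^bsub>M\<^esub>) c ` H) R M" by (rule submodule_smult_image[OF H c])
  then have L: "submodule (ideal_times R M I ((\<odot>\<^bsub>M\<^esub>) c ` H)) R M"
    using I submodule_subset by (intro ideal_times_submodule)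
  have "ideal_times R M I H \<subseteq> {v \<in> carrier M. c \<odot>\<^bsub>M\<^esub> v \<in> ideal_times R M I ((\<odot>\<^bsub>M\<^esub>) c ` H)}"
  proof (rule ideal_times_least[OF submodule_preimage[OF carrier_is_submodule L c]])
    fix a x assume *: "a \<in> I" "x \<in> H"
    then have "c \<odot>\<^bsub>M\<^esub> (a \<odot>\<^bsub>M\<^esub> x) = a \<odot>\<^bsub>M\<^esub> (c \<odot>\<^bsub>M\<^esub> x)"
      using I Hc c by (auto intro!: smult_comm)
    then show "a \<odot>\<^bsub>M\<^esub> x \<in> {v \<in> carrier M. c \<odot>\<^bsub>M\<^esub> v \<in> ideal_times R M I ((\<odot>\<^bsub>M\<^esub>) c ` H)}"
      using * I Hc ideal_times_mem[of a I "c \<odot>\<^bsub>M\<^esub> x"] by auto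
  qed
  then show "(\<odot>\<^bsub>M\<^esub>) c ` ideal_times R M I H \<subseteq> ideal_times R M I ((\<odot>\<^bsub>M\<^esub>) c ` H)" by auto
qed

lemma ideal_smult_empty: "ideal_smult R (Idl {}) M = {\<zero>\<^bsub>M\<^esub>}"
proof
  have Idl: "Idl {} \<subseteq> {\<zero>}" by (rule R.genideal_minimal[OF R.zeroideal]) simp
  show "ideal_smult R (Idl {}) M \<subseteq> {\<zero>\<^bsub>M\<^esub>}"
    unfolding ideal_smult_eq by (rule ideal_times_least[OF submodule_zero]) (use Idl in auto)
  show "{\<zero>\<^bsub>M\<^esub>} \<subseteq> ideal_smult R (Idl {}) M"
    unfolding ideal_smult_eq
    using submodule_mem_simps(1)[OF ideal_times_submodule[of "Idl {}" "carrier M"]] Idl by auto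
qed

end

section \<open>Lengths\<close>

definition submodule_chain ::
  "('a, 'c) ring_scheme \<Rightarrow> ('a, 'b, 'd) module_scheme \<Rightarrow> 'b set \<Rightarrow> 'b set \<Rightarrow> nat \<Rightarrow> (nat \<Rightarrow> 'b set) \<Rightarrow> bool" where
  "submodule_chain R M A B n H \<longleftrightarrow>
     (\<forall>i\<le>n. submodule (H i) R M \<and> B \<subseteq> H i \<and> H i \<subseteq> A) \<and> (\<forall>i<n. H i \<subset> H (Suc i))"

text \<open>Stands for the length of A / B, measured by chains inside M so that no quotient has to
  be formed. A and B may be any sets; \<open>UNIV\<close> and the empty set give
  \<open>module_length\<close>.\<close>

definition rel_length ::
  "('a, 'c) ring_scheme \<Rightarrow> ('a, 'b, 'd) module_scheme \<Rightarrow> 'b set \<Rightarrow> 'b set \<Rightarrow> enat" where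
  "rel_length R M A B = Sup {enat n | n. \<exists>H. submodule_chain R M A B n H}"

lemma module_length_eq_rel_length: "module_length R M = rel_length R M UNIV {}"
  by (simp add: module_length_def rel_length_def submodule_chain_def)

lemma submodule_chain_le: "submodule_chain R M A B n H \<Longrightarrow> enat n \<le> rel_length R M A B"
  unfolding rel_length_def by (intro Sup_upper) auto

lemma rel_length_leI:
  "(\<And>n H. submodule_chain R M A B n H \<Longrightarrow> enat n \<le> c) \<Longrightarrow> rel_length R M A B \<le> c"
  unfolding rel_length_def by (intro Sup_least) auto

lemma submodule_chain_take:
  "submodule_chain R M A B n H \<Longrightarrow> m \<le> n \<Longrightarrow> submodule_chain R M A B m H"
  by (auto simp: submodule_chain_def)

text \<open>If no chain had exactly n steps, then none would have more, since chains can be cut, and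
  the supremum would be at most n - 1.\<close>

lemma submodule_chain_exists:
  assumes "enat n \<le> rel_length R M A B" "submodule A R M" "B \<subseteq> A"
  shows "\<exists>H. submodule_chain R M A B n H"
proof (cases n)
  case 0
  have "submodule_chain R M A B 0 (\<lambda>_. A)" using assms by (auto simp: submodule_chain_def)
  then show ?thesis using 0 by auto
next
  case (Suc m)
  show ?thesis
  proof (rule ccontr)
    assume no: "\<nexists>H. submodule_chain R M A B n H"
    have "rel_length R M A B \<le> enat m"
    proof (rule rel_length_leI)
      fix k H assume "submodule_chain R M A B k H"
      then have "\<not> n \<le> k" using no submodule_chain_take by blast
      then show "enat k \<le> enat m" using Suc by simp
    qed
    then have "enat n \<le> enat m" using assms(1) by (rule order_trans[rotated])
    then show False using Suc by simp
  qed
qed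

text \<open>Comparison of lengths in different modules or intervals. No homomorphism is asked for,
  only a strictly monotone map F on the submodules of the interval; images, preimages, sums and
  unions all serve as F later.\<close>

lemma rel_length_transport:
  assumes "\<And>H. submodule H R M \<Longrightarrow> B \<subseteq> H \<Longrightarrow> H \<subseteq> A \<Longrightarrow>
      submodule (F H) S N \<and> B' \<subseteq> F H \<and> F H \<subseteq> A'"
    and "\<And>H K. submodule H R M \<Longrightarrow> B \<subseteq> H \<Longrightarrow> submodule K R M \<Longrightarrow> K \<subseteq> A \<Longrightarrow> H \<subset> K \<Longrightarrow> F H \<subset> F K"
  shows "rel_length R M A B \<le> rel_length S N A' B'"
proof (rule rel_length_leI)
  fix n H assume "submodule_chain R M A B n H"
  then have *: "\<And>i. i \<le> n \<Longrightarrow> submodule (H i) R M \<and> B \<subseteq> H i \<and> H i \<subseteq> A"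
    "\<And>i. i < n \<Longrightarrow> H i \<subset> H (Suc i)" by (auto simp: submodule_chain_def)
  have "submodule_chain S N A' B' n (\<lambda>i. F (H i))"
    unfolding submodule_chain_def
  proof (intro conjI allI impI)
    fix i assume "i < n"
    then show "F (H i) \<subset> F (H (Suc i))" using *(1)[of i] *(1)[of "Suc i"] *(2)[of i] by (intro assms(2)) auto
  qed (use * assms(1) in blast)+
  then show "enat n \<le> rel_length S N A' B'" by (rule submodule_chain_le)
qed

lemma rel_length_mono:
  assumes "A \<subseteq> A'" "B' \<subseteq> B"
  shows "rel_length R M A B \<le> rel_length R M A' B'"
  by (rule rel_length_transport[where F = id]) (use assms in auto)

lemma rel_length_self: "rel_length R M A A = 0"
proof -
  have "rel_length R M A A \<le> 0"
  proof (rule rel_length_leI)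
    fix n H assume "submodule_chain R M A A n H"
    then have *: "\<And>i. i \<le> n \<Longrightarrow> H i = A" "\<And>i. i < n \<Longrightarrow> H i \<subset> H (Suc i)"
      by (auto simp: submodule_chain_def)
    have "n = 0" using *(1)[of 0] *(1)[of 1] *(2)[of 0] by (cases n) auto
    then show "enat n \<le> 0" by (simp add: zero_enat_def)
  qed
  then show ?thesis by simp
qed

lemma rel_length_zero_imp_eq:
  assumes "rel_length R M A B = 0" "submodule A R M" "submodule B R M" "B \<subseteq> A"
  shows "A = B"
proof (rule ccontr)
  assume "A \<noteq> B"
  then have "submodule_chain R M A B 1 (\<lambda>i. if i = 0 then B else A)"
    using assms by (auto simp: submodule_chain_def)
  from submodule_chain_le[OF this] show False using assms(1) by (simp add: zero_enat_def)
qed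

text \<open>Repetitions are deleted from the chain. The clause on the last member is for the
  induction, which appends the next submodule to it.\<close>

lemma submodule_chain_of_weak_chain:
  assumes "\<And>i. i \<le> n \<Longrightarrow> submodule (G i) R M \<and> B \<subseteq> G i \<and> G i \<subseteq> A"
    and "\<And>i. i < n \<Longrightarrow> G i \<subseteq> G (Suc i)"
  shows "\<exists>K. submodule_chain R M A B (card {i. i < n \<and> G i \<noteq> G (Suc i)}) K \<and>
    K (card {i. i < n \<and> G i \<noteq> G (Suc i)}) = G n"
  using assms
proof (induction n)
  case 0
  then show ?case by (intro exI[of _ G]) (auto simp: submodule_chain_def)
next
  case (Suc n)
  let ?p = "card {i. i < n \<and> G i \<noteq> G (Suc i)}"
  obtain K where K: "submodule_chain R M A B ?p K" "K ?p = G n"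
    using Suc.IH Suc.prems by (meson le_SucI less_SucI)
  show ?case
  proof (cases "G n = G (Suc n)")
    case True
    then have "{i. i < Suc n \<and> G i \<noteq> G (Suc i)} = {i. i < n \<and> G i \<noteq> G (Suc i)}"
      by (auto simp: less_Suc_eq)
    then show ?thesis using K True by auto
  next
    case False
    then have "{i. i < Suc n \<and> G i \<noteq> G (Suc i)} = insert n {i. i < n \<and> G i \<noteq> G (Suc i)}"
      by (auto simp: less_Suc_eq)
    then have card: "card {i. i < Suc n \<and> G i \<noteq> G (Suc i)} = Suc ?p" by simp
    have "submodule_chain R M A B (Suc ?p) (K(Suc ?p := G (Suc n)))"
      using K Suc.prems[of n] Suc.prems(1)[of "Suc n"] False
      by (auto simp: submodule_chain_def le_Suc_eq less_Suc_eq)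
    moreover have "(K(Suc ?p := G (Suc n))) (Suc ?p) = G (Suc n)" by simp
    ultimately show ?thesis unfolding card by blast
  qed
qed

context module
begin

text \<open>By the modular law, a strict step of a chain stays strict after intersection with C or
  after adding C. Counting both kinds of steps gives one inequality; concatenation of chains gives
  the other.\<close>

lemma rel_length_add:
  assumes A: "submodule A R M" and B: "submodule B R M" and C: "submodule C R M"
    and BC: "B \<subseteq> C" and CA: "C \<subseteq> A"
  shows "rel_length R M A B = rel_length R M A C + rel_length R M C B"
proof (rule antisym)
  show "rel_length R M A B \<le> rel_length R M A C + rel_length R M C B"
  proof (rule rel_length_leI)
    fix n H assume "submodule_chain R M A B n H"
    then have H: "\<And>i. i \<le> n \<Longrightarrow> submodule (H i) R M" "\<And>i. i \<le> n \<Longrightarrow> B \<subseteq> H i"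
      "\<And>i. i \<le> n \<Longrightarrow> H i \<subseteq> A" "\<And>i. i < n \<Longrightarrow> H i \<subset> H (Suc i)"
      by (auto simp: submodule_chain_def)
    define S1 where "S1 = {i. i < n \<and> H i \<inter> C \<noteq> H (Suc i) \<inter> C}"
    define S2 where "S2 = {i. i < n \<and> H i <+>\<^bsub>M\<^esub> C \<noteq> H (Suc i) <+>\<^bsub>M\<^esub> C}"
    have "{..<n} \<subseteq> S1 \<union> S2"
    proof
      fix i assume "i \<in> {..<n}"
      then have i: "i < n" by simp
      note Hi = H(1)[of i] H(1)[of "Suc i"]
      show "i \<in> S1 \<union> S2"
      proof (rule ccontr)
        assume "i \<notin> S1 \<union> S2"
        then have eq: "H i \<inter> C = H (Suc i) \<inter> C" "H i <+>\<^bsub>M\<^esub> C = H (Suc i) <+>\<^bsub>M\<^esub> C"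
          using i by (auto simp: S1_def S2_def)
        have "H (Suc i) \<subseteq> H i"
        proof
          fix y assume y: "y \<in> H (Suc i)"
          then have "y \<in> H i <+>\<^bsub>M\<^esub> C" using set_add_upper(1)[OF Hi(2) C] eq i by auto
          then obtain h c where hc: "h \<in> H i" "c \<in> C" "y = h \<oplus>\<^bsub>M\<^esub> c" by (auto simp: mem_set_add_iff)
          have hcar: "h \<in> carrier M" "c \<in> carrier M"
            using hc submodule_subset[OF Hi(1)] submodule_subset[OF C] i by auto
          have "h \<in> H (Suc i)" using hc(1) H(4)[OF i] by auto
          then have "c \<in> H (Suc i)"
            using submodule_minus[OF Hi(2), of y h] y minus_add_cancel(2)[OF hcar] hc(3) i by simp
          then have "c \<in> H i" using eq(1) hc(2) by auto
          then show "y \<in> H i" using hc submodule_mem_simps(3)[OF Hi(1)] i by simp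
        qed
        then show False using H(4)[OF i] by auto
      qed
    qed
    then have "n \<le> card (S1 \<union> S2)" using card_mono[of "S1 \<union> S2" "{..<n}"]
      by (simp add: S1_def S2_def)
    also have "\<dots> \<le> card S1 + card S2" by (rule card_Un_le)
    finally have n: "enat n \<le> enat (card S1) + enat (card S2)" by simp
    have "\<exists>K. submodule_chain R M C B (card S1) K"
      using submodule_chain_of_weak_chain[of n "\<lambda>i. H i \<inter> C" R M B C] H(1,2,4) BC
        submodule_Int[OF H(1) C] unfolding S1_def by blast
    then have 1: "enat (card S1) \<le> rel_length R M C B" using submodule_chain_le by blast
    have "\<exists>K. submodule_chain R M A C (card S2) K"
      using submodule_chain_of_weak_chain[of n "\<lambda>i. H i <+>\<^bsub>M\<^esub> C" R M C A]
        set_add_upper(2)[OF H(1) C] set_add_least[OF A H(3) CA]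
        submodule_set_add[OF H(1) C] set_add_mono[OF psubset_imp_subset[OF H(4)] order.refl[of C]]
      unfolding S2_def by blast
    then have 2: "enat (card S2) \<le> rel_length R M A C" using submodule_chain_le by blast
    show "enat n \<le> rel_length R M A C + rel_length R M C B"
      unfolding add.commute[of "rel_length R M A C"] by (rule order_trans[OF n add_mono[OF 1 2]])
  qed
  show "rel_length R M A C + rel_length R M C B \<le> rel_length R M A B"
  proof -
    have key: "enat n + enat m \<le> rel_length R M A B"
      if n: "enat n \<le> rel_length R M A C" and m: "enat m \<le> rel_length R M C B" for n m
    proof -
      obtain H where H: "submodule_chain R M A C n H" using submodule_chain_exists[OF n A CA] by blast
      obtain G where G: "submodule_chain R M C B m G" using submodule_chain_exists[OF m C BC] by blast
      have "submodule_chain R M A B (m + n) (\<lambda>i. if i \<le> m then G i else H (i - m))"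
        unfolding submodule_chain_def
      proof (intro conjI allI impI)
        fix i assume i: "i < m + n"
        consider "i < m" | "i = m" | "i > m" by linarith
        then show "(if i \<le> m then G i else H (i - m)) \<subset> (if Suc i \<le> m then G (Suc i) else H (Suc i - m))"
        proof cases
          case 1 then show ?thesis using G by (simp add: submodule_chain_def)
        next
          case 2
          then have "G m \<subseteq> C" "C \<subseteq> H 0" "H 0 \<subset> H (Suc 0)" using G H i by (auto simp: submodule_chain_def)
          then show ?thesis using 2 by auto
        next
          case 3
          then have "H (i - m) \<subset> H (Suc (i - m))" using H i by (auto simp: submodule_chain_def)
          then show ?thesis using 3 by (simp add: Suc_diff_le)
        qed
      next
        fix i assume i: "i \<le> m + n"
        have gi: "submodule (G i) R M \<and> B \<subseteq> G i \<and> G i \<subseteq> C" if "i \<le> m"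
          using that G by (simp add: submodule_chain_def)
        have hi: "submodule (H (i - m)) R M \<and> C \<subseteq> H (i - m) \<and> H (i - m) \<subseteq> A" if "\<not> i \<le> m"
          using that i H by (simp add: submodule_chain_def)
        show "submodule (if i \<le> m then G i else H (i - m)) R M"
          and "B \<subseteq> (if i \<le> m then G i else H (i - m))"
          and "(if i \<le> m then G i else H (i - m)) \<subseteq> A"
          using gi hi BC CA by auto
      qed
      from submodule_chain_le[OF this] show ?thesis by (simp add: add.commute)
    qed
    show ?thesis
    \<comment> \<open>If the whole length is finite, so are both parts, and chains realising them
      exist and can be joined.\<close>
    proof (cases "rel_length R M A B")
      case (enat b)
      have bd: "rel_length R M A C \<le> enat b" "rel_length R M C B \<le> enat b"
        using rel_length_mono[OF order.refl BC, of R M A] rel_length_mono[OF CA order.refl, of R M B] enat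
        by auto
      then obtain n m where "rel_length R M A C = enat n" "rel_length R M C B = enat m"
        by (metis enat_ile)
      then show ?thesis using key[of n m] by simp
    qed simp
  qed
qed

end

section \<open>Noetherian modules over local rings\<close>

lemma self_module_simps [simp]:
  "carrier (self_module R) = carrier R" "\<zero>\<^bsub>self_module R\<^esub> = \<zero>\<^bsub>R\<^esub>"
  "x \<oplus>\<^bsub>self_module R\<^esub> y = x \<oplus>\<^bsub>R\<^esub> y" "a \<odot>\<^bsub>self_module R\<^esub> x = a \<otimes>\<^bsub>R\<^esub> x"
  by (simp_all add: self_module_def)

lemma (in cring) self_module_module: "module R (self_module R)"
proof (rule moduleI)
  show "abelian_group (self_module R)"
  proof (rule abelian_groupI)
    fix x assume "x \<in> carrier (self_module R)"
    then show "\<exists>y\<in>carrier (self_module R). y \<oplus>\<^bsub>self_module R\<^esub> x = \<zero>\<^bsub>self_module R\<^esub>"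
      using a_inv_closed l_neg by auto
  qed (auto simp: a_assoc intro: a_comm)
qed (auto simp: l_distr r_distr m_assoc is_cring)

text \<open>Lets the results on submodules serve for ideals, with R as a module over itself.\<close>

lemma (in cring) ideal_iff_submodule: "ideal I R \<longleftrightarrow> submodule I R (self_module R)"
proof
  interpret S: module R "self_module R" by (rule self_module_module)
  assume I: "ideal I R"
  show "submodule I R (self_module R)"
    by (rule S.submoduleI')
      (use I in \<open>auto simp: ideal.Icarr additive_subgroup.zero_closed additive_subgroup.a_closed
        ideal.I_l_closed ideal.axioms(1)\<close>)
next
  interpret S: module R "self_module R" by (rule self_module_module)
  assume I: "submodule I R (self_module R)"
  note i = submodule_mem_simps[OF I, simplified]
  show "ideal I R"
  proof (rule idealI)
    show "subgroup I (add_monoid R)"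
    proof (rule add.subgroupI)
      show "I \<noteq> {}" using i by auto
      fix a assume a: "a \<in> I"
      then have "\<ominus> a = (\<ominus> \<one>) \<otimes> a" using i(2) by (simp add: l_minus)
      then show "\<ominus> a \<in> I" using i(4)[of "\<ominus> \<one>" a] a by simp
    qed (use i in auto)
  next
    fix a x assume "a \<in> I" "x \<in> carrier R"
    then show "x \<otimes> a \<in> I" "a \<otimes> x \<in> I" using i(2,4) m_comm[of a x] by auto
  qed (rule ring_axioms)
qed

lemma (in cring) genideal_eq_submodule_gen: "Idl S = submodule_gen R (self_module R) S"
  by (simp add: genideal_def submodule_gen_def ideal_iff_submodule)

lemma (in cring) exists_maximalideal:
  assumes "ideal I R" "I \<noteq> carrier R"
  shows "\<exists>J. maximalideal J R \<and> I \<subseteq> J"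
proof -
  let ?A = "{J. ideal J R \<and> I \<subseteq> J \<and> \<one> \<notin> J}"
  have "\<exists>J\<in>?A. \<forall>Y\<in>?A. J \<subseteq> Y \<longrightarrow> Y = J"
  proof (rule subset_Zorn_nonempty)
    show "?A \<noteq> {}" using assms ideal.one_imp_carrier by auto
    fix C assume C: "C \<noteq> {}" "subset.chain ?A C"
    then have "subset.chain {J. ideal J R} C" by (auto simp: pred_on.chain_def)
    from chain_Union_is_ideal[OF this] C show "\<Union>C \<in> ?A" by (auto simp: pred_on.chain_def)
  qed
  then obtain J where J: "ideal J R" "I \<subseteq> J" "\<one> \<notin> J"
    and max: "\<And>Y. ideal Y R \<Longrightarrow> I \<subseteq> Y \<Longrightarrow> \<one> \<notin> Y \<Longrightarrow> J \<subseteq> Y \<Longrightarrow> Y = J" by auto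
  have "maximalideal J R"
  proof (rule maximalidealI[OF J(1)])
    show "carrier R \<noteq> J" using J(3) by auto
    fix Y assume "ideal Y R" "J \<subseteq> Y" "Y \<subseteq> carrier R"
    then show "Y = J \<or> Y = carrier R" using max[of Y] J(2) ideal.one_imp_carrier[of Y R] by blast
  qed
  then show ?thesis using J(2) by blast
qed

section \<open>Local rings and their units\<close>

lemma local_ring_cring: "local_ring R \<Longrightarrow> cring R"
  by (simp add: local_ring_def)

lemma local_ring_max_ideal: "local_ring R \<Longrightarrow> maximalideal (max_ideal R) R"
  unfolding local_ring_def max_ideal_def by (rule theI'[of "\<lambda>I. maximalideal I R"]) simp

lemma local_ring_max_ideal_unique: "local_ring R \<Longrightarrow> maximalideal I R \<Longrightarrow> I = max_ideal R"
  using local_ring_max_ideal unfolding local_ring_def by blast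

lemma local_ring_proper_ideal:
  assumes "local_ring R" "ideal I R" "I \<noteq> carrier R"
  shows "I \<subseteq> max_ideal R"
  using cring.exists_maximalideal[OF local_ring_cring[OF assms(1)] assms(2,3)]
    local_ring_max_ideal_unique[OF assms(1)] by blast

lemma local_ring_Units:
  fixes R (structure)
  assumes "local_ring R" "x \<in> carrier R" "x \<notin> max_ideal R"
  shows "x \<in> Units R"
proof -
  interpret cring R by (rule local_ring_cring[OF assms(1)])
  have "PIdl x = carrier R"
  proof (rule ccontr)
    assume "PIdl x \<noteq> carrier R"
    then have "PIdl x \<subseteq> max_ideal R" using local_ring_proper_ideal assms(1) cgenideal_ideal[OF assms(2)] by blast
    then show False using cgenideal_self[OF assms(2)] assms(3) by blast
  qed
  then have "\<one> \<in> PIdl x" by simp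
  then obtain r where "r \<in> carrier R" "\<one> = r \<otimes> x" unfolding cgenideal_def by auto
  then show ?thesis using assms(2) m_comm unfolding Units_def by auto
qed

lemma local_ring_one_minus_Units:
  fixes R (structure)
  assumes "local_ring R" "a \<in> max_ideal R"
  shows "\<one>\<^bsub>R\<^esub> \<ominus>\<^bsub>R\<^esub> a \<in> Units R"
proof -
  interpret cring R by (rule local_ring_cring[OF assms(1)])
  interpret m: maximalideal "max_ideal R" R by (rule local_ring_max_ideal[OF assms(1)])
  have a: "a \<in> carrier R" using assms(2) m.Icarr by simp
  have "\<one> \<ominus> a \<notin> max_ideal R"
  proof
    assume "\<one> \<ominus> a \<in> max_ideal R"
    then have "(\<one> \<ominus> a) \<oplus> a \<in> max_ideal R" using assms(2) m.a_closed by simp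
    moreover have "(\<one> \<ominus> a) \<oplus> a = \<one>" using a by (simp add: a_minus_def a_assoc l_neg)
    ultimately show False using m.one_imp_carrier m.I_notcarr by auto
  qed
  then show ?thesis using local_ring_Units[OF assms(1)] a by simp
qed

locale local_noetherian_module = module R M
  for R :: "('a, 'c) ring_scheme" (structure) and M :: "('a, 'b, 'd) module_scheme" (structure) +
  assumes local: "local_ring R" and noetherian: "noetherian_ring R"
    and fin_gen: "finitely_generated R M"
begin

abbreviation \<mm> :: "'a set" where "\<mm> \<equiv> max_ideal R"

lemma max_ideal_ideal: "ideal \<mm> R"
  using local_ring_max_ideal[OF local] by (rule maximalideal.axioms(1))

lemma max_ideal_subset: "\<mm> \<subseteq> carrier R"
  using ideal.Icarr[OF max_ideal_ideal] by auto

lemma max_ideal_carr [simp]: "a \<in> \<mm> \<Longrightarrow> a \<in> carrier R"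
  using max_ideal_subset by auto

end

section \<open>Submodules of finitely generated modules and Nakayama's lemma\<close>

context module
begin

lemma smult_inv_cancel:
  assumes u: "u \<in> Units R" and x: "x \<in> carrier M"
  shows "inv u \<odot>\<^bsub>M\<^esub> (u \<odot>\<^bsub>M\<^esub> x) = x"
proof -
  have "inv u \<odot>\<^bsub>M\<^esub> (u \<odot>\<^bsub>M\<^esub> x) = (inv u \<otimes> u) \<odot>\<^bsub>M\<^esub> x"
    using u x by (intro smult_assoc1[symmetric]) auto
  then show ?thesis using R.Units_l_inv[OF u] x by simp
qed

text \<open>With T spanned by the remaining generators, this is the ideal of leading coefficients of
  H with respect to s, as in the basis theorem.\<close>

lemma ideal_leading_coeffs:
  assumes T: "submodule T R M" and H: "submodule H R M" and s: "s \<in> carrier M"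
  shows "ideal {r \<in> carrier R. \<exists>t\<in>T. r \<odot>\<^bsub>M\<^esub> s \<oplus>\<^bsub>M\<^esub> t \<in> H} R"
proof -
  interpret S: module R "self_module R" by (rule R.self_module_module)
  note t = submodule_mem_simps[OF T] and h = submodule_mem_simps[OF H]
  show ?thesis
    unfolding R.ideal_iff_submodule
  proof (rule S.submoduleI')
    show "\<zero>\<^bsub>self_module R\<^esub> \<in> {r \<in> carrier R. \<exists>t\<in>T. r \<odot>\<^bsub>M\<^esub> s \<oplus>\<^bsub>M\<^esub> t \<in> H}"
      using t(1) h(1) s by (auto intro!: bexI[of _ "\<zero>\<^bsub>M\<^esub>"])
    fix x y assume "x \<in> {r \<in> carrier R. \<exists>t\<in>T. r \<odot>\<^bsub>M\<^esub> s \<oplus>\<^bsub>M\<^esub> t \<in> H}"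
      "y \<in> {r \<in> carrier R. \<exists>t\<in>T. r \<odot>\<^bsub>M\<^esub> s \<oplus>\<^bsub>M\<^esub> t \<in> H}"
    then obtain u v where xy: "x \<in> carrier R" "y \<in> carrier R" "u \<in> T" "v \<in> T"
      "x \<odot>\<^bsub>M\<^esub> s \<oplus>\<^bsub>M\<^esub> u \<in> H" "y \<odot>\<^bsub>M\<^esub> s \<oplus>\<^bsub>M\<^esub> v \<in> H" by auto
    have "(x \<oplus> y) \<odot>\<^bsub>M\<^esub> s \<oplus>\<^bsub>M\<^esub> (u \<oplus>\<^bsub>M\<^esub> v) = (x \<odot>\<^bsub>M\<^esub> s \<oplus>\<^bsub>M\<^esub> u) \<oplus>\<^bsub>M\<^esub> (y \<odot>\<^bsub>M\<^esub> s \<oplus>\<^bsub>M\<^esub> v)"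
      using xy t(2) s by (simp add: smult_l_distr M.a_ac)
    then have "(x \<oplus> y) \<odot>\<^bsub>M\<^esub> s \<oplus>\<^bsub>M\<^esub> (u \<oplus>\<^bsub>M\<^esub> v) \<in> H" using h(3)[OF xy(5,6)] by simp
    then show "x \<oplus>\<^bsub>self_module R\<^esub> y \<in> {r \<in> carrier R. \<exists>t\<in>T. r \<odot>\<^bsub>M\<^esub> s \<oplus>\<^bsub>M\<^esub> t \<in> H}"
      using xy t(3) by auto
  next
    fix a x assume a: "a \<in> carrier R" and "x \<in> {r \<in> carrier R. \<exists>t\<in>T. r \<odot>\<^bsub>M\<^esub> s \<oplus>\<^bsub>M\<^esub> t \<in> H}"
    then obtain u where x: "x \<in> carrier R" "u \<in> T" "x \<odot>\<^bsub>M\<^esub> s \<oplus>\<^bsub>M\<^esub> u \<in> H" by auto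
    have "(a \<otimes> x) \<odot>\<^bsub>M\<^esub> s \<oplus>\<^bsub>M\<^esub> (a \<odot>\<^bsub>M\<^esub> u) = a \<odot>\<^bsub>M\<^esub> (x \<odot>\<^bsub>M\<^esub> s \<oplus>\<^bsub>M\<^esub> u)"
      using x a t(2) s by (simp add: smult_r_distr smult_assoc1)
    then have "(a \<otimes> x) \<odot>\<^bsub>M\<^esub> s \<oplus>\<^bsub>M\<^esub> (a \<odot>\<^bsub>M\<^esub> u) \<in> H" using h(4)[OF a x(3)] by simp
    then show "a \<odot>\<^bsub>self_module R\<^esub> x \<in> {r \<in> carrier R. \<exists>t\<in>T. r \<odot>\<^bsub>M\<^esub> s \<oplus>\<^bsub>M\<^esub> t \<in> H}"
      using x a t(4) by auto
  qed auto
qed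

text \<open>Induction on the generators of the ambient span: H is generated by lifts of finitely
  many generators of its ideal of leading coefficients, together with generators of its intersection
  with the span of the other elements. H is only required to lie in the span, so that the hypothesis
  applies to that intersection.\<close>

lemma submodule_fin_gen_aux:
  assumes noeth: "noetherian_ring R"
    and "finite S" "S \<subseteq> carrier M" "submodule H R M" "H \<subseteq> submodule_gen R M S"
  shows "\<exists>T. finite T \<and> T \<subseteq> H \<and> H = submodule_gen R M T"
  using assms(2-)
proof (induction S arbitrary: H)
  case empty
  then have "H = {\<zero>\<^bsub>M\<^esub>}" using submodule_gen_empty submodule_mem_simps(1)[OF empty.prems(2)] by auto
  then show ?case using submodule_gen_empty by (intro exI[of _ "{}"]) auto
next
  case (insert s S)
  define G where "G = submodule_gen R M S"
  have sS: "s \<in> carrier M" "S \<subseteq> carrier M" using insert.prems by auto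
  have G: "submodule G R M" unfolding G_def by (rule submodule_gen_submodule[OF sS(2)])
  note H = insert.prems(2)
  note g = submodule_mem_simps[OF G] and h = submodule_mem_simps[OF H]
  define I where "I = {r \<in> carrier R. \<exists>t\<in>G. r \<odot>\<^bsub>M\<^esub> s \<oplus>\<^bsub>M\<^esub> t \<in> H}"
  have "ideal I R" unfolding I_def by (rule ideal_leading_coeffs[OF G H sS(1)])
  then obtain A where A: "A \<subseteq> carrier R" "finite A" "I = Idl A"
    using noetherian_ring.finetely_gen[OF noeth] by blast
  have AI: "A \<subseteq> I" using A R.genideal_self by blast
  then have "\<forall>a\<in>A. \<exists>t. t \<in> G \<and> a \<odot>\<^bsub>M\<^esub> s \<oplus>\<^bsub>M\<^esub> t \<in> H" by (auto simp: I_def)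
  then obtain t where t: "\<And>a. a \<in> A \<Longrightarrow> t a \<in> G" "\<And>a. a \<in> A \<Longrightarrow> a \<odot>\<^bsub>M\<^esub> s \<oplus>\<^bsub>M\<^esub> t a \<in> H" by metis
  define U where "U = (\<lambda>a. a \<odot>\<^bsub>M\<^esub> s \<oplus>\<^bsub>M\<^esub> t a) ` A"
  have U: "finite U" "U \<subseteq> H" using A t by (auto simp: U_def)
  obtain T where T: "finite T" "T \<subseteq> H \<inter> G" "H \<inter> G = submodule_gen R M T"
    using insert.IH[OF sS(2) submodule_Int[OF H G]] G_def by blast
  have UT: "U \<union> T \<subseteq> carrier M" using U T submodule_subset[OF H] by auto
  define K where "K = submodule_gen R M (U \<union> T)"
  have K: "submodule K R M" unfolding K_def by (rule submodule_gen_submodule[OF UT])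
  have UK: "U \<union> T \<subseteq> K" unfolding K_def by (rule submodule_gen_incl)
  have KH: "K \<subseteq> H" unfolding K_def using U T by (intro submodule_gen_least[OF H]) auto
  have "ideal {r \<in> carrier R. \<exists>t\<in>G. r \<odot>\<^bsub>M\<^esub> s \<oplus>\<^bsub>M\<^esub> t \<in> K} R" by (rule ideal_leading_coeffs[OF G K sS(1)])
  moreover have "A \<subseteq> {r \<in> carrier R. \<exists>t\<in>G. r \<odot>\<^bsub>M\<^esub> s \<oplus>\<^bsub>M\<^esub> t \<in> K}"
  proof
    fix a assume a: "a \<in> A"
    then have "a \<odot>\<^bsub>M\<^esub> s \<oplus>\<^bsub>M\<^esub> t a \<in> K" using UK by (auto simp: U_def)
    then show "a \<in> {r \<in> carrier R. \<exists>t\<in>G. r \<odot>\<^bsub>M\<^esub> s \<oplus>\<^bsub>M\<^esub> t \<in> K}" using a A(1) t(1) by blast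
  qed
  ultimately have IK: "I \<subseteq> {r \<in> carrier R. \<exists>t\<in>G. r \<odot>\<^bsub>M\<^esub> s \<oplus>\<^bsub>M\<^esub> t \<in> K}"
    unfolding A(3) by (rule R.genideal_minimal)
  have GK: "H \<inter> G \<subseteq> K" unfolding T(3) K_def by (rule submodule_gen_mono) auto
  \<comment> \<open>Every leading coefficient of H also occurs in K. Subtracting an element of K
    with the same coefficient leaves an element of H in G, hence in K.\<close>
  have "H \<subseteq> K"
  proof
    fix y assume y: "y \<in> H"
    then have "y \<in> submodule_gen R M (insert s S)" using insert.prems(3) by auto
    then obtain u r where ur: "u \<in> G" "r \<in> carrier R" "y = u \<oplus>\<^bsub>M\<^esub> r \<odot>\<^bsub>M\<^esub> s"
      unfolding submodule_gen_insert[OF sS(2,1)] G_def[symmetric] mem_set_add_iff by auto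
    then have y': "y = r \<odot>\<^bsub>M\<^esub> s \<oplus>\<^bsub>M\<^esub> u" using g(2) sS by (simp add: M.a_comm)
    have "r \<odot>\<^bsub>M\<^esub> s \<oplus>\<^bsub>M\<^esub> u \<in> H" using y y' by simp
    then have "r \<in> I" using ur(1,2) by (auto simp: I_def)
    then obtain v where v: "v \<in> G" "r \<odot>\<^bsub>M\<^esub> s \<oplus>\<^bsub>M\<^esub> v \<in> K" using IK by auto
    let ?k = "r \<odot>\<^bsub>M\<^esub> s \<oplus>\<^bsub>M\<^esub> v"
    have car: "r \<odot>\<^bsub>M\<^esub> s \<in> carrier M" "u \<in> carrier M" "v \<in> carrier M" "?k \<in> carrier M" "y \<in> carrier M"
      using g(2) ur v sS y h(2) by auto
    have "y \<ominus>\<^bsub>M\<^esub> ?k = u \<ominus>\<^bsub>M\<^esub> v"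
    proof -
      have "y = (u \<ominus>\<^bsub>M\<^esub> v) \<oplus>\<^bsub>M\<^esub> ?k"
        using car y' minus_add_cancel(3)[of u v] by (metis M.a_comm M.a_lcomm M.minus_closed)
      then show ?thesis using minus_add_cancel(1)[of "u \<ominus>\<^bsub>M\<^esub> v" ?k] car by simp
    qed
    moreover have "u \<ominus>\<^bsub>M\<^esub> v \<in> G" by (rule submodule_minus[OF G ur(1) v(1)])
    moreover have "y \<ominus>\<^bsub>M\<^esub> ?k \<in> H" using submodule_minus[OF H y] v(2) KH by auto
    ultimately have "y \<ominus>\<^bsub>M\<^esub> ?k \<in> K" using GK by auto
    then have "(y \<ominus>\<^bsub>M\<^esub> ?k) \<oplus>\<^bsub>M\<^esub> ?k \<in> K" using submodule_mem_simps(3)[OF K] v(2) by blast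
    then show "y \<in> K" using minus_add_cancel(3)[of y ?k] car by simp
  qed
  then have "H = submodule_gen R M (U \<union> T)" using KH K_def by blast
  then show ?case using U T by (intro exI[of _ "U \<union> T"]) auto
qed

end

context local_noetherian_module
begin

lemma submodule_fin_gen:
  assumes "submodule H R M"
  shows "\<exists>T. finite T \<and> T \<subseteq> H \<and> H = submodule_gen R M T"
proof -
  obtain S where S: "finite S" "S \<subseteq> carrier M" "submodule_gen R M S = carrier M"
    using fin_gen by (auto simp: finitely_generated_def)
  show ?thesis
    by (rule submodule_fin_gen_aux[OF noetherian S(1,2) assms]) (use S(3) submodule_subset[OF assms] in auto)
qed

text \<open>The union of a chain is generated by finitely many elements; these lie in one member,
  which is therefore the union. Zorn's lemma applies.\<close>

lemma submodule_maximal_element: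
  assumes "F \<noteq> {}" "\<And>H. H \<in> F \<Longrightarrow> submodule H R M"
  shows "\<exists>P\<in>F. \<forall>Y\<in>F. P \<subseteq> Y \<longrightarrow> Y = P"
proof (rule subset_Zorn_nonempty[OF assms(1)])
  fix C assume C: "C \<noteq> {}" "subset.chain F C"
  then have CF: "C \<subseteq> F" and lin: "\<And>H K. H \<in> C \<Longrightarrow> K \<in> C \<Longrightarrow> H \<subseteq> K \<or> K \<subseteq> H"
    by (auto simp: pred_on.chain_def)
  have sub: "submodule H R M" if "H \<in> C" for H using that CF assms(2) by auto
  have "submodule (\<Union>C) R M" by (rule submodule_Union_chain[OF C(1) sub lin])
  then obtain T where T: "finite T" "T \<subseteq> \<Union>C" "\<Union>C = submodule_gen R M T"
    using submodule_fin_gen[OF \<open>submodule (\<Union>C) R M\<close>] by auto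
  have "\<exists>H\<in>C. T \<subseteq> H" using T(1,2)
  proof (induction T)
    case empty then show ?case using C(1) by auto
  next
    case (insert t T)
    then obtain H K where "H \<in> C" "T \<subseteq> H" "K \<in> C" "t \<in> K" by auto
    then show ?case using lin[of H K] by blast
  qed
  then obtain H where H: "H \<in> C" "T \<subseteq> H" by auto
  have "\<Union>C \<subseteq> H" unfolding T(3) by (rule submodule_gen_least[OF sub[OF H(1)] H(2)])
  then have "\<Union>C = H" using H by auto
  then show "\<Union>C \<in> F" using H CF by auto
qed

text \<open>Instead of determinants, a submodule P that is maximal among the proper submodules of A
  containing the intersection of A and B. It contains m A: if r v were outside P, then v = w + q r v
  with w in P, and the unit 1 - q r would put v, hence r v, into P. The hypothesis then places all
  of A in P.\<close>

lemma nakayama: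
  assumes A: "submodule A R M" and B: "submodule B R M"
    and sub: "A \<subseteq> ideal_times R M \<mm> A <+>\<^bsub>M\<^esub> B"
  shows "A \<subseteq> B"
proof (rule ccontr)
  assume "\<not> A \<subseteq> B"
  note a = submodule_mem_simps[OF A] and b = submodule_mem_simps[OF B]
  have mA: "ideal_times R M \<mm> A \<subseteq> A" by (rule ideal_times_subset[OF A max_ideal_subset])
  define F where "F = {P. submodule P R M \<and> A \<inter> B \<subseteq> P \<and> P \<subset> A}"
  have "A \<inter> B \<in> F" using \<open>\<not> A \<subseteq> B\<close> submodule_Int[OF A B] by (auto simp: F_def)
  then have "F \<noteq> {}" by auto
  moreover have "submodule H R M" if "H \<in> F" for H using that by (simp add: F_def)
  ultimately have "\<exists>P\<in>F. \<forall>Y\<in>F. P \<subseteq> Y \<longrightarrow> Y = P" by (rule submodule_maximal_element)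
  then obtain P where P: "P \<in> F" and max: "\<And>Y. Y \<in> F \<Longrightarrow> P \<subseteq> Y \<Longrightarrow> Y = P" by blast
  have Ps: "submodule P R M" and ABP: "A \<inter> B \<subseteq> P" and PA: "P \<subset> A" using P by (auto simp: F_def)
  note p = submodule_mem_simps[OF Ps]
  have "ideal_times R M \<mm> A \<subseteq> P"
  proof (rule ideal_times_least[OF Ps])
    fix r v assume r: "r \<in> \<mm>" and v: "v \<in> A"
    have rc: "r \<in> carrier R" and vc: "v \<in> carrier M" using r v a by auto
    show "r \<odot>\<^bsub>M\<^esub> v \<in> P"
    proof (rule ccontr)
      assume n: "r \<odot>\<^bsub>M\<^esub> v \<notin> P"
      let ?T = "(\<lambda>q. q \<odot>\<^bsub>M\<^esub> (r \<odot>\<^bsub>M\<^esub> v)) ` carrier R"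
      have rv: "r \<odot>\<^bsub>M\<^esub> v \<in> A" "r \<odot>\<^bsub>M\<^esub> v \<in> carrier M" using a v rc by auto
      have T: "submodule ?T R M" by (rule submodule_span[OF rv(2)])
      have TA: "?T \<subseteq> A" using a(4) rv(1) by auto
      have PT: "submodule (P <+>\<^bsub>M\<^esub> ?T) R M" by (rule submodule_set_add[OF Ps T])
      have "r \<odot>\<^bsub>M\<^esub> v \<in> P <+>\<^bsub>M\<^esub> ?T" using set_add_upper(2)[OF Ps T] mem_span[OF rv(2)] by blast
      then have "P <+>\<^bsub>M\<^esub> ?T \<noteq> P" using n by auto
      then have "P <+>\<^bsub>M\<^esub> ?T \<notin> F" using max set_add_upper(1)[OF Ps T] by blast
      then have "P <+>\<^bsub>M\<^esub> ?T = A"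
        using PT set_add_upper(1)[OF Ps T] ABP set_add_least[OF A _ TA, of P] PA by (auto simp: F_def)
      then have "v \<in> P <+>\<^bsub>M\<^esub> ?T" using v by simp
      then obtain w q where wq: "w \<in> P" "q \<in> carrier R" "v = w \<oplus>\<^bsub>M\<^esub> q \<odot>\<^bsub>M\<^esub> (r \<odot>\<^bsub>M\<^esub> v)"
        by (auto simp: mem_set_add_iff)
      have qr: "q \<otimes> r \<in> \<mm>" using ideal.I_l_closed[OF max_ideal_ideal r wq(2)] .
      have w: "w \<in> carrier M" using wq p by auto
      have "(\<one> \<ominus> q \<otimes> r) \<odot>\<^bsub>M\<^esub> v = v \<ominus>\<^bsub>M\<^esub> q \<odot>\<^bsub>M\<^esub> (r \<odot>\<^bsub>M\<^esub> v)"
        using wq(2) rc vc by (simp add: smult_minus_distr_l smult_assoc1)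
      also have "\<dots> = w" using minus_add_cancel(1)[OF w, of "q \<odot>\<^bsub>M\<^esub> (r \<odot>\<^bsub>M\<^esub> v)"] wq rv by simp
      finally have w': "(\<one> \<ominus> q \<otimes> r) \<odot>\<^bsub>M\<^esub> v = w" .
      have U: "\<one> \<ominus> q \<otimes> r \<in> Units R" by (rule local_ring_one_minus_Units[OF local qr])
      have "v = inv (\<one> \<ominus> q \<otimes> r) \<odot>\<^bsub>M\<^esub> w"
        using smult_inv_cancel[OF U vc] w' by simp
      then have "v \<in> P" using p(4)[OF _ wq(1), of "inv (\<one> \<ominus> q \<otimes> r)"] U by simp
      then show False using n p(4) rc by blast
    qed
  qed
  moreover have "A \<subseteq> ideal_times R M \<mm> A <+>\<^bsub>M\<^esub> (A \<inter> B)"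
  proof
    fix x assume x: "x \<in> A"
    then have "x \<in> ideal_times R M \<mm> A <+>\<^bsub>M\<^esub> B" using sub by auto
    then obtain y z where yz: "y \<in> ideal_times R M \<mm> A" "z \<in> B" "x = y \<oplus>\<^bsub>M\<^esub> z"
      by (auto simp: mem_set_add_iff)
    then have yc: "y \<in> A" "y \<in> carrier M" "z \<in> carrier M" using mA a b by auto
    have "z \<in> A" using submodule_minus[OF A x yc(1)] minus_add_cancel(2)[OF yc(2,3)] yz by simp
    then show "x \<in> ideal_times R M \<mm> A <+>\<^bsub>M\<^esub> (A \<inter> B)" using yz by (auto intro: set_addI)
  qed
  ultimately have "A \<subseteq> P" using set_add_least[OF Ps] ABP by blast
  then show False using PA by blast
qed

end

section \<open>Generators, quotients and lengths\<close>

context local_noetherian_module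
begin

text \<open>The quotient is cyclic and killed by m. An element of \<open>H 1\<close> outside
  \<open>H 0\<close> has a unit as its coefficient of s, so s lies in \<open>H 1\<close> and the
  chain stops there.\<close>

lemma rel_length_span_le_one:
  assumes B: "submodule B R M" and s: "s \<in> carrier M" and ms: "\<And>a. a \<in> \<mm> \<Longrightarrow> a \<odot>\<^bsub>M\<^esub> s \<in> B"
  shows "rel_length R M (B <+>\<^bsub>M\<^esub> ((\<lambda>r. r \<odot>\<^bsub>M\<^esub> s) ` carrier R)) B \<le> 1"
proof (rule rel_length_leI)
  let ?T = "(\<lambda>r. r \<odot>\<^bsub>M\<^esub> s) ` carrier R"
  note b = submodule_mem_simps[OF B]
  fix n H assume ch: "submodule_chain R M (B <+>\<^bsub>M\<^esub> ?T) B n H"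
  show "enat n \<le> 1"
  proof (rule ccontr)
    assume "\<not> enat n \<le> 1"
    then have n: "n \<ge> 2" by (simp add: one_enat_def)
    then have H: "submodule (H 0) R M" "submodule (H 1) R M" "B \<subseteq> H 0" "H 1 \<subseteq> B <+>\<^bsub>M\<^esub> ?T"
      "H 2 \<subseteq> B <+>\<^bsub>M\<^esub> ?T" "H 0 \<subset> H (Suc 0)" "H 1 \<subset> H (Suc 1)"
      using ch by (auto simp: submodule_chain_def)
    then obtain t where t: "t \<in> H 1" "t \<notin> H 0" by auto
    have "t \<in> B <+>\<^bsub>M\<^esub> ?T" using t H(4) by blast
    then obtain u r where ur: "u \<in> B" "r \<in> carrier R" "t = u \<oplus>\<^bsub>M\<^esub> r \<odot>\<^bsub>M\<^esub> s"
      by (auto simp: mem_set_add_iff)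
    note h1 = submodule_mem_simps[OF H(2)]
    have u1: "u \<in> H 1" using ur(1) H(3,6) by auto
    have "r \<notin> \<mm>"
    proof
      assume "r \<in> \<mm>"
      then have "t \<in> B" using ur(1,3) ms b(3) by simp
      then show False using t H(3) by auto
    qed
    then have r: "r \<in> Units R" using local_ring_Units[OF local ur(2)] by simp
    have rs: "r \<odot>\<^bsub>M\<^esub> s \<in> H 1"
      using submodule_minus[OF H(2) t(1) u1] minus_add_cancel(2)[of u "r \<odot>\<^bsub>M\<^esub> s"] ur s b(2) by simp
    have "s = inv r \<odot>\<^bsub>M\<^esub> (r \<odot>\<^bsub>M\<^esub> s)" using smult_inv_cancel[OF r s] by simp
    then have "s \<in> H 1" using h1(4)[OF _ rs, of "inv r"] r by simp
    then have "?T \<subseteq> H 1" using h1(4) by auto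
    then have "B <+>\<^bsub>M\<^esub> ?T \<subseteq> H 1" using H(3,6) by (intro set_add_least[OF H(2)]) auto
    then show False using H(5,7) by (auto simp: numeral_2_eq_2)
  qed
qed

lemma rel_length_gen_le_card:
  assumes "finite S" "S \<subseteq> carrier M" and B: "submodule B R M"
    and mS: "\<And>a s. a \<in> \<mm> \<Longrightarrow> s \<in> S \<Longrightarrow> a \<odot>\<^bsub>M\<^esub> s \<in> B"
  shows "rel_length R M (submodule_gen R M S <+>\<^bsub>M\<^esub> B) B \<le> enat (card S)"
  using assms(1,2,4)
proof (induction S)
  case empty
  have "{\<zero>\<^bsub>M\<^esub>} <+>\<^bsub>M\<^esub> B = B"
    using set_add_least[OF B, of "{\<zero>\<^bsub>M\<^esub>}" B] submodule_mem_simps(1)[OF B] set_add_upper(2)[OF submodule_zero B]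
    by auto
  then show ?case by (simp add: submodule_gen_empty rel_length_self)
next
  case (insert s S)
  let ?T = "(\<lambda>r. r \<odot>\<^bsub>M\<^esub> s) ` carrier R"
  have sS: "s \<in> carrier M" "S \<subseteq> carrier M" using insert.prems by auto
  define G where "G = submodule_gen R M S"
  have G: "submodule G R M" unfolding G_def by (rule submodule_gen_submodule[OF sS(2)])
  have T: "submodule ?T R M" by (rule submodule_span[OF sS(1)])
  have GB: "submodule (G <+>\<^bsub>M\<^esub> B) R M" by (rule submodule_set_add[OF G B])
  have GT: "submodule (G <+>\<^bsub>M\<^esub> ?T) R M" by (rule submodule_set_add[OF G T])
  have GTB: "submodule (G <+>\<^bsub>M\<^esub> ?T <+>\<^bsub>M\<^esub> B) R M" by (rule submodule_set_add[OF GT B])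
  have GBT: "submodule (G <+>\<^bsub>M\<^esub> B <+>\<^bsub>M\<^esub> ?T) R M" by (rule submodule_set_add[OF GB T])
  have eq: "submodule_gen R M (insert s S) <+>\<^bsub>M\<^esub> B = (G <+>\<^bsub>M\<^esub> B) <+>\<^bsub>M\<^esub> ?T"
    unfolding submodule_gen_insert[OF sS(2,1)] G_def[symmetric]
  proof (rule antisym)
    note up = set_add_upper[OF GB T] set_add_upper[OF G B] set_add_upper[OF GT B] set_add_upper[OF G T]
    show "G <+>\<^bsub>M\<^esub> ?T <+>\<^bsub>M\<^esub> B \<subseteq> G <+>\<^bsub>M\<^esub> B <+>\<^bsub>M\<^esub> ?T"
      using up by (intro set_add_least[OF GBT]) auto
    show "G <+>\<^bsub>M\<^esub> B <+>\<^bsub>M\<^esub> ?T \<subseteq> G <+>\<^bsub>M\<^esub> ?T <+>\<^bsub>M\<^esub> B"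
      using up by (intro set_add_least[OF GTB]) auto
  qed
  have BGB: "B \<subseteq> G <+>\<^bsub>M\<^esub> B" by (rule set_add_upper(2)[OF G B])
  have 1: "rel_length R M (G <+>\<^bsub>M\<^esub> B <+>\<^bsub>M\<^esub> ?T) (G <+>\<^bsub>M\<^esub> B) \<le> 1"
    by (rule rel_length_span_le_one[OF GB sS(1)]) (use insert.prems BGB in auto)
  have 2: "rel_length R M (G <+>\<^bsub>M\<^esub> B) B \<le> enat (card S)"
    unfolding G_def using insert.IH insert.prems by auto
  have "rel_length R M (G <+>\<^bsub>M\<^esub> B <+>\<^bsub>M\<^esub> ?T) B
      = rel_length R M (G <+>\<^bsub>M\<^esub> B <+>\<^bsub>M\<^esub> ?T) (G <+>\<^bsub>M\<^esub> B) + rel_length R M (G <+>\<^bsub>M\<^esub> B) B"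
    by (rule rel_length_add[OF GBT B GB BGB set_add_upper(1)[OF GB T]])
  also have "\<dots> \<le> 1 + enat (card S)" by (rule add_mono[OF 1 2])
  also have "\<dots> = enat (card (insert s S))" using insert.hyps by (simp add: one_enat_def)
  finally show ?case unfolding eq .
qed

lemma rel_length_max_ideal_finite:
  assumes A: "submodule A R M" and B: "submodule B R M" and BA: "B \<subseteq> A" and mA: "ideal_times R M \<mm> A \<subseteq> B"
  shows "rel_length R M A B \<noteq> \<infinity>"
proof -
  obtain S where S: "finite S" "S \<subseteq> A" "A = submodule_gen R M S" using submodule_fin_gen[OF A] by auto
  have Sc: "S \<subseteq> carrier M" using S(2) submodule_subset[OF A] by auto
  have "a \<odot>\<^bsub>M\<^esub> s \<in> B" if "a \<in> \<mm>" "s \<in> S" for a s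
    using ideal_times_mem[OF that(1), of s A] that(2) S(2) mA by auto
  from rel_length_gen_le_card[OF S(1) Sc B this]
  have "rel_length R M (A <+>\<^bsub>M\<^esub> B) B \<le> enat (card S)" using S(3) by simp
  moreover have "A <+>\<^bsub>M\<^esub> B = A"
    using set_add_least[OF A order.refl BA] set_add_upper(1)[OF A B] by auto
  ultimately show ?thesis by (cases "rel_length R M A B") simp_all
qed

lemma max_ideal_times_submodule:
  "submodule A R M \<Longrightarrow> submodule (ideal_times R M \<mm> A) R M"
  by (rule ideal_times_submodule[OF max_ideal_subset submodule_subset])

lemma max_ideal_times_subset:
  "submodule A R M \<Longrightarrow> ideal_times R M \<mm> A \<subseteq> A"
  by (rule ideal_times_subset[OF _ max_ideal_subset])

text \<open>Elements outside the span modulo m A are added greedily. Each raises the length by at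
  least 1, so after d steps the span modulo m A is everything, and Nakayama removes m A.\<close>

lemma generators_exist:
  assumes A: "submodule A R M" and d: "rel_length R M A (ideal_times R M \<mm> A) = enat d"
  shows "\<exists>S. finite S \<and> card S \<le> d \<and> S \<subseteq> A \<and> submodule_gen R M S = A"
proof -
  let ?B = "ideal_times R M \<mm> A"
  have B: "submodule ?B R M" and BA: "?B \<subseteq> A"
    using max_ideal_times_submodule[OF A] max_ideal_times_subset[OF A] by auto
  note a = submodule_mem_simps[OF A]
  have sub: "submodule (submodule_gen R M S) R M" "submodule_gen R M S \<subseteq> A" if "S \<subseteq> A" for S
    using that submodule_gen_submodule submodule_gen_least[OF A that] submodule_subset[OF A] by auto
  have sub2: "submodule (submodule_gen R M S <+>\<^bsub>M\<^esub> ?B) R M" "submodule_gen R M S <+>\<^bsub>M\<^esub> ?B \<subseteq> A"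
    "?B \<subseteq> submodule_gen R M S <+>\<^bsub>M\<^esub> ?B" if "S \<subseteq> A" for S
    using submodule_set_add[OF sub(1)[OF that] B] set_add_least[OF A sub(2)[OF that] BA]
      set_add_upper(2)[OF sub(1)[OF that] B] by auto
  have "(\<exists>S. finite S \<and> card S \<le> k \<and> S \<subseteq> A \<and> submodule_gen R M S <+>\<^bsub>M\<^esub> ?B = A) \<or>
    (\<exists>S. finite S \<and> card S \<le> k \<and> S \<subseteq> A \<and> enat k \<le> rel_length R M (submodule_gen R M S <+>\<^bsub>M\<^esub> ?B) ?B)" for k
  proof (induction k)
    case 0
    show ?case by (intro disjI2 exI[of _ "{}"]) (auto simp: zero_enat_def[symmetric])
  next
    case (Suc k)
    show ?case
    proof (cases "\<exists>S. finite S \<and> card S \<le> k \<and> S \<subseteq> A \<and> submodule_gen R M S <+>\<^bsub>M\<^esub> ?B = A")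
      case True
      then obtain S where "finite S" "card S \<le> k" "S \<subseteq> A" "submodule_gen R M S <+>\<^bsub>M\<^esub> ?B = A" by auto
      then show ?thesis by (intro disjI1 exI[of _ S]) simp
    next
      case False
      then have "\<exists>S. finite S \<and> card S \<le> k \<and> S \<subseteq> A \<and> enat k \<le> rel_length R M (submodule_gen R M S <+>\<^bsub>M\<^esub> ?B) ?B"
        using Suc by argo
      then obtain S where S: "finite S" "card S \<le> k" "S \<subseteq> A"
        "enat k \<le> rel_length R M (submodule_gen R M S <+>\<^bsub>M\<^esub> ?B) ?B" by auto
      with False have S5: "submodule_gen R M S <+>\<^bsub>M\<^esub> ?B \<noteq> A" by auto
      let ?C = "submodule_gen R M S <+>\<^bsub>M\<^esub> ?B"
      obtain s where s: "s \<in> A" "s \<notin> ?C" using S5 sub2(2)[OF S(3)] by auto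
      have sS: "insert s S \<subseteq> A" using s S by auto
      let ?D = "submodule_gen R M (insert s S) <+>\<^bsub>M\<^esub> ?B"
      have CD: "?C \<subseteq> ?D" by (intro set_add_mono submodule_gen_mono) auto
      have "s \<in> submodule_gen R M (insert s S)"
        by (rule subsetD[OF submodule_gen_incl]) auto
      then have "s \<in> ?D" using set_add_upper(1)[OF sub(1)[OF sS] B] by auto
      then have "?C \<noteq> ?D" using s by auto
      then have "rel_length R M ?D ?C \<noteq> 0"
        using rel_length_zero_imp_eq[OF _ sub2(1)[OF sS] sub2(1)[OF S(3)] CD] by auto
      then have 1: "1 \<le> rel_length R M ?D ?C" by (simp add: one_eSuc ileI1)
      have "enat (Suc k) = 1 + enat k" by (simp add: one_enat_def)
      also have "\<dots> \<le> rel_length R M ?D ?C + rel_length R M ?C ?B" by (rule add_mono[OF 1 S(4)])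
      also have "\<dots> = rel_length R M ?D ?B"
        by (rule rel_length_add[OF sub2(1)[OF sS] B sub2(1)[OF S(3)] sub2(3)[OF S(3)] CD, symmetric])
      finally have "enat (Suc k) \<le> rel_length R M ?D ?B" .
      moreover have "card (insert s S) \<le> Suc k" using S(1,2) by (simp add: card_insert_if)
      ultimately show ?thesis using S(1) sS by (intro disjI2 exI[of _ "insert s S"]) simp
    qed
  qed
  from this[of d] have "\<exists>S. finite S \<and> card S \<le> d \<and> S \<subseteq> A \<and> submodule_gen R M S <+>\<^bsub>M\<^esub> ?B = A"
  proof
    assume "\<exists>S. finite S \<and> card S \<le> d \<and> S \<subseteq> A \<and> enat d \<le> rel_length R M (submodule_gen R M S <+>\<^bsub>M\<^esub> ?B) ?B"
    then obtain S where S: "finite S" "card S \<le> d" "S \<subseteq> A"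
      "enat d \<le> rel_length R M (submodule_gen R M S <+>\<^bsub>M\<^esub> ?B) ?B" by auto
    let ?C = "submodule_gen R M S <+>\<^bsub>M\<^esub> ?B"
    have "enat d = rel_length R M A ?C + rel_length R M ?C ?B"
      using rel_length_add[OF A B sub2(1)[OF S(3)] sub2(3)[OF S(3)] sub2(2)[OF S(3)]] d by simp
    then have "rel_length R M A ?C = 0" using S(4)
      by (cases "rel_length R M A ?C"; cases "rel_length R M ?C ?B") (simp_all add: zero_enat_def)
    then have "A = ?C" by (rule rel_length_zero_imp_eq[OF _ A sub2(1)[OF S(3)] sub2(2)[OF S(3)]])
    then show ?thesis using S(1-3) by blast
  qed
  then obtain S where S: "finite S" "card S \<le> d" "S \<subseteq> A" "submodule_gen R M S <+>\<^bsub>M\<^esub> ?B = A" by auto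
  have "A \<subseteq> ?B <+>\<^bsub>M\<^esub> submodule_gen R M S"
    unfolding submodule_set_add_comm[OF B sub(1)[OF S(3)]] S(4) ..
  then have "A \<subseteq> submodule_gen R M S" by (rule nakayama[OF A sub(1)[OF S(3)]])
  then show ?thesis using S sub(2)[OF S(3)] by blast
qed

lemma rel_length_eq_min_gens:
  "rel_length R M (carrier M) (ideal_times R M \<mm> (carrier M)) = enat (min_gens R M)"
proof -
  let ?A = "carrier M" and ?B = "ideal_times R M \<mm> (carrier M)"
  note A = carrier_is_submodule
  have B: "submodule ?B R M" and BA: "?B \<subseteq> ?A"
    using max_ideal_times_submodule[OF A] max_ideal_times_subset[OF A] by auto
  obtain d where d: "rel_length R M ?A ?B = enat d"
    using rel_length_max_ideal_finite[OF A B BA order.refl] by auto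
  have lower: "d \<le> card S" if S: "finite S" "S \<subseteq> carrier M" "submodule_gen R M S = carrier M" for S
  proof -
    have "a \<odot>\<^bsub>M\<^esub> s \<in> ?B" if "a \<in> \<mm>" "s \<in> S" for a s
      using ideal_times_mem[OF that(1), of s ?A] that(2) S(2) by auto
    from rel_length_gen_le_card[OF S(1,2) B this]
    have "rel_length R M (?A <+>\<^bsub>M\<^esub> ?B) ?B \<le> enat (card S)" using S(3) by simp
    moreover have "?A <+>\<^bsub>M\<^esub> ?B = ?A"
      using set_add_least[OF A order.refl BA] set_add_upper(1)[OF A B] by auto
    ultimately show ?thesis using d by simp
  qed
  obtain S where S: "finite S" "card S \<le> d" "S \<subseteq> ?A" "submodule_gen R M S = ?A"
    using generators_exist[OF A d] by auto
  then have "card S = d" using lower by force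
  have "min_gens R M = d"
    unfolding min_gens_def
  proof (rule Least_equality)
    show "\<exists>S. finite S \<and> card S = d \<and> S \<subseteq> carrier M \<and> submodule_gen R M S = carrier M"
      using S \<open>card S = d\<close> by blast
    show "\<And>n. \<exists>S. finite S \<and> card S = n \<and> S \<subseteq> carrier M \<and> submodule_gen R M S = carrier M \<Longrightarrow> d \<le> n"
      using lower by blast
  qed
  then show ?thesis using d by simp
qed

end

section \<open>Submodules of a quotient module\<close>

context module
begin

lemma abelian_subgroup_submodule: "submodule H R M \<Longrightarrow> abelian_subgroup H M"
  by (intro abelian_subgroupI3 additive_subgroup.intro submodule.axioms(1) M.abelian_group_axioms)

text \<open>The correspondence theorem as two strictly monotone maps: the union of a set of cosets,
  and the set of cosets of the elements of a submodule.\<close>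

lemma module_length_quotient:
  assumes H: "submodule H R M"
  shows "module_length R (quotient_module M H) = rel_length R M (carrier M) H"
proof (rule antisym)
  let ?Q = "quotient_module M H"
  interpret H: abelian_subgroup H M by (rule abelian_subgroup_submodule[OF H])
  note h = submodule_mem_simps[OF H]
  have Q: "carrier ?Q = a_rcosets\<^bsub>M\<^esub> H" "\<zero>\<^bsub>?Q\<^esub> = H" "\<And>C D. C \<oplus>\<^bsub>?Q\<^esub> D = C <+>\<^bsub>M\<^esub> D"
    "\<And>r C. r \<odot>\<^bsub>?Q\<^esub> C = (\<Union>x\<in>C. H +>\<^bsub>M\<^esub> (r \<odot>\<^bsub>M\<^esub> x))"
    by (simp_all add: quotient_module_def)
  have coset: "\<exists>x\<in>carrier M. C = H +>\<^bsub>M\<^esub> x" if "C \<in> a_rcosets\<^bsub>M\<^esub> H" for C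
    using that by (auto simp: A_RCOSETS_def' )
  have coset_in: "C = H +>\<^bsub>M\<^esub> x" "x \<in> carrier M" if C: "C \<in> a_rcosets\<^bsub>M\<^esub> H" "x \<in> C" for C x
  proof -
    show "x \<in> carrier M" using H.a_rcosets_carrier[OF C(1)] C(2) by auto
    obtain y where y: "y \<in> carrier M" "C = H +>\<^bsub>M\<^esub> y" using coset[OF C(1)] by auto
    have "H +>\<^bsub>M\<^esub> y = H +>\<^bsub>M\<^esub> x"
      by (rule M.a_repr_independence[OF _ y(1) H.a_subgroup]) (use C(2) y(2) in simp)
    then show "C = H +>\<^bsub>M\<^esub> x" using y(2) by simp
  qed
  have smult_coset: "r \<odot>\<^bsub>?Q\<^esub> (H +>\<^bsub>M\<^esub> x) = H +>\<^bsub>M\<^esub> (r \<odot>\<^bsub>M\<^esub> x)" if r: "r \<in> carrier R" and x: "x \<in> carrier M" for r x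
  proof -
    have "H +>\<^bsub>M\<^esub> (r \<odot>\<^bsub>M\<^esub> y) = H +>\<^bsub>M\<^esub> (r \<odot>\<^bsub>M\<^esub> x)" if yx: "y \<in> H +>\<^bsub>M\<^esub> x" for y
    proof -
      obtain k where k: "k \<in> H" "y = k \<oplus>\<^bsub>M\<^esub> x" using yx by (auto simp: a_r_coset_def')
      then have "r \<odot>\<^bsub>M\<^esub> y = r \<odot>\<^bsub>M\<^esub> k \<oplus>\<^bsub>M\<^esub> r \<odot>\<^bsub>M\<^esub> x" using r x h by (simp add: smult_r_distr)
      then have "r \<odot>\<^bsub>M\<^esub> y \<in> H +>\<^bsub>M\<^esub> (r \<odot>\<^bsub>M\<^esub> x)" using h(4)[OF r k(1)] by (auto simp: a_r_coset_def')
      then have "H +>\<^bsub>M\<^esub> (r \<odot>\<^bsub>M\<^esub> x) = H +>\<^bsub>M\<^esub> (r \<odot>\<^bsub>M\<^esub> y)"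
        by (rule M.a_repr_independence[OF _ _ H.a_subgroup]) (use r x in simp)
      then show ?thesis by simp
    qed
    moreover have "H +>\<^bsub>M\<^esub> x \<noteq> {}" using H.a_rcos_self[OF x] by auto
    ultimately show ?thesis unfolding Q by auto
  qed
  show "module_length R ?Q \<le> rel_length R M (carrier M) H"
    unfolding module_length_eq_rel_length
  proof (rule rel_length_transport[where F = Union])
    fix K assume K: "submodule K R ?Q"
    note k = submodule_mem_simps[OF K, unfolded Q]
    have "submodule (\<Union>K) R M"
    proof (rule submoduleI')
      show "\<Union>K \<subseteq> carrier M" using H.a_rcosets_carrier[OF k(2)] by auto
      show "\<zero>\<^bsub>M\<^esub> \<in> \<Union>K" using k(1) h(1) by blast
      fix x y assume "x \<in> \<Union>K" "y \<in> \<Union>K"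
      then obtain C D where CD: "C \<in> K" "D \<in> K" "x \<in> C" "y \<in> D" by auto
      then have "x \<oplus>\<^bsub>M\<^esub> y \<in> C <+>\<^bsub>M\<^esub> D" by (auto intro: set_addI)
      then show "x \<oplus>\<^bsub>M\<^esub> y \<in> \<Union>K" using k(3)[OF CD(1,2)] by (rule UnionI[rotated])
    next
      fix r x assume r: "r \<in> carrier R" and "x \<in> \<Union>K"
      then obtain C where C: "C \<in> K" "x \<in> C" by auto
      have x: "x \<in> carrier M" "C = H +>\<^bsub>M\<^esub> x" using coset_in[OF k(2)[OF C(1)] C(2)] by auto
      have "r \<odot>\<^bsub>M\<^esub> x \<in> H +>\<^bsub>M\<^esub> (r \<odot>\<^bsub>M\<^esub> x)" using H.a_rcos_self r x by simp
      then have "r \<odot>\<^bsub>M\<^esub> x \<in> (\<Union>x\<in>C. H +>\<^bsub>M\<^esub> (r \<odot>\<^bsub>M\<^esub> x))" using C(2) by auto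
      then show "r \<odot>\<^bsub>M\<^esub> x \<in> \<Union>K" using k(4)[OF r C(1)] by (rule UnionI[rotated])
    qed
    then show "submodule (\<Union>K) R M \<and> H \<subseteq> \<Union>K \<and> \<Union>K \<subseteq> carrier M"
      using k(1) submodule_subset[of "\<Union>K" R M] by auto
  next
    fix K L assume K: "submodule K R ?Q" and L: "submodule L R ?Q" and KL: "K \<subset> L"
    note k = submodule_mem_simps[OF K, unfolded Q] and l = submodule_mem_simps[OF L, unfolded Q]
    obtain C where C: "C \<in> L" "C \<notin> K" using KL by auto
    obtain x where x: "x \<in> carrier M" "C = H +>\<^bsub>M\<^esub> x" using coset[OF l(2)[OF C(1)]] by auto
    have xC: "x \<in> C" using H.a_rcos_self[OF x(1)] x(2) by simp
    have "x \<notin> \<Union>K"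
    proof
      assume "x \<in> \<Union>K"
      then obtain D where D: "D \<in> K" "x \<in> D" by auto
      then have "D = C" using coset_in(1)[OF k(2)[OF D(1)] D(2)] x(2) by simp
      then show False using C D by simp
    qed
    then show "\<Union>K \<subset> \<Union>L" using xC C KL by auto
  qed
  show "rel_length R M (carrier M) H \<le> module_length R ?Q"
    unfolding module_length_eq_rel_length
  proof (rule rel_length_transport[where F = "\<lambda>K. (\<lambda>x. H +>\<^bsub>M\<^esub> x) ` K"])
    fix K assume K: "submodule K R M" and HK: "H \<subseteq> K"
    note k = submodule_mem_simps[OF K]
    \<comment> \<open>Only the additive group is borrowed from the factor group, since
      \<open>quotient_module\<close> leaves its multiplication unspecified.\<close>
    have grp: "group (add_monoid ?Q)"
      using normal.factorgroup_is_group[OF H.a_normal]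
      by (simp add: quotient_module_def FactGroup_def A_RCOSETS_def set_add_def group_def monoid_def
          group_axioms_def Units_def)
    have "subgroup ((\<lambda>x. H +>\<^bsub>M\<^esub> x) ` K) (add_monoid ?Q)"
    proof (rule group.subgroupI[OF grp])
      show "(\<lambda>x. H +>\<^bsub>M\<^esub> x) ` K \<subseteq> carrier (add_monoid ?Q)"
        using k(2) M.a_rcosetsI[of H] submodule_subset[OF H] by (auto simp: Q)
      show "(\<lambda>x. H +>\<^bsub>M\<^esub> x) ` K \<noteq> {}" using k(1) by auto
      fix C assume "C \<in> (\<lambda>x. H +>\<^bsub>M\<^esub> x) ` K"
      then obtain x where x: "x \<in> K" "C = H +>\<^bsub>M\<^esub> x" by auto
      have mx: "\<ominus>\<^bsub>M\<^esub> x \<in> K" by (rule submoduleE(3)[OF K x(1)])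
      have "inv\<^bsub>add_monoid ?Q\<^esub> C = H +>\<^bsub>M\<^esub> (\<ominus>\<^bsub>M\<^esub> x)"
      proof (rule group.inv_equality[OF grp])
        have "(H +>\<^bsub>M\<^esub> (\<ominus>\<^bsub>M\<^esub> x)) <+>\<^bsub>M\<^esub> (H +>\<^bsub>M\<^esub> x) = H +>\<^bsub>M\<^esub> (\<ominus>\<^bsub>M\<^esub> x \<oplus>\<^bsub>M\<^esub> x)"
          using x mx k(2) by (intro H.a_rcos_sum) auto
        also have "\<dots> = H" using x k(2) h(1) M.a_coset_join2[OF _ H.a_subgroup] by (simp add: M.l_neg)
        finally show "(H +>\<^bsub>M\<^esub> (\<ominus>\<^bsub>M\<^esub> x)) \<otimes>\<^bsub>add_monoid ?Q\<^esub> C = \<one>\<^bsub>add_monoid ?Q\<^esub>" using x by (simp add: Q)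
      qed (use x mx k(2) M.a_rcosetsI[of H] submodule_subset[OF H] in \<open>auto simp: Q\<close>)
      then show "inv\<^bsub>add_monoid ?Q\<^esub> C \<in> (\<lambda>x. H +>\<^bsub>M\<^esub> x) ` K" using mx by auto
    next
      fix C D assume "C \<in> (\<lambda>x. H +>\<^bsub>M\<^esub> x) ` K" "D \<in> (\<lambda>x. H +>\<^bsub>M\<^esub> x) ` K"
      then obtain x y where "x \<in> K" "C = H +>\<^bsub>M\<^esub> x" "y \<in> K" "D = H +>\<^bsub>M\<^esub> y" by auto
      then show "C \<otimes>\<^bsub>add_monoid ?Q\<^esub> D \<in> (\<lambda>x. H +>\<^bsub>M\<^esub> x) ` K"
        using H.a_rcos_sum[of x y] k by (simp add: Q)
    qed
    moreover have "submodule_axioms ((\<lambda>x. H +>\<^bsub>M\<^esub> x) ` K) R ?Q"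
      unfolding submodule_axioms_def using smult_coset k by auto
    ultimately show "submodule ((\<lambda>x. H +>\<^bsub>M\<^esub> x) ` K) R ?Q \<and> {} \<subseteq> (\<lambda>x. H +>\<^bsub>M\<^esub> x) ` K \<and> (\<lambda>x. H +>\<^bsub>M\<^esub> x) ` K \<subseteq> UNIV"
      by (simp add: submodule.intro)
  next
    fix K L assume K: "submodule K R M" and HK: "H \<subseteq> K" and L: "submodule L R M" and KL: "K \<subset> L"
    obtain x where x: "x \<in> L" "x \<notin> K" using KL by auto
    have "H +>\<^bsub>M\<^esub> x \<notin> (\<lambda>x. H +>\<^bsub>M\<^esub> x) ` K"
    proof
      assume "H +>\<^bsub>M\<^esub> x \<in> (\<lambda>x. H +>\<^bsub>M\<^esub> x) ` K"
      then obtain y where y: "y \<in> K" "H +>\<^bsub>M\<^esub> x = H +>\<^bsub>M\<^esub> y" by auto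
      have "x \<in> H +>\<^bsub>M\<^esub> y" using H.a_rcos_self[of x] x(1) y(2) submodule_subset[OF L] by auto
      then obtain k where "k \<in> H" "x = k \<oplus>\<^bsub>M\<^esub> y" by (auto simp: a_r_coset_def')
      then show False using x(2) y(1) HK submodule_mem_simps(3)[OF K] by auto
    qed
    then show "(\<lambda>x. H +>\<^bsub>M\<^esub> x) ` K \<subset> (\<lambda>x. H +>\<^bsub>M\<^esub> x) ` L" using x KL by auto
  qed
qed

end

section \<open>Powers of the maximal ideal\<close>

text \<open>The submodule m^n A, obtained by multiplying n times by m. Additivity in n is then
  immediate; \<open>ideals_set_pow_eq\<close> makes the link with powers in the monoid of
  ideals.\<close>

definition max_pow :: "('a, 'c) ring_scheme \<Rightarrow> ('a, 'b, 'd) module_scheme \<Rightarrow> nat \<Rightarrow> 'b set \<Rightarrow> 'b set" where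
  "max_pow R M n A = (ideal_times R M (max_ideal R) ^^ n) A"

definition max_ideal_pow :: "('a, 'c) ring_scheme \<Rightarrow> nat \<Rightarrow> 'a set" where
  "max_ideal_pow R n = max_pow R (self_module R) n (carrier R)"

lemma max_pow_0 [simp]: "max_pow R M 0 A = A"
  by (simp add: max_pow_def)

lemma max_pow_Suc: "max_pow R M (Suc n) A = ideal_times R M (max_ideal R) (max_pow R M n A)"
  by (simp add: max_pow_def)

lemma max_pow_add: "max_pow R M (m + n) A = max_pow R M m (max_pow R M n A)"
  by (simp add: max_pow_def funpow_add)

lemma max_ideal_pow_0 [simp]: "max_ideal_pow R 0 = carrier R"
  by (simp add: max_ideal_pow_def)

lemma max_ideal_pow_Suc:
  "max_ideal_pow R (Suc n) = ideal_times R (self_module R) (max_ideal R) (max_ideal_pow R n)"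
  by (simp add: max_ideal_pow_def max_pow_Suc)

lemma (in cring) self_module_fin_gen: "finitely_generated R (self_module R)"
  unfolding finitely_generated_def
proof (intro exI[of _ "{\<one>}"] conjI)
  show "submodule_gen R (self_module R) {\<one>} = carrier (self_module R)"
    using genideal_one by (simp add: genideal_eq_submodule_gen[symmetric])
qed auto

lemma local_noetherian_self_module:
  assumes "local_ring R" "noetherian_ring R"
  shows "local_noetherian_module R (self_module R)"
proof -
  interpret cring R by (rule local_ring_cring[OF assms(1)])
  show ?thesis
    by (intro local_noetherian_module.intro local_noetherian_module_axioms.intro self_module_module
        assms self_module_fin_gen)
qed

context local_noetherian_module
begin

lemma max_pow_submodule: "submodule A R M \<Longrightarrow> submodule (max_pow R M n A) R M"
  by (induction n) (simp_all add: max_pow_Suc max_ideal_times_submodule)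

lemma max_pow_subset: "submodule A R M \<Longrightarrow> max_pow R M n A \<subseteq> A"
proof (induction n)
  case (Suc n)
  then show ?case
    using max_ideal_times_subset[OF max_pow_submodule[OF Suc.prems, of n]] by (auto simp: max_pow_Suc)
qed simp

lemma max_pow_antimono:
  assumes "submodule A R M" "m \<le> n"
  shows "max_pow R M n A \<subseteq> max_pow R M m A"
proof -
  have "max_pow R M n A = max_pow R M (n - m) (max_pow R M m A)"
    using assms(2) by (simp add: max_pow_add[symmetric])
  then show ?thesis using max_pow_subset[OF max_pow_submodule[OF assms(1)]] by simp
qed

lemma max_pow_mono: "A \<subseteq> B \<Longrightarrow> max_pow R M n A \<subseteq> max_pow R M n B"
  by (induction n) (simp_all add: max_pow_Suc ideal_times_mono)

lemma max_pow_set_add: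
  assumes "submodule A R M" "submodule B R M"
  shows "max_pow R M n (A <+>\<^bsub>M\<^esub> B) = max_pow R M n A <+>\<^bsub>M\<^esub> max_pow R M n B"
  by (induction n)
    (simp_all add: max_pow_Suc ideal_times_set_add[OF max_ideal_subset] max_pow_submodule assms)

lemma max_pow_smult_image:
  assumes "submodule A R M" "c \<in> carrier R"
  shows "max_pow R M n ((\<odot>\<^bsub>M\<^esub>) c ` A) = (\<odot>\<^bsub>M\<^esub>) c ` max_pow R M n A"
  by (induction n)
    (simp_all add: max_pow_Suc ideal_times_smult_image[OF max_ideal_subset] max_pow_submodule assms)

lemma local_noetherian_self: "local_noetherian_module R (self_module R)"
  by (rule local_noetherian_self_module[OF local noetherian])

lemma max_ideal_pow_submodule: "submodule (max_ideal_pow R k) R (self_module R)"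
proof -
  interpret S: local_noetherian_module R "self_module R" by (rule local_noetherian_self)
  show ?thesis unfolding max_ideal_pow_def using S.carrier_is_submodule by (intro S.max_pow_submodule) simp
qed

lemma max_ideal_pow_closed:
  shows "\<zero> \<in> max_ideal_pow R k"
    and "a \<in> max_ideal_pow R k \<Longrightarrow> a \<in> carrier R"
    and "a \<in> max_ideal_pow R k \<Longrightarrow> b \<in> max_ideal_pow R k \<Longrightarrow> a \<oplus> b \<in> max_ideal_pow R k"
    and "a \<in> carrier R \<Longrightarrow> b \<in> max_ideal_pow R k \<Longrightarrow> a \<otimes> b \<in> max_ideal_pow R k"
  using submodule_mem_simps[OF max_ideal_pow_submodule[of k]] by simp_all

lemma max_ideal_pow_antimono:
  assumes "k \<le> l"
  shows "max_ideal_pow R l \<subseteq> max_ideal_pow R k"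
proof -
  interpret S: local_noetherian_module R "self_module R" by (rule local_noetherian_self)
  show ?thesis unfolding max_ideal_pow_def
    using S.max_pow_antimono[OF _ assms] S.carrier_is_submodule by simp
qed

text \<open>The scalars that carry m^j A into m^(k + 1 + j) A form an ideal, so in the induction
  step products b q with b in m and q in m^k suffice.\<close>

lemma max_ideal_pow_smult:
  assumes A: "submodule A R M"
  shows "a \<in> max_ideal_pow R k \<Longrightarrow> v \<in> max_pow R M j A \<Longrightarrow> a \<odot>\<^bsub>M\<^esub> v \<in> max_pow R M (k + j) A"
proof (induction k arbitrary: a v)
  case 0
  then show ?case using submodule_mem_simps(4)[OF max_pow_submodule[OF A]] by simp
next
  case (Suc k)
  interpret S: local_noetherian_module R "self_module R" by (rule local_noetherian_self)
  note P = max_pow_submodule[OF A, of j] and P' = max_pow_submodule[OF A, of "Suc k + j"]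
  note p = submodule_mem_simps[OF P] and p' = submodule_mem_simps[OF P']
  let ?L = "{a \<in> carrier R. \<forall>v\<in>max_pow R M j A. a \<odot>\<^bsub>M\<^esub> v \<in> max_pow R M (Suc k + j) A}"
  have "submodule ?L R (self_module R)"
  proof (rule S.submoduleI')
    fix x y assume "x \<in> ?L" "y \<in> ?L"
    then show "x \<oplus>\<^bsub>self_module R\<^esub> y \<in> ?L" using p(2) p'(3) by (auto simp: smult_l_distr)
  next
    fix x y assume "x \<in> carrier R" "y \<in> ?L"
    then show "x \<odot>\<^bsub>self_module R\<^esub> y \<in> ?L" using p(2) p'(4) by (auto simp: smult_assoc1)
  qed (use p(2) p'(1) in auto)
  then have "max_ideal_pow R (Suc k) \<subseteq> ?L"
    unfolding max_ideal_pow_Suc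
  proof (rule S.ideal_times_least)
    fix b q assume b: "b \<in> \<mm>" and q: "q \<in> max_ideal_pow R k"
    have "(b \<otimes> q) \<odot>\<^bsub>M\<^esub> v \<in> max_pow R M (Suc k + j) A" if "v \<in> max_pow R M j A" for v
      using Suc.IH[OF q that] b max_ideal_pow_closed(2)[OF q] p(2)[OF that]
      by (simp add: smult_assoc1 max_pow_Suc ideal_times_mem)
    then show "b \<odot>\<^bsub>self_module R\<^esub> q \<in> ?L" using b max_ideal_pow_closed(2)[OF q] by simp
  qed
  then show ?case using Suc.prems by auto
qed

lemma max_ideal_pow_mult:
  assumes "a \<in> max_ideal_pow R k" "b \<in> max_ideal_pow R l"
  shows "a \<otimes> b \<in> max_ideal_pow R (k + l)"
proof -
  interpret S: local_noetherian_module R "self_module R" by (rule local_noetherian_self)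
  show ?thesis
    using S.max_ideal_pow_smult[OF S.carrier_is_submodule assms(1), of b l] assms(2)
    by (simp add: max_ideal_pow_def)
qed

lemma max_ideal_pow_nat_pow:
  assumes "a \<in> max_ideal_pow R k"
  shows "a [^] (j::nat) \<in> max_ideal_pow R (k * j)"
proof (induction j)
  case (Suc j)
  then show ?case using max_ideal_pow_mult[OF Suc assms] by (simp add: add.commute)
qed simp

lemma max_ideal_pow_1: "max_ideal_pow R (Suc 0) = \<mm>"
proof -
  interpret S: local_noetherian_module R "self_module R" by (rule local_noetherian_self)
  have m: "submodule \<mm> R (self_module R)" using max_ideal_ideal by (simp add: R.ideal_iff_submodule)
  show ?thesis
  proof
    show "max_ideal_pow R (Suc 0) \<subseteq> \<mm>"
      unfolding max_ideal_pow_Suc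
      by (rule S.ideal_times_least[OF m]) (simp add: ideal.I_r_closed[OF max_ideal_ideal])
    show "\<mm> \<subseteq> max_ideal_pow R (Suc 0)"
    proof
      fix a assume a: "a \<in> \<mm>"
      then show "a \<in> max_ideal_pow R (Suc 0)"
        using S.ideal_times_mem[OF a, of \<one> "carrier R"] by (simp add: max_ideal_pow_Suc)
    qed
  qed
qed

text \<open>Makes inclusions of m^k A checkable on single products a v with a in m^k, although
  \<open>max_pow\<close> is built by iteration. The induction shifts one factor b into the target by
  passing to the submodule of all v with b v in L.\<close>

lemma max_pow_least:
  assumes "submodule A R M" "submodule L R M" "\<And>a v. a \<in> max_ideal_pow R k \<Longrightarrow> v \<in> A \<Longrightarrow> a \<odot>\<^bsub>M\<^esub> v \<in> L"
  shows "max_pow R M k A \<subseteq> L"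
  using assms(2,3)
proof (induction k arbitrary: L)
  case 0
  show ?case
  proof
    fix v assume "v \<in> max_pow R M 0 A"
    then show "v \<in> L" using 0(2)[of \<one> v] submodule_mem_simps(2)[OF assms(1)] by simp
  qed
next
  case (Suc k)
  show ?case
    unfolding max_pow_Suc
  proof (rule ideal_times_least[OF Suc.prems(1)])
    fix b v assume b: "b \<in> \<mm>" and v: "v \<in> max_pow R M k A"
    have "max_pow R M k A \<subseteq> {v \<in> carrier M. b \<odot>\<^bsub>M\<^esub> v \<in> L}"
    proof (rule Suc.IH[OF submodule_preimage[OF carrier_is_submodule Suc.prems(1)]])
      fix a v assume a: "a \<in> max_ideal_pow R k" and v: "v \<in> A"
      have c: "a \<in> carrier R" "v \<in> carrier M" "b \<in> carrier R"
        using max_ideal_pow_closed(2)[OF a] submodule_mem_simps(2)[OF assms(1) v] b by auto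
      have "a \<otimes> b \<in> max_ideal_pow R (k + Suc 0)"
        using max_ideal_pow_mult[OF a, of b "Suc 0"] b max_ideal_pow_1 by simp
      then have "b \<otimes> a \<in> max_ideal_pow R (Suc k)" using c by (simp add: R.m_comm)
      then have "(b \<otimes> a) \<odot>\<^bsub>M\<^esub> v \<in> L" using Suc.prems(2) v by blast
      then show "a \<odot>\<^bsub>M\<^esub> v \<in> {v \<in> carrier M. b \<odot>\<^bsub>M\<^esub> v \<in> L}" using c by (simp add: smult_assoc1)
    qed (use b in simp)
    then show "b \<odot>\<^bsub>M\<^esub> v \<in> L" using v by auto
  qed
qed

lemma max_pow_eq_ideal_times:
  assumes "submodule A R M"
  shows "max_pow R M k A = ideal_times R M (max_ideal_pow R k) A"
proof
  have s: "max_ideal_pow R k \<subseteq> carrier R" using max_ideal_pow_closed(2) by auto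
  show "max_pow R M k A \<subseteq> ideal_times R M (max_ideal_pow R k) A"
    by (rule max_pow_least[OF assms ideal_times_submodule[OF s submodule_subset[OF assms]] ideal_times_mem])
  show "ideal_times R M (max_ideal_pow R k) A \<subseteq> max_pow R M k A"
    using max_ideal_pow_smult[OF assms, of _ k _ 0]
    by (intro ideal_times_least[OF max_pow_submodule[OF assms]]) simp
qed

lemma ideals_set_pow_eq: "\<mm> [^]\<^bsub>ideals_set R\<^esub> (n::nat) = max_ideal_pow R n"
proof (induction n)
  case 0
  show ?case by (simp add: nat_pow_def ideals_set_def)
next
  case (Suc n)
  interpret S: local_noetherian_module R "self_module R" by (rule local_noetherian_self)
  let ?Q = "max_ideal_pow R n"
  have Q: "ideal ?Q R" using max_ideal_pow_submodule by (simp add: R.ideal_iff_submodule)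
  have Qm: "ideal (ideal_prod R ?Q \<mm>) R" by (rule R.ideal_prod_is_ideal[OF Q max_ideal_ideal])
  have "\<mm> [^]\<^bsub>ideals_set R\<^esub> Suc n = ideal_prod R ?Q \<mm>"
    using Suc by (simp add: nat_pow_def ideals_set_def)
  also have "\<dots> = max_ideal_pow R (Suc n)"
  proof
    show "ideal_prod R ?Q \<mm> \<subseteq> max_ideal_pow R (Suc n)"
    proof
      fix s assume "s \<in> ideal_prod R ?Q \<mm>"
      then show "s \<in> max_ideal_pow R (Suc n)"
      proof induction
        case (prod i j)
        then show ?case using max_ideal_pow_mult[of i n j "Suc 0"] max_ideal_pow_1 by simp
      next
        case (sum s1 s2)
        then show ?case by (intro max_ideal_pow_closed(3))
      qed
    qed
    show "max_ideal_pow R (Suc n) \<subseteq> ideal_prod R ?Q \<mm>"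
      unfolding max_ideal_pow_Suc
    proof (rule S.ideal_times_least[OF Qm[unfolded R.ideal_iff_submodule]])
      fix a q assume a: "a \<in> \<mm>" and q: "q \<in> ?Q"
      have "a \<otimes> q = q \<otimes> a" using a max_ideal_pow_closed(2)[OF q] by (simp add: R.m_comm)
      then show "a \<odot>\<^bsub>self_module R\<^esub> q \<in> ideal_prod R ?Q \<mm>" using ideal_prod.prod[OF q a, of R] by simp
    qed
  qed
  finally show ?case .
qed

section \<open>The multiplicity in dimension one, and finiteness of lengths\<close>

lemma ideal_smult_pow_eq:
  "ideal_smult R (\<mm> [^]\<^bsub>ideals_set R\<^esub> (n::nat)) M = max_pow R M n (carrier M)"
  by (simp add: ideal_smult_eq ideals_set_pow_eq max_pow_eq_ideal_times[OF carrier_is_submodule])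

lemma multiplicity_hs_eq:
  assumes "krull_dim R = 1"
  shows "multiplicity_hs R M =
    lim (\<lambda>n. real (the_enat (rel_length R M (carrier M) (max_pow R M n (carrier M)))) / real n)"
  using assms
  by (simp add: multiplicity_hs_def ideal_smult_pow_eq one_enat_def
      module_length_quotient[OF max_pow_submodule[OF carrier_is_submodule]])

lemma rel_length_max_pow_finite:
  assumes A: "submodule A R M"
  shows "rel_length R M A (max_pow R M n A) \<noteq> \<infinity>"
proof (induction n)
  case 0
  then show ?case by (simp add: rel_length_self)
next
  case (Suc n)
  note P = max_pow_submodule[OF A]
  have s: "max_pow R M (Suc n) A \<subseteq> max_pow R M n A" by (rule max_pow_antimono[OF A]) simp
  have "rel_length R M (max_pow R M n A) (max_pow R M (Suc n) A) \<noteq> \<infinity>"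
    by (rule rel_length_max_ideal_finite[OF P P s]) (simp add: max_pow_Suc)
  then show ?case
    using rel_length_add[OF A P P s max_pow_subset[OF A]] Suc
    by (simp only: plus_eq_infty_iff_enat) simp
qed

lemma rel_length_finite:
  assumes "submodule A R M" "max_pow R M n A \<subseteq> B"
  shows "rel_length R M A B \<noteq> \<infinity>"
  using rel_length_mono[OF order.refl assms(2), of R M A] rel_length_max_pow_finite[OF assms(1), of n]
  by (cases "rel_length R M A B") simp_all

end

section \<open>Torsion-free modules over one-dimensional rings\<close>

text \<open>The sum over a window of length k changes by f (n + k) - f n when the window moves, so
  it is nondecreasing and bounded, hence eventually constant.\<close>

lemma eventually_periodic_of_bounded:
  fixes f :: "nat \<Rightarrow> nat"
  assumes k: "k \<ge> 1" and mono: "\<And>n. f n \<le> f (n + k)" and bd: "\<And>n. f n \<le> C"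
  shows "\<exists>N. \<forall>n\<ge>N. f (n + k) = f n"
proof -
  define g where "g n = (\<Sum>i<k. f (n + i))" for n
  have step: "g (Suc n) + f n = g n + f (n + k)" for n
  proof -
    obtain k' where k': "k = Suc k'" using k by (cases k) auto
    have "g n = f n + (\<Sum>i<k'. f (n + Suc i))" unfolding g_def k' by (subst sum.lessThan_Suc_shift) simp
    moreover have "g (Suc n) = (\<Sum>i<k'. f (n + Suc i)) + f (n + k)" unfolding g_def k' by simp
    ultimately show ?thesis by simp
  qed
  have gm: "mono g"
  proof (rule incseq_SucI)
    show "g n \<le> g (Suc n)" for n using step[of n] mono[of n] by linarith
  qed
  have gb: "g n \<le> k * C" for n
    unfolding g_def using sum_bounded_above[of "{..<k}" "\<lambda>i. f (n + i)" C] bd by simp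
  have fin: "finite (range g)" by (rule finite_subset[of _ "{..k * C}"]) (use gb in auto)
  have "Max (range g) \<in> range g" by (rule Max_in[OF fin]) auto
  then obtain N where N: "g N = Max (range g)" by (metis rangeE)
  have "f (n + k) = f n" if "n \<ge> N" for n
  proof -
    have eq: "g m = g N" if "m \<ge> N" for m
      using monoD[OF gm that] Max_ge[OF fin, of "g m"] N by auto
    show ?thesis using step[of n] eq[of n] eq[of "Suc n"] that by simp
  qed
  then show ?thesis by blast
qed

text \<open>The setting in dimension one: t is a parameter, regular on R and on M. The zero module
  is included, so that the kernel of a splitting always qualifies.\<close>

locale torsion_free_module = local_noetherian_module R M
  for R :: "('a, 'c) ring_scheme" (structure) and M :: "('a, 'b, 'd) module_scheme" (structure) +
  fixes t :: 'a and e :: nat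
  assumes t_mem: "t \<in> max_ideal R"
    and t_regular: "\<And>v. v \<in> carrier M \<Longrightarrow> t \<odot>\<^bsub>M\<^esub> v = \<zero>\<^bsub>M\<^esub> \<Longrightarrow> v = \<zero>\<^bsub>M\<^esub>"
    and t_regular_ring: "\<And>a. a \<in> carrier R \<Longrightarrow> t \<otimes> a = \<zero> \<Longrightarrow> a = \<zero>"
    and t_reduction: "max_ideal_pow R e \<subseteq> PIdl t"
begin

abbreviation P :: "nat \<Rightarrow> 'b set" where "P n \<equiv> max_pow R M n (carrier M)"

abbreviation Q :: "nat \<Rightarrow> 'a set" where "Q n \<equiv> max_ideal_pow R n"

abbreviation len :: "'b set \<Rightarrow> 'b set \<Rightarrow> nat" where "len A B \<equiv> the_enat (rel_length R M A B)"

definition regular :: "'a \<Rightarrow> bool" where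
  "regular c \<longleftrightarrow> c \<in> carrier R \<and> (\<forall>v\<in>carrier M. c \<odot>\<^bsub>M\<^esub> v = \<zero>\<^bsub>M\<^esub> \<longrightarrow> v = \<zero>\<^bsub>M\<^esub>)"

text \<open>The submodules that are open in the m-adic topology. \<open>len\<close> passes through
  \<open>the_enat\<close>, so its arithmetic is meaningful only where lengths are finite, and these
  submodules ensure that.\<close>

definition cofinite :: "'b set \<Rightarrow> bool" where
  "cofinite B \<longleftrightarrow> submodule B R M \<and> (\<exists>n. P n \<subseteq> B)"

lemma torsion_free_self: "torsion_free_module R (self_module R) t e"
proof -
  interpret S: local_noetherian_module R "self_module R" by (rule local_noetherian_self)
  show ?thesis by unfold_locales (use t_mem t_regular_ring t_reduction in auto)
qed

lemma P_submodule: "submodule (P n) R M"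
  by (rule max_pow_submodule[OF carrier_is_submodule])

lemma P_closed:
  shows "\<zero>\<^bsub>M\<^esub> \<in> P n"
    and "x \<in> P n \<Longrightarrow> x \<in> carrier M"
    and "x \<in> P n \<Longrightarrow> y \<in> P n \<Longrightarrow> x \<oplus>\<^bsub>M\<^esub> y \<in> P n"
    and "a \<in> carrier R \<Longrightarrow> x \<in> P n \<Longrightarrow> a \<odot>\<^bsub>M\<^esub> x \<in> P n"
  using submodule_mem_simps[OF P_submodule[of n]] by simp_all

lemma P_antimono: "m \<le> n \<Longrightarrow> P n \<subseteq> P m"
  by (rule max_pow_antimono[OF carrier_is_submodule])

lemma Q_smult: "a \<in> Q k \<Longrightarrow> v \<in> P n \<Longrightarrow> a \<odot>\<^bsub>M\<^esub> v \<in> P (n + k)"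
  using max_ideal_pow_smult[OF carrier_is_submodule, of a k v n] by (simp add: add.commute)

lemma P_add: "max_pow R M m (P n) = P (m + n)"
  by (simp add: max_pow_add)

lemma regular_t: "regular t"
  using t_regular t_mem by (simp add: regular_def)

lemma regular_cancel:
  assumes "regular c" "u \<in> carrier M" "v \<in> carrier M" "c \<odot>\<^bsub>M\<^esub> u = c \<odot>\<^bsub>M\<^esub> v"
  shows "u = v"
proof -
  have c: "c \<in> carrier R" using assms(1) by (simp add: regular_def)
  have "c \<odot>\<^bsub>M\<^esub> (u \<ominus>\<^bsub>M\<^esub> v) = \<zero>\<^bsub>M\<^esub>"
    using assms c by (simp add: smult_minus_distr minus_eq_zero_iff)
  then have "u \<ominus>\<^bsub>M\<^esub> v = \<zero>\<^bsub>M\<^esub>" using assms by (auto simp: regular_def)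
  then show ?thesis using assms minus_eq_zero_iff by simp
qed

lemma regular_mem_image_iff:
  assumes "regular c" "submodule H R M" "v \<in> carrier M"
  shows "c \<odot>\<^bsub>M\<^esub> v \<in> (\<odot>\<^bsub>M\<^esub>) c ` H \<longleftrightarrow> v \<in> H"
proof
  assume "c \<odot>\<^bsub>M\<^esub> v \<in> (\<odot>\<^bsub>M\<^esub>) c ` H"
  then obtain h where h: "h \<in> H" "c \<odot>\<^bsub>M\<^esub> v = c \<odot>\<^bsub>M\<^esub> h" by auto
  then have "v = h" using regular_cancel[OF assms(1) assms(3)] submodule_mem_simps(2)[OF assms(2)] by simp
  then show "v \<in> H" using h by simp
qed auto

lemma cofinite_submodule: "cofinite B \<Longrightarrow> submodule B R M"
  by (simp add: cofinite_def)

lemma cofinite_P: "cofinite (P n)"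
  using P_submodule by (auto simp: cofinite_def)

lemma cofinite_mono: "cofinite A \<Longrightarrow> submodule B R M \<Longrightarrow> A \<subseteq> B \<Longrightarrow> cofinite B"
  by (auto simp: cofinite_def)

lemma cofinite_rel_length:
  assumes "submodule A R M" "cofinite B"
  shows "rel_length R M A B = enat (len A B)"
proof -
  obtain n where "P n \<subseteq> B" using assms(2) by (auto simp: cofinite_def)
  then have "max_pow R M n A \<subseteq> B" using max_pow_mono[OF submodule_subset[OF assms(1)], of n] by blast
  then have "rel_length R M A B \<noteq> \<infinity>" by (rule rel_length_finite[OF assms(1)])
  then show ?thesis by auto
qed

lemma len_add:
  assumes "submodule A R M" "submodule C R M" "cofinite B" "B \<subseteq> C" "C \<subseteq> A"
  shows "len A B = len A C + len C B"
proof -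
  have C: "cofinite C" by (rule cofinite_mono[OF assms(3,2,4)])
  have "enat (len A B) = enat (len A C) + enat (len C B)"
    unfolding cofinite_rel_length[OF assms(1,3), symmetric] cofinite_rel_length[OF assms(1) C, symmetric]
      cofinite_rel_length[OF assms(2,3), symmetric]
    by (rule rel_length_add[OF assms(1) cofinite_submodule[OF assms(3)] assms(2,4,5)])
  then show ?thesis by simp
qed

lemma len_le:
  assumes "submodule A R M" "cofinite B" "submodule A' R M" "cofinite B'"
    and "rel_length R M A B \<le> rel_length R M A' B'"
  shows "len A B \<le> len A' B'"
proof -
  have "enat (len A B) \<le> enat (len A' B')"
    unfolding cofinite_rel_length[OF assms(1,2), symmetric] cofinite_rel_length[OF assms(3,4), symmetric]
    by (rule assms(5))
  then show ?thesis by simp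
qed

lemma len_zero_imp_eq:
  assumes "submodule A R M" "cofinite B" "B \<subseteq> A" "len A B = 0"
  shows "A = B"
proof (rule rel_length_zero_imp_eq[OF _ assms(1) cofinite_submodule[OF assms(2)] assms(3)])
  show "rel_length R M A B = 0"
    by (subst cofinite_rel_length[OF assms(1,2)]) (simp add: assms(4) zero_enat_def)
qed

lemma rel_length_smult:
  assumes c: "regular c" and A: "submodule A R M" and B: "submodule B R M"
  shows "rel_length R M ((\<odot>\<^bsub>M\<^esub>) c ` A) ((\<odot>\<^bsub>M\<^esub>) c ` B) = rel_length R M A B"
proof (rule antisym)
  have cc: "c \<in> carrier R" using c by (simp add: regular_def)
  show "rel_length R M A B \<le> rel_length R M ((\<odot>\<^bsub>M\<^esub>) c ` A) ((\<odot>\<^bsub>M\<^esub>) c ` B)"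
  proof (rule rel_length_transport[where F = "(`) ((\<odot>\<^bsub>M\<^esub>) c)"])
    fix H K assume H: "submodule H R M" and K: "submodule K R M" and HK: "H \<subset> K"
    then obtain x where x: "x \<in> K" "x \<notin> H" by auto
    then have "c \<odot>\<^bsub>M\<^esub> x \<notin> (\<odot>\<^bsub>M\<^esub>) c ` H"
      using regular_mem_image_iff[OF c H] submodule_mem_simps(2)[OF K] by auto
    then show "(\<odot>\<^bsub>M\<^esub>) c ` H \<subset> (\<odot>\<^bsub>M\<^esub>) c ` K" using x HK by auto
  qed (use submodule_smult_image cc in auto)
  show "rel_length R M ((\<odot>\<^bsub>M\<^esub>) c ` A) ((\<odot>\<^bsub>M\<^esub>) c ` B) \<le> rel_length R M A B"
  proof (rule rel_length_transport[where F = "\<lambda>H. {v \<in> A. c \<odot>\<^bsub>M\<^esub> v \<in> H}"])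
    fix H assume H: "submodule H R M" and BH: "(\<odot>\<^bsub>M\<^esub>) c ` B \<subseteq> H" and HA: "H \<subseteq> (\<odot>\<^bsub>M\<^esub>) c ` A"
    have "B \<subseteq> A"
    proof
      fix v assume v: "v \<in> B"
      then have "c \<odot>\<^bsub>M\<^esub> v \<in> (\<odot>\<^bsub>M\<^esub>) c ` A" using BH HA by auto
      then show "v \<in> A" using regular_mem_image_iff[OF c A] submodule_mem_simps(2)[OF B v] by simp
    qed
    then show "submodule {v \<in> A. c \<odot>\<^bsub>M\<^esub> v \<in> H} R M \<and> B \<subseteq> {v \<in> A. c \<odot>\<^bsub>M\<^esub> v \<in> H} \<and> {v \<in> A. c \<odot>\<^bsub>M\<^esub> v \<in> H} \<subseteq> A"
      using submodule_preimage[OF A H cc] BH by auto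
  qed blast
qed

lemma len_smult:
  "regular c \<Longrightarrow> submodule A R M \<Longrightarrow> submodule B R M \<Longrightarrow>
    len ((\<odot>\<^bsub>M\<^esub>) c ` A) ((\<odot>\<^bsub>M\<^esub>) c ` B) = len A B"
  by (simp add: rel_length_smult)

text \<open>P (n + m) = m^n P m lies in m^n c M = c P n.\<close>

lemma cofinite_smult:
  assumes c: "c \<in> carrier R" and A: "cofinite A" and cM: "P m \<subseteq> (\<odot>\<^bsub>M\<^esub>) c ` carrier M"
  shows "cofinite ((\<odot>\<^bsub>M\<^esub>) c ` A)"
proof -
  obtain n where n: "P n \<subseteq> A" using A by (auto simp: cofinite_def)
  have "P (n + m) \<subseteq> max_pow R M n ((\<odot>\<^bsub>M\<^esub>) c ` carrier M)"
    unfolding P_add[symmetric] by (rule max_pow_mono[OF cM])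
  also have "\<dots> = (\<odot>\<^bsub>M\<^esub>) c ` P n" by (rule max_pow_smult_image[OF carrier_is_submodule c])
  also have "\<dots> \<subseteq> (\<odot>\<^bsub>M\<^esub>) c ` A" using n by auto
  finally show ?thesis
    using submodule_smult_image[OF cofinite_submodule[OF A] c] by (auto simp: cofinite_def)
qed

lemma smult_image_subset: "submodule A R M \<Longrightarrow> c \<in> carrier R \<Longrightarrow> (\<odot>\<^bsub>M\<^esub>) c ` A \<subseteq> A"
  using submodule_mem_simps(4) by auto

text \<open>The length of M / c A is computed through A and through c M. Since c is regular, c M / c
  A has the same length as M / A, and these terms cancel.\<close>

lemma len_smult_const:
  assumes c: "regular c" and A: "cofinite A" and cM: "P m \<subseteq> (\<odot>\<^bsub>M\<^esub>) c ` carrier M"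
  shows "len A ((\<odot>\<^bsub>M\<^esub>) c ` A) = len (carrier M) ((\<odot>\<^bsub>M\<^esub>) c ` carrier M)"
proof -
  have cc: "c \<in> carrier R" using c by (simp add: regular_def)
  note As = cofinite_submodule[OF A] and M = carrier_is_submodule
  have AM: "A \<subseteq> carrier M" by (rule submodule_subset[OF As])
  have cA: "cofinite ((\<odot>\<^bsub>M\<^esub>) c ` A)" by (rule cofinite_smult[OF cc A cM])
  have sub: "(\<odot>\<^bsub>M\<^esub>) c ` A \<subseteq> (\<odot>\<^bsub>M\<^esub>) c ` carrier M" using AM by auto
  have "len (carrier M) A + len A ((\<odot>\<^bsub>M\<^esub>) c ` A) = len (carrier M) ((\<odot>\<^bsub>M\<^esub>) c ` A)"
    by (rule len_add[OF M As cA smult_image_subset[OF As cc] AM, symmetric])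
  also have "\<dots> = len (carrier M) ((\<odot>\<^bsub>M\<^esub>) c ` carrier M) + len ((\<odot>\<^bsub>M\<^esub>) c ` carrier M) ((\<odot>\<^bsub>M\<^esub>) c ` A)"
    by (rule len_add[OF M submodule_smult_image[OF M cc] cA sub smult_image_subset[OF M cc]])
  finally show ?thesis using len_smult[OF c M As] by simp
qed

lemma P_e_subset: "P (e + n) \<subseteq> (\<odot>\<^bsub>M\<^esub>) t ` P n"
  unfolding max_pow_add
proof (rule max_pow_least[OF P_submodule])
  have tc: "t \<in> carrier R" using t_mem by simp
  show "submodule ((\<odot>\<^bsub>M\<^esub>) t ` P n) R M" by (rule submodule_smult_image[OF P_submodule tc])
  fix a v assume "a \<in> Q e" and v: "v \<in> P n"
  then obtain r where r: "r \<in> carrier R" "a = r \<otimes> t" using t_reduction by (auto simp: cgenideal_def)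
  then have "a \<odot>\<^bsub>M\<^esub> v = t \<odot>\<^bsub>M\<^esub> (r \<odot>\<^bsub>M\<^esub> v)"
    using tc P_closed(2)[OF v] by (simp add: smult_assoc1 smult_comm)
  then show "a \<odot>\<^bsub>M\<^esub> v \<in> (\<odot>\<^bsub>M\<^esub>) t ` P n" using P_closed(4)[OF r(1) v] by auto
qed

text \<open>The bound on the Hilbert function that dimension one provides. As t P n lies in P (n +
  1), the length is at most that of P n / t P n, which does not depend on n.\<close>

lemma len_P_Suc_le: "len (P n) (P (Suc n)) \<le> len (carrier M) ((\<odot>\<^bsub>M\<^esub>) t ` carrier M)"
proof -
  have tc: "t \<in> carrier R" using t_mem by simp
  have *: "P e \<subseteq> (\<odot>\<^bsub>M\<^esub>) t ` carrier M" using P_e_subset[of 0] by simp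
  have "(\<odot>\<^bsub>M\<^esub>) t ` P n \<subseteq> P (Suc n)"
    using ideal_times_mem[OF t_mem] by (auto simp: max_pow_Suc)
  then have "len (P n) (P (Suc n)) \<le> len (P n) ((\<odot>\<^bsub>M\<^esub>) t ` P n)"
    by (intro len_le P_submodule cofinite_P cofinite_smult[OF tc cofinite_P *] rel_length_mono order.refl)
  then show ?thesis using len_smult_const[OF regular_t cofinite_P *] by simp
qed

text \<open>The parameter replaces the Artin-Rees lemma: an element v of the intersection L is t w
  with w in P n for each n, and regularity makes all these w equal. Hence L lies in t L, and
  Nakayama gives L = 0.\<close>

lemma krull_intersection: "(\<Inter>n. P n) = {\<zero>\<^bsub>M\<^esub>}"
proof -
  let ?L = "\<Inter>n. P n"
  have tc: "t \<in> carrier R" using t_mem by simp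
  have L: "submodule ?L R M"
  proof (rule submoduleI')
    have "?L \<subseteq> P 0" by blast
    then show "?L \<subseteq> carrier M" by simp
  qed (simp_all add: P_closed)
  have "?L \<subseteq> ideal_times R M \<mm> ?L"
  proof
    fix v assume v: "v \<in> ?L"
    then have "v \<in> (\<odot>\<^bsub>M\<^esub>) t ` P n" for n using P_e_subset[of n] by blast
    then have w: "\<exists>w. w \<in> P n \<and> v = t \<odot>\<^bsub>M\<^esub> w" for n by auto
    then obtain w0 where w0: "w0 \<in> P 0" "v = t \<odot>\<^bsub>M\<^esub> w0" by blast
    have "w0 \<in> P n" for n
    proof -
      obtain u where u: "u \<in> P n" "v = t \<odot>\<^bsub>M\<^esub> u" using w by blast
      have "t \<odot>\<^bsub>M\<^esub> u = t \<odot>\<^bsub>M\<^esub> w0" by (rule trans[OF u(2)[symmetric] w0(2)])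
      then have "u = w0" by (rule regular_cancel[OF regular_t P_closed(2)[OF u(1)] P_closed(2)[OF w0(1)]])
      then show ?thesis using u by simp
    qed
    then have "w0 \<in> ?L" by blast
    then show "v \<in> ideal_times R M \<mm> ?L" using ideal_times_mem[OF t_mem, of w0 ?L] w0(2) by simp
  qed
  also have "\<dots> \<subseteq> ideal_times R M \<mm> ?L <+>\<^bsub>M\<^esub> {\<zero>\<^bsub>M\<^esub>}"
    by (rule set_add_upper(1)[OF max_ideal_times_submodule[OF L] submodule_zero])
  finally have "?L \<subseteq> {\<zero>\<^bsub>M\<^esub>}" by (rule nakayama[OF L submodule_zero])
  then show ?thesis using submodule_mem_simps(1)[OF L] by blast
qed

section \<open>Nilpotent classes in the associated graded module\<close>

text \<open>For \<open>a \<in> \<mm>\<^sup>k\<close>: the class of \<open>v\<close> in degree \<open>n\<close> of the associated graded module is killed by a power of \<open>a\<close>.\<close>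

definition nil :: "nat \<Rightarrow> 'a \<Rightarrow> nat \<Rightarrow> 'b \<Rightarrow> bool" where
  "nil k a n v \<longleftrightarrow> v \<in> P n \<and> (\<exists>j::nat. (a [^] j) \<odot>\<^bsub>M\<^esub> v \<in> P (n + k * j + 1))"

lemma Q_closed [simp]: "a \<in> Q k \<Longrightarrow> a \<in> carrier R"
  by (rule max_ideal_pow_closed(2))

lemma nil_mono:
  assumes a: "a \<in> Q k" and v: "v \<in> P n" and j: "(a [^] (j::nat)) \<odot>\<^bsub>M\<^esub> v \<in> P (n + k * j + 1)" "j \<le> j'"
  shows "(a [^] j') \<odot>\<^bsub>M\<^esub> v \<in> P (n + k * j' + 1)"
proof -
  obtain i where i: "j' = i + j" using j(2) by (metis le_add_diff_inverse2)
  have ac: "a \<in> carrier R" using a by simp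
  have "a [^] j' = a [^] i \<otimes> a [^] j" unfolding i using ac by (simp add: R.nat_pow_mult)
  then have "(a [^] j') \<odot>\<^bsub>M\<^esub> v = (a [^] i) \<odot>\<^bsub>M\<^esub> ((a [^] j) \<odot>\<^bsub>M\<^esub> v)"
    using ac P_closed(2)[OF v] by (simp add: smult_assoc1)
  also have "\<dots> \<in> P (n + k * j + 1 + k * i)" by (rule Q_smult[OF max_ideal_pow_nat_pow[OF a] j(1)])
  finally show ?thesis unfolding i by (simp add: algebra_simps)
qed

text \<open>In place of the binomial theorem, induction on the sum of the two exponents: a v and b v
  lie in degree n + d, and each has one exponent lower than v. A common power of a + b for both of
  them yields the next power for v.\<close>

lemma nil_add:
  assumes a: "a \<in> Q d" and b: "b \<in> Q d" and "nil d a n v" "nil d b n v"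
  shows "nil d (a \<oplus> b) n v"
proof -
  have ac: "a \<in> carrier R" "b \<in> carrier R" using a b by auto
  have ab: "a \<oplus> b \<in> Q d" by (rule max_ideal_pow_closed(3)[OF a b])
  have key: "\<exists>p::nat. ((a \<oplus> b) [^] p) \<odot>\<^bsub>M\<^esub> v \<in> P (n + d * p + 1)"
    if "v \<in> P n" "(a [^] (j::nat)) \<odot>\<^bsub>M\<^esub> v \<in> P (n + d * j + 1)"
      "(b [^] (l::nat)) \<odot>\<^bsub>M\<^esub> v \<in> P (n + d * l + 1)" for j l n v
    using that
  proof (induction "j + l" arbitrary: j l n v)
    case 0
    then have "v \<in> P (n + 1)" using P_closed(2)[OF 0(2)] by simp
    then show ?case using P_closed(2)[OF 0(2)] by (intro exI[of _ 0]) simp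
  next
    case (Suc s)
    note v = Suc.prems(1) and vc = P_closed(2)[OF Suc.prems(1)]
    show ?case
    proof (cases "j = 0 \<or> l = 0")
      case True
      then have "v \<in> P (n + 1)" using Suc.prems vc by auto
      then show ?thesis using vc by (intro exI[of _ 0]) simp
    next
      case False
      then obtain j' l' where jl: "j = Suc j'" "l = Suc l'" using not0_implies_Suc by metis
      have av: "a \<odot>\<^bsub>M\<^esub> v \<in> P (n + d)" "b \<odot>\<^bsub>M\<^esub> v \<in> P (n + d)" using Q_smult a b v by auto
      have e1: "(a [^] j') \<odot>\<^bsub>M\<^esub> (a \<odot>\<^bsub>M\<^esub> v) = (a [^] j) \<odot>\<^bsub>M\<^esub> v"
        "(b [^] l') \<odot>\<^bsub>M\<^esub> (b \<odot>\<^bsub>M\<^esub> v) = (b [^] l) \<odot>\<^bsub>M\<^esub> v"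
        unfolding jl using ac vc by (simp_all add: smult_assoc1)
      have 1: "(a [^] j') \<odot>\<^bsub>M\<^esub> (a \<odot>\<^bsub>M\<^esub> v) \<in> P ((n + d) + d * j' + 1)"
        unfolding e1 using Suc.prems(2) jl by (simp add: algebra_simps)
      have 2: "(b [^] l') \<odot>\<^bsub>M\<^esub> (b \<odot>\<^bsub>M\<^esub> v) \<in> P ((n + d) + d * l' + 1)"
        unfolding e1 using Suc.prems(3) jl by (simp add: algebra_simps)
      have 3: "(b [^] l) \<odot>\<^bsub>M\<^esub> (a \<odot>\<^bsub>M\<^esub> v) \<in> P ((n + d) + d * l + 1)"
        using Q_smult[OF a Suc.prems(3)] ac vc by (simp add: smult_comm algebra_simps)
      have 4: "(a [^] j) \<odot>\<^bsub>M\<^esub> (b \<odot>\<^bsub>M\<^esub> v) \<in> P ((n + d) + d * j + 1)"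
        using Q_smult[OF b Suc.prems(2)] ac vc by (simp add: smult_comm algebra_simps)
      obtain p1 where p1: "((a \<oplus> b) [^] (p1::nat)) \<odot>\<^bsub>M\<^esub> (a \<odot>\<^bsub>M\<^esub> v) \<in> P ((n + d) + d * p1 + 1)"
        using Suc.hyps(1)[OF _ av(1) 1 3] Suc.hyps(2) jl by auto
      obtain p2 where p2: "((a \<oplus> b) [^] (p2::nat)) \<odot>\<^bsub>M\<^esub> (b \<odot>\<^bsub>M\<^esub> v) \<in> P ((n + d) + d * p2 + 1)"
        using Suc.hyps(1)[OF _ av(2) 4 2] Suc.hyps(2) jl by auto
      let ?p = "max p1 p2"
      have q1: "((a \<oplus> b) [^] ?p) \<odot>\<^bsub>M\<^esub> (a \<odot>\<^bsub>M\<^esub> v) \<in> P ((n + d) + d * ?p + 1)"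
        by (rule nil_mono[OF ab av(1) p1]) simp
      have q2: "((a \<oplus> b) [^] ?p) \<odot>\<^bsub>M\<^esub> (b \<odot>\<^bsub>M\<^esub> v) \<in> P ((n + d) + d * ?p + 1)"
        by (rule nil_mono[OF ab av(2) p2]) simp
      have "((a \<oplus> b) [^] Suc ?p) \<odot>\<^bsub>M\<^esub> v
          = ((a \<oplus> b) [^] ?p) \<odot>\<^bsub>M\<^esub> (a \<odot>\<^bsub>M\<^esub> v) \<oplus>\<^bsub>M\<^esub> ((a \<oplus> b) [^] ?p) \<odot>\<^bsub>M\<^esub> (b \<odot>\<^bsub>M\<^esub> v)"
        using ac vc by (simp add: smult_assoc1 smult_l_distr smult_r_distr)
      then show ?thesis using P_closed(3)[OF q1 q2] by (intro exI[of _ "Suc ?p"]) (simp add: algebra_simps)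
    qed
  qed
  show ?thesis using assms(3,4) key unfolding nil_def by blast
qed

text \<open>In degree d of the associated graded ring such an element has class zero. Used to
  discard terms of too high order.\<close>

lemma nil_of_mem_Suc:
  assumes "a \<in> Q (Suc d)" "v \<in> P n"
  shows "nil d a n v"
proof -
  have "a \<odot>\<^bsub>M\<^esub> v \<in> P (n + Suc d)" by (rule Q_smult[OF assms])
  then show ?thesis unfolding nil_def using assms by (auto intro!: exI[of _ "Suc 0"])
qed

lemma nil_mult:
  assumes a: "a \<in> Q d" and u: "u \<in> Q d'" and "nil d a n v"
  shows "nil (d + d') (a \<otimes> u) n v"
proof -
  obtain j :: nat where v: "v \<in> P n" and j: "(a [^] j) \<odot>\<^bsub>M\<^esub> v \<in> P (n + d * j + 1)"
    using assms(3) by (auto simp: nil_def)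
  have c: "a \<in> carrier R" "u \<in> carrier R" "v \<in> carrier M" using a u P_closed(2)[OF v] by auto
  have "((a \<otimes> u) [^] j) \<odot>\<^bsub>M\<^esub> v = (u [^] j) \<odot>\<^bsub>M\<^esub> ((a [^] j) \<odot>\<^bsub>M\<^esub> v)"
    using c by (simp add: R.nat_pow_distrib R.m_comm[of "a [^] j"] smult_assoc1)
  also have "\<dots> \<in> P (n + d * j + 1 + d' * j)" by (rule Q_smult[OF max_ideal_pow_nat_pow[OF u] j])
  finally show ?thesis using v unfolding nil_def by (auto simp: algebra_simps)
qed

lemma nil_power:
  assumes "a \<in> carrier R" "nil (k * l) (a [^] l) n v"
  shows "nil k a n v"
proof -
  obtain j :: nat where v: "v \<in> P n" and j: "((a [^] l) [^] j) \<odot>\<^bsub>M\<^esub> v \<in> P (n + k * l * j + 1)"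
    using assms(2) by (auto simp: nil_def)
  have "(a [^] (l * j)) \<odot>\<^bsub>M\<^esub> v \<in> P (n + k * (l * j) + 1)"
    using j assms(1) by (simp add: R.nat_pow_pow mult.assoc)
  then show ?thesis using v unfolding nil_def by blast
qed

lemma Q_len_bound: "\<exists>C. \<forall>n. rel_length R (self_module R) (Q n) (Q (Suc n)) \<le> enat C"
proof -
  interpret S: torsion_free_module R "self_module R" t e by (rule torsion_free_self)
  have Q: "Q n = S.P n" for n by (simp add: max_ideal_pow_def)
  have "rel_length R (self_module R) (Q n) (Q (Suc n)) \<le>
      enat (S.len (carrier R) ((\<odot>\<^bsub>self_module R\<^esub>) t ` carrier R))" for n
  proof -
    have "rel_length R (self_module R) (Q n) (Q (Suc n)) = enat (S.len (Q n) (Q (Suc n)))"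
      unfolding Q by (rule S.cofinite_rel_length[OF S.P_submodule S.cofinite_P])
    also have "\<dots> \<le> enat (S.len (carrier R) ((\<odot>\<^bsub>self_module R\<^esub>) t ` carrier R))"
      using S.len_P_Suc_le[of n] unfolding Q by simp
    finally show ?thesis .
  qed
  then show ?thesis by blast
qed

text \<open>
  The lengths of \<open>\<mm>\<^sup>n / \<mm>\<^sup>n\<^sup>+\<^sup>1\<close> are bounded by some \<open>s\<close>, so the monomials \<open>a\<^sup>s\<^sup>-\<^sup>i b\<^sup>i\<close>, \<open>i \<le> s\<close>, in degree
  \<open>k s\<close> of the associated graded ring satisfy a relation. The coefficient of the last monomial
  that occurs can be made \<open>1\<close>.
\<close>

lemma homogeneous_relation:
  assumes a: "a \<in> Q k" and b: "b \<in> Q k"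
  shows "\<exists>(i::nat) (p::nat) g. g \<in> carrier R \<and> (\<forall>y\<in>Q k. y \<otimes> g \<in> Q (k * i)) \<and>
    a [^] p \<otimes> (b [^] i \<ominus> a \<otimes> g) \<in> Q (k * (p + i) + 1)"
proof -
  interpret S: torsion_free_module R "self_module R" t e by (rule torsion_free_self)
  have ac: "a \<in> carrier R" "b \<in> carrier R" using a b by auto
  obtain s where s: "\<And>n. rel_length R (self_module R) (Q n) (Q (Suc n)) \<le> enat s"
    using Q_len_bound by blast
  \<comment> \<open>\<open>U i\<close> collects the forms of degree k s divisible by a^(s + 1 - i),
    modulo the next power of m, and \<open>U 0\<close> is zero there. These s + 2 submodules cannot
    be distinct in a piece of length at most s. An equality \<open>U i = U (Suc i)\<close> turns
    a^(s - i) b^i into a multiple of a^(s + 1 - i), which is the relation with p = s - i.\<close>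
  define U where "U i = (if i = 0 then Q (Suc (k * s)) else
      ((\<odot>\<^bsub>self_module R\<^esub>) (a [^] (Suc s - i)) ` Q (k * (i - 1))) <+>\<^bsub>self_module R\<^esub> Q (Suc (k * s)))" for i
  note Qs = max_ideal_pow_submodule
  have img: "submodule ((\<odot>\<^bsub>self_module R\<^esub>) (a [^] j) ` Q l) R (self_module R)" for j :: nat and l
    by (rule S.submodule_smult_image[OF Qs]) (use ac in simp)
  have Us: "submodule (U i) R (self_module R)" for i
    unfolding U_def using Qs S.submodule_set_add[OF img Qs] by simp
  have lower: "Q (Suc (k * s)) \<subseteq> U i" for i
    unfolding U_def using S.set_add_upper(2)[OF img Qs] by simp
  have upper: "U i \<subseteq> Q (k * s)" if i: "i \<le> Suc s" for i
  proof (cases "i = 0")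
    case True
    then show ?thesis unfolding U_def using max_ideal_pow_antimono[of "k * s" "Suc (k * s)"] by simp
  next
    case False
    have "(\<odot>\<^bsub>self_module R\<^esub>) (a [^] (Suc s - i)) ` Q (k * (i - 1)) \<subseteq> Q (k * s)"
    proof
      fix z assume "z \<in> (\<odot>\<^bsub>self_module R\<^esub>) (a [^] (Suc s - i)) ` Q (k * (i - 1))"
      then obtain q where q: "q \<in> Q (k * (i - 1))" "z = a [^] (Suc s - i) \<otimes> q" by auto
      have "z \<in> Q (k * (Suc s - i) + k * (i - 1))"
        unfolding q(2) by (rule max_ideal_pow_mult[OF max_ideal_pow_nat_pow[OF a] q(1)])
      moreover have "k * (Suc s - i) + k * (i - 1) = k * s"
        using i False by (simp add: distrib_left[symmetric])
      ultimately show "z \<in> Q (k * s)" by simp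
    qed
    then show ?thesis
      unfolding U_def using False S.set_add_least[OF Qs] max_ideal_pow_antimono[of "k * s" "Suc (k * s)"] by simp
  qed
  have mono: "U i \<subseteq> U (Suc i)" if i: "i \<le> s" for i
  proof (cases "i = 0")
    case True
    then show ?thesis using lower[of 1] by (simp add: U_def)
  next
    case False
    have "(\<odot>\<^bsub>self_module R\<^esub>) (a [^] (Suc s - i)) ` Q (k * (i - 1))
        \<subseteq> (\<odot>\<^bsub>self_module R\<^esub>) (a [^] (s - i)) ` Q (k * i)"
    proof
      fix z assume "z \<in> (\<odot>\<^bsub>self_module R\<^esub>) (a [^] (Suc s - i)) ` Q (k * (i - 1))"
      then obtain q where q: "q \<in> Q (k * (i - 1))" "z = a [^] (Suc s - i) \<otimes> q" by auto
      have "z = a [^] (s - i) \<otimes> (a \<otimes> q)"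
        unfolding q(2) using i ac q(1) by (simp add: Suc_diff_le R.m_assoc)
      moreover have "a \<otimes> q \<in> Q (k + k * (i - 1))" by (rule max_ideal_pow_mult[OF a q(1)])
      moreover have "k + k * (i - 1) = k * i" using False by (cases i) auto
      ultimately show "z \<in> (\<odot>\<^bsub>self_module R\<^esub>) (a [^] (s - i)) ` Q (k * i)" by auto
    qed
    then show ?thesis unfolding U_def using False by (simp add: S.set_add_mono)
  qed
  have "\<exists>i\<le>s. U i = U (Suc i)"
  proof (rule ccontr)
    assume no: "\<not> (\<exists>i\<le>s. U i = U (Suc i))"
    have "submodule_chain R (self_module R) (Q (k * s)) (Q (Suc (k * s))) (Suc s) U"
      unfolding submodule_chain_def
    proof (intro conjI allI impI)
      fix i assume "i < Suc s"
      then show "U i \<subset> U (Suc i)" using no mono[of i] by auto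
    qed (use Us lower upper in auto)
    from submodule_chain_le[OF this] have "enat (Suc s) \<le> enat s"
      using s[of "k * s"] order_trans by blast
    then show False by simp
  qed
  then obtain i where i: "i \<le> s" "U i = U (Suc i)" by blast
  have "a [^] (s - i) \<otimes> b [^] i \<in> U (Suc i)"
  proof -
    have "b [^] i \<in> Q (k * i)" by (rule max_ideal_pow_nat_pow[OF b])
    then have "a [^] (s - i) \<otimes> b [^] i \<in> (\<odot>\<^bsub>self_module R\<^esub>) (a [^] (s - i)) ` Q (k * i)" by auto
    from subsetD[OF S.set_add_upper(1)[OF img Qs] this] show ?thesis unfolding U_def by simp
  qed
  then have mem: "a [^] (s - i) \<otimes> b [^] i \<in> U i" using i by simp
  have deg: "k * (s - i + i) + 1 = Suc (k * s)" using i by simp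
  \<comment> \<open>The clause on y g expresses that g has degree k (i - 1) in a form that also
    makes sense for i = 0. In that case a is nilpotent in the associated graded ring and g = 0
    serves.\<close>
  have "\<exists>g. g \<in> carrier R \<and> (\<forall>y\<in>Q k. y \<otimes> g \<in> Q (k * i)) \<and>
    a [^] (s - i) \<otimes> (b [^] i \<ominus> a \<otimes> g) \<in> Q (k * (s - i + i) + 1)"
  proof (cases "i = 0")
    case True
    then have "a [^] (s - i) \<otimes> b [^] i \<in> Q (Suc (k * s))" using mem by (simp add: U_def)
    moreover have "b [^] i \<ominus> a \<otimes> \<zero> = b [^] i" using ac by (simp add: a_minus_def)
    ultimately show ?thesis unfolding deg using max_ideal_pow_closed(1) True by (intro exI[of _ \<zero>]) auto
  next
    case False
    then obtain z q where zq: "z \<in> (\<odot>\<^bsub>self_module R\<^esub>) (a [^] (Suc s - i)) ` Q (k * (i - 1))"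
      "q \<in> Q (Suc (k * s))" "a [^] (s - i) \<otimes> b [^] i = z \<oplus> q"
      using mem by (auto simp: U_def S.mem_set_add_iff)
    then obtain g where g: "g \<in> Q (k * (i - 1))" "z = a [^] (Suc s - i) \<otimes> g" by auto
    have gc: "g \<in> carrier R" "q \<in> carrier R" using g zq by auto
    have "y \<otimes> g \<in> Q (k * i)" if "y \<in> Q k" for y
    proof -
      have "y \<otimes> g \<in> Q (k + k * (i - 1))" by (rule max_ideal_pow_mult[OF that g(1)])
      moreover have "k + k * (i - 1) = k * i" using False by (cases i) auto
      ultimately show ?thesis by simp
    qed
    moreover have "a [^] (s - i) \<otimes> (b [^] i \<ominus> a \<otimes> g) = q"
    proof -
      have z: "z = a [^] (s - i) \<otimes> (a \<otimes> g)"
        unfolding g(2) using i ac gc by (simp add: Suc_diff_le R.m_assoc)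
      have zc: "z \<in> carrier R" unfolding z using ac gc by simp
      have "a [^] (s - i) \<otimes> (b [^] i \<ominus> a \<otimes> g) = a [^] (s - i) \<otimes> b [^] i \<oplus> \<ominus> z"
        unfolding z using ac gc by (simp add: a_minus_def R.r_distr R.r_minus)
      also have "\<dots> = q \<oplus> (z \<oplus> \<ominus> z)" unfolding zq(3) using gc zc by (simp add: R.a_ac)
      also have "\<dots> = q" using gc zc by (simp add: R.r_neg)
      finally show ?thesis .
    qed
    ultimately show ?thesis unfolding deg using gc zq(2) by blast
  qed
  then show ?thesis by blast
qed

text \<open>
  With \<open>G = b\<^sup>i - a g\<close> as above, so that \<open>a\<^sup>p G\<close> vanishes in the associated graded ring, take
  \<open>c = a\<^sup>i\<^sup>+\<^sup>1 + b G\<close>. Then \<open>a\<^sup>p c = a\<^sup>p\<^sup>+\<^sup>i\<^sup>+\<^sup>1\<close> there, and \<open>c - b\<^sup>i\<^sup>+\<^sup>1\<close> is a multiple of \<open>a\<close>.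
\<close>

lemma common_nil:
  assumes a: "a \<in> Q k" and b: "b \<in> Q k" and k: "k \<ge> 1"
  shows "\<exists>k'\<ge>1. \<exists>c\<in>Q k'. \<forall>n v. nil k' c n v \<longrightarrow> nil k a n v \<and> nil k b n v"
proof -
  obtain i p :: nat and g where g: "g \<in> carrier R" "\<And>y. y \<in> Q k \<Longrightarrow> y \<otimes> g \<in> Q (k * i)"
    and G: "a [^] p \<otimes> (b [^] i \<ominus> a \<otimes> g) \<in> Q (k * (p + i) + 1)"
    using homogeneous_relation[OF a b] by blast
  have ac: "a \<in> carrier R" "b \<in> carrier R" using a b by auto
  define G where "G = b [^] i \<ominus> a \<otimes> g"
  define d where "d = k * Suc i"
  define c where "c = a [^] Suc i \<oplus> b \<otimes> G"
  have Gc: "G \<in> carrier R" using ac g by (simp add: G_def)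
  have neg: "\<ominus> z \<in> Q l" if "z \<in> Q l" for z l
  proof -
    have "\<ominus> \<one> \<otimes> z = \<ominus> z" using that by (simp add: R.l_minus)
    then show ?thesis using max_ideal_pow_closed(4)[of "\<ominus> \<one>" z l] that by simp
  qed
  have pow: "z [^] j \<in> Q (k * j)" if "z \<in> Q k" for z and j :: nat by (rule max_ideal_pow_nat_pow[OF that])
  have GQ: "G \<in> Q (k * i)"
    unfolding G_def a_minus_def
    by (intro max_ideal_pow_closed(3) pow b neg g(2) a)
  have cQ: "c \<in> Q d"
    unfolding c_def d_def using pow[OF a, of "Suc i"] max_ideal_pow_mult[OF b GQ]
    by (intro max_ideal_pow_closed(3)) simp_all
  have nil_a: "nil k a n v" if c': "nil d c n v" for n v
  proof -
    have v: "v \<in> P n" using c' by (simp add: nil_def)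
    have 1: "nil (d + k * p) (c \<otimes> a [^] p) n v" by (rule nil_mult[OF cQ pow[OF a] c'])
    define w where "w = b \<otimes> (a [^] p \<otimes> G)"
    have wc: "w \<in> carrier R" using ac Gc by (simp add: w_def)
    have "w \<in> Q (k + (k * (p + i) + 1))" unfolding w_def G_def by (rule max_ideal_pow_mult[OF b G])
    moreover have "k + (k * (p + i) + 1) = Suc (d + k * p)" by (simp add: d_def algebra_simps)
    ultimately have wQ: "\<ominus> w \<in> Q (Suc (d + k * p))" by (simp add: neg)
    then have wQ': "\<ominus> w \<in> Q (d + k * p)" using max_ideal_pow_antimono[of "d + k * p" "Suc (d + k * p)"] by auto
    have cQ': "c \<otimes> a [^] p \<in> Q (d + k * p)" by (rule max_ideal_pow_mult[OF cQ pow[OF a]])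
    have "nil (d + k * p) (c \<otimes> a [^] p \<oplus> \<ominus> w) n v"
      by (rule nil_add[OF cQ' wQ' 1 nil_of_mem_Suc[OF wQ v]])
    moreover have "c \<otimes> a [^] p \<oplus> \<ominus> w = a [^] (Suc i + p)"
    proof -
      have "c \<otimes> a [^] p = a [^] Suc i \<otimes> a [^] p \<oplus> w"
        unfolding c_def w_def using ac Gc by (simp add: R.l_distr R.m_assoc R.m_comm[of G])
      then show ?thesis using ac wc by (simp add: R.nat_pow_mult[symmetric] R.a_assoc R.r_neg R.m_ac)
    qed
    moreover have "d + k * p = k * (Suc i + p)" by (simp add: d_def algebra_simps)
    ultimately show ?thesis using nil_power[OF ac(1), of k "Suc i + p"] by simp
  qed
  have nil_b: "nil k b n v" if c': "nil d c n v" for n v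
  proof -
    \<comment> \<open>Since b G = b^(i + 1) - a b g, this u is the cofactor of a in b^(i + 1) -
      c.\<close>
    define u where "u = b \<otimes> g \<oplus> \<ominus> (a [^] i)"
    have uQ: "u \<in> Q (k * i)" unfolding u_def by (intro max_ideal_pow_closed(3) g(2) b neg pow a)
    have uc: "u \<in> carrier R" using uQ by simp
    have "nil (k + k * i) (a \<otimes> u) n v" by (rule nil_mult[OF a uQ nil_a[OF c']])
    then have au: "nil d (a \<otimes> u) n v" by (simp add: d_def)
    have "a \<otimes> u \<in> Q d" using max_ideal_pow_mult[OF a uQ] by (simp add: d_def)
    then have "nil d (c \<oplus> a \<otimes> u) n v" by (rule nil_add[OF cQ _ c' au])
    moreover have "c \<oplus> a \<otimes> u = b [^] Suc i"
    proof -
      define A where "A = a [^] Suc i"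
      define B where "B = b [^] Suc i"
      define D where "D = a \<otimes> (b \<otimes> g)"
      have car: "A \<in> carrier R" "B \<in> carrier R" "D \<in> carrier R" using ac g by (simp_all add: A_def B_def D_def)
      have "b \<otimes> G = B \<oplus> \<ominus> D"
        unfolding G_def B_def D_def a_minus_def using ac g by (simp add: R.r_distr R.r_minus R.m_ac)
      moreover have "a \<otimes> u = D \<oplus> \<ominus> A"
        unfolding u_def A_def D_def using ac g by (simp add: R.r_distr R.r_minus R.m_comm)
      ultimately have "c \<oplus> a \<otimes> u = (A \<oplus> (B \<oplus> \<ominus> D)) \<oplus> (D \<oplus> \<ominus> A)" by (simp add: c_def A_def)
      also have "\<dots> = B"
      proof -
        have "(A \<oplus> (B \<oplus> \<ominus> D)) \<oplus> (D \<oplus> \<ominus> A) = B \<oplus> ((A \<oplus> \<ominus> A) \<oplus> (D \<oplus> \<ominus> D))"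
          using car by (simp only: R.a_ac R.a_closed R.a_inv_closed)
        then show ?thesis using car by (simp add: R.r_neg)
      qed
      finally show ?thesis by (simp add: B_def)
    qed
    ultimately show ?thesis using nil_power[OF ac(2), of k "Suc i" n v] by (simp add: d_def)
  qed
  have "d \<ge> 1" using k by (simp add: d_def)
  then show ?thesis using cQ nil_a nil_b by blast
qed

text \<open>\<open>common_nil\<close> asks for two elements of the same degree, so the element of
  degree k found so far is paired with y^k. A class on which y^k is nilpotent is one on which y
  is.\<close>

lemma common_nil_finite:
  assumes "finite Y" "Y \<subseteq> Q 1"
  shows "\<exists>k\<ge>1. \<exists>c\<in>Q k. \<forall>n v. nil k c n v \<longrightarrow> (\<forall>y\<in>Y. nil 1 y n v)"
  using assms
proof (induction Y)
  case empty
  show ?case using max_ideal_pow_closed(1)[of 1] by blast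
next
  case (insert y Y)
  then obtain k c where kc: "k \<ge> 1" "c \<in> Q k" "\<And>n v. nil k c n v \<Longrightarrow> \<forall>y\<in>Y. nil 1 y n v" by auto
  have y: "y \<in> Q 1" using insert.prems by simp
  have "y [^] k \<in> Q k" using max_ideal_pow_nat_pow[OF y, of k] by simp
  from common_nil[OF kc(2) this kc(1)] obtain k' c' where c': "k' \<ge> 1" "c' \<in> Q k'"
    "\<And>n v. nil k' c' n v \<Longrightarrow> nil k c n v \<and> nil k (y [^] k) n v" by blast
  have "nil 1 y n v" if "nil k' c' n v" for n v
    using nil_power[of y 1 k n v] c'(3)[OF that] y by simp
  then show ?case using c' kc(3) by (intro exI[of _ k'] conjI bexI[of _ c']) auto
qed

lemma max_pow_span_step:
  assumes v: "v \<in> carrier M" and L: "submodule L R M"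
    and Y: "Idl Y = \<mm>" "\<And>y. y \<in> Y \<Longrightarrow> y \<in> carrier R \<and> y \<odot>\<^bsub>M\<^esub> v \<in> L"
  shows "ideal_times R M \<mm> ((\<lambda>r. r \<odot>\<^bsub>M\<^esub> v) ` carrier R) \<subseteq> L"
proof -
  interpret S: module R "self_module R" by (rule R.self_module_module)
  note l = submodule_mem_simps[OF L]
  have "submodule {b \<in> carrier R. b \<odot>\<^bsub>M\<^esub> v \<in> L} R (self_module R)"
    by (rule S.submoduleI') (use v l in \<open>auto simp: smult_l_distr smult_assoc1\<close>)
  then have "\<mm> \<subseteq> {b \<in> carrier R. b \<odot>\<^bsub>M\<^esub> v \<in> L}"
    unfolding Y(1)[symmetric] using Y(2)
    by (intro R.genideal_minimal) (auto simp: R.ideal_iff_submodule)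
  then have m: "b \<odot>\<^bsub>M\<^esub> v \<in> L" if "b \<in> \<mm>" for b using that by auto
  show ?thesis
  proof (rule ideal_times_least[OF L])
    fix b w assume b: "b \<in> \<mm>" and "w \<in> (\<lambda>r. r \<odot>\<^bsub>M\<^esub> v) ` carrier R"
    then obtain r where r: "r \<in> carrier R" "w = r \<odot>\<^bsub>M\<^esub> v" by auto
    then have "b \<odot>\<^bsub>M\<^esub> w = r \<odot>\<^bsub>M\<^esub> (b \<odot>\<^bsub>M\<^esub> v)" using b v by (simp add: smult_comm)
    then show "b \<odot>\<^bsub>M\<^esub> w \<in> L" using l(4)[OF r(1) m[OF b]] by simp
  qed
qed

lemma colon_submodule: "submodule {w \<in> carrier M. \<forall>a\<in>Q N. a \<odot>\<^bsub>M\<^esub> w \<in> P q} R M" (is "submodule ?L R M")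
proof (rule submoduleI')
  fix a x assume a: "a \<in> carrier R" and x: "x \<in> ?L"
  have "b \<odot>\<^bsub>M\<^esub> (a \<odot>\<^bsub>M\<^esub> x) \<in> P q" if b: "b \<in> Q N" for b
  proof -
    have xc: "x \<in> carrier M" using x by simp
    have "b \<odot>\<^bsub>M\<^esub> (a \<odot>\<^bsub>M\<^esub> x) = a \<odot>\<^bsub>M\<^esub> (b \<odot>\<^bsub>M\<^esub> x)" using a b xc by (intro smult_comm) auto
    then show ?thesis using P_closed(4)[OF a] x b by simp
  qed
  then show "a \<odot>\<^bsub>M\<^esub> x \<in> ?L" using a x by simp
qed (use P_closed in \<open>auto simp: smult_r_distr\<close>)

text \<open>In a monomial of large degree some generator occurs often enough. The count is replaced
  by induction on the sum of the exponents j: passing from v to y v lowers \<open>j y\<close> by one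
  and raises q by one, and an exponent 0 means that v lies in \<open>P q\<close>. Finitely many y
  then give a common exponent N.\<close>

lemma max_pow_span_subset:
  assumes "finite Y" "Y \<subseteq> carrier R" "Idl Y = \<mm>"
  shows "v \<in> carrier M \<Longrightarrow> (\<And>y. y \<in> Y \<Longrightarrow> (y [^] (j y :: nat)) \<odot>\<^bsub>M\<^esub> v \<in> P (q + j y)) \<Longrightarrow> Y \<noteq> {} \<Longrightarrow>
    \<exists>J. max_pow R M J ((\<lambda>r. r \<odot>\<^bsub>M\<^esub> v) ` carrier R) \<subseteq> P (q + J)"
proof (induction "\<Sum>y\<in>Y. j y" arbitrary: j v q rule: less_induct)
  case less
  note v = less.prems(1)
  let ?T = "\<lambda>v. (\<lambda>r. r \<odot>\<^bsub>M\<^esub> v) ` carrier R"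
  show ?case
  proof (cases "\<exists>y\<in>Y. j y = 0")
    case True
    then obtain y where "y \<in> Y" "j y = 0" by blast
    then have "v \<in> P q" using less.prems(2)[of y] v by simp
    then have "?T v \<subseteq> P q" using P_closed(4) by auto
    then show ?thesis by (intro exI[of _ 0]) simp
  next
    case False
    have "\<forall>y\<in>Y. \<exists>J. max_pow R M J (?T (y \<odot>\<^bsub>M\<^esub> v)) \<subseteq> P (q + 1 + J)"
    proof
      fix y assume y: "y \<in> Y"
      have yc: "y \<in> carrier R" using y assms(2) by auto
      let ?j = "j(y := j y - 1)"
      have "(\<Sum>y\<in>Y. ?j y) < (\<Sum>y\<in>Y. j y)"
        by (rule sum_strict_mono_ex1[OF assms(1)]) (use y False in \<open>auto intro!: bexI[of _ y]\<close>)
      moreover have "(y' [^] ?j y') \<odot>\<^bsub>M\<^esub> (y \<odot>\<^bsub>M\<^esub> v) \<in> P (q + 1 + ?j y')" if y': "y' \<in> Y" for y'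
      proof (cases "y' = y")
        case True
        obtain i where i: "j y = Suc i" using False y not0_implies_Suc by blast
        have "(y [^] i) \<odot>\<^bsub>M\<^esub> (y \<odot>\<^bsub>M\<^esub> v) = (y [^] j y) \<odot>\<^bsub>M\<^esub> v"
          unfolding i using yc v by (simp add: smult_assoc1)
        then show ?thesis using less.prems(2)[OF y] True i by simp
      next
        case neq: False
        have yc': "y' \<in> carrier R" using y' assms(2) by auto
        have "y \<in> \<mm>" using y assms(2,3) R.genideal_self by blast
        then have "y \<odot>\<^bsub>M\<^esub> ((y' [^] j y') \<odot>\<^bsub>M\<^esub> v) \<in> P (Suc (q + j y'))"
          using ideal_times_mem[OF _ less.prems(2)[OF y']] by (simp add: max_pow_Suc)
        then show ?thesis using neq yc yc' v by (simp add: smult_comm)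
      qed
      ultimately show "\<exists>J. max_pow R M J (?T (y \<odot>\<^bsub>M\<^esub> v)) \<subseteq> P (q + 1 + J)"
        using less.hyps[of ?j "y \<odot>\<^bsub>M\<^esub> v" "q + 1"] yc v less.prems(3) by simp
    qed
    then obtain J where J: "\<And>y. y \<in> Y \<Longrightarrow> max_pow R M (J y) (?T (y \<odot>\<^bsub>M\<^esub> v)) \<subseteq> P (q + 1 + J y)" by metis
    define N where "N = Max (J ` Y)"
    define L where "L = {w \<in> carrier M. \<forall>a\<in>Q N. a \<odot>\<^bsub>M\<^esub> w \<in> P (q + 1 + N)}"
    have L: "submodule L R M" unfolding L_def by (rule colon_submodule)
    have "y \<in> carrier R \<and> y \<odot>\<^bsub>M\<^esub> v \<in> L" if y: "y \<in> Y" for y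
    proof
      show yc: "y \<in> carrier R" using y assms(2) by auto
      have JN: "J y \<le> N" unfolding N_def using y assms(1) by simp
      have yv: "y \<odot>\<^bsub>M\<^esub> v \<in> carrier M" using yc v by simp
      note T = submodule_span[OF yv]
      have "max_pow R M N (?T (y \<odot>\<^bsub>M\<^esub> v)) = max_pow R M (N - J y) (max_pow R M (J y) (?T (y \<odot>\<^bsub>M\<^esub> v)))"
        using JN by (simp add: max_pow_add[symmetric])
      also have "\<dots> \<subseteq> max_pow R M (N - J y) (P (q + 1 + J y))" by (rule max_pow_mono[OF J[OF y]])
      also have "\<dots> = P (q + 1 + N)" unfolding P_add using JN by (simp add: add.commute)
      finally have "max_pow R M N (?T (y \<odot>\<^bsub>M\<^esub> v)) \<subseteq> P (q + 1 + N)" .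
      moreover have "a \<odot>\<^bsub>M\<^esub> (y \<odot>\<^bsub>M\<^esub> v) \<in> max_pow R M N (?T (y \<odot>\<^bsub>M\<^esub> v))" if "a \<in> Q N" for a
        using max_ideal_pow_smult[OF T that, of "y \<odot>\<^bsub>M\<^esub> v" 0] mem_span[OF yv] by simp
      ultimately show "y \<odot>\<^bsub>M\<^esub> v \<in> L" using yv by (auto simp: L_def)
    qed
    then have "ideal_times R M \<mm> (?T v) \<subseteq> L" by (rule max_pow_span_step[OF v L assms(3)])
    moreover have mT: "submodule (ideal_times R M \<mm> (?T v)) R M"
      by (rule max_ideal_times_submodule[OF submodule_span[OF v]])
    ultimately have "max_pow R M N (ideal_times R M \<mm> (?T v)) \<subseteq> P (q + 1 + N)"
      by (intro max_pow_least[OF mT P_submodule]) (auto simp: L_def)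
    moreover have "max_pow R M (N + Suc 0) (?T v) = max_pow R M N (ideal_times R M \<mm> (?T v))"
      unfolding max_pow_add by (simp add: max_pow_Suc)
    ultimately show ?thesis by (intro exI[of _ "Suc N"]) simp
  qed
qed

end

section \<open>Existence of a reduction\<close>

context torsion_free_module
begin

lemma max_ideal_generators:
  "\<exists>Y. finite Y \<and> Y \<noteq> {} \<and> Y \<subseteq> carrier R \<and> Y \<subseteq> \<mm> \<and> Idl Y = \<mm>"
proof -
  obtain Y where Y: "Y \<subseteq> carrier R" "finite Y" "\<mm> = Idl Y"
    using noetherian_ring.finetely_gen[OF noetherian max_ideal_ideal] by auto
  \<comment> \<open>Adding t ensures that the generating set is nonempty.\<close>
  have Ym: "insert t Y \<subseteq> \<mm>" using t_mem Y R.genideal_self by auto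
  have c: "insert t Y \<subseteq> carrier R" using Ym max_ideal_subset by auto
  have "\<mm> \<subseteq> Idl (insert t Y)"
    unfolding Y(3) using R.genideal_self[OF c]
    by (intro R.genideal_minimal[OF R.genideal_ideal[OF c]]) auto
  moreover have "Idl (insert t Y) \<subseteq> \<mm>" by (rule R.genideal_minimal[OF max_ideal_ideal Ym])
  ultimately show ?thesis using Y(2) Ym c by (intro exI[of _ "insert t Y"]) auto
qed

text \<open>A class on which c is nilpotent is one on which every generator of m is, so it is killed
  by a power of the irrelevant ideal. One homogeneous element thus detects the torsion of the
  associated graded module.\<close>

lemma exists_nil_detector:
  "\<exists>k\<ge>1. \<exists>c\<in>Q k. \<forall>n v. nil k c n v \<longrightarrow>
     (\<exists>J. max_pow R M J ((\<lambda>r. r \<odot>\<^bsub>M\<^esub> v) ` carrier R) \<subseteq> P (n + 1 + J))"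
proof -
  obtain Y where Y: "finite Y" "Y \<noteq> {}" "Y \<subseteq> carrier R" "Y \<subseteq> \<mm>" "Idl Y = \<mm>"
    using max_ideal_generators by blast
  have "Y \<subseteq> Q 1" using Y(4) max_ideal_pow_1 by simp
  from common_nil_finite[OF Y(1) this] obtain k c where kc: "k \<ge> 1" "c \<in> Q k"
    "\<And>n v. nil k c n v \<Longrightarrow> \<forall>y\<in>Y. nil 1 y n v" by blast
  have "\<exists>J. max_pow R M J ((\<lambda>r. r \<odot>\<^bsub>M\<^esub> v) ` carrier R) \<subseteq> P (n + 1 + J)" if v: "nil k c n v" for n v
  proof -
    have vc: "v \<in> carrier M" using v P_closed(2) by (auto simp: nil_def)
    have "\<forall>y\<in>Y. \<exists>j::nat. (y [^] j) \<odot>\<^bsub>M\<^esub> v \<in> P (n + 1 + j)"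
      using kc(3)[OF v] by (simp add: nil_def)
    then obtain j :: "'a \<Rightarrow> nat" where j: "\<And>y. y \<in> Y \<Longrightarrow> (y [^] j y) \<odot>\<^bsub>M\<^esub> v \<in> P (n + 1 + j y)" by metis
    show ?thesis by (rule max_pow_span_subset[OF Y(1,3,5) vc j Y(2)])
  qed
  then show ?thesis using kc by blast
qed

text \<open>Multiplication by a maps A to (a A + B') / B', and by \<open>inj\<close> its kernel lies
  in B.\<close>

lemma rel_length_le_smult:
  assumes A: "submodule A R M" and B': "submodule B' R M" and a: "a \<in> carrier R"
    and inj: "\<And>v. v \<in> A \<Longrightarrow> a \<odot>\<^bsub>M\<^esub> v \<in> B' \<Longrightarrow> v \<in> B"
  shows "rel_length R M A B \<le> rel_length R M (((\<odot>\<^bsub>M\<^esub>) a ` A) <+>\<^bsub>M\<^esub> B') B'"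
proof (rule rel_length_transport[where F = "\<lambda>H. ((\<odot>\<^bsub>M\<^esub>) a ` H) <+>\<^bsub>M\<^esub> B'"])
  fix H assume H: "submodule H R M" "B \<subseteq> H" "H \<subseteq> A"
  note aH = submodule_smult_image[OF H(1) a]
  show "submodule (((\<odot>\<^bsub>M\<^esub>) a ` H) <+>\<^bsub>M\<^esub> B') R M \<and> B' \<subseteq> ((\<odot>\<^bsub>M\<^esub>) a ` H) <+>\<^bsub>M\<^esub> B' \<and>
    ((\<odot>\<^bsub>M\<^esub>) a ` H) <+>\<^bsub>M\<^esub> B' \<subseteq> ((\<odot>\<^bsub>M\<^esub>) a ` A) <+>\<^bsub>M\<^esub> B'"
    using submodule_set_add[OF aH B'] set_add_upper(2)[OF aH B'] H(3)
    by (simp add: set_add_mono image_mono)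
next
  fix H K assume H: "submodule H R M" "B \<subseteq> H" and K: "submodule K R M" "K \<subseteq> A" and HK: "H \<subset> K"
  obtain x where x: "x \<in> K" "x \<notin> H" using HK by auto
  have xc: "x \<in> carrier M" using submodule_mem_simps(2)[OF K(1) x(1)] .
  have "a \<odot>\<^bsub>M\<^esub> x \<notin> ((\<odot>\<^bsub>M\<^esub>) a ` H) <+>\<^bsub>M\<^esub> B'"
  proof
    assume "a \<odot>\<^bsub>M\<^esub> x \<in> ((\<odot>\<^bsub>M\<^esub>) a ` H) <+>\<^bsub>M\<^esub> B'"
    then obtain h b where hb: "h \<in> H" "b \<in> B'" "a \<odot>\<^bsub>M\<^esub> x = a \<odot>\<^bsub>M\<^esub> h \<oplus>\<^bsub>M\<^esub> b"
      by (auto simp: mem_set_add_iff)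
    have hc: "h \<in> carrier M" "b \<in> carrier M"
      using submodule_mem_simps(2)[OF H(1) hb(1)] submodule_mem_simps(2)[OF B' hb(2)] by auto
    have "a \<odot>\<^bsub>M\<^esub> (x \<ominus>\<^bsub>M\<^esub> h) = b"
      using hb(3) minus_add_cancel(2)[of "a \<odot>\<^bsub>M\<^esub> h" b] a xc hc by (simp add: smult_minus_distr)
    moreover have "x \<ominus>\<^bsub>M\<^esub> h \<in> A" using submodule_minus[OF K(1) x(1), of h] hb(1) HK K(2) by auto
    ultimately have "x \<ominus>\<^bsub>M\<^esub> h \<in> H" using inj hb(2) H(2) by auto
    then have "(x \<ominus>\<^bsub>M\<^esub> h) \<oplus>\<^bsub>M\<^esub> h \<in> H" by (rule submodule_mem_simps(3)[OF H(1) _ hb(1)])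
    then show False using x(2) minus_add_cancel(3)[OF xc hc(1)] by simp
  qed
  moreover have "a \<odot>\<^bsub>M\<^esub> x \<in> ((\<odot>\<^bsub>M\<^esub>) a ` K) <+>\<^bsub>M\<^esub> B'"
    using subsetD[OF set_add_upper(1)[OF submodule_smult_image[OF K(1) a] B']] x(1) by auto
  moreover have "((\<odot>\<^bsub>M\<^esub>) a ` H) <+>\<^bsub>M\<^esub> B' \<subseteq> ((\<odot>\<^bsub>M\<^esub>) a ` K) <+>\<^bsub>M\<^esub> B'"
    using HK by (intro set_add_mono) auto
  ultimately show "((\<odot>\<^bsub>M\<^esub>) a ` H) <+>\<^bsub>M\<^esub> B' \<subset> ((\<odot>\<^bsub>M\<^esub>) a ` K) <+>\<^bsub>M\<^esub> B'" by auto
qed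

lemma t_pow_regular: "v \<in> carrier M \<Longrightarrow> (t [^] (n::nat)) \<odot>\<^bsub>M\<^esub> v = \<zero>\<^bsub>M\<^esub> \<Longrightarrow> v = \<zero>\<^bsub>M\<^esub>"
proof (induction n arbitrary: v)
  case (Suc n)
  have tc: "t \<in> carrier R" using t_mem by simp
  have "(t [^] n) \<odot>\<^bsub>M\<^esub> (t \<odot>\<^bsub>M\<^esub> v) = \<zero>\<^bsub>M\<^esub>" using Suc.prems tc by (simp add: smult_assoc1)
  then have "t \<odot>\<^bsub>M\<^esub> v = \<zero>\<^bsub>M\<^esub>" using Suc.IH[of "t \<odot>\<^bsub>M\<^esub> v"] Suc.prems tc by simp
  then show ?case using t_regular Suc.prems by simp
qed simp

definition reduction :: "nat \<Rightarrow> 'a \<Rightarrow> nat \<Rightarrow> bool" where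
  "reduction k c N \<longleftrightarrow> k \<ge> 1 \<and> c \<in> Q k \<and> regular c \<and> (\<forall>n\<ge>N. (\<odot>\<^bsub>M\<^esub>) c ` P n = P (n + k))"

text \<open>
  The submodules \<open>W n\<close> in the proof represent the torsion of the associated graded module. Modulo
  torsion \<open>c\<close> is injective, hence bijective in large degrees because the lengths are bounded. This
  forces the torsion itself to be generated in bounded degree and therefore to vanish in large
  degrees.
\<close>

theorem exists_reduction: "\<exists>k c N. reduction k c N"
proof -
  obtain k c where k: "k \<ge> 1" and c: "c \<in> Q k" and
    det: "\<And>n v. nil k c n v \<Longrightarrow> \<exists>J. max_pow R M J ((\<lambda>r. r \<odot>\<^bsub>M\<^esub> v) ` carrier R) \<subseteq> P (n + 1 + J)"
    using exists_nil_detector by blast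
  have cc: "c \<in> carrier R" using c by simp
  define W where "W n = {v. nil k c n v}" for n
  have WP: "W n \<subseteq> P n" for n by (auto simp: W_def nil_def)
  have PW: "P (Suc n) \<subseteq> W n" for n
  proof
    fix v assume v: "v \<in> P (Suc n)"
    then have "v \<in> P n" using P_antimono[of n "Suc n"] by auto
    then show "v \<in> W n" using v P_closed(2)[OF v] by (auto simp: W_def nil_def intro!: exI[of _ "0::nat"])
  qed
  have Wadd: "x \<oplus>\<^bsub>M\<^esub> y \<in> W n" if xy: "x \<in> W n" "y \<in> W n" for x y n
  proof -
    obtain i j :: nat where x: "x \<in> P n" "(c [^] i) \<odot>\<^bsub>M\<^esub> x \<in> P (n + k * i + 1)"
      and y: "y \<in> P n" "(c [^] j) \<odot>\<^bsub>M\<^esub> y \<in> P (n + k * j + 1)" using xy by (auto simp: W_def nil_def)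
    let ?m = "max i j"
    have "(c [^] ?m) \<odot>\<^bsub>M\<^esub> x \<in> P (n + k * ?m + 1)" "(c [^] ?m) \<odot>\<^bsub>M\<^esub> y \<in> P (n + k * ?m + 1)"
      using nil_mono[OF c x] nil_mono[OF c y] by simp_all
    then have "(c [^] ?m) \<odot>\<^bsub>M\<^esub> (x \<oplus>\<^bsub>M\<^esub> y) \<in> P (n + k * ?m + 1)"
      using P_closed(3) P_closed(2)[OF x(1)] P_closed(2)[OF y(1)] cc by (simp add: smult_r_distr)
    then show ?thesis using P_closed(3)[OF x(1) y(1)] unfolding W_def nil_def by blast
  qed
  have QW: "a \<odot>\<^bsub>M\<^esub> v \<in> W (n + l)" if a: "a \<in> Q l" and v: "v \<in> W n" for a v n l
  proof -
    obtain j :: nat where j: "v \<in> P n" "(c [^] j) \<odot>\<^bsub>M\<^esub> v \<in> P (n + k * j + 1)" using v by (auto simp: W_def nil_def)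
    have "(c [^] j) \<odot>\<^bsub>M\<^esub> (a \<odot>\<^bsub>M\<^esub> v) = a \<odot>\<^bsub>M\<^esub> ((c [^] j) \<odot>\<^bsub>M\<^esub> v)"
      using a cc P_closed(2)[OF j(1)] by (intro smult_comm) auto
    also have "\<dots> \<in> P (n + k * j + 1 + l)" by (rule Q_smult[OF a j(2)])
    finally have "(c [^] j) \<odot>\<^bsub>M\<^esub> (a \<odot>\<^bsub>M\<^esub> v) \<in> P (n + l + k * j + 1)" by (simp add: algebra_simps)
    then show ?thesis using Q_smult[OF a j(1)] unfolding W_def nil_def by blast
  qed
  have W: "submodule (W n) R M" for n
  proof (rule submoduleI')
    show "W n \<subseteq> carrier M" using WP[of n] submodule_subset[OF P_submodule[of n]] by auto
    show "\<zero>\<^bsub>M\<^esub> \<in> W n" using PW[of n] P_closed(1)[of "Suc n"] by auto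
    show "a \<odot>\<^bsub>M\<^esub> x \<in> W n" if "a \<in> carrier R" "x \<in> W n" for a x using QW[of a 0 x n] that by simp
  qed (rule Wadd)
  have cof: "cofinite (W n)" for n using W PW[of n] by (auto simp: cofinite_def)
  have Winj: "v \<in> W n" if v: "v \<in> P n" and cv: "c \<odot>\<^bsub>M\<^esub> v \<in> W (n + k)" for v n
  proof -
    obtain j :: nat where j: "(c [^] j) \<odot>\<^bsub>M\<^esub> (c \<odot>\<^bsub>M\<^esub> v) \<in> P (n + k + k * j + 1)"
      using cv by (auto simp: W_def nil_def)
    have "(c [^] Suc j) \<odot>\<^bsub>M\<^esub> v = (c [^] j) \<odot>\<^bsub>M\<^esub> (c \<odot>\<^bsub>M\<^esub> v)"
      using cc P_closed(2)[OF v] by (simp add: smult_assoc1)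
    then have "(c [^] Suc j) \<odot>\<^bsub>M\<^esub> v \<in> P (n + k * Suc j + 1)" using j by (simp add: algebra_simps)
    then show ?thesis using v unfolding W_def nil_def by blast
  qed
  have cP: "(\<odot>\<^bsub>M\<^esub>) c ` P n \<subseteq> P (n + k)" for n using Q_smult[OF c] by auto
  note cPs = submodule_smult_image[OF P_submodule cc]
  define B where "B n = ((\<odot>\<^bsub>M\<^esub>) c ` P n) <+>\<^bsub>M\<^esub> W (n + k)" for n
  have B: "submodule (B n) R M" "W (n + k) \<subseteq> B n" "B n \<subseteq> P (n + k)" for n
    unfolding B_def using submodule_set_add[OF cPs W] set_add_upper(2)[OF cPs W]
      set_add_least[OF P_submodule cP WP] by auto
  define f where "f n = len (P n) (W n)" for n
  have fB: "f n \<le> len (B n) (W (n + k))" for n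
    unfolding f_def
    by (rule len_le[OF P_submodule cof B(1) cof])
      (unfold B_def, rule rel_length_le_smult[OF P_submodule W cc Winj])
  have fadd: "f (n + k) = len (P (n + k)) (B n) + len (B n) (W (n + k))" for n
    unfolding f_def by (rule len_add[OF P_submodule B(1) cof B(2,3)])
  have fC: "f n \<le> len (carrier M) ((\<odot>\<^bsub>M\<^esub>) t ` carrier M)" for n
  proof -
    have "f n \<le> len (P n) (P (Suc n))"
      unfolding f_def by (intro len_le P_submodule cof cofinite_P rel_length_mono order.refl PW)
    then show ?thesis using len_P_Suc_le[of n] by simp
  qed
  have fm: "f n \<le> f (n + k)" for n using fB[of n] fadd[of n] by simp
  obtain n1 where n1: "\<And>n. n \<ge> n1 \<Longrightarrow> f (n + k) = f n"
    using eventually_periodic_of_bounded[of k f, OF k fm fC] by blast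
  have PB: "P (n + k) = B n" if "n \<ge> n1" for n
  proof (rule len_zero_imp_eq[OF P_submodule _ B(3)])
    show "cofinite (B n)" by (rule cofinite_mono[OF cof B(1,2)])
    show "len (P (n + k)) (B n) = 0" using fB[of n] fadd[of n] n1[OF that] by simp
  qed
  \<comment> \<open>Multiplying P n = c P (n - k) + W n by m^k gives P (n + k) = c P n + m^k W n. If
    c s + z with z in m^k W n lies in W (n + k), so does c s; hence s lies in W n and c s in m^k W
    n.\<close>
  have Wk: "W (n + k) \<subseteq> max_pow R M k (W n)" if n: "n \<ge> n1 + k" for n
  proof
    fix w assume w: "w \<in> W (n + k)"
    obtain n' where n': "n = n' + k" "n' \<ge> n1" using n by (metis le_iff_add add.assoc add.commute)
    have "P (n + k) = max_pow R M k (B n')" using PB[OF n'(2)] n'(1) P_add[of k n] by (simp add: add.commute)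
    also have "\<dots> = ((\<odot>\<^bsub>M\<^esub>) c ` P n) <+>\<^bsub>M\<^esub> max_pow R M k (W n)"
      unfolding B_def max_pow_set_add[OF cPs W] max_pow_smult_image[OF P_submodule cc] P_add
      using n'(1) by (simp add: add.commute)
    finally have "w \<in> ((\<odot>\<^bsub>M\<^esub>) c ` P n) <+>\<^bsub>M\<^esub> max_pow R M k (W n)" using w WP by blast
    then obtain s z where sz: "s \<in> P n" "z \<in> max_pow R M k (W n)" "w = c \<odot>\<^bsub>M\<^esub> s \<oplus>\<^bsub>M\<^esub> z"
      by (auto simp: mem_set_add_iff)
    have WW: "max_pow R M k (W n) \<subseteq> W (n + k)" by (rule max_pow_least[OF W W QW])
    have "c \<odot>\<^bsub>M\<^esub> s \<oplus>\<^bsub>M\<^esub> z \<in> W (n + k)" using w unfolding sz(3) .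
    then have "c \<odot>\<^bsub>M\<^esub> s \<in> W (n + k)"
      by (rule submodule_add_cancel[OF W _ subsetD[OF WW sz(2)] smult_closed[OF cc P_closed(2)[OF sz(1)]]])
    then have "s \<in> W n" by (rule Winj[OF sz(1)])
    then have "c \<odot>\<^bsub>M\<^esub> s \<in> max_pow R M k (W n)"
      using max_ideal_pow_smult[OF W c, of s 0] by simp
    then show "w \<in> max_pow R M k (W n)"
      unfolding sz(3) by (rule submodule_mem_simps(3)[OF max_pow_submodule[OF W] _ sz(2)])
  qed
  have Wik: "W (n + i * k) \<subseteq> max_pow R M (i * k) (W n)" if n: "n \<ge> n1 + k" for n i
  proof (induction i)
    case (Suc i)
    have "W (n + Suc i * k) \<subseteq> max_pow R M k (W (n + i * k))"
      using Wk[of "n + i * k"] n by (simp add: algebra_simps)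
    also have "\<dots> \<subseteq> max_pow R M k (max_pow R M (i * k) (W n))" by (rule max_pow_mono[OF Suc])
    finally show ?case by (simp add: max_pow_add[symmetric])
  qed simp
  have WJ: "\<exists>J. \<forall>j\<ge>J. max_pow R M j (W n) \<subseteq> P (n + 1 + j)" for n
  proof -
    obtain T where T: "finite T" "T \<subseteq> W n" "W n = submodule_gen R M T" using submodule_fin_gen[OF W] by blast
    have "\<forall>v\<in>T. \<exists>J. max_pow R M J ((\<lambda>r. r \<odot>\<^bsub>M\<^esub> v) ` carrier R) \<subseteq> P (n + 1 + J)"
      using T(2) det by (auto simp: W_def)
    then obtain J where J: "\<And>v. v \<in> T \<Longrightarrow> max_pow R M (J v) ((\<lambda>r. r \<odot>\<^bsub>M\<^esub> v) ` carrier R) \<subseteq> P (n + 1 + J v)"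
      by metis
    have "max_pow R M j (W n) \<subseteq> P (n + 1 + j)" if j: "j \<ge> (\<Sum>v\<in>T. J v)" for j
    proof -
      let ?L = "{w \<in> carrier M. \<forall>a\<in>Q j. a \<odot>\<^bsub>M\<^esub> w \<in> P (n + 1 + j)}"
      have "T \<subseteq> ?L"
      proof
        fix v assume v: "v \<in> T"
        have vc: "v \<in> carrier M" using v T(2) submodule_subset[OF W] by auto
        have "J v \<le> (\<Sum>v\<in>T. J v)" by (rule member_le_sum[OF v _ T(1)]) simp
        then have Jj: "J v \<le> j" using j by simp
        have "max_pow R M j ((\<lambda>r. r \<odot>\<^bsub>M\<^esub> v) ` carrier R)
            = max_pow R M (j - J v) (max_pow R M (J v) ((\<lambda>r. r \<odot>\<^bsub>M\<^esub> v) ` carrier R))"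
          using Jj by (simp add: max_pow_add[symmetric])
        also have "\<dots> \<subseteq> max_pow R M (j - J v) (P (n + 1 + J v))" by (rule max_pow_mono[OF J[OF v]])
        also have "\<dots> = P (n + 1 + j)" unfolding P_add using Jj by (simp add: add.commute)
        finally have "max_pow R M j ((\<lambda>r. r \<odot>\<^bsub>M\<^esub> v) ` carrier R) \<subseteq> P (n + 1 + j)" .
        moreover have "a \<odot>\<^bsub>M\<^esub> v \<in> max_pow R M j ((\<lambda>r. r \<odot>\<^bsub>M\<^esub> v) ` carrier R)" if "a \<in> Q j" for a
          using max_ideal_pow_smult[OF submodule_span[OF vc] that, of v 0] mem_span[OF vc] by simp
        ultimately show "v \<in> ?L" using vc by auto
      qed
      then have "W n \<subseteq> ?L" unfolding T(3) by (rule submodule_gen_least[OF colon_submodule])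
      then show ?thesis by (intro max_pow_least[OF W P_submodule]) auto
    qed
    then show ?thesis by blast
  qed
  then obtain J where J: "\<And>n j. j \<ge> J n \<Longrightarrow> max_pow R M j (W n) \<subseteq> P (n + 1 + j)" by metis
  \<comment> \<open>A large n has the form n1 + k + r + i k with r < k, so the k exponents
    \<open>J (n1 + k + r)\<close> suffice, one for each residue class. The second summand k absorbs
    r.\<close>
  define n2 where "n2 = n1 + k + k + (\<Sum>r<k. J (n1 + k + r))"
  have Wn2: "W n \<subseteq> P (Suc n)" if n: "n \<ge> n2" for n
  proof -
    define d where "d = n - (n1 + k)"
    define r where "r = d mod k"
    define i where "i = d div k"
    have d: "d = i * k + r" unfolding i_def r_def by simp
    have r: "r < k" unfolding r_def using k by simp
    have n': "n = (n1 + k + r) + i * k" using n d unfolding n2_def d_def by simp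
    have "J (n1 + k + r) \<le> (\<Sum>r<k. J (n1 + k + r))"
      by (rule member_le_sum) (use r in auto)
    then have "i * k \<ge> J (n1 + k + r)" using n n' r unfolding n2_def by linarith
    from J[OF this] have "max_pow R M (i * k) (W (n1 + k + r)) \<subseteq> P (Suc n)" using n' by simp
    then show ?thesis using Wik[of "n1 + k + r" i] n' by auto
  qed
  define N where "N = n1 + n2"
  have red: "(\<odot>\<^bsub>M\<^esub>) c ` P n = P (n + k)" if n: "n \<ge> N" for n
  proof (rule antisym[OF cP])
    have "P (n + k) = B n" using n by (intro PB) (simp add: N_def)
    also have "\<dots> \<subseteq> ((\<odot>\<^bsub>M\<^esub>) c ` P n) <+>\<^bsub>M\<^esub> P (Suc (n + k))"
      unfolding B_def using n by (intro set_add_mono Wn2 order.refl) (simp add: N_def)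
    also have "\<dots> = P (Suc (n + k)) <+>\<^bsub>M\<^esub> ((\<odot>\<^bsub>M\<^esub>) c ` P n)"
      by (rule submodule_set_add_comm[OF cPs P_submodule])
    finally show "P (n + k) \<subseteq> (\<odot>\<^bsub>M\<^esub>) c ` P n"
      unfolding max_pow_Suc by (rule nakayama[OF P_submodule cPs])
  qed
  \<comment> \<open>The vanishing of W is known in large degrees only, so v is first moved to degree
    N by t^N, which is injective. An element of P N killed by c lies in each W (N + j) in turn,
    hence in every power of the filtration.\<close>
  have "v = \<zero>\<^bsub>M\<^esub>" if v: "v \<in> carrier M" and cv: "c \<odot>\<^bsub>M\<^esub> v = \<zero>\<^bsub>M\<^esub>" for v
  proof (rule ccontr)
    assume nz: "v \<noteq> \<zero>\<^bsub>M\<^esub>"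
    have tc: "t \<in> carrier R" using t_mem by simp
    define w where "w = (t [^] N) \<odot>\<^bsub>M\<^esub> v"
    have "t \<in> Q (Suc 0)" using t_mem max_ideal_pow_1 by simp
    from max_ideal_pow_nat_pow[OF this, of N] have "t [^] N \<in> Q N" by simp
    from Q_smult[OF this, of v 0] have wN: "w \<in> P N" using v by (simp add: w_def)
    have w0: "w \<noteq> \<zero>\<^bsub>M\<^esub>" using t_pow_regular[OF v, of N] nz by (auto simp: w_def)
    have cw: "c \<odot>\<^bsub>M\<^esub> w = \<zero>\<^bsub>M\<^esub>"
      unfolding w_def using smult_comm[of c "t [^] N" v] cc tc v cv by simp
    have "w \<in> P (N + j)" for j
    proof (induction j)
      case (Suc j)
      have "w \<in> W (N + j)"
        using Suc cw cc P_closed(1) P_closed(2)[OF wN]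
        by (auto simp: W_def nil_def intro!: exI[of _ "Suc 0"])
      then show ?case using Wn2[of "N + j"] by (auto simp: N_def)
    qed (use wN in simp)
    then have "w \<in> P n" for n using P_antimono[of n "N + n"] by auto
    then have "w \<in> (\<Inter>n. P n)" by blast
    then show False using krull_intersection w0 by simp
  qed
  then have "regular c" using cc by (simp add: regular_def)
  then have "reduction k c N" using k c red by (simp add: reduction_def)
  then show ?thesis by blast
qed

end

section \<open>Multiplicity and number of generators\<close>

text \<open>The function k f(n) - n D has period k from N on, so it is bounded, and division by k n
  sends it to 0.\<close>

lemma tendsto_div_of_quasi_periodic:
  fixes f :: "nat \<Rightarrow> nat"
  assumes k: "k \<ge> 1" and f: "\<And>n. n \<ge> N \<Longrightarrow> f (n + k) = f n + D"
  shows "(\<lambda>n. real (f n) / real n) \<longlonglongrightarrow> real D / real k"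
proof -
  define g where "g n = real k * real (f n) - real n * real D" for n
  have per: "g (n + k) = g n" if "n \<ge> N" for n
    using f[OF that] by (simp add: g_def algebra_simps)
  define B where "B = Max ((\<lambda>n. \<bar>g n\<bar>) ` {N..N + k})"
  have "n \<ge> N \<Longrightarrow> \<bar>g n\<bar> \<le> B" for n
  proof (induction n rule: less_induct)
    case (less n)
    show ?case
    proof (cases "n \<le> N + k")
      case True
      then show ?thesis unfolding B_def using less.prems by (intro Max_ge) auto
    next
      case False
      then have "\<bar>g (n - k)\<bar> \<le> B" using k by (intro less.IH) auto
      then show ?thesis using per[of "n - k"] False by simp
    qed
  qed
  then have bound: "eventually (\<lambda>n. \<bar>g n\<bar> \<le> B) sequentially" by (auto simp: eventually_sequentially)
  have "(\<lambda>n. (B / real k) / real n) \<longlonglongrightarrow> 0" by (rule lim_const_over_n)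
  then have "(\<lambda>n. g n / real k / real n) \<longlonglongrightarrow> 0"
  proof (rule metric_tendsto_imp_tendsto)
    show "eventually (\<lambda>n. dist (g n / real k / real n) 0 \<le> dist (B / real k / real n) 0) sequentially"
      using bound by eventually_elim (auto simp: dist_norm intro!: divide_right_mono)
  qed
  then have lim: "(\<lambda>n. real D / real k + g n / real k / real n) \<longlonglongrightarrow> real D / real k + 0"
    by (intro tendsto_add tendsto_const)
  have "eventually (\<lambda>n. real D / real k + g n / real k / real n = real (f n) / real n) sequentially"
    using eventually_gt_at_top[of "0::nat"]
    by eventually_elim (use k in \<open>simp add: g_def field_simps\<close>)
  then show ?thesis using lim by (simp add: tendsto_cong)
qed

context torsion_free_module
begin

abbreviation hilb :: "nat \<Rightarrow> nat" where "hilb n \<equiv> len (P n) (P (Suc n))"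

lemma len_P_add: "i \<le> j \<Longrightarrow> j \<le> l \<Longrightarrow> len (P i) (P l) = len (P i) (P j) + len (P j) (P l)"
  by (intro len_add P_submodule cofinite_P P_antimono)

lemma len_P_P: "len (P n) (P n) = 0"
  by (simp add: rel_length_self zero_enat_def)

lemma len_P_sum: "len (P n) (P (n + m)) = (\<Sum>j<m. hilb (n + j))"
  by (induction m) (simp_all add: len_P_P len_P_add[of n "n + m" "Suc (n + m)" for m])

context
  fixes k c N
  assumes red: "reduction k c N"
begin

abbreviation "D \<equiv> len (carrier M) ((\<odot>\<^bsub>M\<^esub>) c ` carrier M)"

lemma red_facts: "k \<ge> 1" "c \<in> Q k" "regular c" "c \<in> carrier R" "\<And>n. n \<ge> N \<Longrightarrow> (\<odot>\<^bsub>M\<^esub>) c ` P n = P (n + k)"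
  using red by (auto simp: reduction_def)

lemma P_subset_smult: "P (N + k) \<subseteq> (\<odot>\<^bsub>M\<^esub>) c ` carrier M"
  using red_facts(5)[of N] P_closed(2)[of _ N] by auto

lemma len_P_shift: "n \<ge> N \<Longrightarrow> len (P n) (P (n + k)) = D"
  using len_smult_const[OF red_facts(3) cofinite_P P_subset_smult, of n] red_facts(5) by simp

lemma len_P_shift': "n \<ge> N \<Longrightarrow> len (P 0) (P (n + k)) = len (P 0) (P n) + D"
  using len_P_add[of 0 n "n + k"] len_P_shift[of n] by simp

lemma multiplicity_eq:
  assumes "krull_dim R = 1"
  shows "multiplicity_hs R M = real D / real k"
  unfolding multiplicity_hs_eq[OF assms]
  using tendsto_div_of_quasi_periodic[OF red_facts(1), of N "\<lambda>n. len (P 0) (P n)" D] len_P_shift'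
  by (intro limI) simp

lemma c_pow_P: "(\<odot>\<^bsub>M\<^esub>) (c [^] (j::nat)) ` P N = P (N + k * j)"
proof (induction j)
  case 0
  have "(\<odot>\<^bsub>M\<^esub>) \<one> ` P N = P N" using P_closed(2)[of _ N] by force
  then show ?case by simp
next
  case (Suc j)
  have "(\<odot>\<^bsub>M\<^esub>) (c [^] Suc j) ` P N = (\<odot>\<^bsub>M\<^esub>) c ` (\<odot>\<^bsub>M\<^esub>) (c [^] j) ` P N"
    unfolding image_image
    by (rule image_cong[OF refl])
      (use red_facts(4) P_closed(2)[of _ N] in \<open>simp add: smult_assoc1 smult_comm\<close>)
  also have "\<dots> = P (N + k * Suc j)"
    unfolding Suc using red_facts(5)[of "N + k * j"] by (simp add: algebra_simps)
  finally show ?case .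
qed

lemma c_pow_regular: "regular (c [^] (j::nat))"
proof (induction j)
  case 0
  then show ?case by (simp add: regular_def)
next
  case (Suc j)
  have "v = \<zero>\<^bsub>M\<^esub>" if v: "v \<in> carrier M" "(c [^] Suc j) \<odot>\<^bsub>M\<^esub> v = \<zero>\<^bsub>M\<^esub>" for v
  proof -
    have "(c [^] j) \<odot>\<^bsub>M\<^esub> (c \<odot>\<^bsub>M\<^esub> v) = \<zero>\<^bsub>M\<^esub>" using v red_facts(4) by (simp add: smult_assoc1)
    then have "c \<odot>\<^bsub>M\<^esub> v = \<zero>\<^bsub>M\<^esub>" using Suc v(1) red_facts(4) unfolding regular_def by simp
    then show ?thesis using red_facts(3) v(1) unfolding regular_def by simp
  qed
  then show ?case using red_facts(4) unfolding regular_def by simp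
qed

end

text \<open>From n = N on, P n equals its Ratliff-Rush closure: c^J v lies in P (n + k J) = c^J P n,
  and the regular element c^J cancels.\<close>

lemma ratliff_rush:
  assumes red: "reduction k c N" and v: "v \<in> carrier M" and n: "n \<ge> N"
    and J: "max_pow R M J ((\<lambda>r. r \<odot>\<^bsub>M\<^esub> v) ` carrier R) \<subseteq> P (n + J)"
  shows "v \<in> P n"
proof -
  have redn: "reduction k c n" using red n by (auto simp: reduction_def)
  have k: "J \<le> k * J" using red_facts(1)[OF red] by simp
  have "max_pow R M (k * J) ((\<lambda>r. r \<odot>\<^bsub>M\<^esub> v) ` carrier R)
      = max_pow R M (k * J - J) (max_pow R M J ((\<lambda>r. r \<odot>\<^bsub>M\<^esub> v) ` carrier R))"
    using k by (simp add: max_pow_add[symmetric])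
  also have "\<dots> \<subseteq> max_pow R M (k * J - J) (P (n + J))" by (rule max_pow_mono[OF J])
  also have "\<dots> = P (n + k * J)" unfolding P_add using k by (simp add: add.commute)
  finally have "max_pow R M (k * J) ((\<lambda>r. r \<odot>\<^bsub>M\<^esub> v) ` carrier R) \<subseteq> P (n + k * J)" .
  moreover have "(c [^] J) \<odot>\<^bsub>M\<^esub> v \<in> max_pow R M (k * J) ((\<lambda>r. r \<odot>\<^bsub>M\<^esub> v) ` carrier R)"
    using max_ideal_pow_smult[OF submodule_span[OF v] max_ideal_pow_nat_pow[OF red_facts(2)[OF red], of J], of v 0]
      mem_span[OF v] by simp
  ultimately have "(c [^] J) \<odot>\<^bsub>M\<^esub> v \<in> (\<odot>\<^bsub>M\<^esub>) (c [^] J) ` P n"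
    using c_pow_P[OF redn, of J] by auto
  then show ?thesis using regular_mem_image_iff[OF c_pow_regular[OF red] P_submodule v] by simp
qed

text \<open>Inside \<open>A\<close>, the kernel of the localisation of \<open>M / \<mm>\<^sup>n M\<close> at \<open>y / \<mm>\<close>, that is, on the blowup chart of \<open>y\<close>.\<close>

definition sat :: "nat \<Rightarrow> 'a \<Rightarrow> 'b set \<Rightarrow> 'b set" where
  "sat n y A = {v \<in> A. \<exists>j::nat. (y [^] j) \<odot>\<^bsub>M\<^esub> v \<in> P (n + j)}"

lemma sat_closed:
  assumes A: "submodule A R M" and y: "y \<in> \<mm>"
  shows "submodule (sat n y A) R M"
proof -
  have y1: "y \<in> Q 1" using y max_ideal_pow_1 by simp
  note a = submodule_mem_simps[OF A]
  have up: "(y [^] (i + j)) \<odot>\<^bsub>M\<^esub> v \<in> P (n + (i + j))"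
    if "v \<in> carrier M" "(y [^] j) \<odot>\<^bsub>M\<^esub> v \<in> P (n + j)" for v and i j :: nat
  proof -
    have "(y [^] i) \<odot>\<^bsub>M\<^esub> ((y [^] j) \<odot>\<^bsub>M\<^esub> v) \<in> P (n + j + 1 * i)"
      by (rule Q_smult[OF max_ideal_pow_nat_pow[OF y1] that(2)])
    then show ?thesis using that y by (simp add: smult_assoc1[symmetric] R.nat_pow_mult algebra_simps)
  qed
  show ?thesis
  proof (rule submoduleI')
    show "\<zero>\<^bsub>M\<^esub> \<in> sat n y A" unfolding sat_def using a(1) P_closed(1) y by (auto intro!: exI[of _ "0::nat"])
    fix u v assume "u \<in> sat n y A" "v \<in> sat n y A"
    then obtain i j :: nat where ij: "u \<in> A" "v \<in> A" "(y [^] i) \<odot>\<^bsub>M\<^esub> u \<in> P (n + i)" "(y [^] j) \<odot>\<^bsub>M\<^esub> v \<in> P (n + j)"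
      by (auto simp: sat_def)
    have "(y [^] (i + j)) \<odot>\<^bsub>M\<^esub> u \<in> P (n + (i + j))" "(y [^] (i + j)) \<odot>\<^bsub>M\<^esub> v \<in> P (n + (i + j))"
      using up[OF a(2)[OF ij(1)] ij(3), of j] up[OF a(2)[OF ij(2)] ij(4), of i] by (simp_all add: add.commute)
    then have "(y [^] (i + j)) \<odot>\<^bsub>M\<^esub> (u \<oplus>\<^bsub>M\<^esub> v) \<in> P (n + (i + j))"
      using P_closed(3) a(2) ij y by (simp add: smult_r_distr)
    then show "u \<oplus>\<^bsub>M\<^esub> v \<in> sat n y A" unfolding sat_def using a(3)[OF ij(1,2)] by blast
  next
    fix r v assume r: "r \<in> carrier R" and "v \<in> sat n y A"
    then obtain j :: nat where j: "v \<in> A" "(y [^] j) \<odot>\<^bsub>M\<^esub> v \<in> P (n + j)" by (auto simp: sat_def)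
    have "(y [^] j) \<odot>\<^bsub>M\<^esub> (r \<odot>\<^bsub>M\<^esub> v) \<in> P (n + j)"
      using P_closed(4)[OF r j(2)] smult_comm[of "y [^] j" r v] r a(2)[OF j(1)] y by simp
    then show "r \<odot>\<^bsub>M\<^esub> v \<in> sat n y A" unfolding sat_def using a(4)[OF r j(1)] by blast
  qed (use a(2) in \<open>auto simp: sat_def\<close>)
qed

lemma sat_subset: "sat n y A \<subseteq> A"
  by (auto simp: sat_def)

lemma P_subset_sat: "P n \<subseteq> A \<Longrightarrow> P n \<subseteq> sat n y A"
  using P_closed(2) by (auto simp: sat_def intro!: exI[of _ "0::nat"])

text \<open>Says that y embeds A / sat n y A into m A / m (sat n y A). Indeed m (sat n y A) lies in
  \<open>sat (n + 1) y A\<close>, and if the latter contains y v, then y^(j + 1) v lies in P (n + (j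
  + 1)) for some j.\<close>

lemma sat_inj:
  assumes A: "submodule A R M" and y: "y \<in> \<mm>"
    and v: "v \<in> A" "y \<odot>\<^bsub>M\<^esub> v \<in> ideal_times R M \<mm> (sat n y A)"
  shows "v \<in> sat n y A"
proof -
  have yc: "y \<in> carrier R" using y by simp
  note a = submodule_mem_simps[OF A]
  have "ideal_times R M \<mm> (sat n y A) \<subseteq> sat (n + 1) y A"
  proof (rule ideal_times_least[OF sat_closed[OF A y]])
    fix b w assume b: "b \<in> \<mm>" and "w \<in> sat n y A"
    then obtain j :: nat where w: "w \<in> A" "(y [^] j) \<odot>\<^bsub>M\<^esub> w \<in> P (n + j)" by (auto simp: sat_def)
    have "(y [^] j) \<odot>\<^bsub>M\<^esub> (b \<odot>\<^bsub>M\<^esub> w) = b \<odot>\<^bsub>M\<^esub> ((y [^] j) \<odot>\<^bsub>M\<^esub> w)"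
      using b yc a(2)[OF w(1)] by (intro smult_comm) auto
    also have "\<dots> \<in> P (Suc (n + j))" unfolding max_pow_Suc by (rule ideal_times_mem[OF b w(2)])
    finally show "b \<odot>\<^bsub>M\<^esub> w \<in> sat (n + 1) y A" using a(4)[OF _ w(1), of b] b by (auto simp: sat_def)
  qed
  then obtain j :: nat where j: "(y [^] j) \<odot>\<^bsub>M\<^esub> (y \<odot>\<^bsub>M\<^esub> v) \<in> P (n + 1 + j)" using v(2) by (auto simp: sat_def)
  have "(y [^] Suc j) \<odot>\<^bsub>M\<^esub> v \<in> P (n + Suc j)"
    using j yc a(2)[OF v(1)] by (simp add: smult_assoc1)
  then show ?thesis using v(1) unfolding sat_def by blast
qed

text \<open>One generator is used at a time, so that each quotient of the filtration is embedded by
  a single element.\<close>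

fun sats :: "nat \<Rightarrow> 'a list \<Rightarrow> 'b set \<Rightarrow> 'b set" where
  "sats n [] A = A"
| "sats n (y # ys) A = sats n ys (sat n y A)"

lemma sats_eq: "sats n ys A = {v \<in> A. \<forall>y\<in>set ys. \<exists>j::nat. (y [^] j) \<odot>\<^bsub>M\<^esub> v \<in> P (n + j)}"
  by (induction ys arbitrary: A) (auto simp: sat_def)

lemma sats_facts:
  assumes "submodule A R M" "P n \<subseteq> A" "set ys \<subseteq> \<mm>"
  shows "submodule (sats n ys A) R M \<and> P n \<subseteq> sats n ys A \<and> sats n ys A \<subseteq> A"
  using assms
proof (induction ys arbitrary: A)
  case (Cons y ys)
  have y: "y \<in> \<mm>" "set ys \<subseteq> \<mm>" using Cons.prems by auto
  have "submodule (sats n ys (sat n y A)) R M \<and> P n \<subseteq> sats n ys (sat n y A) \<and> sats n ys (sat n y A) \<subseteq> sat n y A"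
    by (rule Cons.IH[OF sat_closed[OF Cons.prems(1) y(1)] P_subset_sat[OF Cons.prems(2)] y(2)])
  then show ?case using sat_subset[of n y A] by auto
qed simp

text \<open>The case of equal lengths yields m A = y A + m A'; here this relation is carried to all
  powers of m by repeated multiplication.\<close>

lemma max_pow_smult_step:
  assumes A: "submodule A R M" and A': "submodule A' R M" and y: "y \<in> \<mm>"
    and eq: "ideal_times R M \<mm> A \<subseteq> ((\<odot>\<^bsub>M\<^esub>) y ` A) <+>\<^bsub>M\<^esub> ideal_times R M \<mm> A'"
  shows "max_pow R M j A \<subseteq> ((\<odot>\<^bsub>M\<^esub>) (y [^] j) ` A) <+>\<^bsub>M\<^esub> max_pow R M j A'"
proof (induction j)
  case 0
  have "A = (\<odot>\<^bsub>M\<^esub>) \<one> ` A" using submodule_mem_simps(2)[OF A] by force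
  then show ?case using set_add_upper(1)[OF A A'] by simp
next
  case (Suc j)
  let ?m = "ideal_times R M \<mm>"
  have yj: "y [^] j \<in> carrier R" "y [^] Suc j \<in> carrier R" using y by auto
  note yA = submodule_smult_image[OF A]
  note pA' = max_pow_submodule[OF A']
  have "max_pow R M (Suc j) A \<subseteq> ?m (((\<odot>\<^bsub>M\<^esub>) (y [^] j) ` A) <+>\<^bsub>M\<^esub> max_pow R M j A')"
    unfolding max_pow_Suc by (rule ideal_times_mono[OF order.refl Suc])
  also have "\<dots> = ((\<odot>\<^bsub>M\<^esub>) (y [^] j) ` ?m A) <+>\<^bsub>M\<^esub> max_pow R M (Suc j) A'"
    by (simp add: ideal_times_set_add[OF max_ideal_subset yA[OF yj(1)] pA']
        ideal_times_smult_image[OF max_ideal_subset A yj(1)] max_pow_Suc)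
  also have "\<dots> \<subseteq> ((\<odot>\<^bsub>M\<^esub>) (y [^] Suc j) ` A) <+>\<^bsub>M\<^esub> max_pow R M (Suc j) A'"
  proof (rule set_add_least[OF submodule_set_add[OF yA[OF yj(2)] pA']])
    show "max_pow R M (Suc j) A' \<subseteq> ((\<odot>\<^bsub>M\<^esub>) (y [^] Suc j) ` A) <+>\<^bsub>M\<^esub> max_pow R M (Suc j) A'"
      by (rule set_add_upper(2)[OF yA[OF yj(2)] pA'])
    show "(\<odot>\<^bsub>M\<^esub>) (y [^] j) ` ?m A \<subseteq> ((\<odot>\<^bsub>M\<^esub>) (y [^] Suc j) ` A) <+>\<^bsub>M\<^esub> max_pow R M (Suc j) A'"
    proof
      fix w assume "w \<in> (\<odot>\<^bsub>M\<^esub>) (y [^] j) ` ?m A"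
      then obtain u where u: "u \<in> ?m A" "w = (y [^] j) \<odot>\<^bsub>M\<^esub> u" by auto
      have "u \<in> ((\<odot>\<^bsub>M\<^esub>) y ` A) <+>\<^bsub>M\<^esub> ?m A'" using u(1) eq by auto
      then obtain a b where ab: "a \<in> A" "b \<in> ?m A'" "u = y \<odot>\<^bsub>M\<^esub> a \<oplus>\<^bsub>M\<^esub> b" by (auto simp: mem_set_add_iff)
      have car: "a \<in> carrier M" "b \<in> carrier M"
        using submodule_mem_simps(2)[OF A ab(1)] submodule_mem_simps(2)[OF max_ideal_times_submodule[OF A'] ab(2)]
        by auto
      have "w = (y [^] Suc j) \<odot>\<^bsub>M\<^esub> a \<oplus>\<^bsub>M\<^esub> (y [^] j) \<odot>\<^bsub>M\<^esub> b"
        unfolding u(2) ab(3) using y car by (simp add: smult_r_distr smult_assoc1)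
      moreover have "(y [^] j) \<odot>\<^bsub>M\<^esub> b \<in> max_pow R M (Suc j) A'"
      proof -
        have "y \<in> Q (Suc 0)" using y max_ideal_pow_1 by simp
        from max_ideal_pow_nat_pow[OF this, of j] have "y [^] j \<in> Q j" by simp
        moreover have "b \<in> max_pow R M (Suc 0) A'" using ab(2) by (simp add: max_pow_Suc)
        ultimately show ?thesis using max_ideal_pow_smult[OF A', of "y [^] j" j b "Suc 0"] by simp
      qed
      ultimately show "w \<in> ((\<odot>\<^bsub>M\<^esub>) (y [^] Suc j) ` A) <+>\<^bsub>M\<^esub> max_pow R M (Suc j) A'"
        using ab(1) by (auto intro: set_addI)
    qed
  qed
  finally show ?case .
qed

end

section \<open>Monotonicity of the Hilbert function and the case of equality\<close>

context torsion_free_module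
begin

text \<open>By \<open>max_pow_smult_step\<close>, y^j maps A onto m^j A modulo m^j A', so preimages
  under y^j of distinct submodules in the interval remain distinct.\<close>

lemma rel_length_max_pow_le:
  assumes A: "submodule A R M" and A': "submodule A' R M" and sub: "A' \<subseteq> A" and y: "y \<in> \<mm>"
    and eq: "ideal_times R M \<mm> A \<subseteq> ((\<odot>\<^bsub>M\<^esub>) y ` A) <+>\<^bsub>M\<^esub> ideal_times R M \<mm> A'"
  shows "rel_length R M (max_pow R M j A) (max_pow R M j A') \<le> rel_length R M A A'"
proof (rule rel_length_transport[where F = "\<lambda>H. {v \<in> A. (y [^] j) \<odot>\<^bsub>M\<^esub> v \<in> H}"])
  have yj: "y [^] j \<in> carrier R" using y by simp
  have yQ: "y [^] j \<in> Q j"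
  proof -
    have "y \<in> Q (Suc 0)" using y max_ideal_pow_1 by simp
    from max_ideal_pow_nat_pow[OF this, of j] show ?thesis by simp
  qed
  {
    fix H assume H: "submodule H R M" "max_pow R M j A' \<subseteq> H"
    have "A' \<subseteq> {v \<in> A. (y [^] j) \<odot>\<^bsub>M\<^esub> v \<in> H}"
      using max_ideal_pow_smult[OF A' yQ, of _ 0] H(2) sub by auto
    then show "submodule {v \<in> A. (y [^] j) \<odot>\<^bsub>M\<^esub> v \<in> H} R M \<and> A' \<subseteq> {v \<in> A. (y [^] j) \<odot>\<^bsub>M\<^esub> v \<in> H} \<and>
      {v \<in> A. (y [^] j) \<odot>\<^bsub>M\<^esub> v \<in> H} \<subseteq> A"
      using submodule_preimage[OF A H(1) yj] by auto
  }
  fix H K assume H: "submodule H R M" "max_pow R M j A' \<subseteq> H" and K: "submodule K R M" "K \<subseteq> max_pow R M j A"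
    and HK: "H \<subset> K"
  obtain x where x: "x \<in> K" "x \<notin> H" using HK by auto
  have "x \<in> ((\<odot>\<^bsub>M\<^esub>) (y [^] j) ` A) <+>\<^bsub>M\<^esub> max_pow R M j A'"
    using x(1) K(2) max_pow_smult_step[OF A A' y eq, of j] by auto
  then obtain a b where ab: "a \<in> A" "b \<in> max_pow R M j A'" "x = (y [^] j) \<odot>\<^bsub>M\<^esub> a \<oplus>\<^bsub>M\<^esub> b"
    by (auto simp: mem_set_add_iff)
  have bH: "b \<in> H" using ab(2) H(2) by auto
  have ac: "(y [^] j) \<odot>\<^bsub>M\<^esub> a \<in> carrier M" using submodule_mem_simps(2)[OF A ab(1)] yj by simp
  have "(y [^] j) \<odot>\<^bsub>M\<^esub> a \<notin> H"
  proof
    assume "(y [^] j) \<odot>\<^bsub>M\<^esub> a \<in> H"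
    from submodule_mem_simps(3)[OF H(1) this bH] show False using x(2) ab(3) by simp
  qed
  moreover have "(y [^] j) \<odot>\<^bsub>M\<^esub> a \<in> K"
  proof (rule submodule_add_cancel[OF K(1) _ _ ac])
    show "(y [^] j) \<odot>\<^bsub>M\<^esub> a \<oplus>\<^bsub>M\<^esub> b \<in> K" using x(1) unfolding ab(3) .
    show "b \<in> K" using bH HK by auto
  qed
  ultimately show "{v \<in> A. (y [^] j) \<odot>\<^bsub>M\<^esub> v \<in> H} \<subset> {v \<in> A. (y [^] j) \<odot>\<^bsub>M\<^esub> v \<in> K}"
    using ab(1) HK by auto
qed

lemma cofinite_max_pow: "cofinite A \<Longrightarrow> cofinite (max_pow R M j A)"
proof -
  assume A: "cofinite A"
  then obtain n where "P n \<subseteq> A" by (auto simp: cofinite_def)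
  then have "P (j + n) \<subseteq> max_pow R M j A" unfolding P_add[symmetric] by (rule max_pow_mono)
  then show ?thesis using max_pow_submodule[OF cofinite_submodule[OF A]] by (auto simp: cofinite_def)
qed

lemma cofinite_max_ideal_times: "cofinite A \<Longrightarrow> cofinite (ideal_times R M \<mm> A)"
  using cofinite_max_pow[of A "Suc 0"] by (simp add: max_pow_Suc)

text \<open>Multiplication by y embeds A / B into m A / m B. If the lengths agree the embedding is
  onto, so m A = y A + m B, and then y^j is onto in every higher step.\<close>

lemma sat_len:
  assumes A: "cofinite A" and PA: "P n \<subseteq> A" and y: "y \<in> \<mm>"
  defines "B \<equiv> sat n y A"
  shows "len A B \<le> len (ideal_times R M \<mm> A) (ideal_times R M \<mm> B)"
    and "len (ideal_times R M \<mm> A) (ideal_times R M \<mm> B) \<le> len A B \<Longrightarrow>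
      len (max_pow R M j A) (max_pow R M j B) \<le> len A B"
proof -
  note As = cofinite_submodule[OF A]
  have Bs: "submodule B R M" unfolding B_def by (rule sat_closed[OF As y])
  have B: "cofinite B" using Bs P_subset_sat[OF PA] unfolding cofinite_def B_def by blast
  have BA: "B \<subseteq> A" unfolding B_def by (rule sat_subset)
  have yc: "y \<in> carrier R" using y by simp
  let ?m = "ideal_times R M \<mm>"
  let ?C = "((\<odot>\<^bsub>M\<^esub>) y ` A) <+>\<^bsub>M\<^esub> ?m B"
  note mA = max_ideal_times_submodule[OF As] and mB = max_ideal_times_submodule[OF Bs]
  note yA = submodule_smult_image[OF As yc]
  have C: "submodule ?C R M" by (rule submodule_set_add[OF yA mB])
  have BC: "?m B \<subseteq> ?C" by (rule set_add_upper(2)[OF yA mB])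
  have CA: "?C \<subseteq> ?m A"
    by (rule set_add_least[OF mA _ ideal_times_mono[OF order.refl BA]]) (use ideal_times_mem[OF y] in auto)
  note cmB = cofinite_max_ideal_times[OF B]
  have 1: "len A B \<le> len ?C (?m B)"
  proof (rule len_le[OF As B C cmB rel_length_le_smult[OF As mB yc]])
    show "v \<in> B" if "v \<in> A" "y \<odot>\<^bsub>M\<^esub> v \<in> ?m B" for v
      using sat_inj[OF As y that(1)] that(2) by (simp add: B_def)
  qed
  have 2: "len (?m A) (?m B) = len (?m A) ?C + len ?C (?m B)" by (rule len_add[OF mA C cmB BC CA])
  show "len A B \<le> len (?m A) (?m B)" using 1 2 by simp
  assume "len (?m A) (?m B) \<le> len A B"
  then have "len (?m A) ?C = 0" using 1 2 by simp
  then have "?m A = ?C" by (rule len_zero_imp_eq[OF mA cofinite_mono[OF cmB C BC] CA])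
  then have "rel_length R M (max_pow R M j A) (max_pow R M j B) \<le> rel_length R M A B"
    by (intro rel_length_max_pow_le[OF As Bs BA y]) simp
  then show "len (max_pow R M j A) (max_pow R M j B) \<le> len A B"
    by (rule len_le[OF max_pow_submodule[OF As] cofinite_max_pow[OF B] As B])
qed

text \<open>Lengths add along the filtration and grow at each step, so equality of the totals forces
  equality step by step.\<close>

lemma sats_len:
  assumes "cofinite A" "P n \<subseteq> A" "set ys \<subseteq> \<mm>"
  shows "len A (sats n ys A) \<le> len (ideal_times R M \<mm> A) (ideal_times R M \<mm> (sats n ys A)) \<and>
    (len (ideal_times R M \<mm> A) (ideal_times R M \<mm> (sats n ys A)) \<le> len A (sats n ys A) \<longrightarrow>
      (\<forall>j. len (max_pow R M j A) (max_pow R M j (sats n ys A)) \<le> len A (sats n ys A)))"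
  using assms
proof (induction ys arbitrary: A)
  case Nil
  then show ?case by (simp add: rel_length_self zero_enat_def)
next
  case (Cons y ys)
  let ?m = "ideal_times R M \<mm>"
  note A = Cons.prems(1) and As = cofinite_submodule[OF Cons.prems(1)]
  have y: "y \<in> \<mm>" and ys: "set ys \<subseteq> \<mm>" using Cons.prems(3) by auto
  define A' where "A' = sat n y A"
  define B where "B = sats n ys A'"
  have A's: "submodule A' R M" unfolding A'_def by (rule sat_closed[OF As y])
  have PA': "P n \<subseteq> A'" unfolding A'_def by (rule P_subset_sat[OF Cons.prems(2)])
  have A': "cofinite A'" using A's PA' by (auto simp: cofinite_def)
  have A'A: "A' \<subseteq> A" unfolding A'_def by (rule sat_subset)
  have Bs: "submodule B R M" "P n \<subseteq> B" "B \<subseteq> A'" unfolding B_def using sats_facts[OF A's PA' ys] by auto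
  have B: "cofinite B" using Bs by (auto simp: cofinite_def)
  note IH = Cons.IH[OF A' PA' ys, folded B_def]
  have 1: "len A B = len A A' + len A' B" by (rule len_add[OF As A's B Bs(3) A'A])
  have 2: "len (?m A) (?m B) = len (?m A) (?m A') + len (?m A') (?m B)"
    using Bs(3) A'A by (intro len_add max_ideal_times_submodule As A's cofinite_max_ideal_times B ideal_times_mono order.refl)
  have 3: "len A A' \<le> len (?m A) (?m A')" unfolding A'_def by (rule sat_len(1)[OF A Cons.prems(2) y])
  have "len (max_pow R M j A) (max_pow R M j B) \<le> len A B" if le: "len (?m A) (?m B) \<le> len A B" for j
  proof -
    have "len (?m A) (?m A') \<le> len A A'" "len (?m A') (?m B) \<le> len A' B" using le 1 2 3 IH by auto
    then have "len (max_pow R M j A) (max_pow R M j A') \<le> len A A'"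
      "len (max_pow R M j A') (max_pow R M j B) \<le> len A' B"
      using sat_len(2)[OF A Cons.prems(2) y, of j] IH unfolding A'_def by auto
    moreover have "len (max_pow R M j A) (max_pow R M j B)
        = len (max_pow R M j A) (max_pow R M j A') + len (max_pow R M j A') (max_pow R M j B)"
      using Bs(3) A'A by (intro len_add max_pow_submodule As A's cofinite_max_pow B max_pow_mono)
    ultimately show ?thesis using 1 by simp
  qed
  then show ?case using 1 2 3 IH unfolding sats.simps(2) A'_def[symmetric] B_def[symmetric] by auto
qed

text \<open>For n >= N the filtration of P i along generators of m ends in P n, by
  \<open>max_pow_span_subset\<close> and \<open>ratliff_rush\<close>. Thus length(P i / P n) is at
  most length(P (i + 1) / P (n + 1)); computing the length of P i / P (n + 1) through P n and
  through P (i + 1) converts this into a comparison of \<open>hilb\<close>.\<close>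

lemma hilb_le:
  assumes red: "reduction k c N" and n: "i \<le> n" "N \<le> n"
  shows "hilb i \<le> hilb n"
    and "hilb n \<le> hilb i \<Longrightarrow> len (P (j + i)) (P (j + n)) \<le> len (P i) (P n)"
proof -
  obtain Y where Y: "finite Y" "Y \<noteq> {}" "Y \<subseteq> carrier R" "Y \<subseteq> \<mm>" "Idl Y = \<mm>"
    using max_ideal_generators by blast
  obtain ys where ys: "set ys = Y" using finite_list[OF Y(1)] by blast
  have ysm: "set ys \<subseteq> \<mm>" using ys Y(4) by simp
  have PP: "P n \<subseteq> P i" by (rule P_antimono[OF n(1)])
  have "sats n ys (P i) = P n"
  proof
    show "P n \<subseteq> sats n ys (P i)" using sats_facts[OF P_submodule PP ysm] by blast
    show "sats n ys (P i) \<subseteq> P n"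
    proof
      fix v assume "v \<in> sats n ys (P i)"
      then have v: "v \<in> P i" "\<forall>y\<in>Y. \<exists>j::nat. (y [^] j) \<odot>\<^bsub>M\<^esub> v \<in> P (n + j)" by (auto simp: sats_eq ys)
      then obtain j :: "'a \<Rightarrow> nat" where j: "\<And>y. y \<in> Y \<Longrightarrow> (y [^] j y) \<odot>\<^bsub>M\<^esub> v \<in> P (n + j y)" by metis
      have vc: "v \<in> carrier M" by (rule P_closed(2)[OF v(1)])
      obtain J where "max_pow R M J ((\<lambda>r. r \<odot>\<^bsub>M\<^esub> v) ` carrier R) \<subseteq> P (n + J)"
        using max_pow_span_subset[OF Y(1,3,5) vc j Y(2)] by blast
      then show "v \<in> P n" by (rule ratliff_rush[OF red vc n(2)])
    qed
  qed
  then have L: "len (P i) (P n) \<le> len (P (Suc i)) (P (Suc n))"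
    "len (P (Suc i)) (P (Suc n)) \<le> len (P i) (P n) \<longrightarrow> (\<forall>j. len (P (j + i)) (P (j + n)) \<le> len (P i) (P n))"
    using sats_len[OF cofinite_P PP ysm] by (simp_all add: max_pow_Suc max_pow_add)
  have "len (P i) (P n) + hilb n = hilb i + len (P (Suc i)) (P (Suc n))"
    using len_P_add[of i n "Suc n"] len_P_add[of i "Suc i" "Suc n"] n(1) by simp
  then show "hilb i \<le> hilb n" "hilb n \<le> hilb i \<Longrightarrow> len (P (j + i)) (P (j + n)) \<le> len (P i) (P n)"
    using L by auto
qed

text \<open>The length D of M / c M is the sum of k values of \<open>hilb\<close> from N on, none
  below \<open>hilb 0\<close>. If D = k (hilb 0), all of them equal \<open>hilb 0\<close>, and the
  equality case of \<open>hilb_le\<close> bounds length(P k / P (N + k)) by length(M / P N). Hence D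
  is at most length(M / P k), while c M lies in P k.\<close>

lemma smult_eq_max_pow_of_multiplicity:
  assumes red: "reduction k c N" and eq: "k * hilb 0 = len (carrier M) ((\<odot>\<^bsub>M\<^esub>) c ` carrier M)"
  shows "(\<odot>\<^bsub>M\<^esub>) c ` carrier M = P k"
proof -
  note rf = red_facts[OF red]
  let ?D = "len (carrier M) ((\<odot>\<^bsub>M\<^esub>) c ` carrier M)"
  have "?D = (\<Sum>j<k. hilb (N + j))" using len_P_shift[OF red, of N] len_P_sum[of N k] by simp
  moreover have "hilb 0 \<le> hilb (N + j)" for j by (rule hilb_le(1)[OF red]) auto
  moreover have "(\<Sum>j<k. hilb 0) < (\<Sum>j<k. hilb (N + j))" if "hilb 0 < hilb N"
    by (rule sum_strict_mono_ex1)
      (use that rf(1) hilb_le(1)[OF red, of 0] in \<open>auto intro!: bexI[of _ 0]\<close>)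
  ultimately have "hilb N \<le> hilb 0" using eq by force
  then have le: "len (P k) (P (N + k)) \<le> len (P 0) (P N)"
    using hilb_le(2)[OF red, of 0 N k] by (simp add: add.commute)
  have sub: "(\<odot>\<^bsub>M\<^esub>) c ` carrier M \<subseteq> P k" using Q_smult[OF rf(2), of _ 0] by auto
  have cof: "cofinite ((\<odot>\<^bsub>M\<^esub>) c ` carrier M)"
    using submodule_smult_image[OF carrier_is_submodule rf(4)] P_subset_smult[OF red] by (auto simp: cofinite_def)
  have "len (P 0) (P k) + len (P k) (P (N + k)) = len (P 0) (P N) + ?D"
    using len_P_shift'[OF red, of N] len_P_add[of 0 k "N + k"] by simp
  then have "?D \<le> len (carrier M) (P k)" using le by simp
  moreover have "?D = len (carrier M) (P k) + len (P k) ((\<odot>\<^bsub>M\<^esub>) c ` carrier M)"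
    by (rule len_add[OF carrier_is_submodule P_submodule cof sub]) (use P_closed(2) in auto)
  ultimately have "len (P k) ((\<odot>\<^bsub>M\<^esub>) c ` carrier M) = 0" by simp
  then show ?thesis using len_zero_imp_eq[OF P_submodule cof sub] by simp
qed

text \<open>Here c P n = P (n + k) for all n, so N = 0 is allowed. Then \<open>hilb\<close> is
  monotone from 0 on, and \<open>hilb k = hilb 0\<close> makes it constant up to k.\<close>

lemma multiplicity_of_smult_eq_max_pow:
  assumes k: "k \<ge> 1" and c: "c \<in> Q k" "regular c" and eq: "(\<odot>\<^bsub>M\<^esub>) c ` carrier M = P k"
  shows "reduction k c 0" "k * hilb 0 = len (carrier M) ((\<odot>\<^bsub>M\<^esub>) c ` carrier M)"
proof -
  have cc: "c \<in> carrier R" using c by simp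
  have cP: "(\<odot>\<^bsub>M\<^esub>) c ` P n = P (n + k)" for n
    using max_pow_smult_image[OF carrier_is_submodule cc, of n] by (simp add: eq P_add)
  then show red: "reduction k c 0" using k c by (simp add: reduction_def)
  have "hilb k = hilb 0" using len_smult[OF c(2) P_submodule P_submodule, of 0 1] cP[of 0] cP[of 1] by simp
  then have "hilb j = hilb 0" if "j < k" for j
    using hilb_le(1)[OF red, of 0 j] hilb_le(1)[OF red, of j k] that by simp
  then have "(\<Sum>j<k. hilb (0 + j)) = (\<Sum>j<k. hilb 0)" by (intro sum.cong) auto
  then show "k * hilb 0 = len (carrier M) ((\<odot>\<^bsub>M\<^esub>) c ` carrier M)"
    using len_P_shift[OF red, of 0] len_P_sum[of 0 k] by simp
qed

lemma hilb_0_eq_min_gens: "hilb 0 = min_gens R M"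
  using rel_length_eq_min_gens by (simp add: max_pow_Suc)

text \<open>The form in which the Ulrich property is used from here on: one direction produces c for
  M, the other certifies the complement of m.\<close>

theorem min_gens_eq_multiplicity_iff:
  assumes "krull_dim R = 1"
  shows "real (min_gens R M) = multiplicity_hs R M \<longleftrightarrow>
    (\<exists>k\<ge>1. \<exists>c\<in>Q k. regular c \<and> (\<odot>\<^bsub>M\<^esub>) c ` carrier M = P k)"
proof
  assume eq: "real (min_gens R M) = multiplicity_hs R M"
  obtain k c N where red: "reduction k c N" using exists_reduction by blast
  note rf = red_facts[OF red]
  define d where "d = len (carrier M) ((\<odot>\<^bsub>M\<^esub>) c ` carrier M)"
  have "real k * real (min_gens R M) = real d"
    using rf(1) unfolding eq multiplicity_eq[OF red assms] d_def[symmetric] by simp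
  then have "real (k * min_gens R M) = real d" by simp
  then have "k * min_gens R M = d" by (simp only: of_nat_eq_iff)
  then have "k * hilb 0 = len (carrier M) ((\<odot>\<^bsub>M\<^esub>) c ` carrier M)"
    unfolding hilb_0_eq_min_gens d_def .
  from smult_eq_max_pow_of_multiplicity[OF red this]
  show "\<exists>k\<ge>1. \<exists>c\<in>Q k. regular c \<and> (\<odot>\<^bsub>M\<^esub>) c ` carrier M = P k" using rf by blast
next
  assume "\<exists>k\<ge>1. \<exists>c\<in>Q k. regular c \<and> (\<odot>\<^bsub>M\<^esub>) c ` carrier M = P k"
  then obtain k c where kc: "k \<ge> 1" "c \<in> Q k" "regular c" "(\<odot>\<^bsub>M\<^esub>) c ` carrier M = P k" by blast
  note r = multiplicity_of_smult_eq_max_pow[OF kc]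
  have "real (len (carrier M) ((\<odot>\<^bsub>M\<^esub>) c ` carrier M)) = real k * real (min_gens R M)"
    unfolding r(2)[symmetric] hilb_0_eq_min_gens by simp
  then show "real (min_gens R M) = multiplicity_hs R M"
    unfolding multiplicity_eq[OF r(1) assms] using kc(1) by simp
qed

end

section \<open>Dimension and depth\<close>

lemma krull_dim_ge:
  assumes "\<forall>i\<le>n. primeideal (P i) R" "\<forall>i<n. P i \<subset> P (Suc i)"
  shows "enat n \<le> krull_dim R"
  unfolding krull_dim_def by (rule Sup_upper) (use assms in blast)

lemma krull_dim_leI:
  assumes "\<And>n P. \<forall>i\<le>n. primeideal (P i) R \<Longrightarrow> \<forall>i<n. P i \<subset> P (Suc i) \<Longrightarrow> enat n \<le> d"
  shows "krull_dim R \<le> d"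
  unfolding krull_dim_def by (rule Sup_least) (use assms in blast)

lemma (in cring) krull_dim_quotient_le:
  assumes J: "ideal J R"
  shows "krull_dim (R Quot J) \<le> krull_dim R"
proof (rule krull_dim_leI)
  fix n P assume P: "\<forall>i\<le>n. primeideal (P i) (R Quot J)" "\<forall>i<n. P i \<subset> P (Suc i)"
  have hom: "ring_hom_ring R (R Quot J) ((+>) J)" by (rule ideal.rcos_ring_hom_ring[OF J])
  let ?V = "\<lambda>i. {r \<in> carrier R. J +> r \<in> P i}"
  have prime: "primeideal (?V i) R" if "i \<le> n" for i
    using ring_hom_ring.primeideal_vimage[OF hom is_cring] P(1) that by blast
  have "?V i \<subset> ?V (Suc i)" if i: "i < n" for i
  proof -
    obtain C where C: "C \<in> P (Suc i)" "C \<notin> P i" using P(2) i by blast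
    have "primeideal (P (Suc i)) (R Quot J)" using P(1) i by simp
    then have "C \<in> carrier (R Quot J)" using C(1) ideal.Icarr primeideal.axioms(1) by metis
    then obtain r where "r \<in> carrier R" "C = J +> r" by (auto simp: FactRing_def A_RCOSETS_def')
    then have "r \<in> ?V (Suc i)" "r \<notin> ?V i" using C by auto
    moreover have "?V i \<subseteq> ?V (Suc i)" using P(2) i by blast
    ultimately show ?thesis by blast
  qed
  then show "enat n \<le> krull_dim R" using prime by (intro krull_dim_ge[of n ?V]) auto
qed

lemma (in cring) primeideal_quotient_image:
  assumes J: "ideal J R" and P: "primeideal P R" and JP: "J \<subseteq> P"
  shows "primeideal ((+>) J ` P) (R Quot J)"
    and "a \<in> carrier R \<Longrightarrow> J +> a \<in> (+>) J ` P \<longleftrightarrow> a \<in> P"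
proof -
  have Pi: "ideal P R" by (rule primeideal.axioms(1)[OF P])
  show mem: "J +> a \<in> (+>) J ` P \<longleftrightarrow> a \<in> P" if a: "a \<in> carrier R" for a
  proof
    assume "J +> a \<in> (+>) J ` P"
    then obtain c where c: "c \<in> P" "J +> a = J +> c" by auto
    have cc: "c \<in> carrier R" using ideal.Icarr[OF Pi c(1)] .
    have "a \<ominus> c \<in> P" using quotient_eq_iff_same_a_r_cos[OF J a cc] c(2) JP by auto
    then have "(a \<ominus> c) \<oplus> c \<in> P" using c(1) additive_subgroup.a_closed[OF ideal.axioms(1)[OF Pi]] by blast
    then show "a \<in> P" using a cc by (simp add: a_minus_def a_assoc l_neg)
  qed auto
  have one: "\<one> \<notin> P" using ideal.one_imp_carrier[OF Pi] primeideal.I_notcarr[OF P] by auto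
  show "primeideal ((+>) J ` P) (R Quot J)"
  proof (rule primeidealI)
    show "ideal ((+>) J ` P) (R Quot J)" by (rule ring_ideal_imp_quot_ideal[OF J Pi])
    show "cring (R Quot J)" by (rule ideal.quotient_is_cring[OF J is_cring])
    show "carrier (R Quot J) \<noteq> (+>) J ` P"
    proof
      assume "carrier (R Quot J) = (+>) J ` P"
      moreover have "J +> \<one> \<in> carrier (R Quot J)" by (auto simp: FactRing_def A_RCOSETS_def')
      ultimately show False using mem[OF one_closed] one by simp
    qed
    fix C D assume "C \<in> carrier (R Quot J)" "D \<in> carrier (R Quot J)" and CD: "C \<otimes>\<^bsub>R Quot J\<^esub> D \<in> (+>) J ` P"
    then obtain a b where ab: "a \<in> carrier R" "C = J +> a" "b \<in> carrier R" "D = J +> b"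
      by (auto simp: FactRing_def A_RCOSETS_def')
    have "C \<otimes>\<^bsub>R Quot J\<^esub> D = J +> (a \<otimes> b)"
      using ideal.rcoset_mult_add[OF J ab(1,3)] ab by (simp add: FactRing_def)
    then have "a \<otimes> b \<in> P" using CD mem ab by simp
    then have "a \<in> P \<or> b \<in> P" by (rule primeideal.I_prime[OF P ab(1,3)])
    then show "C \<in> (+>) J ` P \<or> D \<in> (+>) J ` P" using ab by auto
  qed
qed

text \<open>An ideal J that is maximal among those above I missing S is prime: for a and b outside
  J, both J + aR and J + bR meet S, and multiplying two such elements shows that a b is outside
  J.\<close>

lemma (in cring) exists_primeideal_avoiding:
  assumes I: "ideal I R" and S: "S \<subseteq> carrier R" "S \<noteq> {}" "\<And>a b. a \<in> S \<Longrightarrow> b \<in> S \<Longrightarrow> a \<otimes> b \<in> S"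
    and IS: "I \<inter> S = {}"
  shows "\<exists>P. primeideal P R \<and> I \<subseteq> P \<and> P \<inter> S = {}"
proof -
  interpret S: module R "self_module R" by (rule self_module_module)
  let ?A = "{J. ideal J R \<and> I \<subseteq> J \<and> J \<inter> S = {}}"
  have "\<exists>J\<in>?A. \<forall>Y\<in>?A. J \<subseteq> Y \<longrightarrow> Y = J"
  proof (rule subset_Zorn_nonempty)
    show "?A \<noteq> {}" using I IS by auto
    fix C assume C: "C \<noteq> {}" "subset.chain ?A C"
    then have "subset.chain {J. ideal J R} C" by (auto simp: pred_on.chain_def)
    from chain_Union_is_ideal[OF this] C show "\<Union>C \<in> ?A" by (auto simp: pred_on.chain_def)
  qed
  then obtain J where J: "ideal J R" "I \<subseteq> J" "J \<inter> S = {}"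
    and max: "\<And>Y. ideal Y R \<Longrightarrow> I \<subseteq> Y \<Longrightarrow> Y \<inter> S = {} \<Longrightarrow> J \<subseteq> Y \<Longrightarrow> Y = J" by auto
  have Js: "submodule J R (self_module R)" using J(1) by (simp add: ideal_iff_submodule)
  note j = submodule_mem_simps[OF Js, simplified]
  have hit: "\<exists>x\<in>J. \<exists>r\<in>carrier R. x \<oplus> r \<otimes> a \<in> S" if a: "a \<in> carrier R" "a \<notin> J" for a
  proof -
    let ?T = "(\<lambda>r. r \<otimes> a) ` carrier R"
    have T: "submodule ?T R (self_module R)" using S.submodule_span[of a] a by simp
    let ?Y = "J <+>\<^bsub>self_module R\<^esub> ?T"
    have Y: "ideal ?Y R" using S.submodule_set_add[OF Js T] by (simp add: ideal_iff_submodule)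
    have JY: "J \<subseteq> ?Y" by (rule S.set_add_upper(1)[OF Js T])
    have "a \<in> ?T" using S.mem_span[of a] a by simp
    then have "a \<in> ?Y" using S.set_add_upper(2)[OF Js T] by auto
    then have "?Y \<noteq> J" using a(2) by auto
    then have "?Y \<inter> S \<noteq> {}" using max[OF Y _ _ JY] J(2) JY by blast
    then show ?thesis by (auto simp: S.mem_set_add_iff)
  qed
  have "primeideal J R"
  proof (rule primeidealI[OF J(1) is_cring])
    show "carrier R \<noteq> J" using J(3) S by auto
    fix a b assume a: "a \<in> carrier R" and b: "b \<in> carrier R" and ab: "a \<otimes> b \<in> J"
    show "a \<in> J \<or> b \<in> J"
    proof (rule ccontr)
      assume "\<not> (a \<in> J \<or> b \<in> J)"
      then obtain x r y s where *: "x \<in> J" "r \<in> carrier R" "x \<oplus> r \<otimes> a \<in> S"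
        "y \<in> J" "s \<in> carrier R" "y \<oplus> s \<otimes> b \<in> S" using hit[of a] hit[of b] a b by blast
      have car: "x \<in> carrier R" "y \<in> carrier R" using * j(2) by auto
      have "(x \<oplus> r \<otimes> a) \<otimes> (y \<oplus> s \<otimes> b) = (y \<oplus> s \<otimes> b) \<otimes> x \<oplus> ((r \<otimes> a) \<otimes> y \<oplus> (r \<otimes> s) \<otimes> (a \<otimes> b))"
        using car * a b by (simp add: l_distr r_distr m_ac a_ac)
      also have "\<dots> \<in> J" using j(3,4) * ab car a b by simp
      finally show False using S(3)[OF *(3,6)] J(3) by blast
    qed
  qed
  then show ?thesis using J by blast
qed

section \<open>Existence of a parameter, and its regularity on modules of positive depth\<close>

context local_noetherian_module
begin

text \<open>An ideal that is maximal among those containing no power of \<open>\<mm>\<close> is prime.\<close>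

lemma exists_nonmaximal_prime:
  assumes I: "ideal I R" and no: "\<And>e. \<not> max_ideal_pow R e \<subseteq> I"
  shows "\<exists>p. primeideal p R \<and> I \<subseteq> p \<and> p \<subset> \<mm>"
proof -
  interpret S: local_noetherian_module R "self_module R" by (rule local_noetherian_self)
  define F where "F = {J. submodule J R (self_module R) \<and> I \<subseteq> J \<and> (\<forall>e. \<not> max_ideal_pow R e \<subseteq> J)}"
  have "I \<in> F" using I no by (simp add: F_def R.ideal_iff_submodule)
  then have "F \<noteq> {}" by auto
  moreover have "submodule J R (self_module R)" if "J \<in> F" for J using that by (simp add: F_def)
  ultimately have "\<exists>J\<in>F. \<forall>Y\<in>F. J \<subseteq> Y \<longrightarrow> Y = J" by (rule S.submodule_maximal_element)
  then obtain p where p: "p \<in> F" and max: "\<And>Y. Y \<in> F \<Longrightarrow> p \<subseteq> Y \<Longrightarrow> Y = p" by blast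
  have ps: "submodule p R (self_module R)" and Ip: "I \<subseteq> p" and nop: "\<And>e. \<not> max_ideal_pow R e \<subseteq> p"
    using p by (auto simp: F_def)
  have pid: "ideal p R" using ps by (simp add: R.ideal_iff_submodule)
  note pm = submodule_mem_simps[OF ps, simplified]
  have hit: "\<exists>e. max_ideal_pow R e \<subseteq> p <+>\<^bsub>self_module R\<^esub> ((\<lambda>r. r \<otimes> a) ` carrier R)"
    if a: "a \<in> carrier R" "a \<notin> p" for a
  proof -
    let ?T = "(\<lambda>r. r \<otimes> a) ` carrier R"
    have T: "submodule ?T R (self_module R)" using S.submodule_span[of a] a by simp
    let ?Y = "p <+>\<^bsub>self_module R\<^esub> ?T"
    have Y: "submodule ?Y R (self_module R)" by (rule S.submodule_set_add[OF ps T])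
    have pY: "p \<subseteq> ?Y" by (rule S.set_add_upper(1)[OF ps T])
    have "a \<in> ?T" using S.mem_span[of a] a by simp
    then have "a \<in> ?Y" using S.set_add_upper(2)[OF ps T] by auto
    then have "?Y \<noteq> p" using a(2) by auto
    then have "?Y \<notin> F" using max[OF _ pY] by blast
    then show ?thesis using Y Ip pY unfolding F_def by blast
  qed
  have "primeideal p R"
  proof (rule primeidealI[OF pid R.is_cring])
    show "carrier R \<noteq> p" using nop[of 0] by auto
    fix a b assume a: "a \<in> carrier R" and b: "b \<in> carrier R" and ab: "a \<otimes> b \<in> p"
    show "a \<in> p \<or> b \<in> p"
    proof (rule ccontr)
      assume n: "\<not> (a \<in> p \<or> b \<in> p)"
      then obtain e where e: "max_ideal_pow R e \<subseteq> p <+>\<^bsub>self_module R\<^esub> ((\<lambda>r. r \<otimes> a) ` carrier R)"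
        using hit a by blast
      obtain f where f: "max_ideal_pow R f \<subseteq> p <+>\<^bsub>self_module R\<^esub> ((\<lambda>r. r \<otimes> b) ` carrier R)"
        using hit b n by blast
      have "max_pow R (self_module R) e (max_ideal_pow R f) \<subseteq> p"
      proof (rule S.max_pow_least[OF max_ideal_pow_submodule ps])
        fix u v assume "u \<in> max_ideal_pow R e" "v \<in> max_ideal_pow R f"
        then have "u \<in> p <+>\<^bsub>self_module R\<^esub> ((\<lambda>r. r \<otimes> a) ` carrier R)"
          "v \<in> p <+>\<^bsub>self_module R\<^esub> ((\<lambda>r. r \<otimes> b) ` carrier R)" using e f by auto
        then obtain x r y s where *: "x \<in> p" "r \<in> carrier R" "u = x \<oplus> r \<otimes> a"
          "y \<in> p" "s \<in> carrier R" "v = y \<oplus> s \<otimes> b" by (auto simp: S.mem_set_add_iff)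
        have car: "x \<in> carrier R" "y \<in> carrier R" using * pm(2) by auto
        have "u \<otimes> v = (y \<oplus> s \<otimes> b) \<otimes> x \<oplus> ((r \<otimes> a) \<otimes> y \<oplus> (r \<otimes> s) \<otimes> (a \<otimes> b))"
          unfolding *(3,6) using car * a b by (simp add: R.l_distr R.r_distr R.m_ac R.a_ac)
        also have "\<dots> \<in> p" using pm(3,4) * ab car a b by simp
        finally show "u \<odot>\<^bsub>self_module R\<^esub> v \<in> p" by simp
      qed
      then have "max_ideal_pow R (e + f) \<subseteq> p" by (simp add: max_ideal_pow_def max_pow_add)
      then show False using nop by blast
    qed
  qed
  moreover have "p \<subseteq> \<mm>" by (rule local_ring_proper_ideal[OF local pid]) (use nop[of 0] in auto)
  moreover have "p \<noteq> \<mm>" using nop[of "Suc 0"] max_ideal_pow_1 by auto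
  ultimately show ?thesis using Ip by blast
qed

text \<open>Positive depth gives a nonempty regular sequence. Its first element is regular on M
  itself, as the empty set generates the zero ideal.\<close>

lemma exists_regular_of_depth:
  assumes "module_depth R M \<noteq> 0"
  shows "\<exists>a\<in>\<mm>. \<forall>v\<in>carrier M. a \<odot>\<^bsub>M\<^esub> v = \<zero>\<^bsub>M\<^esub> \<longrightarrow> v = \<zero>\<^bsub>M\<^esub>"
proof -
  have "\<exists>xs. set xs \<subseteq> \<mm> \<and> regular_sequence R M xs \<and> xs \<noteq> []"
  proof (rule ccontr)
    assume "\<not> ?thesis"
    then have "module_depth R M \<le> 0"
      unfolding module_depth_def by (intro Sup_least) (auto simp: zero_enat_def)
    then show False using assms by simp
  qed
  then obtain xs where xs: "set xs \<subseteq> \<mm>" "regular_sequence R M xs" "xs \<noteq> []" by blast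
  have "v = \<zero>\<^bsub>M\<^esub>" if "v \<in> carrier M" "xs ! 0 \<odot>\<^bsub>M\<^esub> v = \<zero>\<^bsub>M\<^esub>" for v
  proof -
    have "v \<in> ideal_smult R (genideal R (set (take 0 xs))) M"
    proof -
      have "\<forall>y\<in>carrier M. xs ! 0 \<odot>\<^bsub>M\<^esub> y \<in> ideal_smult R (genideal R (set (take 0 xs))) M \<longrightarrow>
          y \<in> ideal_smult R (genideal R (set (take 0 xs))) M"
        using xs(2,3) unfolding regular_sequence_def by blast
      then show ?thesis using that ideal_smult_empty by simp
    qed
    then show ?thesis using ideal_smult_empty by simp
  qed
  moreover have "xs ! 0 \<in> \<mm>" using xs by auto
  ultimately show ?thesis by blast
qed

end

text \<open>If no power of m lay in tR, a prime p strictly below m would contain t. As t is regular,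
  products of powers of t with elements outside p are nonzero, so some prime q avoids all of them.
  Then q lies in p and does not contain t, and q, p, m form a chain too long for dimension
  one.\<close>

lemma cohen_macaulay_reduction:
  fixes R (structure)
  assumes CM: "cohen_macaulay_local_ring R" and dim: "krull_dim R = 1"
  shows "\<exists>t\<in>max_ideal R. \<exists>e. (\<forall>a\<in>carrier R. t \<otimes> a = \<zero> \<longrightarrow> a = \<zero>) \<and> max_ideal_pow R e \<subseteq> PIdl t"
proof -
  have l: "local_ring R" "noetherian_ring R" using CM by (auto simp: cohen_macaulay_local_ring_def)
  interpret cring R by (rule local_ring_cring[OF l(1)])
  interpret S: local_noetherian_module R "self_module R" by (rule local_noetherian_self_module[OF l])
  have "module_depth R (self_module R) = 1" using CM dim by (simp add: cohen_macaulay_local_ring_def)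
  then obtain t where t: "t \<in> max_ideal R" "\<And>a. a \<in> carrier R \<Longrightarrow> t \<otimes> a = \<zero> \<Longrightarrow> a = \<zero>"
    using S.exists_regular_of_depth by auto
  have tc: "t \<in> carrier R" using t by simp
  have tpow: "a = \<zero>" if "a \<in> carrier R" "a \<otimes> t [^] (n::nat) = \<zero>" for a n
    using that
  proof (induction n)
    case (Suc n)
    have "t \<otimes> (a \<otimes> t [^] n) = \<zero>" using Suc.prems tc by (simp add: m_ac)
    then have "a \<otimes> t [^] n = \<zero>" using t(2) Suc.prems tc by simp
    then show ?case using Suc by simp
  qed simp
  have "\<exists>e. max_ideal_pow R e \<subseteq> PIdl t"
  proof (rule ccontr)
    assume "\<nexists>e. max_ideal_pow R e \<subseteq> PIdl t"
    then obtain p where p: "primeideal p R" "PIdl t \<subseteq> p" "p \<subset> max_ideal R"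
      using S.exists_nonmaximal_prime[OF cgenideal_ideal[OF tc]] by blast
    have pid: "ideal p R" by (rule primeideal.axioms(1)[OF p(1)])
    have one: "\<one> \<notin> p" using ideal.one_imp_carrier[OF pid] primeideal.I_notcarr[OF p(1)] by auto
    have tp: "t \<in> p" using p(2) cgenideal_self[OF tc] by auto
    define U where "U = {s \<otimes> t [^] n | s (n::nat). s \<in> carrier R \<and> s \<notin> p}"
    have "\<exists>q. primeideal q R \<and> {\<zero>} \<subseteq> q \<and> q \<inter> U = {}"
    proof (rule exists_primeideal_avoiding[OF zeroideal])
      show "U \<subseteq> carrier R" using tc by (auto simp: U_def)
      show "U \<noteq> {}" using one by (auto simp: U_def)
      show "{\<zero>} \<inter> U = {}"
      proof -
        have "s \<in> p" if "s \<in> carrier R" "s \<otimes> t [^] n = \<zero>" for s and n :: nat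
          using tpow[OF that] additive_subgroup.zero_closed[OF ideal.axioms(1)[OF pid]] by simp
        then show ?thesis unfolding U_def by force
      qed
      fix a b assume "a \<in> U" "b \<in> U"
      then obtain s n s' n' where *: "a = s \<otimes> t [^] (n::nat)" "b = s' \<otimes> t [^] (n'::nat)"
        "s \<in> carrier R" "s \<notin> p" "s' \<in> carrier R" "s' \<notin> p" by (auto simp: U_def)
      have "a \<otimes> b = (s \<otimes> s') \<otimes> t [^] (n + n')"
        using * tc by (simp add: m_ac nat_pow_mult[symmetric])
      moreover have "s \<otimes> s' \<notin> p" using primeideal.I_prime[OF p(1)] * by blast
      ultimately show "a \<otimes> b \<in> U" using * unfolding U_def by blast
    qed
    then obtain q where q: "primeideal q R" "q \<inter> U = {}" by blast
    have qc: "q \<subseteq> carrier R" using ideal.Icarr[OF primeideal.axioms(1)[OF q(1)]] by auto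
    have "q \<subseteq> p"
    proof
      fix s assume s: "s \<in> q"
      show "s \<in> p"
      proof (rule ccontr)
        assume "s \<notin> p"
        then have "s \<otimes> t [^] (0::nat) \<in> U" using s qc unfolding U_def by blast
        then have "s \<in> U" using subsetD[OF qc s] by simp
        then show False using s q(2) by auto
      qed
    qed
    moreover have "t \<notin> q"
    proof
      assume "t \<in> q"
      moreover have "\<one> \<otimes> t [^] (1::nat) \<in> U" using one unfolding U_def by blast
      ultimately show False using q(2) tc by auto
    qed
    ultimately have qp: "q \<subset> p" using tp by auto
    have "enat 2 \<le> krull_dim R"
    proof (rule krull_dim_ge[where P = "\<lambda>i. if i = 0 then q else if i = 1 then p else max_ideal R"])
      show "\<forall>i\<le>2. primeideal (if i = 0 then q else if i = 1 then p else max_ideal R) R"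
        using q(1) p(1) maximalideal_prime[OF local_ring_max_ideal[OF l(1)]] by simp
    qed (use qp p(3) in \<open>auto simp: less_2_cases_iff\<close>)
    then show False using dim by (simp add: one_enat_def)
  qed
  then show ?thesis using t by blast
qed

context local_noetherian_module
begin

text \<open>The parameter chosen for R also works for M: if a in m is regular on M, then a^e is a
  multiple of t, so t v = 0 gives a^e v = 0 and v = 0.\<close>

lemma torsion_freeI:
  assumes t: "t \<in> \<mm>" "\<And>a. a \<in> carrier R \<Longrightarrow> t \<otimes> a = \<zero> \<Longrightarrow> a = \<zero>" "max_ideal_pow R e \<subseteq> PIdl t"
    and depth: "module_depth R M \<noteq> 0"
  shows "torsion_free_module R M t e"
proof
  fix v assume v: "v \<in> carrier M" and tv: "t \<odot>\<^bsub>M\<^esub> v = \<zero>\<^bsub>M\<^esub>"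
  obtain a where a: "a \<in> \<mm>" and reg: "\<And>v. v \<in> carrier M \<Longrightarrow> a \<odot>\<^bsub>M\<^esub> v = \<zero>\<^bsub>M\<^esub> \<Longrightarrow> v = \<zero>\<^bsub>M\<^esub>"
    using exists_regular_of_depth[OF depth] by blast
  have ac: "a \<in> carrier R" and tc: "t \<in> carrier R" using a t by auto
  have "a \<in> max_ideal_pow R (Suc 0)" using a max_ideal_pow_1 by simp
  from max_ideal_pow_nat_pow[OF this, of e] have "a [^] e \<in> PIdl t" using t(3) by auto
  then obtain r where r: "r \<in> carrier R" "a [^] e = r \<otimes> t" by (auto simp: cgenideal_def)
  have "(a [^] e) \<odot>\<^bsub>M\<^esub> v = \<zero>\<^bsub>M\<^esub>" unfolding r(2) using r(1) tc v tv by (simp add: smult_assoc1)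
  moreover have "w = \<zero>\<^bsub>M\<^esub>" if "w \<in> carrier M" "(a [^] n) \<odot>\<^bsub>M\<^esub> w = \<zero>\<^bsub>M\<^esub>" for n :: nat and w
    using that
  proof (induction n arbitrary: w)
    case (Suc n)
    then have "(a [^] n) \<odot>\<^bsub>M\<^esub> (a \<odot>\<^bsub>M\<^esub> w) = \<zero>\<^bsub>M\<^esub>" using ac by (simp add: smult_assoc1)
    then have "a \<odot>\<^bsub>M\<^esub> w = \<zero>\<^bsub>M\<^esub>" using Suc.IH[of "a \<odot>\<^bsub>M\<^esub> w"] Suc.prems(1) ac by simp
    then show ?case using reg Suc.prems(1) by simp
  qed simp
  ultimately show "v = \<zero>\<^bsub>M\<^esub>" using v by blast
qed (use t in auto)

end

section \<open>Depth and dimension of nonzero torsion-free modules\<close>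

context torsion_free_module
begin

lemma ideal_smult_principal:
  assumes a: "a \<in> carrier R"
  shows "ideal_smult R (Idl {a}) M = (\<odot>\<^bsub>M\<^esub>) a ` carrier M"
  unfolding ideal_smult_eq
proof
  have aM: "submodule ((\<odot>\<^bsub>M\<^esub>) a ` carrier M) R M" by (rule submodule_smult_image[OF carrier_is_submodule a])
  show "ideal_times R M (Idl {a}) (carrier M) \<subseteq> (\<odot>\<^bsub>M\<^esub>) a ` carrier M"
  proof (rule ideal_times_least[OF aM])
    fix b v assume "b \<in> Idl {a}" and v: "v \<in> carrier M"
    then obtain r where r: "r \<in> carrier R" "b = r \<otimes> a"
      unfolding R.cgenideal_eq_genideal[OF a, symmetric] by (auto simp: cgenideal_def)
    then have "b \<odot>\<^bsub>M\<^esub> v = a \<odot>\<^bsub>M\<^esub> (r \<odot>\<^bsub>M\<^esub> v)" using a v by (simp add: smult_assoc1 smult_comm)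
    then show "b \<odot>\<^bsub>M\<^esub> v \<in> (\<odot>\<^bsub>M\<^esub>) a ` carrier M" using r v by auto
  qed
  show "(\<odot>\<^bsub>M\<^esub>) a ` carrier M \<subseteq> ideal_times R M (Idl {a}) (carrier M)"
    using ideal_times_mem R.genideal_self'[OF a] by auto
qed

lemma smult_max_ideal_proper:
  assumes "carrier M \<noteq> {\<zero>\<^bsub>M\<^esub>}" "a \<in> \<mm>"
  shows "(\<odot>\<^bsub>M\<^esub>) a ` carrier M \<noteq> carrier M"
proof
  assume eq: "(\<odot>\<^bsub>M\<^esub>) a ` carrier M = carrier M"
  have "carrier M \<subseteq> ideal_times R M \<mm> (carrier M)"
    using ideal_times_mem[OF assms(2), of _ "carrier M"] eq by (metis image_subsetI)
  also have "\<dots> \<subseteq> ideal_times R M \<mm> (carrier M) <+>\<^bsub>M\<^esub> {\<zero>\<^bsub>M\<^esub>}"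
    by (rule set_add_upper(1)[OF max_ideal_times_submodule[OF carrier_is_submodule] submodule_zero])
  finally have "carrier M \<subseteq> {\<zero>\<^bsub>M\<^esub>}" by (rule nakayama[OF carrier_is_submodule submodule_zero])
  then show False using assms(1) M.zero_closed by blast
qed

lemma pow_e_eq:
  assumes "a \<in> \<mm>"
  shows "\<exists>r\<in>carrier R. a [^] e = r \<otimes> t"
proof -
  have "a \<in> Q (Suc 0)" using assms max_ideal_pow_1 by simp
  from max_ideal_pow_nat_pow[OF this, of e] have "a [^] e \<in> PIdl t" using t_reduction by auto
  then show ?thesis by (auto simp: cgenideal_def)
qed

text \<open>
  For a regular sequence \<open>a, b\<close>, the element \<open>t\<close> divides a power of \<open>b\<close>, so it is regular on \<open>M / a M\<close>.
  Hence \<open>a\<close> is regular on \<open>M / t M\<close>, where it is nilpotent.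
\<close>

lemma regular_sequence_length_le_1:
  assumes nz: "carrier M \<noteq> {\<zero>\<^bsub>M\<^esub>}" and xs: "set xs \<subseteq> \<mm>" "regular_sequence R M xs"
  shows "length xs \<le> 1"
proof (rule ccontr)
  assume "\<not> length xs \<le> 1"
  then obtain a b ys where xs': "xs = a # b # ys" by (cases xs; cases "tl xs") auto
  have ab: "a \<in> \<mm>" "b \<in> \<mm>" and abc: "a \<in> carrier R" "b \<in> carrier R" using xs(1) xs' by auto
  have tc: "t \<in> carrier R" using t_mem by simp
  let ?aM = "(\<odot>\<^bsub>M\<^esub>) a ` carrier M" and ?tM = "(\<odot>\<^bsub>M\<^esub>) t ` carrier M"
  have reg: "\<forall>v\<in>carrier M. xs ! i \<odot>\<^bsub>M\<^esub> v \<in> ideal_smult R (genideal R (set (take i xs))) M \<longrightarrow>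
      v \<in> ideal_smult R (genideal R (set (take i xs))) M" if "i < length xs" for i
    using xs(2) that unfolding regular_sequence_def by blast
  have "v = \<zero>\<^bsub>M\<^esub>" if "v \<in> carrier M" "a \<odot>\<^bsub>M\<^esub> v = \<zero>\<^bsub>M\<^esub>" for v
    using reg[of 0] that ideal_smult_empty by (simp add: xs')
  then have a: "regular a" using abc by (simp add: regular_def)
  have b: "v \<in> ?aM" if "v \<in> carrier M" "b \<odot>\<^bsub>M\<^esub> v \<in> ?aM" for v
    using reg[of 1] that by (simp add: xs' ideal_smult_principal[OF abc(1)])
  have bn: "v \<in> ?aM" if "v \<in> carrier M" "(b [^] n) \<odot>\<^bsub>M\<^esub> v \<in> ?aM" for v and n :: nat
    using that
  proof (induction n arbitrary: v)
    case (Suc n)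
    have "(b [^] n) \<odot>\<^bsub>M\<^esub> (b \<odot>\<^bsub>M\<^esub> v) \<in> ?aM" using Suc.prems abc by (simp add: smult_assoc1)
    then have "b \<odot>\<^bsub>M\<^esub> v \<in> ?aM" using Suc.IH[of "b \<odot>\<^bsub>M\<^esub> v"] Suc.prems abc by simp
    then show ?case using b Suc.prems by simp
  qed simp
  have tinj: "v \<in> ?aM" if v: "v \<in> carrier M" "t \<odot>\<^bsub>M\<^esub> v \<in> ?aM" for v
  proof -
    obtain r where r: "r \<in> carrier R" "b [^] e = r \<otimes> t" using pow_e_eq[OF ab(2)] by blast
    have "r \<odot>\<^bsub>M\<^esub> (t \<odot>\<^bsub>M\<^esub> v) \<in> ?aM"
      by (rule submodule_mem_simps(4)[OF submodule_smult_image[OF carrier_is_submodule abc(1)] r(1) v(2)])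
    then have "(b [^] e) \<odot>\<^bsub>M\<^esub> v \<in> ?aM" unfolding r(2) using r(1) tc v(1) by (simp add: smult_assoc1)
    then show ?thesis by (rule bn[OF v(1)])
  qed
  have ainj: "v \<in> ?tM" if v: "v \<in> carrier M" "a \<odot>\<^bsub>M\<^esub> v \<in> ?tM" for v
  proof -
    obtain w where w: "w \<in> carrier M" "a \<odot>\<^bsub>M\<^esub> v = t \<odot>\<^bsub>M\<^esub> w" using v(2) by auto
    then have "t \<odot>\<^bsub>M\<^esub> w \<in> ?aM" using v(1) by (metis imageI)
    from tinj[OF w(1) this] obtain w' where w': "w' \<in> carrier M" "w = a \<odot>\<^bsub>M\<^esub> w'" by auto
    have "a \<odot>\<^bsub>M\<^esub> v = a \<odot>\<^bsub>M\<^esub> (t \<odot>\<^bsub>M\<^esub> w')"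
      unfolding w(2) w'(2) by (rule smult_comm[OF tc abc(1) w'(1)])
    then have "v = t \<odot>\<^bsub>M\<^esub> w'" by (rule regular_cancel[OF a v(1) smult_closed[OF tc w'(1)]])
    then show ?thesis using w'(1) by auto
  qed
  have an: "v \<in> ?tM" if "v \<in> carrier M" "(a [^] n) \<odot>\<^bsub>M\<^esub> v \<in> ?tM" for v and n :: nat
    using that
  proof (induction n arbitrary: v)
    case (Suc n)
    have "(a [^] n) \<odot>\<^bsub>M\<^esub> (a \<odot>\<^bsub>M\<^esub> v) \<in> ?tM" using Suc.prems abc by (simp add: smult_assoc1)
    then have "a \<odot>\<^bsub>M\<^esub> v \<in> ?tM" using Suc.IH[of "a \<odot>\<^bsub>M\<^esub> v"] Suc.prems abc by simp
    then show ?case using ainj Suc.prems by simp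
  qed simp
  have "v \<in> ?tM" if v: "v \<in> carrier M" for v
  proof -
    obtain r where r: "r \<in> carrier R" "a [^] e = r \<otimes> t" using pow_e_eq[OF ab(1)] by blast
    have "(a [^] e) \<odot>\<^bsub>M\<^esub> v = t \<odot>\<^bsub>M\<^esub> (r \<odot>\<^bsub>M\<^esub> v)"
      unfolding r(2) using r(1) tc v by (simp add: smult_assoc1 smult_comm)
    then have "(a [^] e) \<odot>\<^bsub>M\<^esub> v \<in> ?tM" using r(1) v by simp
    then show ?thesis by (rule an[OF v])
  qed
  then have "?tM = carrier M" using tc by auto
  then show False using smult_max_ideal_proper[OF nz t_mem] by simp
qed

lemma module_depth_eq_1:
  assumes nz: "carrier M \<noteq> {\<zero>\<^bsub>M\<^esub>}"
  shows "module_depth R M = 1"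
  unfolding module_depth_def
proof (rule antisym)
  show "Sup {enat (length xs) |xs. set xs \<subseteq> \<mm> \<and> regular_sequence R M xs} \<le> 1"
    by (rule Sup_least) (use regular_sequence_length_le_1[OF nz] in \<open>auto simp: one_enat_def\<close>)
  have tc: "t \<in> carrier R" using t_mem by simp
  have "regular_sequence R M [t]"
    unfolding regular_sequence_def
  proof (intro conjI allI impI ballI)
    show "set [t] \<subseteq> carrier R" using tc by simp
    show "ideal_smult R (Idl (set [t])) M \<noteq> carrier M"
      using smult_max_ideal_proper[OF nz t_mem] ideal_smult_principal[OF tc] by simp
    fix i v assume i: "i < length [t]" and v: "v \<in> carrier M"
      and tv: "[t] ! i \<odot>\<^bsub>M\<^esub> v \<in> ideal_smult R (Idl (set (take i [t]))) M"
    have "t \<odot>\<^bsub>M\<^esub> v \<in> {\<zero>\<^bsub>M\<^esub>}" using tv i ideal_smult_empty by simp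
    then have "v = \<zero>\<^bsub>M\<^esub>" using t_regular[OF v] by simp
    then show "v \<in> ideal_smult R (Idl (set (take i [t]))) M" using i ideal_smult_empty by simp
  qed
  then show "1 \<le> Sup {enat (length xs) |xs. set xs \<subseteq> \<mm> \<and> regular_sequence R M xs}"
    using t_mem by (intro Sup_upper) (auto simp: one_enat_def intro!: exI[of _ "[t]"])
qed

lemma annihilator_ideal: "ideal (annihilator R M) R"
proof -
  interpret S: module R "self_module R" by (rule R.self_module_module)
  show ?thesis
    unfolding R.ideal_iff_submodule annihilator_def
    by (rule S.submoduleI') (auto simp: smult_l_distr smult_assoc1)
qed

text \<open>No power of m annihilates M, because powers of t are injective on it. So a prime
  strictly below m contains the annihilator, and the images of this prime and of m form a chain in
  the quotient ring.\<close>

lemma module_dim_eq_1: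
  assumes nz: "carrier M \<noteq> {\<zero>\<^bsub>M\<^esub>}" and dim: "krull_dim R = 1"
  shows "module_dim R M = 1"
proof (rule antisym)
  let ?J = "annihilator R M"
  show "module_dim R M \<le> 1"
    unfolding module_dim_def using R.krull_dim_quotient_le[OF annihilator_ideal] dim by simp
  have "\<not> Q n \<subseteq> ?J" for n
  proof
    assume sub: "Q n \<subseteq> ?J"
    obtain v where v: "v \<in> carrier M" "v \<noteq> \<zero>\<^bsub>M\<^esub>" using nz M.zero_closed by blast
    have "t \<in> Q (Suc 0)" using t_mem max_ideal_pow_1 by simp
    from max_ideal_pow_nat_pow[OF this, of n] have "t [^] n \<in> ?J" using sub by auto
    then have "(t [^] n) \<odot>\<^bsub>M\<^esub> v = \<zero>\<^bsub>M\<^esub>" using v by (simp add: annihilator_def)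
    then show False using t_pow_regular[OF v(1)] v(2) by blast
  qed
  then obtain p where p: "primeideal p R" "?J \<subseteq> p" "p \<subset> \<mm>"
    using exists_nonmaximal_prime[OF annihilator_ideal] by blast
  have m: "primeideal \<mm> R" by (rule R.maximalideal_prime[OF local_ring_max_ideal[OF local]])
  have Jm: "?J \<subseteq> \<mm>" using p by auto
  note ip = R.primeideal_quotient_image[OF annihilator_ideal p(1,2)]
    and im = R.primeideal_quotient_image[OF annihilator_ideal m Jm]
  obtain a where a: "a \<in> \<mm>" "a \<notin> p" using p(3) by auto
  have "?J +> a \<notin> (+>) ?J ` p" using ip(2)[of a] a by simp
  then have "(+>) ?J ` p \<subset> (+>) ?J ` \<mm>" using a p(3) by auto
  then have "enat 1 \<le> krull_dim (R Quot ?J)"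
    by (intro krull_dim_ge[where P = "\<lambda>i. if i = 0 then (+>) ?J ` p else (+>) ?J ` \<mm>"])
      (use ip(1) im(1) in auto)
  then show "1 \<le> module_dim R M" by (simp add: module_dim_def one_enat_def)
qed

lemma maximal_cohen_macaulayI:
  assumes "carrier M \<noteq> {\<zero>\<^bsub>M\<^esub>}" "krull_dim R = 1"
  shows "maximal_cohen_macaulay R M"
  using assms module_axioms fin_gen module_depth_eq_1 module_dim_eq_1
  by (simp add: maximal_cohen_macaulay_def)

end

section \<open>Direct powers, linear forms and endomorphisms\<close>

lemma direct_power_simps [simp]:
  "carrier (direct_power M n) = {..<n} \<rightarrow>\<^sub>E carrier M"
  "\<zero>\<^bsub>direct_power M n\<^esub> = (\<lambda>i\<in>{..<n}. \<zero>\<^bsub>M\<^esub>)"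
  "x \<oplus>\<^bsub>direct_power M n\<^esub> y = (\<lambda>i\<in>{..<n}. x i \<oplus>\<^bsub>M\<^esub> y i)"
  "r \<odot>\<^bsub>direct_power M n\<^esub> x = (\<lambda>i\<in>{..<n}. r \<odot>\<^bsub>M\<^esub> x i)"
  by (simp_all add: direct_power_def)

lemma max_ideal_module_simps [simp]:
  "carrier (max_ideal_module R) = max_ideal R"
  "\<zero>\<^bsub>max_ideal_module R\<^esub> = \<zero>\<^bsub>R\<^esub>"
  "x \<oplus>\<^bsub>max_ideal_module R\<^esub> y = x \<oplus>\<^bsub>R\<^esub> y"
  "a \<odot>\<^bsub>max_ideal_module R\<^esub> x = a \<otimes>\<^bsub>R\<^esub> x"
  by (simp_all add: max_ideal_module_def self_module_def)

lemma direct_sum_simps [simp]: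
  "carrier (direct_sum M N) = carrier M \<times> carrier N"
  "(x, y) \<oplus>\<^bsub>direct_sum M N\<^esub> (x', y') = (x \<oplus>\<^bsub>M\<^esub> x', y \<oplus>\<^bsub>N\<^esub> y')"
  "r \<odot>\<^bsub>direct_sum M N\<^esub> (x, y) = (r \<odot>\<^bsub>M\<^esub> x, r \<odot>\<^bsub>N\<^esub> y)"
  by (simp_all add: direct_sum_def)

context module
begin

lemma direct_power_module: "module R (direct_power M n)"
proof (rule moduleI)
  let ?W = "direct_power M n"
  show "cring R" by (rule R.is_cring)
  show "abelian_group ?W"
  proof (rule abelian_groupI)
    fix x y z assume x: "x \<in> carrier ?W" and y: "y \<in> carrier ?W" and z: "z \<in> carrier ?W"
    show "x \<oplus>\<^bsub>?W\<^esub> y \<in> carrier ?W" using x y by auto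
    show "x \<oplus>\<^bsub>?W\<^esub> y \<oplus>\<^bsub>?W\<^esub> z = x \<oplus>\<^bsub>?W\<^esub> (y \<oplus>\<^bsub>?W\<^esub> z)"
      using x y z by (auto simp: PiE_iff M.a_assoc intro!: restrict_ext)
    show "x \<oplus>\<^bsub>?W\<^esub> y = y \<oplus>\<^bsub>?W\<^esub> x"
      using x y by (auto simp: PiE_iff intro!: restrict_ext M.a_comm)
    show "\<zero>\<^bsub>?W\<^esub> \<oplus>\<^bsub>?W\<^esub> x = x"
      using x by (auto simp: PiE_iff extensional_def restrict_def fun_eq_iff)
    show "\<exists>y\<in>carrier ?W. y \<oplus>\<^bsub>?W\<^esub> x = \<zero>\<^bsub>?W\<^esub>"
      using x by (intro bexI[of _ "\<lambda>i\<in>{..<n}. \<ominus>\<^bsub>M\<^esub> x i"])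
        (auto simp: PiE_iff M.l_neg intro!: restrict_ext)
  qed auto
  show "\<one> \<odot>\<^bsub>?W\<^esub> x = x" if "x \<in> carrier ?W" for x
    using that by (auto simp: PiE_iff extensional_def restrict_def fun_eq_iff)
qed (auto simp: PiE_iff smult_l_distr smult_r_distr smult_assoc1 intro!: restrict_ext)

lemma direct_power_fin_gen:
  assumes "finitely_generated R M"
  shows "finitely_generated R (direct_power M n)"
proof -
  let ?W = "direct_power M n"
  interpret W: module R ?W by (rule direct_power_module)
  obtain S where S: "finite S" "S \<subseteq> carrier M" "submodule_gen R M S = carrier M"
    using assms by (auto simp: finitely_generated_def)
  define single where "single i s = (\<lambda>j\<in>{..<n}. if j = i then s else \<zero>\<^bsub>M\<^esub>)" for i s
  define T where "T = (\<lambda>(i, s). single i s) ` ({..<n} \<times> S)"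
  have single: "single i s \<in> carrier ?W" if "s \<in> carrier M" for i s using that by (auto simp: single_def)
  have T: "finite T" "T \<subseteq> carrier ?W"
  proof -
    show "finite T" unfolding T_def using S(1) by simp
    show "T \<subseteq> carrier ?W"
    proof
      fix x assume "x \<in> T"
      then obtain i s where "s \<in> S" "x = single i s" unfolding T_def by auto
      then show "x \<in> carrier ?W" using single[of s i] S(2) by auto
    qed
  qed
  have "carrier ?W \<subseteq> submodule_gen R ?W T"
    unfolding submodule_gen_def
  proof (rule Inter_greatest)
    fix H assume "H \<in> {H. submodule H R ?W \<and> T \<subseteq> H}"
    then have H: "submodule H R ?W" and TH: "T \<subseteq> H" by auto
    note h = submodule_mem_simps[OF H]
    have sH: "single i s \<in> H" if i: "i < n" and s: "s \<in> carrier M" for i s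
    proof -
      let ?L = "{w \<in> carrier M. single i w \<in> H}"
      have "submodule ?L R M"
      proof (rule submoduleI')
        have "single i \<zero>\<^bsub>M\<^esub> = \<zero>\<^bsub>?W\<^esub>" by (auto simp: single_def)
        then have "single i \<zero>\<^bsub>M\<^esub> \<in> H" by (simp only: h(1))
        then show "\<zero>\<^bsub>M\<^esub> \<in> ?L" by simp
        fix x y assume xy: "x \<in> ?L" "y \<in> ?L"
        then have "single i (x \<oplus>\<^bsub>M\<^esub> y) = single i x \<oplus>\<^bsub>?W\<^esub> single i y"
          by (auto simp: single_def intro!: restrict_ext)
        moreover have "single i x \<oplus>\<^bsub>?W\<^esub> single i y \<in> H" by (rule h(3)) (use xy in simp_all)
        ultimately have "single i (x \<oplus>\<^bsub>M\<^esub> y) \<in> H" by (simp only:)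
        then show "x \<oplus>\<^bsub>M\<^esub> y \<in> ?L" using xy by simp
      next
        fix a x assume a: "a \<in> carrier R" and x: "x \<in> ?L"
        have "single i (a \<odot>\<^bsub>M\<^esub> x) = a \<odot>\<^bsub>?W\<^esub> single i x"
          using a x by (auto simp: single_def intro!: restrict_ext)
        moreover have "a \<odot>\<^bsub>?W\<^esub> single i x \<in> H" by (rule h(4)[OF a]) (use x in simp)
        ultimately have "single i (a \<odot>\<^bsub>M\<^esub> x) \<in> H" by (simp only:)
        then show "a \<odot>\<^bsub>M\<^esub> x \<in> ?L" using a x by simp
      qed auto
      moreover have "S \<subseteq> ?L" using S(2) TH i unfolding T_def by force
      ultimately have "carrier M \<subseteq> ?L" unfolding S(3)[symmetric] by (rule submodule_gen_least)
      then show ?thesis using s by blast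
    qed
    show "carrier ?W \<subseteq> H"
    proof
      fix v assume v: "v \<in> carrier ?W"
      define tr where "tr m = (\<lambda>j\<in>{..<n}. if j < m then v j else \<zero>\<^bsub>M\<^esub>)" for m
      have "m \<le> n \<Longrightarrow> tr m \<in> H" for m
      proof (induction m)
        case 0
        have "tr 0 = \<zero>\<^bsub>?W\<^esub>" by (auto simp: tr_def)
        then show ?case by (simp only: h(1))
      next
        case (Suc m)
        have vm: "v m \<in> carrier M" using v Suc.prems by (auto simp: PiE_iff)
        have "tr (Suc m) = tr m \<oplus>\<^bsub>?W\<^esub> single m (v m)"
          using v vm by (auto simp: tr_def single_def PiE_iff less_Suc_eq intro!: restrict_ext)
        moreover have "tr m \<oplus>\<^bsub>?W\<^esub> single m (v m) \<in> H"
          by (rule h(3)[OF Suc.IH sH]) (use Suc.prems vm in simp_all)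
        ultimately show ?case by (simp only:)
      qed
      moreover have "tr n = v" using v by (auto simp: tr_def PiE_iff extensional_def restrict_def fun_eq_iff)
      ultimately show "v \<in> H" by force
    qed
  qed
  moreover have "submodule_gen R ?W T \<subseteq> carrier ?W"
    by (rule W.submodule_gen_least[OF W.carrier_is_submodule T(2)])
  ultimately show ?thesis unfolding finitely_generated_def using T by blast
qed

end

lemma (in torsion_free_module) direct_power_torsion_free:
  "torsion_free_module R (direct_power M n) t e"
proof -
  interpret W: module R "direct_power M n" by (rule direct_power_module)
  show ?thesis
  proof
    show "finitely_generated R (direct_power M n)" by (rule direct_power_fin_gen[OF fin_gen])
    fix v assume v: "v \<in> carrier (direct_power M n)" and tv: "t \<odot>\<^bsub>direct_power M n\<^esub> v = \<zero>\<^bsub>direct_power M n\<^esub>"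
    have "v i = \<zero>\<^bsub>M\<^esub>" if i: "i < n" for i
    proof -
      have "t \<odot>\<^bsub>M\<^esub> v i = \<zero>\<^bsub>M\<^esub>" using fun_cong[OF tv, of i] i by simp
      then show ?thesis using t_regular v i by (auto simp: PiE_iff)
    qed
    then show "v = \<zero>\<^bsub>direct_power M n\<^esub>"
      using v by (auto simp: PiE_iff extensional_def restrict_def fun_eq_iff)
  qed (use local noetherian noetherian_ring.finetely_gen[OF noetherian] t_mem t_regular_ring t_reduction in auto)
qed

text \<open>A homomorphism to R without the extensionality of \<open>module_hom\<close>, so that
  sums of forms over coordinates can be written as plain functions.\<close>

definition linear_form ::
  "('a, 'c) ring_scheme \<Rightarrow> ('a, 'b, 'd) module_scheme \<Rightarrow> ('b \<Rightarrow> 'a) \<Rightarrow> bool" where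
  "linear_form R M f \<longleftrightarrow> f \<in> carrier M \<rightarrow> carrier R \<and>
     (\<forall>x\<in>carrier M. \<forall>y\<in>carrier M. f (x \<oplus>\<^bsub>M\<^esub> y) = f x \<oplus>\<^bsub>R\<^esub> f y) \<and>
     (\<forall>r\<in>carrier R. \<forall>x\<in>carrier M. f (r \<odot>\<^bsub>M\<^esub> x) = r \<otimes>\<^bsub>R\<^esub> f x)"

lemma linear_formD:
  assumes "linear_form R M f"
  shows "x \<in> carrier M \<Longrightarrow> f x \<in> carrier R"
    and "x \<in> carrier M \<Longrightarrow> y \<in> carrier M \<Longrightarrow> f (x \<oplus>\<^bsub>M\<^esub> y) = f x \<oplus>\<^bsub>R\<^esub> f y"
    and "r \<in> carrier R \<Longrightarrow> x \<in> carrier M \<Longrightarrow> f (r \<odot>\<^bsub>M\<^esub> x) = r \<otimes>\<^bsub>R\<^esub> f x"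
  using assms by (auto simp: linear_form_def)

lemma module_hom_linear_form:
  "f \<in> module_hom R M (self_module R) \<Longrightarrow> linear_form R M f"
  by (auto simp: module_hom_def linear_form_def)

context module
begin

lemma linear_form_zero: "linear_form R M f \<Longrightarrow> f \<zero>\<^bsub>M\<^esub> = \<zero>"
  using linear_formD(3)[of R M f \<zero> "\<zero>\<^bsub>M\<^esub>"] linear_formD(1)[of R M f "\<zero>\<^bsub>M\<^esub>"] by simp

lemma linear_form_image_submodule:
  assumes f: "linear_form R M f" and H: "submodule H R M"
  shows "submodule (f ` H) R (self_module R)"
proof -
  interpret S: module R "self_module R" by (rule R.self_module_module)
  note h = submodule_mem_simps[OF H] and fd = linear_formD[OF f]
  show ?thesis
  proof (rule S.submoduleI')
    show "f ` H \<subseteq> carrier (self_module R)" using h(2) fd(1) by auto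
    show "\<zero>\<^bsub>self_module R\<^esub> \<in> f ` H" using linear_form_zero[OF f] h(1) by force
    fix x y assume "x \<in> f ` H" "y \<in> f ` H"
    then obtain u v where uv: "u \<in> H" "v \<in> H" "x = f u" "y = f v" by auto
    have "x \<oplus>\<^bsub>self_module R\<^esub> y = f (u \<oplus>\<^bsub>M\<^esub> v)" using uv fd(2)[OF h(2) h(2)] by simp
    then show "x \<oplus>\<^bsub>self_module R\<^esub> y \<in> f ` H" using h(3)[OF uv(1,2)] by auto
  next
    fix r x assume r: "r \<in> carrier R" and "x \<in> f ` H"
    then obtain u where u: "u \<in> H" "x = f u" by auto
    have "r \<odot>\<^bsub>self_module R\<^esub> x = f (r \<odot>\<^bsub>M\<^esub> u)" using u fd(3)[OF r h(2)[OF u(1)]] by simp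
    then show "r \<odot>\<^bsub>self_module R\<^esub> x \<in> f ` H" using h(4)[OF r u(1)] by auto
  qed
qed

lemma linear_form_finsum:
  assumes f: "\<And>i. i < n \<Longrightarrow> linear_form R M (f i)"
  shows "linear_form R (direct_power M n) (\<lambda>v. \<Oplus>i\<in>{..<n}. f i (v i))"
  unfolding linear_form_def
proof (intro conjI ballI)
  have fc: "(\<lambda>i. f i (v i)) \<in> {..<n} \<rightarrow> carrier R" if "v \<in> carrier (direct_power M n)" for v
    using that linear_formD(1)[OF f] by (auto simp: PiE_iff)
  show "(\<lambda>v. \<Oplus>i\<in>{..<n}. f i (v i)) \<in> carrier (direct_power M n) \<rightarrow> carrier R"
    using fc by (auto intro!: R.finsum_closed)
  fix x y assume x: "x \<in> carrier (direct_power M n)" and y: "y \<in> carrier (direct_power M n)"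
  have "(\<Oplus>i\<in>{..<n}. f i ((x \<oplus>\<^bsub>direct_power M n\<^esub> y) i)) = (\<Oplus>i\<in>{..<n}. f i (x i) \<oplus> f i (y i))"
  proof (rule R.finsum_cong'[OF refl])
    show "(\<lambda>i. f i (x i) \<oplus> f i (y i)) \<in> {..<n} \<rightarrow> carrier R" using fc[OF x] fc[OF y] by auto
    fix i assume "i \<in> {..<n}"
    then show "f i ((x \<oplus>\<^bsub>direct_power M n\<^esub> y) i) = f i (x i) \<oplus> f i (y i)"
      using linear_formD(2)[OF f, of i "x i" "y i"] x y by (auto simp: PiE_iff)
  qed
  also have "\<dots> = (\<Oplus>i\<in>{..<n}. f i (x i)) \<oplus> (\<Oplus>i\<in>{..<n}. f i (y i))"
    by (rule R.finsum_addf[OF fc[OF x] fc[OF y]])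
  finally show "(\<Oplus>i\<in>{..<n}. f i ((x \<oplus>\<^bsub>direct_power M n\<^esub> y) i)) = (\<Oplus>i\<in>{..<n}. f i (x i)) \<oplus> (\<Oplus>i\<in>{..<n}. f i (y i))" .
next
  have fc: "(\<lambda>i. f i (v i)) \<in> {..<n} \<rightarrow> carrier R" if "v \<in> carrier (direct_power M n)" for v
    using that linear_formD(1)[OF f] by (auto simp: PiE_iff)
  fix r x assume r: "r \<in> carrier R" and x: "x \<in> carrier (direct_power M n)"
  have "(\<Oplus>i\<in>{..<n}. f i ((r \<odot>\<^bsub>direct_power M n\<^esub> x) i)) = (\<Oplus>i\<in>{..<n}. r \<otimes> f i (x i))"
  proof (rule R.finsum_cong'[OF refl])
    show "(\<lambda>i. r \<otimes> f i (x i)) \<in> {..<n} \<rightarrow> carrier R" using fc[OF x] r by auto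
    fix i assume "i \<in> {..<n}"
    then show "f i ((r \<odot>\<^bsub>direct_power M n\<^esub> x) i) = r \<otimes> f i (x i)"
      using linear_formD(3)[OF f, of i r "x i"] x r by (auto simp: PiE_iff)
  qed
  also have "\<dots> = r \<otimes> (\<Oplus>i\<in>{..<n}. f i (x i))"
    by (rule R.finsum_rdistr[symmetric]) (use r fc[OF x] in auto)
  finally show "(\<Oplus>i\<in>{..<n}. f i ((r \<odot>\<^bsub>direct_power M n\<^esub> x) i)) = r \<otimes> (\<Oplus>i\<in>{..<n}. f i (x i))" .
qed

end

section \<open>The endomorphism ring of the maximal ideal\<close>

lemma max_endo_ring_simps [simp]:
  "\<zero>\<^bsub>max_endo_ring R\<^esub> = (\<lambda>x\<in>max_ideal R. \<zero>\<^bsub>R\<^esub>)"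
  "\<one>\<^bsub>max_endo_ring R\<^esub> = (\<lambda>x\<in>max_ideal R. x)"
  "f \<oplus>\<^bsub>max_endo_ring R\<^esub> g = (\<lambda>x\<in>max_ideal R. f x \<oplus>\<^bsub>R\<^esub> g x)"
  "f \<otimes>\<^bsub>max_endo_ring R\<^esub> g = compose (max_ideal R) f g"
  by (simp_all add: max_endo_ring_def endo_ring_def)

lemma max_endo_carrier_iff:
  "f \<in> carrier (max_endo_ring R) \<longleftrightarrow> f \<in> max_ideal R \<rightarrow>\<^sub>E max_ideal R \<and>
    (\<forall>x\<in>max_ideal R. \<forall>y\<in>max_ideal R. f (x \<oplus>\<^bsub>R\<^esub> y) = f x \<oplus>\<^bsub>R\<^esub> f y) \<and>
    (\<forall>r\<in>carrier R. \<forall>x\<in>max_ideal R. f (r \<otimes>\<^bsub>R\<^esub> x) = r \<otimes>\<^bsub>R\<^esub> f x)"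
  by (auto simp: max_endo_ring_def endo_ring_def module_hom_def)

lemma max_endo_eqI:
  assumes "f \<in> carrier (max_endo_ring R)" "g \<in> carrier (max_endo_ring R)"
    and "\<And>x. x \<in> max_ideal R \<Longrightarrow> f x = g x"
  shows "f = g"
  using assms by (auto simp: max_endo_carrier_iff intro: PiE_ext)

context local_noetherian_module
begin

lemma max_ideal_closed:
  shows "\<zero> \<in> \<mm>" and "a \<in> \<mm> \<Longrightarrow> b \<in> \<mm> \<Longrightarrow> a \<oplus> b \<in> \<mm>" and "a \<in> \<mm> \<Longrightarrow> \<ominus> a \<in> \<mm>"
    and "r \<in> carrier R \<Longrightarrow> a \<in> \<mm> \<Longrightarrow> r \<otimes> a \<in> \<mm>"
proof -
  have s: "additive_subgroup \<mm> R" by (rule ideal.axioms(1)[OF max_ideal_ideal])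
  show "\<zero> \<in> \<mm>" by (rule additive_subgroup.zero_closed[OF s])
  show "a \<in> \<mm> \<Longrightarrow> b \<in> \<mm> \<Longrightarrow> a \<oplus> b \<in> \<mm>" by (rule additive_subgroup.a_closed[OF s])
  show rm: "r \<in> carrier R \<Longrightarrow> a \<in> \<mm> \<Longrightarrow> r \<otimes> a \<in> \<mm>" for r a by (rule ideal.I_l_closed[OF max_ideal_ideal])
  show "a \<in> \<mm> \<Longrightarrow> \<ominus> a \<in> \<mm>" using rm[of "\<ominus> \<one>" a] by (simp add: R.l_minus)
qed

text \<open>The fourth fact lets f be treated as multiplication by a fraction f(y) / y: both of its
  sides equal f (x y).\<close>

lemma max_endoD:
  assumes "f \<in> carrier (max_endo_ring R)"
  shows "x \<in> \<mm> \<Longrightarrow> f x \<in> \<mm>"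
    and "x \<in> \<mm> \<Longrightarrow> y \<in> \<mm> \<Longrightarrow> f (x \<oplus> y) = f x \<oplus> f y"
    and "r \<in> carrier R \<Longrightarrow> x \<in> \<mm> \<Longrightarrow> f (r \<otimes> x) = r \<otimes> f x"
    and "x \<in> \<mm> \<Longrightarrow> y \<in> \<mm> \<Longrightarrow> x \<otimes> f y = y \<otimes> f x"
proof -
  show 1: "x \<in> \<mm> \<Longrightarrow> f x \<in> \<mm>" for x using assms by (auto simp: max_endo_carrier_iff PiE_iff)
  show "x \<in> \<mm> \<Longrightarrow> y \<in> \<mm> \<Longrightarrow> f (x \<oplus> y) = f x \<oplus> f y" using assms by (auto simp: max_endo_carrier_iff)
  show 3: "r \<in> carrier R \<Longrightarrow> x \<in> \<mm> \<Longrightarrow> f (r \<otimes> x) = r \<otimes> f x" for r x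
    using assms by (auto simp: max_endo_carrier_iff)
  assume xy: "x \<in> \<mm>" "y \<in> \<mm>"
  have "x \<otimes> f y = f (x \<otimes> y)" using 3[of x y] xy by simp
  also have "\<dots> = f (y \<otimes> x)" using xy R.m_comm[of x y] by simp
  also have "\<dots> = y \<otimes> f x" using 3[of y x] xy by simp
  finally show "x \<otimes> f y = y \<otimes> f x" .
qed

text \<open>Commutativity of composition is where the regular element c enters: c (c f(g(x))) = x
  f(c) g(c) is symmetric in f and g.\<close>

lemma max_endo_ring_cring:
  assumes c: "c \<in> \<mm>" "\<And>a. a \<in> carrier R \<Longrightarrow> c \<otimes> a = \<zero> \<Longrightarrow> a = \<zero>"
  shows "cring (max_endo_ring R)"
proof (rule cringI)
  let ?E = "max_endo_ring R"
  note m = max_ideal_closed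
  have cancel: "a = b" if ab: "a \<in> carrier R" "b \<in> carrier R" "c \<otimes> a = c \<otimes> b" for a b
  proof -
    have "c \<otimes> (a \<ominus> b) = \<zero>" using ab c(1) by (simp add: a_minus_def R.r_distr R.r_minus R.r_neg)
    then have "a \<ominus> b = \<zero>" using c(2) ab by simp
    then show ?thesis using ab by simp
  qed
  have add: "f \<oplus>\<^bsub>?E\<^esub> g \<in> carrier ?E" if f: "f \<in> carrier ?E" and g: "g \<in> carrier ?E" for f g
    using max_endoD[OF f] max_endoD[OF g] m
    by (auto simp: max_endo_carrier_iff R.a_ac R.r_distr)
  have mult: "f \<otimes>\<^bsub>?E\<^esub> g \<in> carrier ?E" if f: "f \<in> carrier ?E" and g: "g \<in> carrier ?E" for f g
    using max_endoD[OF f] max_endoD[OF g] m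
    by (auto simp: max_endo_carrier_iff compose_def)
  have one: "\<one>\<^bsub>?E\<^esub> \<in> carrier ?E" using m by (auto simp: max_endo_carrier_iff)
  have zero: "\<zero>\<^bsub>?E\<^esub> \<in> carrier ?E" using m by (auto simp: max_endo_carrier_iff)
  show "abelian_group ?E"
  proof (rule abelian_groupI)
    fix f assume f: "f \<in> carrier ?E"
    let ?g = "\<lambda>x\<in>\<mm>. \<ominus> f x"
    have g: "?g \<in> carrier ?E"
      using max_endoD[OF f] m by (auto simp: max_endo_carrier_iff R.minus_add R.r_minus)
    show "\<exists>g\<in>carrier ?E. g \<oplus>\<^bsub>?E\<^esub> f = \<zero>\<^bsub>?E\<^esub>"
      using g max_endoD(1)[OF f] by (intro bexI[of _ ?g]) (auto simp: R.l_neg intro!: restrict_ext)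
    show "\<zero>\<^bsub>?E\<^esub> \<oplus>\<^bsub>?E\<^esub> f = f"
      by (rule max_endo_eqI[OF add[OF zero f] f]) (use max_endoD(1)[OF f] in auto)
  next
    fix f g h assume f: "f \<in> carrier ?E" and g: "g \<in> carrier ?E" and h: "h \<in> carrier ?E"
    show "f \<oplus>\<^bsub>?E\<^esub> g \<oplus>\<^bsub>?E\<^esub> h = f \<oplus>\<^bsub>?E\<^esub> (g \<oplus>\<^bsub>?E\<^esub> h)"
      using max_endoD(1)[OF f] max_endoD(1)[OF g] max_endoD(1)[OF h]
      by (auto simp: R.a_assoc intro!: restrict_ext)
  next
    fix f g assume f: "f \<in> carrier ?E" and g: "g \<in> carrier ?E"
    show "f \<oplus>\<^bsub>?E\<^esub> g = g \<oplus>\<^bsub>?E\<^esub> f"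
      using max_endoD(1)[OF f] max_endoD(1)[OF g] by (auto simp: R.a_comm intro!: restrict_ext)
  qed (use add zero in blast)+
  show "Group.comm_monoid ?E"
  proof (rule comm_monoidI)
    fix f g assume f: "f \<in> carrier ?E" and g: "g \<in> carrier ?E"
    show "f \<otimes>\<^bsub>?E\<^esub> g \<in> carrier ?E" by (rule mult[OF f g])
    show "f \<otimes>\<^bsub>?E\<^esub> g = g \<otimes>\<^bsub>?E\<^esub> f"
    proof (rule max_endo_eqI[OF mult[OF f g] mult[OF g f]])
      fix x assume x: "x \<in> \<mm>"
      note fd = max_endoD[OF f] and gd = max_endoD[OF g]
      have "c \<otimes> (c \<otimes> f (g x)) = c \<otimes> (g x \<otimes> f c)" using fd(4)[OF c(1) gd(1)[OF x]] by simp
      also have "\<dots> = (c \<otimes> g x) \<otimes> f c" using c(1) gd(1)[OF x] fd(1)[OF c(1)] by (simp add: R.m_assoc)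
      also have "\<dots> = (x \<otimes> g c) \<otimes> f c" using gd(4)[OF c(1) x] by simp
      also have "\<dots> = (x \<otimes> f c) \<otimes> g c" using x gd(1)[OF c(1)] fd(1)[OF c(1)] by (simp add: R.m_ac)
      also have "\<dots> = (c \<otimes> f x) \<otimes> g c" using fd(4)[OF c(1) x] by simp
      also have "\<dots> = c \<otimes> (f x \<otimes> g c)" using c(1) fd(1)[OF x] gd(1)[OF c(1)] by (simp add: R.m_assoc)
      also have "\<dots> = c \<otimes> (c \<otimes> g (f x))" using gd(4)[OF c(1) fd(1)[OF x]] by simp
      finally have "c \<otimes> f (g x) = c \<otimes> g (f x)"
        by (rule cancel[rotated 2]) (use c(1) fd(1) gd(1) x in auto)
      then have "f (g x) = g (f x)" by (rule cancel[rotated 2]) (use fd(1) gd(1) x in auto)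
      then show "(f \<otimes>\<^bsub>?E\<^esub> g) x = (g \<otimes>\<^bsub>?E\<^esub> f) x" using x by (simp add: compose_def)
    qed
  next
    fix f g h assume f: "f \<in> carrier ?E" and g: "g \<in> carrier ?E" and h: "h \<in> carrier ?E"
    show "f \<otimes>\<^bsub>?E\<^esub> g \<otimes>\<^bsub>?E\<^esub> h = f \<otimes>\<^bsub>?E\<^esub> (g \<otimes>\<^bsub>?E\<^esub> h)"
      using max_endoD(1)[OF h] by (auto simp: compose_def intro!: restrict_ext)
  next
    fix f assume f: "f \<in> carrier ?E"
    show "\<one>\<^bsub>?E\<^esub> \<otimes>\<^bsub>?E\<^esub> f = f"
      by (rule max_endo_eqI[OF mult[OF one f] f]) (use max_endoD(1)[OF f] in \<open>auto simp: compose_def\<close>)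
  qed (rule one)
  fix f g h assume f: "f \<in> carrier ?E" and g: "g \<in> carrier ?E" and h: "h \<in> carrier ?E"
  show "(f \<oplus>\<^bsub>?E\<^esub> g) \<otimes>\<^bsub>?E\<^esub> h = f \<otimes>\<^bsub>?E\<^esub> h \<oplus>\<^bsub>?E\<^esub> g \<otimes>\<^bsub>?E\<^esub> h"
    using max_endoD(1)[OF h] by (auto simp: compose_def intro!: restrict_ext)
qed

end

section \<open>The action of the endomorphism ring\<close>

text \<open>M is closed under fractions a / c with a in m^k, as a module over the blowup algebra
  would be. These conditions pass to direct powers coordinatewise, so no multiplicity of a direct
  power has to be computed.\<close>

locale blowup_module = torsion_free_module R M t e
  for R :: "('a, 'c) ring_scheme" (structure) and M :: "('a, 'b, 'd) module_scheme" (structure)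
    and t :: 'a and e :: nat +
  fixes c :: 'a and k :: nat
  assumes k_pos: "k \<ge> 1" and c_mem: "c \<in> max_ideal_pow R k"
    and c_regular: "\<And>v. v \<in> carrier M \<Longrightarrow> c \<odot>\<^bsub>M\<^esub> v = \<zero>\<^bsub>M\<^esub> \<Longrightarrow> v = \<zero>\<^bsub>M\<^esub>"
    and c_regular_ring: "\<And>a. a \<in> carrier R \<Longrightarrow> c \<otimes> a = \<zero> \<Longrightarrow> a = \<zero>"
    and c_divides: "\<And>a v. a \<in> max_ideal_pow R k \<Longrightarrow> v \<in> carrier M \<Longrightarrow> \<exists>w\<in>carrier M. a \<odot>\<^bsub>M\<^esub> v = c \<odot>\<^bsub>M\<^esub> w"
begin

abbreviation E where "E \<equiv> max_endo_ring R"

lemma c_carrier [simp]: "c \<in> carrier R"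
  using c_mem by simp

lemma c_max_ideal: "c \<in> \<mm>"
  using c_mem max_ideal_pow_antimono[OF k_pos] max_ideal_pow_1 by auto

lemma regular_c: "regular c"
  using c_regular by (simp add: regular_def)

lemma c_cancel_ring:
  assumes "a \<in> carrier R" "b \<in> carrier R" "c \<otimes> a = c \<otimes> b"
  shows "a = b"
proof -
  have "c \<otimes> (a \<ominus> b) = \<zero>" using assms by (simp add: a_minus_def R.r_distr R.r_minus R.r_neg)
  then have "a \<ominus> b = \<zero>" using c_regular_ring assms by simp
  then show ?thesis using assms by simp
qed

lemma E_cring: "cring E"
  by (rule max_endo_ring_cring[OF c_max_ideal c_regular_ring])

text \<open>On a product b z with b in m, the value is z alpha(b). It follows that alpha(c) lies in
  m^k, so c divides alpha(c) M.\<close>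

lemma E_apply_Q:
  assumes \<alpha>: "\<alpha> \<in> carrier E" and a: "a \<in> Q (Suc n)"
  shows "\<alpha> a \<in> Q (Suc n)"
proof -
  interpret S: torsion_free_module R "self_module R" t e by (rule torsion_free_self)
  have sub: "Q (Suc n) \<subseteq> \<mm>" using max_ideal_pow_antimono[of "Suc 0" "Suc n"] max_ideal_pow_1 by simp
  note Qc = max_ideal_pow_closed[where k = "Suc n"]
  let ?L = "{z \<in> \<mm>. \<alpha> z \<in> Q (Suc n)}"
  have "submodule ?L R (self_module R)"
  proof (rule S.submoduleI')
    have "\<alpha> \<zero> = \<zero>" using max_endoD(3)[OF \<alpha>, of \<zero> \<zero>] max_endoD(1)[OF \<alpha>, of \<zero>] max_ideal_closed(1) by simp
    then show "\<zero>\<^bsub>self_module R\<^esub> \<in> ?L" using max_ideal_closed(1) max_ideal_pow_closed(1) by simp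
  qed (use max_endoD[OF \<alpha>] max_ideal_closed Qc in auto)
  then have "Q (Suc n) \<subseteq> ?L"
    unfolding max_ideal_pow_Suc
  proof (rule S.ideal_times_least)
    fix b z assume b: "b \<in> \<mm>" and z: "z \<in> Q n"
    have zc: "z \<in> carrier R" using z by simp
    have "\<alpha> (b \<otimes> z) = z \<otimes> \<alpha> b"
      using max_endoD(3)[OF \<alpha> zc b] b zc by (simp add: R.m_comm)
    moreover have "z \<otimes> \<alpha> b \<in> Q (n + Suc 0)"
      by (rule max_ideal_pow_mult[OF z]) (use max_endoD(1)[OF \<alpha> b] max_ideal_pow_1 in simp)
    moreover have "b \<otimes> z \<in> \<mm>" using max_ideal_closed(4)[OF zc b] b zc by (simp add: R.m_comm)
    ultimately show "b \<odot>\<^bsub>self_module R\<^esub> z \<in> {z \<in> \<mm>. \<alpha> z \<in> ideal_times R (self_module R) \<mm> (Q n)}"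
      by (simp add: max_ideal_pow_Suc)
  qed
  then show ?thesis using a by blast
qed

lemma E_apply_c: "\<alpha> \<in> carrier E \<Longrightarrow> \<alpha> c \<in> Q k"
  using E_apply_Q[of \<alpha> c "k - 1"] k_pos c_mem by simp

text \<open>The endomorphism \<open>\<alpha>\<close> acts as the fraction \<open>\<alpha>(c) / c\<close>.\<close>

definition act :: "('a \<Rightarrow> 'a) \<Rightarrow> 'b \<Rightarrow> 'b" where
  "act \<alpha> v = (THE w. w \<in> carrier M \<and> c \<odot>\<^bsub>M\<^esub> w = \<alpha> c \<odot>\<^bsub>M\<^esub> v)"

lemma act:
  assumes "\<alpha> \<in> carrier E" "v \<in> carrier M"
  shows "act \<alpha> v \<in> carrier M" "c \<odot>\<^bsub>M\<^esub> act \<alpha> v = \<alpha> c \<odot>\<^bsub>M\<^esub> v"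
proof -
  obtain w where w: "w \<in> carrier M" "\<alpha> c \<odot>\<^bsub>M\<^esub> v = c \<odot>\<^bsub>M\<^esub> w"
    using c_divides[OF E_apply_c[OF assms(1)] assms(2)] by blast
  have "act \<alpha> v \<in> carrier M \<and> c \<odot>\<^bsub>M\<^esub> act \<alpha> v = \<alpha> c \<odot>\<^bsub>M\<^esub> v"
    unfolding act_def
  proof (rule theI[of _ w])
    fix u assume "u \<in> carrier M \<and> c \<odot>\<^bsub>M\<^esub> u = \<alpha> c \<odot>\<^bsub>M\<^esub> v"
    then show "u = w" using regular_cancel[OF regular_c, of u w] w by simp
  qed (use w in simp)
  then show "act \<alpha> v \<in> carrier M" "c \<odot>\<^bsub>M\<^esub> act \<alpha> v = \<alpha> c \<odot>\<^bsub>M\<^esub> v" by auto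
qed

lemma act_eqI:
  assumes "\<alpha> \<in> carrier E" "v \<in> carrier M" "w \<in> carrier M" "c \<odot>\<^bsub>M\<^esub> w = \<alpha> c \<odot>\<^bsub>M\<^esub> v"
  shows "act \<alpha> v = w"
  by (rule regular_cancel[OF regular_c act(1)[OF assms(1,2)] assms(3)])
    (simp only: act(2)[OF assms(1,2)] assms(4))

lemma homothety_E: "r \<in> carrier R \<Longrightarrow> homothety (max_ideal_module R) r \<in> carrier E"
  using max_ideal_closed by (auto simp: max_endo_carrier_iff homothety_def R.r_distr intro: R.m_lcomm)

lemma act_homothety:
  assumes "r \<in> carrier R" "v \<in> carrier M"
  shows "act (homothety (max_ideal_module R) r) v = r \<odot>\<^bsub>M\<^esub> v"
  by (rule act_eqI[OF homothety_E[OF assms(1)] assms(2)])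
    (use assms c_max_ideal in \<open>simp_all add: homothety_def smult_assoc1 smult_comm\<close>)

lemma linear_form_act:
  assumes f: "linear_form R M f" and \<alpha>: "\<alpha> \<in> carrier E" and v: "v \<in> carrier M"
  shows "c \<otimes> f (act \<alpha> v) = \<alpha> c \<otimes> f v"
proof -
  have "c \<otimes> f (act \<alpha> v) = f (c \<odot>\<^bsub>M\<^esub> act \<alpha> v)"
    using linear_formD(3)[OF f c_carrier act(1)[OF \<alpha> v]] by simp
  also have "\<dots> = \<alpha> c \<otimes> f v"
    unfolding act(2)[OF \<alpha> v] using linear_formD(3)[OF f _ v] E_apply_c[OF \<alpha>] by simp
  finally show ?thesis .
qed

end

text \<open>The fraction u / c need not lie in M. The last condition only asks for z u / c with z in
  m, which is what a section on m requires.\<close>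

locale split_module = blowup_module R M t e c k
  for R :: "('a, 'c) ring_scheme" (structure) and M :: "('a, 'b, 'd) module_scheme" (structure)
    and t :: 'a and e :: nat and c :: 'a and k :: nat +
  fixes f :: "'b \<Rightarrow> 'a" and u :: 'b
  assumes f: "linear_form R M f" and f_max: "\<And>v. v \<in> carrier M \<Longrightarrow> f v \<in> max_ideal R"
    and u: "u \<in> carrier M" "f u = c"
    and u_divisible: "\<And>z. z \<in> max_ideal R \<Longrightarrow> \<exists>w\<in>carrier M. z \<odot>\<^bsub>M\<^esub> u = c \<odot>\<^bsub>M\<^esub> w"
begin

definition lift :: "'a \<Rightarrow> 'b" where
  "lift z = (THE w. w \<in> carrier M \<and> c \<odot>\<^bsub>M\<^esub> w = z \<odot>\<^bsub>M\<^esub> u)"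

lemma lift:
  assumes "z \<in> \<mm>"
  shows "lift z \<in> carrier M" "c \<odot>\<^bsub>M\<^esub> lift z = z \<odot>\<^bsub>M\<^esub> u"
proof -
  obtain w where w: "w \<in> carrier M" "z \<odot>\<^bsub>M\<^esub> u = c \<odot>\<^bsub>M\<^esub> w" using u_divisible[OF assms] by blast
  have "lift z \<in> carrier M \<and> c \<odot>\<^bsub>M\<^esub> lift z = z \<odot>\<^bsub>M\<^esub> u"
    unfolding lift_def
  proof (rule theI[of _ w])
    fix v assume "v \<in> carrier M \<and> c \<odot>\<^bsub>M\<^esub> v = z \<odot>\<^bsub>M\<^esub> u"
    then show "v = w" using regular_cancel[OF regular_c, of v w] w by simp
  qed (use w in simp)
  then show "lift z \<in> carrier M" "c \<odot>\<^bsub>M\<^esub> lift z = z \<odot>\<^bsub>M\<^esub> u" by auto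
qed

lemma lift_eqI:
  assumes "z \<in> \<mm>" "w \<in> carrier M" "c \<odot>\<^bsub>M\<^esub> w = z \<odot>\<^bsub>M\<^esub> u"
  shows "lift z = w"
  by (rule regular_cancel[OF regular_c lift(1)[OF assms(1)] assms(2)])
    (simp only: lift(2)[OF assms(1)] assms(3))

lemma lift_add:
  assumes "y \<in> \<mm>" "z \<in> \<mm>"
  shows "lift (y \<oplus> z) = lift y \<oplus>\<^bsub>M\<^esub> lift z"
proof (rule lift_eqI)
  show "c \<odot>\<^bsub>M\<^esub> (lift y \<oplus>\<^bsub>M\<^esub> lift z) = (y \<oplus> z) \<odot>\<^bsub>M\<^esub> u"
    using lift[OF assms(1)] lift[OF assms(2)] u(1) assms by (simp add: smult_r_distr smult_l_distr)
qed (use assms lift max_ideal_closed in auto)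

lemma lift_smult:
  assumes "r \<in> carrier R" "z \<in> \<mm>"
  shows "lift (r \<otimes> z) = r \<odot>\<^bsub>M\<^esub> lift z"
proof (rule lift_eqI)
  show "c \<odot>\<^bsub>M\<^esub> (r \<odot>\<^bsub>M\<^esub> lift z) = (r \<otimes> z) \<odot>\<^bsub>M\<^esub> u"
    using smult_comm[OF c_carrier assms(1) lift(1)[OF assms(2)]] lift(2)[OF assms(2)] u(1) assms
    by (simp add: smult_assoc1)
qed (use assms lift max_ideal_closed in auto)

lemma f_lift:
  assumes z: "z \<in> \<mm>"
  shows "f (lift z) = z"
proof (rule c_cancel_ring)
  have "c \<otimes> f (lift z) = f (z \<odot>\<^bsub>M\<^esub> u)"
    using linear_formD(3)[OF f c_carrier lift(1)[OF z]] lift(2)[OF z] by simp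
  also have "\<dots> = z \<otimes> c" using linear_formD(3)[OF f _ u(1), of z] u(2) z by simp
  finally show "c \<otimes> f (lift z) = c \<otimes> z" using z by (simp add: R.m_comm)
qed (use z lift linear_formD(1)[OF f] in auto)

abbreviation K :: "'b set" where "K \<equiv> {v \<in> carrier M. f v = \<zero>}"

lemma K_submodule: "submodule K R M"
  by (rule submoduleI') (use linear_formD[OF f] linear_form_zero[OF f] in auto)

lemma minus_lift_mem_K:
  assumes v: "v \<in> carrier M"
  shows "v \<ominus>\<^bsub>M\<^esub> lift (f v) \<in> K"
proof -
  note s = lift(1)[OF f_max[OF v]]
  have d: "v \<ominus>\<^bsub>M\<^esub> lift (f v) \<in> carrier M" using v s by simp
  have "f v = f (v \<ominus>\<^bsub>M\<^esub> lift (f v)) \<oplus> f v"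
    using linear_formD(2)[OF f d s] minus_add_cancel(3)[OF v s] f_lift[OF f_max[OF v]] by simp
  then have "f (v \<ominus>\<^bsub>M\<^esub> lift (f v)) = \<zero>"
    using linear_formD(1)[OF f v] linear_formD(1)[OF f d] by (metis R.add.r_cancel_one')
  then show ?thesis using d by simp
qed

lemma direct_summand_max_ideal: "direct_summand R (max_ideal_module R) M"
  unfolding direct_summand_def
proof (intro exI conjI)
  let ?A = "lift ` \<mm>"
  show A: "submodule ?A R M"
  proof (rule submoduleI')
    show "?A \<subseteq> carrier M" using lift(1) by auto
    have "lift \<zero> = \<zero>\<^bsub>M\<^esub>" by (rule lift_eqI) (use max_ideal_closed(1) u(1) in auto)
    then show "\<zero>\<^bsub>M\<^esub> \<in> ?A" using max_ideal_closed(1) by force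
    fix x y assume "x \<in> ?A" "y \<in> ?A"
    then obtain a b where "a \<in> \<mm>" "b \<in> \<mm>" "x = lift a" "y = lift b" by auto
    then show "x \<oplus>\<^bsub>M\<^esub> y \<in> ?A" using lift_add[of a b] max_ideal_closed(2)[of a b] by (metis imageI)
  next
    fix r x assume "r \<in> carrier R" "x \<in> ?A"
    then obtain a where "r \<in> carrier R" "a \<in> \<mm>" "x = lift a" by auto
    then show "r \<odot>\<^bsub>M\<^esub> x \<in> ?A" using lift_smult[of r a] max_ideal_closed(4)[of r a] by (metis imageI)
  qed
  show K: "submodule K R M" by (rule K_submodule)
  show "?A \<inter> K = {\<zero>\<^bsub>M\<^esub>}"
  proof
    show "{\<zero>\<^bsub>M\<^esub>} \<subseteq> ?A \<inter> K" using submodule_mem_simps(1)[OF A] submodule_mem_simps(1)[OF K] by simp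
    show "?A \<inter> K \<subseteq> {\<zero>\<^bsub>M\<^esub>}"
    proof
      fix x assume "x \<in> ?A \<inter> K"
      then obtain a where a: "a \<in> \<mm>" "x = lift a" "f x = \<zero>" by auto
      then have "a = \<zero>" using f_lift[OF a(1)] by simp
      moreover have "lift \<zero> = \<zero>\<^bsub>M\<^esub>" by (rule lift_eqI) (use max_ideal_closed(1) u(1) in auto)
      ultimately show "x \<in> {\<zero>\<^bsub>M\<^esub>}" using a(2) by simp
    qed
  qed
  show "?A <+>\<^bsub>M\<^esub> K = carrier M"
  proof
    show "?A <+>\<^bsub>M\<^esub> K \<subseteq> carrier M" by (rule submodule_subset[OF submodule_set_add[OF A K]])
    show "carrier M \<subseteq> ?A <+>\<^bsub>M\<^esub> K"
    proof
      fix v assume v: "v \<in> carrier M"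
      note s = lift(1)[OF f_max[OF v]]
      have "lift (f v) \<oplus>\<^bsub>M\<^esub> (v \<ominus>\<^bsub>M\<^esub> lift (f v)) \<in> ?A <+>\<^bsub>M\<^esub> K"
        using f_max[OF v] minus_lift_mem_K[OF v] by (intro set_addI) auto
      then show "v \<in> ?A <+>\<^bsub>M\<^esub> K" using minus_add_cancel(4)[OF v s] by simp
    qed
  qed
  show "module_iso R (max_ideal_module R) (M\<lparr>carrier := ?A\<rparr>)"
    unfolding module_iso_def
  proof (intro bexI)
    let ?g = "restrict lift \<mm>"
    have "inj_on lift \<mm>" by (rule inj_on_inverseI[of _ f]) (rule f_lift)
    then show "bij_betw ?g (carrier (max_ideal_module R)) (carrier (M\<lparr>carrier := ?A\<rparr>))"
      by (simp add: bij_betw_def inj_on_restrict_eq)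
    show "?g \<in> module_hom R (max_ideal_module R) (M\<lparr>carrier := ?A\<rparr>)"
      using lift_add lift_smult max_ideal_closed by (auto simp: module_hom_def)
  qed
qed

section \<open>The kernel as a module over the endomorphism ring and over R\<close>

definition kernel_module :: "('a \<Rightarrow> 'a, 'b) module" where
  "kernel_module = \<lparr>carrier = K, monoid.mult = undefined, one = undefined,
     ring.zero = \<zero>\<^bsub>M\<^esub>, add = add M, smult = act\<rparr>"

lemma kernel_module_simps [simp]:
  "carrier kernel_module = K" "\<zero>\<^bsub>kernel_module\<^esub> = \<zero>\<^bsub>M\<^esub>"
  "x \<oplus>\<^bsub>kernel_module\<^esub> y = x \<oplus>\<^bsub>M\<^esub> y" "\<alpha> \<odot>\<^bsub>kernel_module\<^esub> x = act \<alpha> x"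
  by (simp_all add: kernel_module_def)

lemma restrict_kernel_simps [simp]:
  "carrier (max_endo_restrict R kernel_module) = K" "\<zero>\<^bsub>max_endo_restrict R kernel_module\<^esub> = \<zero>\<^bsub>M\<^esub>"
  "x \<oplus>\<^bsub>max_endo_restrict R kernel_module\<^esub> y = x \<oplus>\<^bsub>M\<^esub> y"
  "r \<odot>\<^bsub>max_endo_restrict R kernel_module\<^esub> x = act (homothety (max_ideal_module R) r) x"
  by (simp_all add: max_endo_restrict_def restrict_scalars_def kernel_module_def)

text \<open>Stated for any record with the additive structure of K, to serve both for
  \<open>kernel_module\<close> and for its restriction to R.\<close>

lemma K_abelian_group:
  assumes "carrier N = K" "\<zero>\<^bsub>N\<^esub> = \<zero>\<^bsub>M\<^esub>" "\<And>x y. x \<oplus>\<^bsub>N\<^esub> y = x \<oplus>\<^bsub>M\<^esub> y"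
  shows "abelian_group N"
proof (rule abelian_groupI)
  note km = submodule_mem_simps[OF K_submodule]
  fix x y z assume "x \<in> carrier N" "y \<in> carrier N" "z \<in> carrier N"
  then have x: "x \<in> K" and y: "y \<in> K" and z: "z \<in> K" unfolding assms .
  note car = km(2)[OF x] km(2)[OF y] km(2)[OF z]
  show "x \<oplus>\<^bsub>N\<^esub> y \<in> carrier N" unfolding assms by (rule km(3)[OF x y])
  show "x \<oplus>\<^bsub>N\<^esub> y \<oplus>\<^bsub>N\<^esub> z = x \<oplus>\<^bsub>N\<^esub> (y \<oplus>\<^bsub>N\<^esub> z)" unfolding assms by (rule M.a_assoc[OF car])
  show "x \<oplus>\<^bsub>N\<^esub> y = y \<oplus>\<^bsub>N\<^esub> x" unfolding assms by (rule M.a_comm[OF car(1,2)])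
  show "\<zero>\<^bsub>N\<^esub> \<oplus>\<^bsub>N\<^esub> x = x" unfolding assms by (rule M.l_zero[OF car(1)])
  show "\<exists>y\<in>carrier N. y \<oplus>\<^bsub>N\<^esub> x = \<zero>\<^bsub>N\<^esub>"
    unfolding assms using submoduleE(3)[OF K_submodule x] M.l_neg[OF car(1)] by (rule bexI[rotated])
next
  show "\<zero>\<^bsub>N\<^esub> \<in> carrier N" unfolding assms by (rule submodule_mem_simps(1)[OF K_submodule])
qed

lemma act_K: "\<alpha> \<in> carrier E \<Longrightarrow> v \<in> K \<Longrightarrow> act \<alpha> v \<in> K"
proof -
  assume \<alpha>: "\<alpha> \<in> carrier E" and v: "v \<in> K"
  have "c \<otimes> f (act \<alpha> v) = \<zero>" using linear_form_act[OF f \<alpha>, of v] v E_apply_c[OF \<alpha>] by simp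
  then have "f (act \<alpha> v) = \<zero>" using c_regular_ring linear_formD(1)[OF f] act(1)[OF \<alpha>] v by simp
  then show ?thesis using act(1)[OF \<alpha>] v by simp
qed

lemma kernel_module_module: "module E kernel_module"
proof (rule moduleI)
  show "cring E" by (rule E_cring)
  show "abelian_group kernel_module" by (rule K_abelian_group) simp_all
next
  fix \<alpha> x assume "\<alpha> \<in> carrier E" "x \<in> carrier kernel_module"
  then show "\<alpha> \<odot>\<^bsub>kernel_module\<^esub> x \<in> carrier kernel_module" using act_K[of \<alpha> x] by simp
next
  fix \<alpha> \<beta> x assume \<alpha>: "\<alpha> \<in> carrier E" and \<beta>: "\<beta> \<in> carrier E" and "x \<in> carrier kernel_module"
  then have x: "x \<in> carrier M" by simp
  have ab: "\<alpha> c \<in> carrier R" "\<beta> c \<in> carrier R" using Q_closed[OF E_apply_c[OF \<alpha>]] Q_closed[OF E_apply_c[OF \<beta>]] by auto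
  have E: "\<alpha> \<oplus>\<^bsub>E\<^esub> \<beta> \<in> carrier E" "\<alpha> \<otimes>\<^bsub>E\<^esub> \<beta> \<in> carrier E"
    using cring.cring_simprules(1,5)[OF E_cring \<alpha> \<beta>] by auto
  show "(\<alpha> \<oplus>\<^bsub>E\<^esub> \<beta>) \<odot>\<^bsub>kernel_module\<^esub> x = \<alpha> \<odot>\<^bsub>kernel_module\<^esub> x \<oplus>\<^bsub>kernel_module\<^esub> \<beta> \<odot>\<^bsub>kernel_module\<^esub> x"
    unfolding kernel_module_simps
  proof (rule act_eqI[OF E(1) x])
    show "c \<odot>\<^bsub>M\<^esub> (act \<alpha> x \<oplus>\<^bsub>M\<^esub> act \<beta> x) = (\<alpha> \<oplus>\<^bsub>E\<^esub> \<beta>) c \<odot>\<^bsub>M\<^esub> x"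
      using act[OF \<alpha> x] act[OF \<beta> x] ab x c_max_ideal by (simp add: smult_r_distr smult_l_distr)
  qed (use act(1)[OF \<alpha> x] act(1)[OF \<beta> x] in simp)
  show "(\<alpha> \<otimes>\<^bsub>E\<^esub> \<beta>) \<odot>\<^bsub>kernel_module\<^esub> x = \<alpha> \<odot>\<^bsub>kernel_module\<^esub> (\<beta> \<odot>\<^bsub>kernel_module\<^esub> x)"
    unfolding kernel_module_simps
  proof (rule act_eqI[OF E(2) x])
    note \<beta>x = act[OF \<beta> x]
    note \<alpha>\<beta>x = act[OF \<alpha> \<beta>x(1)]
    have \<beta>c: "\<beta> c \<in> \<mm>" by (rule max_endoD(1)[OF \<beta> c_max_ideal])
    \<comment> \<open>Each application of \<open>act\<close> divides by c once, so the composite is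
      compared after two multiplications by c.\<close>
    have "c \<odot>\<^bsub>M\<^esub> (c \<odot>\<^bsub>M\<^esub> act \<alpha> (act \<beta> x)) = \<alpha> c \<odot>\<^bsub>M\<^esub> (\<beta> c \<odot>\<^bsub>M\<^esub> x)"
      unfolding \<alpha>\<beta>x(2) \<beta>x(2)[symmetric] by (rule smult_comm[OF c_carrier ab(1) \<beta>x(1)])
    also have "\<dots> = (c \<otimes> \<alpha> (\<beta> c)) \<odot>\<^bsub>M\<^esub> x"
      using max_endoD(4)[OF \<alpha> c_max_ideal \<beta>c] ab x by (simp add: smult_assoc1[symmetric] R.m_comm)
    also have "\<dots> = c \<odot>\<^bsub>M\<^esub> (\<alpha> (\<beta> c) \<odot>\<^bsub>M\<^esub> x)"
      using max_endoD(1)[OF \<alpha> \<beta>c] x by (simp add: smult_assoc1)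
    finally have "c \<odot>\<^bsub>M\<^esub> act \<alpha> (act \<beta> x) = \<alpha> (\<beta> c) \<odot>\<^bsub>M\<^esub> x"
      by (rule regular_cancel[OF regular_c, rotated 2])
        (use \<alpha>\<beta>x(1) max_endoD(1)[OF \<alpha> \<beta>c] x in auto)
    then show "c \<odot>\<^bsub>M\<^esub> act \<alpha> (act \<beta> x) = (\<alpha> \<otimes>\<^bsub>E\<^esub> \<beta>) c \<odot>\<^bsub>M\<^esub> x"
      using c_max_ideal by (simp add: compose_def)
  qed (use act(1)[OF \<alpha> act(1)[OF \<beta> x]] in simp)
next
  fix \<alpha> x y assume \<alpha>: "\<alpha> \<in> carrier E" and "x \<in> carrier kernel_module" "y \<in> carrier kernel_module"
  then have x: "x \<in> carrier M" and y: "y \<in> carrier M" by auto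
  show "\<alpha> \<odot>\<^bsub>kernel_module\<^esub> (x \<oplus>\<^bsub>kernel_module\<^esub> y)
      = \<alpha> \<odot>\<^bsub>kernel_module\<^esub> x \<oplus>\<^bsub>kernel_module\<^esub> \<alpha> \<odot>\<^bsub>kernel_module\<^esub> y"
    unfolding kernel_module_simps
    by (rule act_eqI[OF \<alpha>])
      (use x y act[OF \<alpha> x] act[OF \<alpha> y] E_apply_c[OF \<alpha>] in \<open>simp_all add: smult_r_distr\<close>)
next
  fix x assume "x \<in> carrier kernel_module"
  then have x: "x \<in> carrier M" by simp
  show "\<one>\<^bsub>E\<^esub> \<odot>\<^bsub>kernel_module\<^esub> x = x"
    unfolding kernel_module_simps
    by (rule act_eqI[OF cring.cring_simprules(6)[OF E_cring] x x]) (use c_max_ideal in simp)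
qed

abbreviation KR where "KR \<equiv> max_endo_restrict R kernel_module"

lemma restrict_smult: "r \<in> carrier R \<Longrightarrow> x \<in> K \<Longrightarrow> r \<odot>\<^bsub>KR\<^esub> x = r \<odot>\<^bsub>M\<^esub> x"
  using act_homothety[of r x] by simp

lemma restrict_kernel_module: "module R KR"
proof (rule moduleI)
  note km = submodule_mem_simps[OF K_submodule]
  have carX: "carrier KR = K" by simp
  show "abelian_group KR" by (rule K_abelian_group) simp_all
  fix a b x y assume a: "a \<in> carrier R" and b: "b \<in> carrier R" and "x \<in> carrier KR" "y \<in> carrier KR"
  then have x: "x \<in> K" and y: "y \<in> K" by (simp_all only: carX)
  have xc: "x \<in> carrier M" and yc: "y \<in> carrier M" using x y by auto
  show "a \<odot>\<^bsub>KR\<^esub> x \<in> carrier KR" unfolding restrict_smult[OF a x] carX by (rule km(4)[OF a x])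
  show "(a \<oplus> b) \<odot>\<^bsub>KR\<^esub> x = a \<odot>\<^bsub>KR\<^esub> x \<oplus>\<^bsub>KR\<^esub> b \<odot>\<^bsub>KR\<^esub> x"
    unfolding restrict_smult[OF a x] restrict_smult[OF b x] restrict_smult[OF R.a_closed[OF a b] x]
      restrict_kernel_simps(3) by (rule smult_l_distr[OF a b xc])
  show "a \<odot>\<^bsub>KR\<^esub> (x \<oplus>\<^bsub>KR\<^esub> y) = a \<odot>\<^bsub>KR\<^esub> x \<oplus>\<^bsub>KR\<^esub> a \<odot>\<^bsub>KR\<^esub> y"
    unfolding restrict_kernel_simps(3) restrict_smult[OF a x] restrict_smult[OF a y] restrict_smult[OF a km(3)[OF x y]]
    by (rule smult_r_distr[OF a xc yc])
  show "(a \<otimes> b) \<odot>\<^bsub>KR\<^esub> x = a \<odot>\<^bsub>KR\<^esub> (b \<odot>\<^bsub>KR\<^esub> x)"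
    unfolding restrict_smult[OF b x] restrict_smult[OF a km(4)[OF b x]] restrict_smult[OF R.m_closed[OF a b] x]
    by (rule smult_assoc1[OF a b xc])
next
  fix x assume "x \<in> carrier KR"
  then have x: "x \<in> K" by simp
  then show "\<one> \<odot>\<^bsub>KR\<^esub> x = x" unfolding restrict_smult[OF R.one_closed x] by simp
qed (rule R.is_cring)

lemma submodule_restrict:
  assumes H: "submodule H R KR"
  shows "submodule H R M"
proof -
  note h = submodule_mem_simps[OF H]
  have HK: "H \<subseteq> K" using submodule_subset[OF H] by simp
  show ?thesis
  proof (rule submoduleI')
    show "H \<subseteq> carrier M" using HK by auto
    show "\<zero>\<^bsub>M\<^esub> \<in> H" using h(1) by simp
    show "x \<oplus>\<^bsub>M\<^esub> y \<in> H" if "x \<in> H" "y \<in> H" for x y using h(3)[OF that] by simp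
    show "a \<odot>\<^bsub>M\<^esub> x \<in> H" if "a \<in> carrier R" "x \<in> H" for a x
      using h(4)[OF that] restrict_smult[OF that(1), of x] that(2) HK by auto
  qed
qed

lemma submodule_kernel:
  assumes H: "submodule H E kernel_module"
  shows "submodule H R M"
proof -
  note h = submodule_mem_simps[OF H]
  have HK: "H \<subseteq> K" using submodule_subset[OF H] by simp
  show ?thesis
  proof (rule submoduleI')
    show "H \<subseteq> carrier M" using HK by auto
    show "\<zero>\<^bsub>M\<^esub> \<in> H" using h(1) by simp
    show "x \<oplus>\<^bsub>M\<^esub> y \<in> H" if "x \<in> H" "y \<in> H" for x y using h(3)[OF that] by simp
    show "a \<odot>\<^bsub>M\<^esub> x \<in> H" if a: "a \<in> carrier R" and x: "x \<in> H" for a x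
    proof -
      have "x \<in> carrier M" using x HK by auto
      from act_homothety[OF a this] h(4)[OF homothety_E[OF a] x] show ?thesis by simp
    qed
  qed
qed

lemma K_generators: "\<exists>T. finite T \<and> T \<subseteq> K \<and> K = submodule_gen R M T"
  by (rule submodule_fin_gen[OF K_submodule])

lemma restrict_fin_gen: "finitely_generated R KR"
proof -
  interpret KR: module R KR by (rule restrict_kernel_module)
  obtain T where T: "finite T" "T \<subseteq> K" "K = submodule_gen R M T" using K_generators by blast
  have TX: "T \<subseteq> carrier KR" using T(2) by simp
  have "K \<subseteq> submodule_gen R KR T"
    unfolding submodule_gen_def
  proof (rule Inter_greatest)
    fix H assume "H \<in> {H. submodule H R KR \<and> T \<subseteq> H}"
    then have "submodule H R M" "T \<subseteq> H" using submodule_restrict by auto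
    then show "K \<subseteq> H" unfolding T(3) by (rule submodule_gen_least)
  qed
  moreover have "submodule_gen R KR T \<subseteq> carrier KR"
    by (rule KR.submodule_gen_least[OF KR.carrier_is_submodule TX])
  ultimately have "submodule_gen R KR T = carrier KR" by (intro antisym) simp_all
  then show ?thesis using T(1) TX unfolding finitely_generated_def by blast
qed

text \<open>R acts through E, so every E-submodule is an R-submodule, and generators of K over R
  also generate it over E.\<close>

lemma kernel_fin_gen: "finitely_generated E kernel_module"
proof -
  interpret N: module E kernel_module by (rule kernel_module_module)
  obtain T where T: "finite T" "T \<subseteq> K" "K = submodule_gen R M T" using K_generators by blast
  have TX: "T \<subseteq> carrier kernel_module" using T(2) by simp
  have "K \<subseteq> submodule_gen E kernel_module T"
    unfolding submodule_gen_def
  proof (rule Inter_greatest)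
    fix H assume "H \<in> {H. submodule H E kernel_module \<and> T \<subseteq> H}"
    then have "submodule H R M" "T \<subseteq> H" using submodule_kernel by auto
    then show "K \<subseteq> H" unfolding T(3) by (rule submodule_gen_least)
  qed
  moreover have "submodule_gen E kernel_module T \<subseteq> carrier kernel_module"
    by (rule N.submodule_gen_least[OF N.carrier_is_submodule TX])
  ultimately have "submodule_gen E kernel_module T = carrier kernel_module" by (intro antisym) simp_all
  then show ?thesis using T(1) TX unfolding finitely_generated_def by blast
qed

lemma restrict_torsion_free: "torsion_free_module R KR t e"
proof -
  interpret KR: module R KR by (rule restrict_kernel_module)
  have tc: "t \<in> carrier R" using t_mem by simp
  show ?thesis
  proof
    show "finitely_generated R KR" by (rule restrict_fin_gen)
    fix v assume "v \<in> carrier KR" and tv: "t \<odot>\<^bsub>KR\<^esub> v = \<zero>\<^bsub>KR\<^esub>"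
    then have v: "v \<in> K" by simp
    have "t \<odot>\<^bsub>M\<^esub> v = \<zero>\<^bsub>M\<^esub>" using tv unfolding restrict_smult[OF tc v] by simp
    then show "v = \<zero>\<^bsub>KR\<^esub>" using t_regular v by simp
  qed (use local noetherian noetherian_ring.finetely_gen[OF noetherian] t_mem t_regular_ring t_reduction in auto)
qed

text \<open>The criterion is checked with the same c and k. If a v = c w with v in K, then c f(w) =
  a f(v) = 0, so w lies in K; hence c K = m^k K.\<close>

lemma restrict_ulrich:
  assumes dim: "krull_dim R = 1" and nz: "K \<noteq> {\<zero>\<^bsub>M\<^esub>}"
  shows "ulrich R KR"
proof -
  interpret KR: torsion_free_module R KR t e by (rule restrict_torsion_free)
  have carX: "carrier KR = K" by simp
  have MCM: "maximal_cohen_macaulay R KR" by (rule KR.maximal_cohen_macaulayI) (use nz dim in auto)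
  have reg: "KR.regular c"
    unfolding KR.regular_def
  proof (intro conjI ballI impI c_carrier)
    fix v assume "v \<in> carrier KR" and cv: "c \<odot>\<^bsub>KR\<^esub> v = \<zero>\<^bsub>KR\<^esub>"
    then have v: "v \<in> K" by simp
    then show "v = \<zero>\<^bsub>KR\<^esub>" using c_regular[of v] cv restrict_smult[OF c_carrier v] by simp
  qed
  have "(\<odot>\<^bsub>KR\<^esub>) c ` carrier KR = KR.P k"
  proof
    have "(\<odot>\<^bsub>KR\<^esub>) c ` carrier KR \<subseteq> KR.P (0 + k)" using KR.Q_smult[OF c_mem, of _ 0] by auto
    then show "(\<odot>\<^bsub>KR\<^esub>) c ` carrier KR \<subseteq> KR.P k" by simp
    show "KR.P k \<subseteq> (\<odot>\<^bsub>KR\<^esub>) c ` carrier KR"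
    proof (rule KR.max_pow_least[OF KR.carrier_is_submodule KR.submodule_smult_image[OF KR.carrier_is_submodule c_carrier]])
      fix a v assume a: "a \<in> Q k" and "v \<in> carrier KR"
      then have v: "v \<in> K" by simp
      have ac: "a \<in> carrier R" using a by simp
      obtain w where w: "w \<in> carrier M" "a \<odot>\<^bsub>M\<^esub> v = c \<odot>\<^bsub>M\<^esub> w" using c_divides[OF a, of v] v by auto
      have "c \<otimes> f w = f (a \<odot>\<^bsub>M\<^esub> v)" using linear_formD(3)[OF f c_carrier w(1)] w(2) by simp
      also have "\<dots> = \<zero>" using linear_formD(3)[OF f ac, of v] v ac by simp
      finally have "f w = \<zero>" using c_regular_ring linear_formD(1)[OF f w(1)] by simp
      then have wK: "w \<in> K" using w(1) by simp
      have "a \<odot>\<^bsub>KR\<^esub> v = c \<odot>\<^bsub>KR\<^esub> w"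
        unfolding restrict_smult[OF ac v] restrict_smult[OF c_carrier wK] by (rule w(2))
      then show "a \<odot>\<^bsub>KR\<^esub> v \<in> (\<odot>\<^bsub>KR\<^esub>) c ` carrier KR" using wK unfolding carX by (rule image_eqI)
    qed
  qed
  then have "real (min_gens R KR) = multiplicity_hs R KR"
    using KR.min_gens_eq_multiplicity_iff[OF dim] k_pos c_mem reg by blast
  then show ?thesis using MCM by (simp add: ulrich_def)
qed

lemma iso_direct_sum: "module_iso R M (direct_sum (max_ideal_module R) KR)"
  unfolding module_iso_def
proof (intro bexI)
  let ?S = "direct_sum (max_ideal_module R) KR"
  let ?g = "\<lambda>v\<in>carrier M. (f v, v \<ominus>\<^bsub>M\<^esub> lift (f v))"
  have carS: "carrier ?S = \<mm> \<times> K" by simp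
  have lc: "lift (f v) \<in> carrier M" if "v \<in> carrier M" for v using lift(1)[OF f_max[OF that]] .
  show "?g \<in> module_hom R M ?S"
    unfolding module_hom_def mem_Collect_eq
  proof (intro conjI ballI)
    show "?g \<in> carrier M \<rightarrow>\<^sub>E carrier ?S"
      unfolding carS using f_max minus_lift_mem_K by auto
    fix x y assume x: "x \<in> carrier M" and y: "y \<in> carrier M"
    have "(x \<oplus>\<^bsub>M\<^esub> y) \<ominus>\<^bsub>M\<^esub> lift (f (x \<oplus>\<^bsub>M\<^esub> y)) = (x \<ominus>\<^bsub>M\<^esub> lift (f x)) \<oplus>\<^bsub>M\<^esub> (y \<ominus>\<^bsub>M\<^esub> lift (f y))"
      using x y lc[OF x] lc[OF y] linear_formD(2)[OF f x y] lift_add[OF f_max[OF x] f_max[OF y]]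
      by (simp add: a_minus_def M.minus_add M.a_ac)
    then show "?g (x \<oplus>\<^bsub>M\<^esub> y) = ?g x \<oplus>\<^bsub>?S\<^esub> ?g y"
      using x y linear_formD(2)[OF f x y] by simp
  next
    fix r x assume r: "r \<in> carrier R" and x: "x \<in> carrier M"
    have "(r \<odot>\<^bsub>M\<^esub> x) \<ominus>\<^bsub>M\<^esub> lift (f (r \<odot>\<^bsub>M\<^esub> x)) = r \<odot>\<^bsub>M\<^esub> (x \<ominus>\<^bsub>M\<^esub> lift (f x))"
      using x r lc[OF x] linear_formD(3)[OF f r x] lift_smult[OF r f_max[OF x]] by (simp add: smult_minus_distr)
    then show "?g (r \<odot>\<^bsub>M\<^esub> x) = r \<odot>\<^bsub>?S\<^esub> ?g x"
      using x r linear_formD(3)[OF f r x] restrict_smult[OF r minus_lift_mem_K[OF x]]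
      by (simp del: restrict_kernel_simps)
  qed
  show "bij_betw ?g (carrier M) (carrier ?S)"
    unfolding carS
  proof (rule bij_betwI[where g = "\<lambda>(z, x). lift z \<oplus>\<^bsub>M\<^esub> x"])
    show "?g \<in> carrier M \<rightarrow> \<mm> \<times> K" using f_max minus_lift_mem_K by auto
    show "(\<lambda>(z, x). lift z \<oplus>\<^bsub>M\<^esub> x) \<in> \<mm> \<times> K \<rightarrow> carrier M" using lift(1) by auto
    show "(case ?g v of (z, x) \<Rightarrow> lift z \<oplus>\<^bsub>M\<^esub> x) = v" if "v \<in> carrier M" for v
      using that minus_add_cancel(4)[OF that lc[OF that]] by simp
    fix y assume "y \<in> \<mm> \<times> K"
    then obtain z x where y: "y = (z, x)" "z \<in> \<mm>" "x \<in> carrier M" "f x = \<zero>" by auto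
    have lz: "lift z \<in> carrier M" by (rule lift(1)[OF y(2)])
    have "f (lift z \<oplus>\<^bsub>M\<^esub> x) = z" using linear_formD(2)[OF f lz y(3)] f_lift[OF y(2)] y by simp
    then show "?g (case y of (z, x) \<Rightarrow> lift z \<oplus>\<^bsub>M\<^esub> x) = y"
      using y lz minus_add_cancel(2)[OF lz y(3)] by simp
  qed
qed

theorem splitting:
  assumes "krull_dim R = 1"
  shows "\<exists>N :: ('a \<Rightarrow> 'a, 'b) module. module E N \<and> finitely_generated E N \<and>
    module_iso R M (direct_sum (max_ideal_module R) (max_endo_restrict R N)) \<and>
    (carrier N = {\<zero>\<^bsub>N\<^esub>} \<or> ulrich R (max_endo_restrict R N))"
  using kernel_module_module kernel_fin_gen iso_direct_sum restrict_ulrich[OF assms]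
  by (intro exI[of _ kernel_module]) auto

end

section \<open>Splitting off the maximal ideal\<close>

text \<open>In the local case the complement still has to consist of functions on naturals, so the
  splitting is carried out on \<open>direct_power M 1\<close> and brought back to M.\<close>

lemma module_iso_direct_power_one:
  fixes R :: "('a, 'c) ring_scheme" and M :: "('a, 'b, 'd) module_scheme"
  assumes M: "module R M" and iso: "module_iso R (direct_power M 1) Y"
  shows "module_iso R M Y"
proof -
  interpret module R M by (rule M)
  let ?W = "direct_power M 1"
  define h where "h v = (\<lambda>j\<in>{..<1::nat}. v)" for v :: 'b
  have h: "h v \<in> carrier ?W" if "v \<in> carrier M" for v using that by (auto simp: h_def)
  have add: "h (x \<oplus>\<^bsub>M\<^esub> y) = h x \<oplus>\<^bsub>?W\<^esub> h y" for x y by (auto simp: h_def)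
  have sm: "h (r \<odot>\<^bsub>M\<^esub> x) = r \<odot>\<^bsub>?W\<^esub> h x" for r x by (auto simp: h_def)
  have bij: "bij_betw h (carrier M) (carrier ?W)"
  proof (rule bij_betwI[where g = "\<lambda>v. v 0"])
    show "h \<in> carrier M \<rightarrow> carrier ?W" using h by auto
    show "(\<lambda>v. v 0) \<in> carrier ?W \<rightarrow> carrier M" by auto
    show "h v 0 = v" for v by (simp add: h_def)
    show "h (v 0) = v" if "v \<in> carrier ?W" for v
      using that by (auto simp: h_def PiE_iff extensional_def restrict_def fun_eq_iff)
  qed
  obtain g where g: "g \<in> module_hom R ?W Y" "bij_betw g (carrier ?W) (carrier Y)"
    using iso by (auto simp: module_iso_def)
  have gd: "g \<in> carrier ?W \<rightarrow> carrier Y"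
    "\<And>x y. x \<in> carrier ?W \<Longrightarrow> y \<in> carrier ?W \<Longrightarrow> g (x \<oplus>\<^bsub>?W\<^esub> y) = g x \<oplus>\<^bsub>Y\<^esub> g y"
    "\<And>r x. r \<in> carrier R \<Longrightarrow> x \<in> carrier ?W \<Longrightarrow> g (r \<odot>\<^bsub>?W\<^esub> x) = r \<odot>\<^bsub>Y\<^esub> g x"
    using g(1) unfolding module_hom_def by blast+
  show ?thesis
    unfolding module_iso_def
  proof (intro bexI)
    show "compose (carrier M) g h \<in> module_hom R M Y"
      unfolding module_hom_def mem_Collect_eq
    proof (intro conjI ballI)
      show "compose (carrier M) g h \<in> carrier M \<rightarrow>\<^sub>E carrier Y"
        using gd(1) h by (auto simp: compose_def)
      fix x y assume x: "x \<in> carrier M" and y: "y \<in> carrier M"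
      show "compose (carrier M) g h (x \<oplus>\<^bsub>M\<^esub> y) = compose (carrier M) g h x \<oplus>\<^bsub>Y\<^esub> compose (carrier M) g h y"
        using gd(2)[OF h[OF x] h[OF y]] x y unfolding compose_def add[symmetric] by simp
    next
      fix r x assume r: "r \<in> carrier R" and x: "x \<in> carrier M"
      show "compose (carrier M) g h (r \<odot>\<^bsub>M\<^esub> x) = r \<odot>\<^bsub>Y\<^esub> compose (carrier M) g h x"
        using gd(3)[OF r h[OF x]] r x unfolding compose_def sm[symmetric] by simp
    qed
    have "bij_betw (g \<circ> h) (carrier M) (carrier Y)" by (rule bij_betw_trans[OF bij g(2)])
    then show "bij_betw (compose (carrier M) g h) (carrier M) (carrier Y)"
      by (rule iffD1[OF bij_betw_cong, rotated]) (simp add: compose_def)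
  qed
qed

section \<open>Sums of linear forms with image the maximal ideal\<close>

context local_noetherian_module
begin

lemma linear_form_max_pow:
  assumes f: "linear_form R M f"
  shows "max_pow R (self_module R) j (f ` carrier M) \<subseteq> f ` max_pow R M j (carrier M)"
proof -
  interpret S: local_noetherian_module R "self_module R" by (rule local_noetherian_self)
  note P = max_pow_submodule[OF carrier_is_submodule, of j]
  show ?thesis
  proof (rule S.max_pow_least[OF linear_form_image_submodule[OF f carrier_is_submodule] linear_form_image_submodule[OF f P]])
    fix a y assume a: "a \<in> max_ideal_pow R j" and "y \<in> f ` carrier M"
    then obtain v where v: "v \<in> carrier M" "y = f v" by auto
    have "a \<odot>\<^bsub>self_module R\<^esub> y = f (a \<odot>\<^bsub>M\<^esub> v)"
      using linear_formD(3)[OF f max_ideal_pow_closed(2)[OF a] v(1)] v(2) by simp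
    moreover have "a \<odot>\<^bsub>M\<^esub> v \<in> max_pow R M j (carrier M)"
      using max_ideal_pow_smult[OF carrier_is_submodule a, of v 0] v(1) by simp
    ultimately show "a \<odot>\<^bsub>self_module R\<^esub> y \<in> f ` max_pow R M j (carrier M)" by auto
  qed
qed

lemma trace_mem:
  assumes "trace_ideal R M = \<mm>" "f \<in> module_hom R M (self_module R)" "v \<in> carrier M"
  shows "f v \<in> \<mm>"
proof -
  have "(\<Union>f\<in>module_hom R M (self_module R). f ` carrier M) \<subseteq> carrier R"
    by (auto simp: module_hom_def)
  from R.genideal_self[OF this] show ?thesis using assms unfolding trace_ideal_def by blast
qed

text \<open>Among the images of finite sums of forms a maximal one exists, as R is Noetherian.
  Adjoining one more form cannot enlarge it, so it contains every value of every form and hence the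
  trace.\<close>

lemma trace_surjection:
  assumes trace: "trace_ideal R M = \<mm>"
  shows "\<exists>n\<ge>1. \<exists>f. (\<forall>i<n. f i \<in> module_hom R M (self_module R)) \<and>
    (\<lambda>v. \<Oplus>i\<in>{..<n}. f i (v i)) ` carrier (direct_power M n) = \<mm>"
proof -
  interpret S: local_noetherian_module R "self_module R" by (rule local_noetherian_self)
  let ?H = "module_hom R M (self_module R)"
  let ?I = "\<lambda>n f. (\<lambda>v. \<Oplus>i\<in>{..<n}. f i (v i)) ` carrier (direct_power M n)"
  define F where "F = {?I n f | (n::nat) f. n \<ge> 1 \<and> (\<forall>i<n. f i \<in> ?H)}"
  have lin: "linear_form R (direct_power M n) (\<lambda>v. \<Oplus>i\<in>{..<n}. f i (v i))"
    if "\<forall>i<n. f i \<in> ?H" for n and f :: "nat \<Rightarrow> 'b \<Rightarrow> 'a"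
    by (rule linear_form_finsum) (use that module_hom_linear_form in blast)
  have sub: "submodule I R (self_module R)" if "I \<in> F" for I
  proof -
    obtain n f where nf: "I = ?I n f" "\<forall>i<n. f i \<in> ?H" using \<open>I \<in> F\<close> unfolding F_def by blast
    interpret W: module R "direct_power M n" by (rule direct_power_module)
    show ?thesis unfolding nf(1) by (rule W.linear_form_image_submodule[OF lin[OF nf(2)] W.carrier_is_submodule])
  qed
  \<comment> \<open>The zero form shows that the family of images with n >= 1 is nonempty.\<close>
  have "(\<lambda>x\<in>carrier M. \<zero>) \<in> ?H" by (auto simp: module_hom_def)
  then have "?I 1 (\<lambda>_. \<lambda>x\<in>carrier M. \<zero>) \<in> F"
    unfolding F_def by (intro CollectI exI[of _ 1] exI[of _ "\<lambda>_. \<lambda>x\<in>carrier M. \<zero>"]) simp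
  then have "F \<noteq> {}" by blast
  from S.submodule_maximal_element[OF this sub]
  obtain I where I: "I \<in> F" and max: "\<And>Y. Y \<in> F \<Longrightarrow> I \<subseteq> Y \<Longrightarrow> Y = I" by blast
  obtain n f where nf: "n \<ge> 1" "\<forall>i<n. f i \<in> ?H" "I = ?I n f" using I unfolding F_def by blast
  note fl = module_hom_linear_form[OF mp[OF spec[OF nf(2)]]]
  have gI: "g v \<in> I" if g: "g \<in> ?H" and v: "v \<in> carrier M" for g v
  proof -
    note gl = module_hom_linear_form[OF g]
    let ?f = "f(n := g)"
    have ext: "(\<Oplus>i\<in>{..<Suc n}. ?f i ((w(n := x)) i)) = g x \<oplus> (\<Oplus>i\<in>{..<n}. f i (w i))"
      if w: "w \<in> carrier (direct_power M n)" and x: "x \<in> carrier M" for w x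
    proof -
      have wf: "(\<lambda>i. f i (w i)) \<in> {..<n} \<rightarrow> carrier R"
        using w linear_formD(1)[OF fl] by (auto simp: PiE_iff)
      have "(\<Oplus>i\<in>{..<n}. ?f i ((w(n := x)) i)) = (\<Oplus>i\<in>{..<n}. f i (w i))"
        by (rule R.finsum_cong'[OF refl wf]) auto
      moreover have "(\<Oplus>i\<in>insert n {..<n}. ?f i ((w(n := x)) i)) = ?f n ((w(n := x)) n) \<oplus> (\<Oplus>i\<in>{..<n}. ?f i ((w(n := x)) i))"
        by (rule R.finsum_insert) (use wf linear_formD(1)[OF gl x] in \<open>auto simp: Pi_iff\<close>)
      ultimately show ?thesis by (simp add: lessThan_Suc)
    qed
    have mem: "w(n := x) \<in> carrier (direct_power M (Suc n))"
      if "w \<in> carrier (direct_power M n)" "x \<in> carrier M" for w x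
      using that by (auto simp: PiE_iff extensional_def)
    have J: "?I (Suc n) ?f \<in> F"
    proof -
      have "\<forall>i<Suc n. ?f i \<in> ?H" using nf(2) g by (simp add: less_Suc_eq)
      then show ?thesis unfolding F_def by (intro CollectI exI[of _ "Suc n"] exI[of _ ?f]) simp
    qed
    have "I \<subseteq> ?I (Suc n) ?f"
    proof
      fix y assume "y \<in> I"
      then obtain w where w: "w \<in> carrier (direct_power M n)" "y = (\<Oplus>i\<in>{..<n}. f i (w i))"
        unfolding nf(3) by blast
      have "(\<Oplus>i\<in>{..<n}. f i (w i)) \<in> carrier R" using linear_formD(1)[OF lin[OF nf(2)] w(1)] .
      then have "y = (\<Oplus>i\<in>{..<Suc n}. ?f i ((w(n := \<zero>\<^bsub>M\<^esub>)) i))"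
        unfolding ext[OF w(1) M.zero_closed] using w(2) linear_form_zero[OF gl] by simp
      then show "y \<in> ?I (Suc n) ?f" by (rule image_eqI[OF _ mem[OF w(1) M.zero_closed]])
    qed
    then have eq: "?I (Suc n) ?f = I" by (rule max[OF J])
    define z where "z = (\<lambda>i\<in>{..<n}. \<zero>\<^bsub>M\<^esub>)"
    have z: "z \<in> carrier (direct_power M n)" by (auto simp: z_def)
    have "(\<Oplus>i\<in>{..<n}. f i (z i)) = (\<Oplus>i\<in>{..<n}. \<zero>)"
      by (rule R.finsum_cong') (use linear_form_zero[OF fl] in \<open>auto simp: z_def\<close>)
    then have "(\<Oplus>i\<in>{..<n}. f i (z i)) = \<zero>" by simp
    then have "g v = (\<Oplus>i\<in>{..<Suc n}. ?f i ((z(n := v)) i))"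
      unfolding ext[OF z v] using linear_formD(1)[OF gl v] by simp
    then have "g v \<in> ?I (Suc n) ?f" by (rule image_eqI[OF _ mem[OF z v]])
    then show ?thesis unfolding eq .
  qed
  have "\<mm> \<subseteq> I"
    unfolding trace[symmetric] trace_ideal_def
    by (rule R.genideal_minimal) (use gI sub[OF I] in \<open>auto simp: R.ideal_iff_submodule\<close>)
  moreover have "I \<subseteq> \<mm>"
  proof
    fix y assume "y \<in> I"
    then obtain w where w: "w \<in> carrier (direct_power M n)" "y = (\<Oplus>i\<in>{..<n}. f i (w i))"
      unfolding nf(3) by blast
    have "j \<le> n \<Longrightarrow> (\<Oplus>i\<in>{..<j}. f i (w i)) \<in> \<mm>" for j
    proof (induction j)
      case 0
      then show ?case using max_ideal_closed(1) by simp
    next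
      case (Suc j)
      have fm: "f i (w i) \<in> \<mm>" if "i < n" for i
        using trace_mem[OF trace mp[OF spec[OF nf(2)] that]] w(1) that by (auto simp: PiE_iff)
      have "(\<Oplus>i\<in>insert j {..<j}. f i (w i)) = f j (w j) \<oplus> (\<Oplus>i\<in>{..<j}. f i (w i))"
        by (rule R.finsum_insert) (use fm Suc.prems in \<open>auto simp: Pi_iff\<close>)
      then show ?case using max_ideal_closed(2)[OF fm[of j] Suc.IH] Suc.prems by (simp add: lessThan_Suc)
    qed
    then show "y \<in> \<mm>" using w(2) by simp
  qed
  ultimately show ?thesis using nf by blast
qed

end

lemma (in blowup_module) direct_power_blowup: "blowup_module R (direct_power M n) t e c k"
proof -
  interpret W: torsion_free_module R "direct_power M n" t e by (rule direct_power_torsion_free)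
  show ?thesis
  proof
    fix v assume v: "v \<in> carrier (direct_power M n)" and cv: "c \<odot>\<^bsub>direct_power M n\<^esub> v = \<zero>\<^bsub>direct_power M n\<^esub>"
    have "v i = \<zero>\<^bsub>M\<^esub>" if i: "i < n" for i
    proof -
      have "c \<odot>\<^bsub>M\<^esub> v i = \<zero>\<^bsub>M\<^esub>" using fun_cong[OF cv, of i] i by simp
      then show ?thesis using c_regular v i by (auto simp: PiE_iff)
    qed
    then show "v = \<zero>\<^bsub>direct_power M n\<^esub>"
      using v by (auto simp: PiE_iff extensional_def restrict_def fun_eq_iff)
  next
    fix a v assume a: "a \<in> Q k" and v: "v \<in> carrier (direct_power M n)"
    have "\<forall>i\<in>{..<n}. \<exists>w. w \<in> carrier M \<and> a \<odot>\<^bsub>M\<^esub> v i = c \<odot>\<^bsub>M\<^esub> w"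
      using c_divides[OF a] v by (auto simp: PiE_iff)
    then obtain w where w: "\<And>i. i < n \<Longrightarrow> w i \<in> carrier M" "\<And>i. i < n \<Longrightarrow> a \<odot>\<^bsub>M\<^esub> v i = c \<odot>\<^bsub>M\<^esub> w i"
      by (metis lessThan_iff)
    show "\<exists>w\<in>carrier (direct_power M n). a \<odot>\<^bsub>direct_power M n\<^esub> v = c \<odot>\<^bsub>direct_power M n\<^esub> w"
      by (rule bexI[of _ "\<lambda>i\<in>{..<n}. w i"]) (use w in \<open>auto intro!: restrict_ext\<close>)
  qed (use k_pos c_mem c_regular_ring in auto)
qed

lemma (in blowup_module) P_k_divisible: "v \<in> P k \<Longrightarrow> \<exists>w\<in>carrier M. v = c \<odot>\<^bsub>M\<^esub> w"
proof -
  have "P k \<subseteq> (\<odot>\<^bsub>M\<^esub>) c ` carrier M"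
    by (rule max_pow_least[OF carrier_is_submodule submodule_smult_image[OF carrier_is_submodule c_carrier]])
      (use c_divides in blast)
  then show "v \<in> P k \<Longrightarrow> \<exists>w\<in>carrier M. v = c \<odot>\<^bsub>M\<^esub> w" by auto
qed

text \<open>As c lies in m^(k-1) f(M), it is the value of an element u of \<open>P (k - 1)\<close>.
  For z in m the product z u then lies in \<open>P k\<close>, where c divides.\<close>

lemma (in blowup_module) splitting_element:
  assumes f: "linear_form R M f" and surj: "f ` carrier M = \<mm>"
  shows "\<exists>u\<in>carrier M. f u = c \<and> (\<forall>z\<in>\<mm>. \<exists>w\<in>carrier M. z \<odot>\<^bsub>M\<^esub> u = c \<odot>\<^bsub>M\<^esub> w)"
proof -
  have k: "Suc (k - 1) = k" using k_pos by simp
  have "max_pow R (self_module R) (k - 1) (Q (Suc 0)) = Q (k - 1 + Suc 0)"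
    by (simp add: max_ideal_pow_def max_pow_add[symmetric] del: max_pow_Suc)
  then have "c \<in> max_pow R (self_module R) (k - 1) \<mm>" using c_mem k max_ideal_pow_1 by simp
  then obtain u where u: "u \<in> P (k - 1)" "f u = c"
    using linear_form_max_pow[OF f, of "k - 1"] unfolding surj by blast
  have "\<exists>w\<in>carrier M. z \<odot>\<^bsub>M\<^esub> u = c \<odot>\<^bsub>M\<^esub> w" if z: "z \<in> \<mm>" for z
  proof (rule P_k_divisible)
    show "z \<odot>\<^bsub>M\<^esub> u \<in> P k" using ideal_times_mem[OF z u(1)] k by (metis max_pow_Suc)
  qed
  then show ?thesis using u P_closed(2)[OF u(1)] by blast
qed

section \<open>Fractions with denominator c, and the case of a local endomorphism ring\<close>

context blowup_module
begin

text \<open>Multiplication by the fraction \<open>b / c\<close>; it maps \<open>\<mm>\<close> to itself if \<open>b\<close> satisfies \<open>c_multiple\<close>.\<close>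

definition quot_c :: "'a \<Rightarrow> 'a \<Rightarrow> 'a" where
  "quot_c b = (\<lambda>y\<in>\<mm>. THE z. z \<in> \<mm> \<and> c \<otimes> z = b \<otimes> y)"

definition c_multiple :: "'a \<Rightarrow> bool" where
  "c_multiple b \<longleftrightarrow> b \<in> carrier R \<and> (\<forall>y\<in>\<mm>. \<exists>z\<in>\<mm>. b \<otimes> y = c \<otimes> z)"

lemma quot_c:
  assumes "c_multiple b" "y \<in> \<mm>"
  shows "quot_c b y \<in> \<mm>" "c \<otimes> quot_c b y = b \<otimes> y"
proof -
  obtain z where z: "z \<in> \<mm>" "b \<otimes> y = c \<otimes> z" using assms unfolding c_multiple_def by blast
  have "(THE z. z \<in> \<mm> \<and> c \<otimes> z = b \<otimes> y) \<in> \<mm> \<and> c \<otimes> (THE z. z \<in> \<mm> \<and> c \<otimes> z = b \<otimes> y) = b \<otimes> y"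
  proof (rule theI[of _ z])
    fix x assume "x \<in> \<mm> \<and> c \<otimes> x = b \<otimes> y"
    then show "x = z" using c_cancel_ring[of x z] z by simp
  qed (use z in simp)
  then show "quot_c b y \<in> \<mm>" "c \<otimes> quot_c b y = b \<otimes> y" using assms(2) by (auto simp: quot_c_def)
qed

lemma quot_c_eqI:
  assumes "c_multiple b" "y \<in> \<mm>" "z \<in> \<mm>" "c \<otimes> z = b \<otimes> y"
  shows "quot_c b y = z"
  by (rule c_cancel_ring) (use quot_c[OF assms(1,2)] assms in auto)

lemma quot_c_E:
  assumes b: "c_multiple b"
  shows "quot_c b \<in> carrier E"
  unfolding max_endo_carrier_iff
proof (intro conjI ballI)
  have bc: "b \<in> carrier R" using b by (simp add: c_multiple_def)
  show "quot_c b \<in> \<mm> \<rightarrow>\<^sub>E \<mm>" using quot_c(1)[OF b] by (auto simp: quot_c_def)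
  fix x y assume x: "x \<in> \<mm>" and y: "y \<in> \<mm>"
  show "quot_c b (x \<oplus> y) = quot_c b x \<oplus> quot_c b y"
    by (rule quot_c_eqI[OF b])
      (use quot_c[OF b x] quot_c[OF b y] x y bc max_ideal_closed(2) in \<open>auto simp: R.r_distr\<close>)
next
  have bc: "b \<in> carrier R" using b by (simp add: c_multiple_def)
  fix r x assume r: "r \<in> carrier R" and x: "x \<in> \<mm>"
  have "c \<otimes> (r \<otimes> quot_c b x) = r \<otimes> (c \<otimes> quot_c b x)"
    using r quot_c(1)[OF b x] by (intro R.m_lcomm) auto
  also have "\<dots> = b \<otimes> (r \<otimes> x)" unfolding quot_c(2)[OF b x] using r x bc by (intro R.m_lcomm) auto
  finally show "quot_c b (r \<otimes> x) = r \<otimes> quot_c b x"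
    by (rule quot_c_eqI[OF b, rotated 2]) (use quot_c(1)[OF b x] r x max_ideal_closed(4) in auto)
qed

lemma c_multiple_zero: "c_multiple \<zero>" "quot_c \<zero> = \<zero>\<^bsub>E\<^esub>"
proof -
  show z: "c_multiple \<zero>" using max_ideal_closed(1) by (auto simp: c_multiple_def intro!: bexI[of _ \<zero>])
  show "quot_c \<zero> = \<zero>\<^bsub>E\<^esub>"
  proof (rule max_endo_eqI[OF quot_c_E[OF z] cring.cring_simprules(2)[OF E_cring]])
    fix x assume x: "x \<in> \<mm>"
    have "quot_c \<zero> x = \<zero>" by (rule quot_c_eqI[OF z x max_ideal_closed(1)]) (use x in simp)
    then show "quot_c \<zero> x = \<zero>\<^bsub>E\<^esub> x" using x by simp
  qed
qed

lemma c_multiple_add: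
  assumes a: "c_multiple a" and b: "c_multiple b"
  shows "c_multiple (a \<oplus> b)" "quot_c (a \<oplus> b) = quot_c a \<oplus>\<^bsub>E\<^esub> quot_c b"
proof -
  have ab: "a \<in> carrier R" "b \<in> carrier R" using a b by (auto simp: c_multiple_def)
  have eq: "c \<otimes> (quot_c a y \<oplus> quot_c b y) = (a \<oplus> b) \<otimes> y" if y: "y \<in> \<mm>" for y
    using quot_c[OF a y] quot_c[OF b y] y ab by (simp add: R.r_distr R.l_distr)
  show s: "c_multiple (a \<oplus> b)"
    unfolding c_multiple_def
    using ab eq[symmetric] max_ideal_closed(2) quot_c(1)[OF a] quot_c(1)[OF b] by blast
  show "quot_c (a \<oplus> b) = quot_c a \<oplus>\<^bsub>E\<^esub> quot_c b"
  proof (rule max_endo_eqI[OF quot_c_E[OF s] cring.cring_simprules(1)[OF E_cring quot_c_E[OF a] quot_c_E[OF b]]])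
    fix x assume x: "x \<in> \<mm>"
    have "quot_c (a \<oplus> b) x = quot_c a x \<oplus> quot_c b x"
      by (rule quot_c_eqI[OF s x _ eq[OF x]]) (use quot_c(1)[OF a x] quot_c(1)[OF b x] max_ideal_closed(2) in auto)
    then show "quot_c (a \<oplus> b) x = (quot_c a \<oplus>\<^bsub>E\<^esub> quot_c b) x" using x by simp
  qed
qed

lemma quot_c_c: "quot_c c = \<one>\<^bsub>E\<^esub>"
proof -
  have s: "c_multiple c" by (auto simp: c_multiple_def)
  show ?thesis
  proof (rule max_endo_eqI[OF quot_c_E[OF s] cring.cring_simprules(6)[OF E_cring]])
    fix x assume x: "x \<in> \<mm>"
    have "quot_c c x = x" by (rule quot_c_eqI[OF s x x refl])
    then show "quot_c c x = \<one>\<^bsub>E\<^esub> x" using x by simp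
  qed
qed

text \<open>The fractions f_i(u_i) / c are endomorphisms of m with sum 1, so they cannot all lie in
  the maximal ideal of E. If beta is the inverse of one that does not, then v = beta u_i satisfies
  f_i(v) = c.\<close>

lemma local_splitting_element:
  fixes n :: nat
  assumes E: "local_ring E" and f: "\<And>i. i < n \<Longrightarrow> linear_form R M (f i)"
    and f_max: "\<And>i v. i < n \<Longrightarrow> v \<in> carrier M \<Longrightarrow> f i v \<in> \<mm>"
    and u: "\<And>i. i < n \<Longrightarrow> u i \<in> carrier M" "(\<Oplus>i\<in>{..<n}. f i (u i)) = c"
    and u_divisible: "\<And>i z. i < n \<Longrightarrow> z \<in> \<mm> \<Longrightarrow> \<exists>w\<in>carrier M. z \<odot>\<^bsub>M\<^esub> u i = c \<odot>\<^bsub>M\<^esub> w"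
  shows "\<exists>i<n. \<exists>v\<in>carrier M. f i v = c \<and> (\<forall>z\<in>\<mm>. \<exists>w\<in>carrier M. z \<odot>\<^bsub>M\<^esub> v = c \<odot>\<^bsub>M\<^esub> w)"
proof -
  interpret m: maximalideal "max_ideal E" E by (rule local_ring_max_ideal[OF E])
  define b where "b i = f i (u i)" for i
  have bm: "b i \<in> \<mm>" if "i < n" for i using f_max u that by (simp add: b_def)
  have cm: "c_multiple (b i)" if i: "i < n" for i
    unfolding c_multiple_def
  proof (intro conjI ballI)
    show "b i \<in> carrier R" using bm[OF i] by simp
    fix y assume y: "y \<in> \<mm>"
    obtain w where w: "w \<in> carrier M" "y \<odot>\<^bsub>M\<^esub> u i = c \<odot>\<^bsub>M\<^esub> w" using u_divisible[OF i y] by blast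
    have "b i \<otimes> y = y \<otimes> b i" using bm[OF i] y by (simp add: R.m_comm)
    also have "\<dots> = f i (y \<odot>\<^bsub>M\<^esub> u i)" unfolding b_def using linear_formD(3)[OF f[OF i] _ u(1)[OF i], of y] y by simp
    also have "\<dots> = c \<otimes> f i w" unfolding w(2) by (rule linear_formD(3)[OF f[OF i] c_carrier w(1)])
    finally show "\<exists>z\<in>\<mm>. b i \<otimes> y = c \<otimes> z" using f_max[OF i w(1)] by blast
  qed
  have "\<exists>i<n. quot_c (b i) \<notin> max_ideal E"
  proof (rule ccontr)
    assume "\<not> (\<exists>i<n. quot_c (b i) \<notin> max_ideal E)"
    then have all: "quot_c (b i) \<in> max_ideal E" if "i < n" for i using that by blast
    \<comment> \<open>\<open>quot_c\<close> is additive on elements satisfying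
      \<open>c_multiple\<close>, so the induction carries this property of the partial sums
      along.\<close>
    have "j \<le> n \<Longrightarrow> c_multiple (\<Oplus>i\<in>{..<j}. b i) \<and> quot_c (\<Oplus>i\<in>{..<j}. b i) \<in> max_ideal E" for j
    proof (induction j)
      case 0
      have "\<zero>\<^bsub>E\<^esub> \<in> max_ideal E" by (rule additive_subgroup.zero_closed[OF ideal.axioms(1)[OF m.is_ideal]])
      then show ?case using c_multiple_zero by (simp del: max_endo_ring_simps)
    next
      case (Suc j)
      have "(\<Oplus>i\<in>insert j {..<j}. b i) = b j \<oplus> (\<Oplus>i\<in>{..<j}. b i)"
        by (rule R.finsum_insert) (use bm Suc.prems in \<open>auto simp: Pi_iff\<close>)
      then have s: "(\<Oplus>i\<in>{..<Suc j}. b i) = b j \<oplus> (\<Oplus>i\<in>{..<j}. b i)" by (simp add: lessThan_Suc)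
      have IH: "c_multiple (\<Oplus>i\<in>{..<j}. b i)" "quot_c (\<Oplus>i\<in>{..<j}. b i) \<in> max_ideal E"
        using Suc by auto
      have j: "j < n" using Suc.prems by simp
      show ?case
        unfolding s c_multiple_add(2)[OF cm[OF j] IH(1)]
        using c_multiple_add(1)[OF cm[OF j] IH(1)] additive_subgroup.a_closed[OF ideal.axioms(1)[OF m.is_ideal] all[OF j] IH(2)] by blast
    qed
    from this[of n] have "\<one>\<^bsub>E\<^esub> \<in> max_ideal E" using u(2) quot_c_c by (simp add: b_def del: max_endo_ring_simps)
    then show False using m.one_imp_carrier m.I_notcarr by simp
  qed
  then obtain i where i: "i < n" "quot_c (b i) \<notin> max_ideal E" by blast
  have "quot_c (b i) \<in> Units E" by (rule local_ring_Units[OF E quot_c_E[OF cm[OF i(1)]] i(2)])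
  then obtain \<beta> where \<beta>: "\<beta> \<in> carrier E" "quot_c (b i) \<otimes>\<^bsub>E\<^esub> \<beta> = \<one>\<^bsub>E\<^esub>" unfolding Units_def by blast
  have \<beta>c: "\<beta> c \<in> \<mm>" by (rule max_endoD(1)[OF \<beta>(1) c_max_ideal])
  have "quot_c (b i) (\<beta> c) = c" using fun_cong[OF \<beta>(2), of c] c_max_ideal by (simp add: compose_def)
  then have cc: "c \<otimes> c = b i \<otimes> \<beta> c" using quot_c(2)[OF cm[OF i(1)] \<beta>c] by simp
  define v where "v = act \<beta> (u i)"
  note a = act[OF \<beta>(1) u(1)[OF i(1)]]
  have v: "v \<in> carrier M" using a(1) by (simp add: v_def)
  have "c \<otimes> f i v = \<beta> c \<otimes> b i" unfolding v_def b_def by (rule linear_form_act[OF f[OF i(1)] \<beta>(1) u(1)[OF i(1)]])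
  also have "\<dots> = c \<otimes> c" using cc \<beta>c bm[OF i(1)] by (simp add: R.m_comm)
  finally have "f i v = c" by (rule c_cancel_ring[rotated 2]) (use f_max[OF i(1) v] in auto)
  \<comment> \<open>If z u_i = c w, then z v = beta(c) w, and beta(c) lies in m^k, so c divides this
    element.\<close>
  moreover have "\<exists>w\<in>carrier M. z \<odot>\<^bsub>M\<^esub> v = c \<odot>\<^bsub>M\<^esub> w" if z: "z \<in> \<mm>" for z
  proof -
    have zc: "z \<in> carrier R" and bc: "\<beta> c \<in> carrier R" using z \<beta>c by auto
    obtain w where w: "w \<in> carrier M" "z \<odot>\<^bsub>M\<^esub> u i = c \<odot>\<^bsub>M\<^esub> w" using u_divisible[OF i(1) z] by blast
    have "c \<odot>\<^bsub>M\<^esub> (z \<odot>\<^bsub>M\<^esub> v) = z \<odot>\<^bsub>M\<^esub> (c \<odot>\<^bsub>M\<^esub> v)" by (rule smult_comm[OF c_carrier zc v])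
    also have "\<dots> = \<beta> c \<odot>\<^bsub>M\<^esub> (z \<odot>\<^bsub>M\<^esub> u i)"
      unfolding v_def a(2) by (rule smult_comm[OF zc bc u(1)[OF i(1)]])
    also have "\<dots> = c \<odot>\<^bsub>M\<^esub> (\<beta> c \<odot>\<^bsub>M\<^esub> w)" unfolding w(2) by (rule smult_comm[OF bc c_carrier w(1)])
    finally have "z \<odot>\<^bsub>M\<^esub> v = \<beta> c \<odot>\<^bsub>M\<^esub> w"
      by (rule regular_cancel[OF regular_c, rotated 2]) (use zc bc v w(1) in auto)
    then show ?thesis using c_divides[OF E_apply_c[OF \<beta>(1)] w(1)] by simp
  qed
  ultimately show ?thesis using i(1) v by blast
qed

end

text \<open>The new point is that c is regular on R. Suppose c a = 0 and let s lie in m^k. For each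
  v there is w with s v = c w, so a s f(v) = a c f(w) = 0 for every form f. Thus a s kills the
  trace, which is m.\<close>

lemma (in torsion_free_module) ulrich_blowup:
  assumes dim: "krull_dim R = 1" and ulrich: "real (min_gens R M) = multiplicity_hs R M"
    and trace: "trace_ideal R M = \<mm>"
  shows "\<exists>c k. blowup_module R M t e c k"
proof -
  obtain k c where k: "k \<ge> 1" "c \<in> Q k" "regular c" and eq: "(\<odot>\<^bsub>M\<^esub>) c ` carrier M = P k"
    using min_gens_eq_multiplicity_iff[OF dim] ulrich by blast
  have div: "\<exists>w\<in>carrier M. a \<odot>\<^bsub>M\<^esub> v = c \<odot>\<^bsub>M\<^esub> w" if "a \<in> Q k" "v \<in> carrier M" for a v
  proof -
    have "a \<odot>\<^bsub>M\<^esub> v \<in> P (0 + k)" using Q_smult[OF that(1), of v 0] that(2) by simp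
    then have "a \<odot>\<^bsub>M\<^esub> v \<in> (\<odot>\<^bsub>M\<^esub>) c ` carrier M" unfolding eq by simp
    then show ?thesis by auto
  qed
  have cc: "c \<in> carrier R" using k by simp
  have tc: "t \<in> carrier R" using t_mem by simp
  have reg: "a = \<zero>" if a: "a \<in> carrier R" "c \<otimes> a = \<zero>" for a
  proof -
    interpret S: torsion_free_module R "self_module R" t e by (rule torsion_free_self)
    \<comment> \<open>This s lies in m^k, where \<open>div\<close> applies, and a s t = 0 still
      forces a = 0 because t is regular on R.\<close>
    define s where "s = t [^] k"
    have "t \<in> Q (Suc 0)" using t_mem max_ideal_pow_1 by simp
    from max_ideal_pow_nat_pow[OF this, of k] have sQ: "s \<in> Q k" by (simp add: s_def)
    have sc: "s \<in> carrier R" using sQ by simp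
    let ?L = "{b \<in> carrier R. a \<otimes> s \<otimes> b = \<zero>}"
    have L: "submodule ?L R (self_module R)"
      by (rule S.submoduleI') (use a sc R.m_lcomm[of "a \<otimes> s"] in \<open>auto simp: R.r_distr\<close>)
    have "(\<Union>f\<in>module_hom R M (self_module R). f ` carrier M) \<subseteq> ?L"
    proof
      fix y assume "y \<in> (\<Union>f\<in>module_hom R M (self_module R). f ` carrier M)"
      then obtain f v where f: "f \<in> module_hom R M (self_module R)" and v: "v \<in> carrier M" "y = f v" by blast
      note fl = linear_formD[OF module_hom_linear_form[OF f]]
      obtain w where w: "w \<in> carrier M" "s \<odot>\<^bsub>M\<^esub> v = c \<odot>\<^bsub>M\<^esub> w" using div[OF sQ v(1)] by blast
      have "s \<otimes> f v = c \<otimes> f w" using fl(3)[OF sc v(1)] fl(3)[OF cc w(1)] w(2) by simp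
      then have "a \<otimes> s \<otimes> y = a \<otimes> (c \<otimes> f w)" using v(2) a(1) sc fl(1)[OF v(1)] by (simp add: R.m_assoc)
      also have "\<dots> = (c \<otimes> a) \<otimes> f w" using a(1) cc fl(1)[OF w(1)] by (simp add: R.m_ac)
      also have "\<dots> = \<zero>" using a(2) fl(1)[OF w(1)] by simp
      finally show "y \<in> ?L" using v fl(1)[OF v(1)] by simp
    qed
    then have "\<mm> \<subseteq> ?L"
      unfolding trace[symmetric] trace_ideal_def
      by (intro R.genideal_minimal) (use L in \<open>simp_all add: R.ideal_iff_submodule\<close>)
    then have "a \<otimes> s \<otimes> t = \<zero>" using t_mem by blast
    then have "(t [^] Suc k) \<odot>\<^bsub>self_module R\<^esub> a = \<zero>\<^bsub>self_module R\<^esub>"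
      using a(1) tc by (simp add: s_def R.m_ac)
    then show ?thesis using S.t_pow_regular[of a "Suc k"] a(1) by simp
  qed
  have "blowup_module R M t e c k"
    by unfold_locales (use k div reg in \<open>auto simp: regular_def\<close>)
  then show ?thesis by blast
qed

theorem proposition3p15:
  fixes R :: "('a, 'c) ring_scheme" and M :: "('a, 'b, 'd) module_scheme"
  assumes "cohen_macaulay_local_ring R"
    and "krull_dim R = 1"
    and "\<not> regular_local_ring R"
    and "full_trace_ulrich R M"
  shows "(\<exists>n\<ge>1. \<exists>N :: ('a \<Rightarrow> 'a, nat \<Rightarrow> 'b) module.
            module (max_endo_ring R) N \<and> finitely_generated (max_endo_ring R) N \<and>
            module_iso R (direct_power M n)
              (direct_sum (max_ideal_module R) (max_endo_restrict R N)) \<and>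
            (carrier N = {\<zero>\<^bsub>N\<^esub>} \<or> ulrich R (max_endo_restrict R N)))
       \<and> (local_ring (max_endo_ring R) \<longrightarrow>
            (\<exists>N :: ('a \<Rightarrow> 'a, nat \<Rightarrow> 'b) module.
               module (max_endo_ring R) N \<and> finitely_generated (max_endo_ring R) N \<and>
               module_iso R M
                 (direct_sum (max_ideal_module R) (max_endo_restrict R N)) \<and>
               (carrier N = {\<zero>\<^bsub>N\<^esub>} \<or> ulrich R (max_endo_restrict R N)))
            \<and> direct_summand R (max_ideal_module R) M)"
proof -
  have loc: "local_ring R" "noetherian_ring R" using assms(1) by (auto simp: cohen_macaulay_local_ring_def)
  have M: "module R M" "finitely_generated R M" "module_depth R M \<noteq> 0"
    and ulrich: "real (min_gens R M) = multiplicity_hs R M" and trace: "trace_ideal R M = max_ideal R"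
    using assms(2,4) by (auto simp: full_trace_ulrich_def ulrich_def maximal_cohen_macaulay_def)
  interpret M0: local_noetherian_module R M
    by (intro local_noetherian_module.intro local_noetherian_module_axioms.intro M loc)
  obtain t e where t: "t \<in> max_ideal R" "\<And>a. a \<in> carrier R \<Longrightarrow> t \<otimes>\<^bsub>R\<^esub> a = \<zero>\<^bsub>R\<^esub> \<Longrightarrow> a = \<zero>\<^bsub>R\<^esub>"
    "max_ideal_pow R e \<subseteq> PIdl\<^bsub>R\<^esub> t" using cohen_macaulay_reduction[OF assms(1,2)] by blast
  interpret M1: torsion_free_module R M t e by (rule M0.torsion_freeI[OF t M(3)])
  obtain c k where "blowup_module R M t e c k" using M1.ulrich_blowup[OF assms(2) ulrich trace] by blast
  then interpret M: blowup_module R M t e c k .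
  obtain n f where n: "n \<ge> 1" and fH: "\<forall>i<n. f i \<in> module_hom R M (self_module R)"
    and surj: "(\<lambda>v. \<Oplus>\<^bsub>R\<^esub>i\<in>{..<n}. f i (v i)) ` carrier (direct_power M n) = max_ideal R"
    using M0.trace_surjection[OF trace] by blast
  define g where "g = (\<lambda>v. \<Oplus>\<^bsub>R\<^esub>i\<in>{..<n}. f i (v i))"
  have fl: "linear_form R M (f i)" if "i < n" for i using fH that by (simp add: module_hom_linear_form)
  have fm: "f i v \<in> max_ideal R" if "i < n" "v \<in> carrier M" for i v
    using M0.trace_mem[OF trace _ that(2)] fH that(1) by blast
  have gl: "linear_form R (direct_power M n) g" unfolding g_def by (rule M0.linear_form_finsum[OF fl])
  have gs: "g ` carrier (direct_power M n) = max_ideal R" unfolding g_def by (rule surj)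
  interpret W: blowup_module R "direct_power M n" t e c k by (rule M.direct_power_blowup)
  obtain u where u: "u \<in> carrier (direct_power M n)" "g u = c"
    "\<And>z. z \<in> max_ideal R \<Longrightarrow> \<exists>w\<in>carrier (direct_power M n). z \<odot>\<^bsub>direct_power M n\<^esub> u = c \<odot>\<^bsub>direct_power M n\<^esub> w"
    using W.splitting_element[OF gl gs] by blast
  interpret WS: split_module R "direct_power M n" t e c k g u
    by unfold_locales (use gl gs u in \<open>auto simp del: direct_power_simps\<close>)
  note 1 = WS.splitting[OF assms(2)]
  have 2: "(\<exists>N :: ('a \<Rightarrow> 'a, nat \<Rightarrow> 'b) module.
       module (max_endo_ring R) N \<and> finitely_generated (max_endo_ring R) N \<and>
       module_iso R M (direct_sum (max_ideal_module R) (max_endo_restrict R N)) \<and>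
       (carrier N = {\<zero>\<^bsub>N\<^esub>} \<or> ulrich R (max_endo_restrict R N)))
    \<and> direct_summand R (max_ideal_module R) M" if E: "local_ring (max_endo_ring R)"
  proof -
    have div: "\<exists>w\<in>carrier M. z \<odot>\<^bsub>M\<^esub> u i = c \<odot>\<^bsub>M\<^esub> w" if i: "i < n" and z: "z \<in> max_ideal R" for i z
    proof -
      obtain w where w: "w \<in> carrier (direct_power M n)" "z \<odot>\<^bsub>direct_power M n\<^esub> u = c \<odot>\<^bsub>direct_power M n\<^esub> w"
        using u(3)[OF z] by blast
      have "z \<odot>\<^bsub>M\<^esub> u i = c \<odot>\<^bsub>M\<^esub> w i" using fun_cong[OF w(2), of i] i by simp
      then show ?thesis using w(1) i by (auto simp: PiE_iff)
    qed
    have ui: "u i \<in> carrier M" if "i < n" for i using u(1) that by (auto simp: PiE_iff)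
    obtain i v where i: "i < n" and v: "v \<in> carrier M" "f i v = c"
      "\<And>z. z \<in> max_ideal R \<Longrightarrow> \<exists>w\<in>carrier M. z \<odot>\<^bsub>M\<^esub> v = c \<odot>\<^bsub>M\<^esub> w"
      using M.local_splitting_element[OF E fl fm ui u(2)[unfolded g_def] div] by blast
    interpret MS: split_module R M t e c k "f i" v
      by unfold_locales (use fl[OF i] fm[OF i] v in auto)
    \<comment> \<open>The same data are split twice: on M to obtain the direct summand, and on
      \<open>direct_power M 1\<close> to obtain a complement whose elements have the required
      type.\<close>
    interpret W1: blowup_module R "direct_power M 1" t e c k by (rule M.direct_power_blowup)
    let ?v = "\<lambda>j\<in>{..<1::nat}. v"
    have w1: "\<exists>w\<in>carrier (direct_power M 1). z \<odot>\<^bsub>direct_power M 1\<^esub> ?v = c \<odot>\<^bsub>direct_power M 1\<^esub> w"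
      if z: "z \<in> max_ideal R" for z
    proof -
      obtain w where w: "w \<in> carrier M" "z \<odot>\<^bsub>M\<^esub> v = c \<odot>\<^bsub>M\<^esub> w" using v(3)[OF z] by blast
      show ?thesis by (rule bexI[of _ "\<lambda>j\<in>{..<1}. w"]) (use w in auto)
    qed
    have l1: "linear_form R (direct_power M 1) (\<lambda>w. f i (w 0))"
      using linear_formD[OF fl[OF i]] by (auto simp: linear_form_def PiE_iff)
    interpret W1S: split_module R "direct_power M 1" t e c k "\<lambda>w. f i (w 0)" ?v
    proof
      show "f i (w 0) \<in> max_ideal R" if "w \<in> carrier (direct_power M 1)" for w
        using fm[OF i, of "w 0"] that by (auto simp: PiE_iff)
      show "?v \<in> carrier (direct_power M 1)" using v(1) by auto
      show "f i (?v 0) = c" using v(2) by simp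
    qed (rule l1, rule w1)
    show ?thesis
      using W1S.splitting[OF assms(2)] module_iso_direct_power_one[OF M(1)] MS.direct_summand_max_ideal by blast
  qed
  show ?thesis using 1 2 n by blast
qed

end
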